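(* Let $\mathcal{C}$ be a reduced curve in $\mathbb{P}^2$ such that $c_{\mathcal{T}_{\mathcal{C}}}(t) = (at-1)(bt-1)$ with $a,b \in \mathbb{Z}_{>0}$, $a \leq b$. (1) Let $L \in \mathrm{Irr}(\mathcal{C})$ be a line and let $\mathcal{C}' := \bigcup_{C \in \mathrm{Irr}(\mathcal{C}) \setminus \{L\}} C$. Then: (a) $|\mathcal{C}' \cap L| \leq a+1-\epsilon(\mathcal{C},\mathcal{C}')$ or $|\mathcal{C}' \cap L| \geq b+1-\epsilon(\mathcal{C},\mathcal{C}')$; (b) if $|\mathcal{C}' \cap L| = a+1-\epsilon(\mathcal{C},\mathcal{C}')$ or $|\mathcal{C}' \cap L| = b+1-\epsilon(\mathcal{C},\mathcal{C}')$, then $\mathcal{C}$ is free with exponents $(a,b)$; (c) if $|\mathcal{C}' \cap L| > b+1-\epsilon(\mathcal{C},\mathcal{C}')$, then $\mathcal{C}$ is not free. (2) Let $L \subset \mathbb{P}^2$ be a line such that $L \notin \mathrm{Irr}(\mathcal{C})$. Then: (a) $|\mathcal{C} \cap L| \leq a+1-\epsilon(\mathcal{C}\cup L,\mathcal{C})$ or $|\mathcal{C} \cap L| \geq b+1-\epsilon(\mathcal{C}\cup L,\mathcal{C})$; (b) if $|\mathcal{C} \cap L| = a+1-\epsilon(\mathcal{C}\cup L,\mathcal{C})$ or $|\mathcal{C} \cap L| = b+1-\epsilon(\mathcal{C}\cup L,\mathcal{C})$, then $\mathcal{C}$ is free with exponents $(a,b)$; (c) if $|\mathcal{C} \cap L|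 < a+1-\epsilon(\mathcal{C}\cup L,\mathcal{C})$, then $\mathcal{C}$ is not free.
   Context: $\mathbb{P}^2$ is the complex projective plane and $S=\mathbb{C}[x,y,z]$. For a reduced curve $\mathcal{C}\subset\mathbb{P}^2$ with defining homogeneous polynomial $f_{\mathcal{C}}\in S$, let $D_0(\mathcal{C})=\{\theta\in \mathrm{Der}(S) : \theta(f_{\mathcal{C}})=0\}$, a graded $S$-module, where a derivation $\theta = \theta_1\partial_x+\theta_2\partial_y+\theta_3\partial_z$ has degree $d$ if the $\theta_i$ are homogeneous of degree $d$. Let $\mathcal{T}_{\mathcal{C}}$ be the sheafification of $D_0(\mathcal{C})$; it is a rank 2 vector bundle on $\mathbb{P}^2$. Its Chern polynomial is $c_{\mathcal{T}_{\mathcal{C}}}(t)=1+c_1(\mathcal{T}_{\mathcal{C}})t+c_2(\mathcal{T}_{\mathcal{C}})t^2$, with $c_1,c_2$ the Chern numbers. The curve $\mathcal{C}$ is free if $D_0(\mathcal{C})$ is a free $S$-module (equivalently $\mathcal{T}_{\mathcal{C}}$ splits as a direct sum of line bundles); it is free with exponents $(a,b)$ if $D_0(\mathcal{C})\cong S(-a)\oplus S(-b)$, i.e. $\mathcal{T}_{\mathcal{C}}\cong\mathcal{O}_{\mathbb{P}^2}(-a)\oplus\mathcal{O}_{\mathbb{P}^2}(-b)$. $\mathrm{Irr}(\mathcal{C})$ is the set of irreducible components of $\mathcal{C}$. $|X\cap Y|$ is the number of points of the set $X\cap Y$ (without multiplicity). For $p\in\mathcal{C}$, $\mu_p(\mathcal{C})$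 and $\tau_p(\mathcal{C})$ are the Milnor and Tjurina numbers of $\mathcal{C}$ at $p$ (both zero if $p$ is a smooth point of $\mathcal{C}$), and $\epsilon_p(\mathcal{C}):=\mu_p(\mathcal{C})-\tau_p(\mathcal{C})$. For reduced curves $\mathcal{C}_1,\mathcal{C}_2$ with no common irreducible component, $\epsilon(\mathcal{C}_1\cup\mathcal{C}_2,\mathcal{C}_1):=\sum_{p\in\mathcal{C}_1\cap\mathcal{C}_2}\left[\epsilon_p(\mathcal{C}_1\cup\mathcal{C}_2)-\epsilon_p(\mathcal{C}_1)\right]$. In particular, in (1), $\epsilon(\mathcal{C},\mathcal{C}')=\epsilon(\mathcal{C}'\cup L,\mathcal{C}')$ is the sum over $p\in\mathcal{C}'\cap L$. *)

theory Defs
  imports "HOL-Analysis.Analysis" "HOL-Computational_Algebra.Computational_Algebra"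
    "HOL-Computational_Algebra.Field_as_Ring"
begin

section \<open>The graded ring of polynomials in x, y, z\<close>

text \<open>
  The ring \<open>S\<close> is built as \<open>\<complex>[x][y][z]\<close>, with x the innermost and z the outermost variable,
  so that the coefficient of \<open>x^i y^j z^k\<close> in \<open>f\<close> is \<open>coeff (coeff (coeff f k) j) i\<close>.
\<close>

type_synonym S = "complex poly poly poly"

text \<open>Degrees are integers because shifted modules need them; for \<open>d < 0\<close> only 0 qualifies.\<close>

definition homogeneous :: "int \<Rightarrow> S \<Rightarrow> bool" where
  "homogeneous d f \<longleftrightarrow>
     (\<forall>i j k. coeff (coeff (coeff f k) j) i \<noteq> 0 \<longrightarrow> int (i + j + k) = d)"

definition dx :: "S \<Rightarrow> S" where "dx f = map_poly (map_poly pderiv) f"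
definition dy :: "S \<Rightarrow> S" where "dy f = map_poly pderiv f"
definition dz :: "S \<Rightarrow> S" where "dz f = pderiv f"

text \<open>Evaluation in a complex algebra \<open>R\<close> whose structure map is \<open>\<iota>\<close>.\<close>

definition eval_S :: "(complex \<Rightarrow> 'r::comm_ring_1) \<Rightarrow> S \<Rightarrow> 'r ^ 3 \<Rightarrow> 'r" where
  "eval_S \<iota> f v =
     poly (map_poly (\<lambda>q. poly (map_poly (\<lambda>r. poly (map_poly \<iota> r) (v $ 1)) q) (v $ 2)) f) (v $ 3)"

section \<open>Plane curves\<close>

text \<open>
  Points of the projective plane are the lines through the origin of \<open>\<complex>\<^sup>3\<close>. A reduced curve is
  given by a defining polynomial, which is unique up to a nonzero constant. The set of its points
  is \<open>pts f\<close>; the union of two curves without common component is defined by the product.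
\<close>

definition P2 :: "(complex ^ 3) set set" where
  "P2 = {vec.span {v} | v. v \<noteq> 0}"

definition pts :: "S \<Rightarrow> (complex ^ 3) set set" where
  "pts f = {p \<in> P2. \<forall>v\<in>p. eval_S id f v = 0}"

definition reduced_curve :: "S \<Rightarrow> bool" where
  "reduced_curve f \<longleftrightarrow> (\<exists>d. homogeneous d f) \<and> \<not> is_unit f \<and> squarefree f"

text \<open>\<open>prime_factors f\<close> has exactly one (normalized) polynomial for each irreducible component.\<close>

definition Irr :: "S \<Rightarrow> S set" where
  "Irr f = prime_factors f"

definition line :: "S \<Rightarrow> bool" where
  "line l \<longleftrightarrow> homogeneous 1 l \<and> l \<noteq> 0"

section \<open>Logarithmic derivations and freeness\<close>

text \<open>The vector \<open>\<theta>\<close> stands for the derivation \<open>\<theta>\<^sub>1 \<partial>\<^sub>x + \<theta>\<^sub>2 \<partial>\<^sub>y + \<theta>\<^sub>3 \<partial>\<^sub>z\<close> of \<open>S\<close>.\<close>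

definition der_apply :: "S ^ 3 \<Rightarrow> S \<Rightarrow> S" where
  "der_apply \<theta> f = \<theta> $ 1 * dx f + \<theta> $ 2 * dy f + \<theta> $ 3 * dz f"

definition homogeneous_der :: "int \<Rightarrow> S ^ 3 \<Rightarrow> bool" where
  "homogeneous_der d \<theta> \<longleftrightarrow> (\<forall>i. homogeneous d (\<theta> $ i))"

definition D0 :: "S \<Rightarrow> (S ^ 3) set" where
  "D0 f = {\<theta>. der_apply \<theta> f = 0}"

definition free_curve :: "S \<Rightarrow> bool" where
  "free_curve f \<longleftrightarrow> (\<exists>B. module.independent (*s) B \<and> module.span (*s) B = D0 f)"

text \<open>
  The map below is a homomorphism of graded modules on \<open>S(-a) \<oplus> S(-b)\<close> because its values on
  the two generators are homogeneous of degrees \<open>a\<close> and \<open>b\<close>; every such homomorphism has this form.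
\<close>

definition free_with_exponents :: "S \<Rightarrow> int \<Rightarrow> int \<Rightarrow> bool" where
  "free_with_exponents f a b \<longleftrightarrow>
     (\<exists>\<theta> \<eta>. homogeneous_der a \<theta> \<and> homogeneous_der b \<eta> \<and>
            bij_betw (\<lambda>(g, h). g *s \<theta> + h *s \<eta>) UNIV (D0 f))"

section \<open>The Chern polynomial\<close>

definition free_mod :: "nat \<Rightarrow> (nat \<Rightarrow> S) set" where
  "free_mod n = {v. \<forall>j\<ge>n. v j = 0}"

definition mat_map :: "nat \<Rightarrow> nat \<Rightarrow> (nat \<Rightarrow> nat \<Rightarrow> S) \<Rightarrow> (nat \<Rightarrow> S) \<Rightarrow> (nat \<Rightarrow> S)" where
  "mat_map r s A v = (\<lambda>i. if i < r then (\<Sum>j<s. A i j * v j) else 0)"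

definition der_map :: "nat \<Rightarrow> (nat \<Rightarrow> S ^ 3) \<Rightarrow> (nat \<Rightarrow> S) \<Rightarrow> S ^ 3" where
  "der_map s \<Theta> v = (\<Sum>j<s. v j *s \<Theta> j)"

text \<open>
  A graded free resolution \<open>0 \<rightarrow> F\<^sub>m \<rightarrow> \<dots> \<rightarrow> F\<^sub>1 \<rightarrow> F\<^sub>0 \<rightarrow> M \<rightarrow> 0\<close> of a graded submodule \<open>M\<close> of
  \<open>Der(S)\<close>. The list \<open>d k\<close> holds the degrees of the generators of \<open>F\<^sub>k\<close>, i.e. \<open>F\<^sub>k\<close> is the sum
  of the \<open>S(-e)\<close> for \<open>e\<close> in \<open>d k\<close>; the map \<open>F\<^sub>0 \<rightarrow> M\<close> is given by the images \<open>\<Theta> j\<close> of the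
  generators and \<open>F\<^sub>k\<^sub>+\<^sub>1 \<rightarrow> F\<^sub>k\<close> by the matrix \<open>A k\<close>. As \<open>F\<^sub>k = 0\<close> for \<open>k > m\<close>, the last
  condition includes the injectivity of \<open>F\<^sub>m \<rightarrow> F\<^sub>m\<^sub>-\<^sub>1\<close>.
\<close>

definition graded_free_resolution ::
  "(S ^ 3) set \<Rightarrow> nat \<Rightarrow> (nat \<Rightarrow> int list) \<Rightarrow> (nat \<Rightarrow> S ^ 3) \<Rightarrow> (nat \<Rightarrow> nat \<Rightarrow> nat \<Rightarrow> S) \<Rightarrow> bool" where
  "graded_free_resolution M m d \<Theta> A \<longleftrightarrow>
     (let r = (\<lambda>k. length (d k)) in
       (\<forall>k>m. d k = []) \<and>
       (\<forall>j<r 0. homogeneous_der (d 0 ! j) (\<Theta> j)) \<and>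
       (\<forall>k. \<forall>i<r k. \<forall>j<r (Suc k). homogeneous (d (Suc k) ! j - d k ! i) (A k i j)) \<and>
       der_map (r 0) \<Theta> ` free_mod (r 0) = M \<and>
       {v \<in> free_mod (r 0). der_map (r 0) \<Theta> v = 0} =
         mat_map (r 0) (r 1) (A 0) ` free_mod (r 1) \<and>
       (\<forall>k. {v \<in> free_mod (r (Suc k)). mat_map (r k) (r (Suc k)) (A k) v = (\<lambda>_. 0)} =
         mat_map (r (Suc k)) (r (Suc (Suc k))) (A (Suc k)) ` free_mod (r (Suc (Suc k)))))"

text \<open>The sum of the line bundles \<open>O(-e)\<close>, for \<open>e\<close> in a list, has the Chern polynomial
  \<open>\<Prod>(1 - e t)\<close>.\<close>

definition chern_split :: "int list \<Rightarrow> int poly" where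
  "chern_split es = (\<Prod>e\<leftarrow>es. [:1, - e:])"

text \<open>
  The Chern polynomial of the sheaf on the projective plane associated with the graded module
  \<open>M\<close>. Sheafification turns a resolution of \<open>M\<close> into a resolution of the sheaf by sums of line
  bundles, so by multiplicativity of Chern classes the Chern polynomial is the alternating
  product of the \<open>chern_split (d k)\<close> in \<open>\<int>[t]/(t\<^sup>3)\<close>, independently of the resolution.
\<close>

definition has_chern_polynomial :: "(S ^ 3) set \<Rightarrow> int poly \<Rightarrow> bool" where
  "has_chern_polynomial M c \<longleftrightarrow> degree c \<le> 2 \<and>
     (\<exists>m d \<Theta> A. graded_free_resolution M m d \<Theta> A \<and>
        monom 1 3 dvd c * (\<Prod>k\<in>{k. k \<le> m \<and> odd k}. chern_split (d k))
                      - (\<Prod>k\<in>{k. k \<le> m \<and> even k}. chern_split (d k)))"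

section \<open>Milnor and Tjurina numbers\<close>

text \<open>
  Local computations take place in the completed local ring \<open>\<complex>[[u, w]]\<close>, with u the inner and w
  the outer variable. For isolated singularities the dimensions of the Milnor and Tjurina
  algebras are the same as over convergent power series.
\<close>

type_synonym local_ring = "complex fps fps"

definition const2 :: "complex \<Rightarrow> local_ring" where
  "const2 c = fps_const (fps_const c)"

definition var_u :: local_ring where "var_u = fps_const fps_X"
definition var_w :: local_ring where "var_w = fps_X"

definition du :: "local_ring \<Rightarrow> local_ring" where
  "du g = Abs_fps (\<lambda>n. fps_deriv (fps_nth g n))"
definition dw :: "local_ring \<Rightarrow> local_ring" where
  "dw g = fps_deriv g"

text \<open>
  If the i-th coordinate of \<open>v\<close> is nonzero, the point spanned by \<open>v\<close> has an affine chart that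
  varies the other two coordinates, which have the indices \<open>i + 1\<close> and \<open>i + 2\<close> since the index
  type 3 has arithmetic modulo 3. A different choice of \<open>v\<close> and \<open>i\<close> changes the local equation
  only by a unit and a change of local coordinates.
\<close>

definition germ :: "S \<Rightarrow> complex ^ 3 \<Rightarrow> 3 \<Rightarrow> local_ring" where
  "germ f v i = eval_S const2 f
     (\<chi> k. const2 (v $ k) + (if k = i + 1 then var_u else if k = i + 2 then var_w else 0))"

definition local_equation :: "S \<Rightarrow> (complex ^ 3) set \<Rightarrow> local_ring" where
  "local_equation f p =
     (case SOME vi. fst vi \<in> p \<and> fst vi $ snd vi \<noteq> 0 of (v, i) \<Rightarrow> germ f v i)"

text \<open>The dimension of \<open>\<complex>[[u, w]] / I\<close>: the size of a set \<open>B\<close> whose classes form a basis.\<close>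

definition quotient_dim :: "local_ring set \<Rightarrow> nat" where
  "quotient_dim I = (THE n. \<exists>B. finite B \<and> card B = n \<and>
     (\<forall>g. \<exists>!c. (\<forall>b. b \<notin> B \<longrightarrow> c b = 0) \<and> g - (\<Sum>b\<in>B. const2 (c b) * b) \<in> I))"

text \<open>\<open>module.span (*) X\<close> is the ideal generated by \<open>X\<close>.\<close>

definition milnor :: "S \<Rightarrow> (complex ^ 3) set \<Rightarrow> nat" where
  "milnor f p = (let g = local_equation f p in quotient_dim (module.span (*) {du g, dw g}))"

definition tjurina :: "S \<Rightarrow> (complex ^ 3) set \<Rightarrow> nat" where
  "tjurina f p = (let g = local_equation f p in quotient_dim (module.span (*) {g, du g, dw g}))"

definition eps :: "S \<Rightarrow> (complex ^ 3) set \<Rightarrow> int" where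
  "eps f p = int (milnor f p) - int (tjurina f p)"

text \<open>\<open>eps_union f g\<close> is the invariant \<open>\<epsilon>(C\<^sub>1 \<union> C\<^sub>2, C\<^sub>1)\<close> of the curves \<open>C\<^sub>1\<close> of \<open>f\<close>, \<open>C\<^sub>2\<close> of \<open>g\<close>.\<close>

definition eps_union :: "S \<Rightarrow> S \<Rightarrow> int" where
  "eps_union f g = (\<Sum>p\<in>pts f \<inter> pts g. eps (f * g) p - eps f p)"

end

theory Submission
  imports Defs "HOL-Library.Function_Algebras"
begin

text \<open>
  Everything is restricted to the line \<open>L = 0\<close>. Let \<open>g\<close> be a curve that does not contain it. The
  restrictions of \<open>\<theta>(L)\<close> to the line, for \<open>\<theta>\<close> in \<open>D0 g\<close>, generate an ideal \<open>(G)\<close>; put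
  \<open>n = deg g - 1 - deg G\<close>. Up to a multiple of the Euler derivation, \<open>D0 (L * g)\<close> is the kernel of
  this restriction. The first differences of the Hilbert functions of \<open>D0 g\<close> and of \<open>D0 (L * g)\<close>
  are sums of the dimensions of two graded spaces over the coordinate ring of the line, which equal
  \<open>k + 1 - n\<close> and \<open>k + 1 - deg G\<close> in large degrees \<open>k\<close> (the latter shifted by one degree for
  \<open>D0 (L * g)\<close>) and are never larger than the positive parts of these numbers. The
  Chern polynomial says that the Hilbert function agrees with that of
  \<open>S(-a) \<oplus> S(-b)\<close> in large degrees. Summation of the inequalities gives \<open>(n - a) (n - b) \<ge> 0\<close>;
  if this product vanishes, then all inequalities are equalities, and Nakayama's lemma for \<open>L\<close>
  lifts generators from the line. If the curve is free, its generators have degrees at most \<open>b\<close>,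
  too small to produce a nonzero element of one of the two spaces in case (c).

  The number \<open>n\<close> is computed locally. At a point of the line where \<open>g\<close> restricts to a function of
  order \<open>i\<close> and \<open>G\<close> has order \<open>m\<close>, adding the line raises the Milnor number by \<open>2i - 1\<close> and the
  Tjurina number by \<open>i + m\<close>. Since \<open>i\<close> adds up to \<open>deg g\<close> and \<open>m\<close> to \<open>deg G\<close>, the number of
  intersection points plus \<open>\<epsilon>\<close> is \<open>deg g - deg G = n + 1\<close>.
\<close>

section \<open>Dimensions of quotients of vector spaces\<close>

text \<open>The restriction to the line sees only \<open>deg G\<close>, which has to be recovered
  from Milnor and Tjurina numbers, and the two meet different obstacles. The Tjurina number is
  governed by a local colon ideal, whereas \<open>G\<close> comes from global derivations. A local
  relation is therefore lifted: its coefficients are approximated by forms, the error vanishes to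
  high order at the point, and forms that are invertible there carry it into the global Jacobian
  ideal. For the Milnor number, the intersection multiplicities of \<open>g_u = 0\<close> with
  \<open>w g_w\<close> and with \<open>g + w g_w\<close> have to be compared, although these need
  not give the same ideal together with \<open>g_u\<close>. They agree along each branch of
  \<open>g_u = 0\<close>; over formal power series the branches come from Puiseux series, after a
  ramification \<open>w \<mapsto> w^N\<close> that multiplies all colengths by \<open>N\<close>.
  Finally, the Chern polynomial does not know the rank: that it is 2, and that \<open>a + b\<close>
  is the degree of the curve minus one, follows because the Jacobian ideal of a reduced curve has
  bounded codimension in all large degrees.\<close>

definition adj :: "('k \<Rightarrow> 'a \<Rightarrow> 'a::plus) \<Rightarrow> 'a set \<Rightarrow> 'a \<Rightarrow> 'a set" where
  "adj s V x = {v + s c x | v c. v \<in> V}"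

lemma adjI: "v \<in> V \<Longrightarrow> y = v + s c x \<Longrightarrow> y \<in> adj s V x"
  by (auto simp: adj_def)

lemma adjE: "y \<in> adj s V x \<Longrightarrow> (\<And>v c. v \<in> V \<Longrightarrow> y = v + s c x \<Longrightarrow> P) \<Longrightarrow> P"
  by (auto simp: adj_def)

text \<open>\<open>fd s I V n\<close> says that \<open>V\<close> arises from \<open>I\<close> by adjoining \<open>n\<close> vectors, one at a time and each
  outside of the span so far, i.e. that \<open>dim V/I = n\<close>.\<close>

inductive fd :: "('k::field \<Rightarrow> 'a \<Rightarrow> 'a::ab_group_add) \<Rightarrow> 'a set \<Rightarrow> 'a set \<Rightarrow> nat \<Rightarrow> bool" for s I where
  fd_refl: "fd s I I 0"
| fd_step: "fd s I V n \<Longrightarrow> x \<notin> V \<Longrightarrow> fd s I (adj s V x) (Suc n)"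

locale vspace = vector_space scale for scale :: "'k::field \<Rightarrow> 'b::ab_group_add \<Rightarrow> 'b"
begin

lemma subspace_adj: "subspace V \<Longrightarrow> subspace (adj scale V x)"
  unfolding subspace_def
proof (intro conjI ballI allI; elim conjE)
  assume V: "0 \<in> V" "\<forall>x\<in>V. \<forall>y\<in>V. x + y \<in> V" "\<forall>c. \<forall>x\<in>V. scale c x \<in> V"
  show "0 \<in> adj scale V x" using V(1) by (intro adjI[of 0 _ _ _ 0]) auto
  fix y assume "y \<in> adj scale V x"
  then obtain v c where y: "y = v + scale c x" "v \<in> V" by (auto elim: adjE)
  show "scale d y \<in> adj scale V x" for d
    using V(3) y by (intro adjI[of "scale d v" _ _ _ "d * c"]) (auto simp: scale_right_distrib)
  fix z assume "z \<in> adj scale V x"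
  then obtain w d where z: "z = w + scale d x" "w \<in> V" by (auto elim: adjE)
  have "y + z = (v + w) + scale (c + d) x" by (simp add: y z scale_left_distrib)
  then show "y + z \<in> adj scale V x" using V(2) y z by (blast intro: adjI)
qed

lemma adj_superset: "V \<subseteq> adj scale V x"
  by (auto intro: adjI[where c = 0])

lemma adj_commute: "adj scale (adj scale V x) y = adj scale (adj scale V y) x"
proof -
  have "adj scale (adj scale V x) y \<subseteq> adj scale (adj scale V y) x" for x y
  proof
    fix z assume "z \<in> adj scale (adj scale V x) y"
    then obtain v c d where z: "z = v + scale c x + scale d y" "v \<in> V" by (auto simp: adj_def)
    have "v + scale d y \<in> adj scale V y" using z(2) by (rule adjI[where c = d]) simp
    then show "z \<in> adj scale (adj scale V y) x"
      by (rule adjI[where c = c]) (simp add: z(1) algebra_simps)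
  qed
  then show ?thesis by blast
qed

lemma adj_mem: "subspace V \<Longrightarrow> x \<in> adj scale V x"
  by (auto simp: subspace_def intro: adjI[of 0 _ _ _ 1])

lemma adj_least: "subspace W \<Longrightarrow> V \<subseteq> W \<Longrightarrow> x \<in> W \<Longrightarrow> adj scale V x \<subseteq> W"
  by (auto simp: subspace_def elim!: adjE)

lemma fd_subspace: "fd scale I V n \<Longrightarrow> subspace I \<Longrightarrow> subspace V"
  by (induction rule: fd.induct) (blast intro: subspace_adj)+

lemma fd_subset: "fd scale I V n \<Longrightarrow> subspace I \<Longrightarrow> I \<subseteq> V"
proof (induction rule: fd.induct)
  case (fd_step V n x)
  then show ?case using adj_superset[of V x] by blast
qed auto

lemma fd_step': 
  assumes "fd scale I V n" "subspace I" "x \<notin> V" "W = adj scale V x"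
  shows "fd scale I W (Suc n)"
  using assms by (auto intro: fd.intros)

lemma fd_trans: "fd scale J V n \<Longrightarrow> fd scale I J m \<Longrightarrow> fd scale I V (m + n)"
  by (induction rule: fd.induct) (auto intro: fd.intros)

lemma fd_0: "fd scale I V 0 \<longleftrightarrow> V = I"
  by (auto elim: fd.cases intro: fd.intros)

lemma fd_pos: "fd scale I V n \<Longrightarrow> subspace I \<Longrightarrow> n > 0 \<Longrightarrow> \<exists>x\<in>V. x \<notin> I"
proof (induction rule: fd.induct)
  case (fd_step V n x)
  then show ?case using fd_subset[of I V n] adj_mem[of V x] fd_subspace[of I V n] by blast
qed auto

text \<open>Second isomorphism theorem along a linear map.\<close>

lemma fd_push:
  assumes "fd scale I V n" "subspace I" "vspace s'"
    "Vector_Spaces.linear scale s' T" "module.subspace s' J" "\<And>v. v \<in> V \<Longrightarrow> T v \<in> J \<longleftrightarrow> v \<in> I"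
  shows "fd s' J {T v + j | v j. v \<in> V \<and> j \<in> J} n"
  using assms(1,6)
proof (induction rule: fd.induct)
  interpret B: vspace s' by fact
  interpret T: Vector_Spaces.linear scale s' T by fact
  have J: "0 \<in> J" "\<And>x y. x \<in> J \<Longrightarrow> y \<in> J \<Longrightarrow> x + y \<in> J" "\<And>x y. x \<in> J \<Longrightarrow> y \<in> J \<Longrightarrow> x - y \<in> J" 
    using assms(5) B.subspace_diff by (auto simp: B.subspace_def)
  case fd_refl
  have "{T v + j | v j. v \<in> I \<and> j \<in> J} = J"
  proof (intro set_eqI iffI)
    fix x assume "x \<in> J" then show "x \<in> {T v + j | v j. v \<in> I \<and> j \<in> J}"
      using assms(2) by (auto simp: subspace_def intro!: exI[of _ 0] exI[of _ x] simp: T.zero)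
  qed (use fd_refl J in auto)
  then show ?case by (simp add: fd.fd_refl)
next
  interpret B: vspace s' by fact
  interpret T: Vector_Spaces.linear scale s' T by fact
  case (fd_step V n x)
  have V: "subspace V" using fd_subspace fd_step assms by blast
  have "V \<subseteq> adj scale V x" by (rule adj_superset)
  with fd_step have IH: "fd s' J {T v + j | v j. v \<in> V \<and> j \<in> J} n" by blast
  have I: "I \<subseteq> V" using fd_subset fd_step assms by blast
  have x: "T x \<notin> {T v + j | v j. v \<in> V \<and> j \<in> J}"
  proof
    assume "T x \<in> {T v + j | v j. v \<in> V \<and> j \<in> J}"
    then obtain v j where v: "T x = T v + j" "v \<in> V" "j \<in> J" by auto
    then have "T (x - v) \<in> J" by (simp add: T.diff)
    moreover have "x - v \<in> adj scale V x" using V v by (intro adjI[of "-v" _ _ _ 1]) (auto simp: subspace_neg)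
    ultimately have "x - v \<in> V" using fd_step.prems I by blast
    then have "(x - v) + v \<in> V" using v V by (blast intro: subspace_add)
    then show False using fd_step by simp
  qed
  have "{T v + j | v j. v \<in> adj scale V x \<and> j \<in> J} = adj s' {T v + j | v j. v \<in> V \<and> j \<in> J} (T x)" (is "?A = ?B")
  proof (intro subset_antisym subsetI)
    fix y assume "y \<in> ?A"
    then obtain v c j where "y = T (v + scale c x) + j" "v \<in> V" "j \<in> J" by (auto simp: adj_def)
    then have "y = (T v + j) + s' c (T x)" by (simp add: T.add T.scale)
    then show "y \<in> ?B" using \<open>v \<in> V\<close> \<open>j \<in> J\<close> by (blast intro: adjI)
  next
    fix y assume "y \<in> ?B"
    then obtain v c j where "y = (T v + j) + s' c (T x)" "v \<in> V" "j \<in> J" by (auto simp: adj_def)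
    then have "y = T (v + scale c x) + j" by (simp add: T.add T.scale)
    then show "y \<in> ?A" using \<open>v \<in> V\<close> \<open>j \<in> J\<close> by (blast intro: adjI)
  qed
  then show ?case using fd.fd_step[OF IH x] by simp
qed

lemma fd_pull:
  assumes "fd s' J W n" "vspace s'" "module.subspace s' J"
    "Vector_Spaces.linear scale s' T" "subspace V" "W \<subseteq> T ` V"
  shows "fd scale {v \<in> V. T v \<in> J} {v \<in> V. T v \<in> W} n"
  using assms(1,6)
proof (induction rule: fd.induct)
  case fd_refl
  show ?case by (rule fd.intros)
next
  interpret B: vspace s' by fact
  interpret T: Vector_Spaces.linear scale s' T by fact
  case (fd_step W n y)
  have W: "module.subspace s' W" using B.fd_subspace fd_step assms by blast
  have sub: "W \<subseteq> adj s' W y" "y \<in> adj s' W y" by (rule B.adj_superset, rule B.adj_mem[OF W])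
  with fd_step have IH: "fd scale {v \<in> V. T v \<in> J} {v \<in> V. T v \<in> W} n" by blast
  from sub fd_step.prems obtain x where x: "x \<in> V" "T x = y" by blast
  have "{v \<in> V. T v \<in> adj s' W y} = adj scale {v \<in> V. T v \<in> W} x"
  proof (intro set_eqI iffI)
    fix v assume "v \<in> {v \<in> V. T v \<in> adj s' W y}"
    then obtain w c where v: "v \<in> V" "T v = w + s' c y" "w \<in> W" by (auto simp: adj_def)
    then have "v - scale c x \<in> V" "T (v - scale c x) \<in> W" using x assms(5)
      by (auto simp: T.diff T.scale intro: subspace_diff subspace_scale)
    then show "v \<in> adj scale {v \<in> V. T v \<in> W} x" using v by (intro adjI[of "v - scale c x" _ _ _ c]) auto
  next
    fix v assume "v \<in> adj scale {v \<in> V. T v \<in> W} x"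
    then obtain w c where w: "v = w + scale c x" "w \<in> V" "T w \<in> W" by (auto simp: adj_def)
    then have "T v = T w + s' c y" "v \<in> V" using x assms(5)
      by (auto simp: T.add T.scale subspace_add subspace_scale)
    then show "v \<in> {v \<in> V. T v \<in> adj s' W y}" using w by (auto intro: adjI)
  qed
  then show ?case using fd.fd_step[OF IH, of x] fd_step x by auto
qed

text \<open>Steinitz exchange: if \<open>x\<close> fell into the span of \<open>V\<close> and
  \<open>y\<close>, then \<open>y\<close> would lie in the span of \<open>V\<close> and
  \<open>x\<close>. So every step of the chain stays proper after \<open>y\<close> is
  adjoined.\<close>

lemma fd_adj_both:
  assumes "fd scale I V n" "subspace I" "y \<notin> V"
  shows "fd scale (adj scale I y) (adj scale V y) n"
  using assms(1,3)
proof (induction rule: fd.induct)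
  case fd_refl
  show ?case by (rule fd.intros)
next
  case (fd_step V n x)
  have V: "subspace V" using fd_subspace fd_step assms by blast
  have "y \<notin> V" using fd_step.prems adj_superset[of V x] by blast
  then have IH: "fd scale (adj scale I y) (adj scale V y) n" by (rule fd_step.IH)
  have x: "x \<notin> adj scale V y"
  proof
    assume "x \<in> adj scale V y"
    then obtain v c where x: "x = v + scale c y" "v \<in> V" by (auto simp: adj_def)
    have "c \<noteq> 0" using x fd_step.hyps by auto
    then have y: "y = - scale (inverse c) v + scale (inverse c) x" by (simp add: x scale_right_distrib)
    have "- scale (inverse c) v \<in> V" using x(2) V by (simp add: subspace_neg subspace_scale)
    then have "y \<in> adj scale V x" using y by (rule adjI)
    then show False using fd_step.prems by simp
  qed
  show ?case unfolding adj_commute[of V x y] by (rule fd.fd_step[OF IH x])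
qed

text \<open>Additivity of dimension. If \<open>J\<close> is not contained in the last but one space
  \<open>V\<close>, an element \<open>y\<close> of \<open>J\<close> outside \<open>V\<close> can
  replace the vector adjoined last, and \<open>J\<close> is \<open>J \<inter> V\<close> with
  \<open>y\<close> adjoined. Uniqueness and monotonicity of dimensions are corollaries.\<close>

lemma fd_split:
  assumes "fd scale I V n" "subspace I" "subspace J" "I \<subseteq> J" "J \<subseteq> V"
  shows "\<exists>a b. fd scale I J a \<and> fd scale J V b \<and> a + b = n"
  using assms(1,3,4,5)
proof (induction arbitrary: J rule: fd.induct)
  case fd_refl
  then have "J = I" by auto
  then show ?case by (auto simp: fd_0)
next
  case (fd_step V n x)
  have V: "subspace V" using fd_subspace fd_step assms by blast
  have IV: "I \<subseteq> V" using fd_subset fd_step assms by blast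
  have "subspace (J \<inter> V)" using V fd_step by (simp add: subspace_inter)
  then obtain a b where ab: "fd scale I (J \<inter> V) a" "fd scale (J \<inter> V) V b" "a + b = n"
    using fd_step.IH[of "J \<inter> V"] fd_step.prems IV by blast
  show ?case
  proof (cases "J \<subseteq> V")
    case True
    then have "J \<inter> V = J" by blast
    then show ?thesis using ab fd_step.hyps fd_subspace by (metis add_Suc_right fd.fd_step)
  next
    case False
    then obtain y where y: "y \<in> J" "y \<notin> V" by blast
    then obtain v c where vc: "y = v + scale c x" "v \<in> V" using fd_step.prems by (blast elim: adjE)
    have c: "c \<noteq> 0" using vc y by auto
    then have x: "x = scale (inverse c) (y - v)" by (simp add: vc)
    have 1: "adj scale V x = adj scale V y"
    proof (intro subset_antisym adj_least subspace_adj V adj_superset)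
      have "y \<in> adj scale V y" "v \<in> adj scale V y" using adj_mem[OF V] adj_superset vc by blast+
      then show "x \<in> adj scale V y" unfolding x by (intro subspace_scale subspace_diff subspace_adj V)
    qed (use vc in \<open>blast intro: adjI\<close>)
    have 2: "J = adj scale (J \<inter> V) y"
    proof (intro subset_antisym adj_least)
      show "J \<subseteq> adj scale (J \<inter> V) y"
      proof
        fix z assume z: "z \<in> J"
        then obtain w d where w: "z = w + scale d y" "w \<in> V" using fd_step.prems 1 by (blast elim: adjE)
        then have "w = z - scale d y" by simp
        then have "w \<in> J" using z y fd_step.prems by (simp add: subspace_diff subspace_scale)
        then show "z \<in> adj scale (J \<inter> V) y" using w by (blast intro: adjI)
      qed
    qed (use y fd_step.prems in auto)
    have "fd scale I J (Suc a)" using fd.fd_step[OF ab(1), of y] 2 y by auto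
    moreover have "fd scale J (adj scale V x) b" using fd_adj_both[OF ab(2) \<open>subspace (J \<inter> V)\<close> y(2)] 1 2 by simp
    ultimately show ?thesis using ab by auto
  qed
qed

lemma fd_adj_unique:
  assumes "fd scale V W a" "subspace V" "x \<notin> V" "W = adj scale V x"
  shows "a = 1"
  using assms(1)
proof (cases rule: fd.cases)
  case fd_refl
  then show ?thesis using assms adj_mem by blast
next
  case (fd_step U n z)
  have U: "subspace U" "V \<subseteq> U" using fd_subspace fd_subset fd_step assms by blast+
  have "U = V"
  proof (rule ccontr)
    assume "U \<noteq> V"
    then obtain y where y: "y \<in> U" "y \<notin> V" using U by blast
    have "U \<subseteq> W" using fd_step adj_superset by blast
    then obtain v c where vc: "y = v + scale c x" "v \<in> V" using y assms by (blast elim: adjE)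
    then have "c \<noteq> 0" using y by auto
    then have "x = scale (inverse c) (y - v)" by (simp add: vc)
    then have "x \<in> U" using U y vc by (metis subsetD subspace_scale subspace_diff)
    then have "W \<subseteq> U" unfolding assms(4) by (intro adj_least U)
    then show False using fd_step adj_mem[OF U(1), of z] by blast
  qed
  then have "n = 0" using fd_step fd_pos[of V U n] assms by auto
  then show ?thesis using fd_step by simp
qed

lemma fd_unique: "fd scale I V n \<Longrightarrow> fd scale I V m \<Longrightarrow> subspace I \<Longrightarrow> n = m"
proof (induction arbitrary: m rule: fd.induct)
  case fd_refl
  then show ?case using fd_pos by fastforce
next
  case (fd_step V n x)
  have V: "subspace V" "I \<subseteq> V" using fd_subspace fd_subset fd_step by blast+
  obtain a b where ab: "fd scale I V a" "fd scale V (adj scale V x) b" "a + b = m"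
    using fd_split[OF fd_step.prems(1,2) V adj_superset] by blast
  then show ?case using fd_step.IH[of a] fd_adj_unique[OF ab(2) V(1) fd_step.hyps(2)] fd_step.prems by simp
qed

lemma fd_le:
  assumes "fd scale I V n" "fd scale I J m" "subspace I" "J \<subseteq> V"
  shows "m \<le> n"
proof -
  obtain a b where "fd scale I J a" "a + b = n"
    using fd_split[OF assms(1,3) fd_subspace[OF assms(2,3)] fd_subset[OF assms(2,3)] assms(4)] by blast
  then show ?thesis using fd_unique[OF assms(2) _ assms(3), of a] by simp
qed

lemma fd_eq:
  assumes "fd scale I V n" "fd scale I J n" "subspace I" "J \<subseteq> V"
  shows "J = V"
proof -
  obtain a b where ab: "fd scale I J a" "fd scale J V b" "a + b = n"
    using fd_split[OF assms(1,3) fd_subspace[OF assms(2,3)] fd_subset[OF assms(2,3)] assms(4)]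
    by (elim exE conjE) (rule that)
  have "b = 0" using fd_unique[OF assms(2) ab(1) assms(3)] ab(3) by simp
  then have "V = J" using ab(2) fd_0[of J V] by simp
  then show ?thesis by simp
qed

text \<open>Rank-nullity, assembled from the dimensions of kernel and image;
  \<open>fd_kernel'\<close> is the version that produces these two dimensions from the total
  one.\<close>

lemma fd_kernel:
  assumes "subspace V" "vspace s'" "Vector_Spaces.linear scale s' T" "fd s' {0} (T ` V) m" "fd scale {0} {v \<in> V. T v = 0} n"
  shows "fd scale {0} V (n + m)"
proof -
  interpret B: vspace s' by fact
  have "fd scale {v \<in> V. T v \<in> {0}} {v \<in> V. T v \<in> T ` V} m"
    using fd_pull[OF assms(4,2) B.subspace_single_0 assms(3,1)] by blast
  moreover have "{v \<in> V. T v \<in> T ` V} = V" by blast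
  ultimately show ?thesis using assms(5) fd_trans by auto
qed

lemma fd_kernel':
  assumes "fd scale {0} V n" "vspace s'" "Vector_Spaces.linear scale s' T"
  shows "\<exists>a b. fd scale {0} {v \<in> V. T v = 0} a \<and> fd s' {0} (T ` V) b \<and> a + b = n"
proof -
  interpret B: vspace s' by fact
  interpret T: Vector_Spaces.linear scale s' T by fact
  have V: "subspace V" using fd_subspace[OF assms(1)] by simp
  have K: "subspace {v \<in> V. T v = 0}" using V by (auto simp: subspace_def T.add T.scale T.zero)
  then obtain a b where ab: "fd scale {0} {v \<in> V. T v = 0} a" "fd scale {v \<in> V. T v = 0} V b" "a + b = n"
    using fd_split[OF assms(1) _ K] V by (auto simp: subspace_def T.zero)
  have "fd s' {0} {T v + j | v j. v \<in> V \<and> j \<in> {0}} b"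
    by (rule fd_push[OF ab(2) K assms(2,3)]) auto
  moreover have "{T v + j | v j. v \<in> V \<and> j \<in> {0}} = T ` V" by auto
  ultimately show ?thesis using ab by auto
qed

lemma fd_inj_image:
  assumes "fd scale {0} V n" "vspace s'" "Vector_Spaces.linear scale s' T" "\<And>v. v \<in> V \<Longrightarrow> T v = 0 \<Longrightarrow> v = 0"
  shows "fd s' {0} (T ` V) n"
proof -
  interpret T: Vector_Spaces.linear scale s' T by fact
  have "subspace V" using fd_subspace[OF assms(1)] by simp
  then have "{v \<in> V. T v = 0} = {0}" using assms(4) by (auto simp: subspace_def T.zero)
  then obtain a b where ab: "fd scale {0} {0} a" "fd s' {0} (T ` V) b" "a + b = n"
    using fd_kernel'[OF assms(1-3)] by auto
  have "a = 0" using fd_unique[OF ab(1) fd_refl] by simp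
  then show ?thesis using ab by simp
qed

lemma fd_sub: "fd scale I V n \<Longrightarrow> subspace I \<Longrightarrow> subspace J \<Longrightarrow> I \<subseteq> J \<Longrightarrow> J \<subseteq> V \<Longrightarrow> \<exists>m\<le>n. fd scale I J m"
  using fd_split[of I V n J] le_add1 by blast

lemma ex1_eq: "\<exists>!c. P c \<Longrightarrow> P d \<Longrightarrow> P e \<Longrightarrow> d = e"
  by blast

text \<open>The condition in the definition of \<open>quotient_dim\<close>, for an arbitrary scalar
  multiplication and relative to a subspace \<open>V\<close>, so that induction along a chain is
  possible.\<close>

definition basis_mod :: "'b set \<Rightarrow> 'b set \<Rightarrow> 'b set \<Rightarrow> bool" where
  "basis_mod B I V \<longleftrightarrow> finite B \<and>
     (\<forall>g\<in>V. \<exists>!c. (\<forall>b. b \<notin> B \<longrightarrow> c b = 0) \<and> g - (\<Sum>b\<in>B. scale (c b) b) \<in> I)"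

lemma fd_basis:
  assumes "fd scale I V n" "subspace I"
  shows "\<exists>B. B \<subseteq> V \<and> basis_mod B I V \<and> card B = n"
  using assms(1)
proof (induction rule: fd.induct)
  case fd_refl
  have "\<exists>!c. \<forall>b. c b = (0::'k)" for g :: 'b by (rule ex1I[of _ "\<lambda>_. 0"]) auto
  then have "basis_mod {} I I" by (auto simp: basis_mod_def)
  then show ?case by (auto intro!: exI[of _ "{}"])
next
  case (fd_step V n x)
  then obtain B where B: "B \<subseteq> V" "finite B" "card B = n"
    and un: "\<And>g. g \<in> V \<Longrightarrow> \<exists>!c. (\<forall>b. b \<notin> B \<longrightarrow> c b = 0) \<and> g - (\<Sum>b\<in>B. scale (c b) b) \<in> I"
    unfolding basis_mod_def by auto
  have V: "subspace V" "I \<subseteq> V" using fd_subspace fd_subset fd_step assms by blast+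
  have x: "x \<notin> B" using B fd_step by blast
  have sumV: "(\<Sum>b\<in>B. scale (c b) b) \<in> V" for c using B V by (intro subspace_sum subspace_scale) auto
  have "\<exists>!c. (\<forall>b. b \<notin> insert x B \<longrightarrow> c b = 0) \<and> g - (\<Sum>b\<in>insert x B. scale (c b) b) \<in> I"
    if "g \<in> adj scale V x" for g
  proof -
    obtain v e where v: "g = v + scale e x" "v \<in> V" using \<open>g \<in> adj scale V x\<close> by (auto elim: adjE)
    obtain c where c: "\<forall>b. b \<notin> B \<longrightarrow> c b = 0" "v - (\<Sum>b\<in>B. scale (c b) b) \<in> I"
      using ex1_implies_ex[OF un[OF v(2)]] by (elim exE conjE) (rule that)
    show ?thesis
    proof (rule ex1I[of _ "c(x := e)"])
      have "(\<Sum>b\<in>B. scale ((c(x := e)) b) b) = (\<Sum>b\<in>B. scale (c b) b)" using x by (intro sum.cong) auto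
      then show "(\<forall>b. b \<notin> insert x B \<longrightarrow> (c(x := e)) b = 0) \<and> g - (\<Sum>b\<in>insert x B. scale ((c(x := e)) b) b) \<in> I"
        using c x B v by (auto simp: algebra_simps)
    next
      fix d assume d: "(\<forall>b. b \<notin> insert x B \<longrightarrow> d b = 0) \<and> g - (\<Sum>b\<in>insert x B. scale (d b) b) \<in> I"
      then have 1: "g - scale (d x) x - (\<Sum>b\<in>B. scale (d b) b) \<in> I" using x B by (simp add: algebra_simps)
      then have "g - scale (d x) x - (\<Sum>b\<in>B. scale (d b) b) + (\<Sum>b\<in>B. scale (d b) b) \<in> V"
        using V sumV by (intro subspace_add) auto
      then have "g - scale (d x) x - v \<in> V" using subspace_diff[OF V(1) _ v(2)] by simp
      then have 2: "scale (e - d x) x \<in> V" by (simp add: v algebra_simps)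
      have ed: "d x = e"
      proof (rule ccontr)
        assume "d x \<noteq> e"
        then have "x = scale (inverse (e - d x)) (scale (e - d x) x)" by simp
        then show False using 2 V fd_step subspace_scale by metis
      qed
      then have "v - (\<Sum>b\<in>B. scale (d b) b) \<in> I" using 1 v by simp
      moreover have "(\<Sum>b\<in>B. scale ((d(x := 0)) b) b) = (\<Sum>b\<in>B. scale (d b) b)"
        using x by (intro sum.cong) auto
      ultimately have 3: "(\<forall>b. b \<notin> B \<longrightarrow> (d(x := 0)) b = 0) \<and> v - (\<Sum>b\<in>B. scale ((d(x := 0)) b) b) \<in> I"
        using d by simp
      have "d(x := 0) = c" by (rule ex1_eq[OF un[OF v(2)]], rule 3, intro conjI c)
      then show "d = c(x := e)" using ed by auto
    qed
  qed
  then have "basis_mod (insert x B) I (adj scale V x)" using B by (auto simp: basis_mod_def)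
  moreover have "insert x B \<subseteq> adj scale V x" using B adj_superset[of V x] adj_mem[OF V(1), of x] by blast
  moreover have "card (insert x B) = Suc n" using B x by simp
  ultimately show ?case by blast
qed

lemma basis_mod_fd:
  assumes "basis_mod B I UNIV" "subspace I"
  shows "fd scale I UNIV (card B)"
proof -
  have fB: "finite B" and un: "\<And>g. \<exists>!c. (\<forall>b. b \<notin> B \<longrightarrow> c b = 0) \<and> g - (\<Sum>b\<in>B. scale (c b) b) \<in> I"
    using assms(1) unfolding basis_mod_def by simp_all
  have "fd scale I {i + (\<Sum>b\<in>A. scale (c b) b) | i c. i \<in> I} (card A)" if "finite A" "A \<subseteq> B" for A
    using that
  proof (induction rule: finite_induct)
    case empty
    have "{i + (\<Sum>b\<in>{}. scale (c b) b) | i (c :: 'b \<Rightarrow> 'k). i \<in> I} = I" by simp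
    then show ?case by (simp add: fd.intros)
  next
    case (insert x A)
    let ?V = "{i + (\<Sum>b\<in>A. scale (c b) b) | i c. i \<in> I}"
    have x: "x \<notin> ?V"
    proof
      assume "x \<in> ?V"
      then obtain i c where i: "x = i + (\<Sum>b\<in>A. scale (c b) b)" "i \<in> I" by auto
      \<comment> \<open>If \<open>x\<close> lay in the span of the elements already adjoined, it
        would have two coefficient functions: \<open>d\<close> and the indicator \<open>e\<close> of
        \<open>x\<close>.\<close>
      define d where "d = (\<lambda>b. if b \<in> A then c b else 0)"
      have "(\<Sum>b\<in>B. scale (d b) b) = (\<Sum>b\<in>A. scale (c b) b)"
        unfolding d_def using insert.prems fB by (intro sum.mono_neutral_cong_right) auto
      then have 1: "(\<forall>b. b \<notin> B \<longrightarrow> d b = 0) \<and> x - (\<Sum>b\<in>B. scale (d b) b) \<in> I"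
        using i insert.prems by (metis (no_types, lifting) add_diff_cancel_right' d_def insert_subset subsetD)
      define e where "e = (\<lambda>b. if b = x then 1 else (0::'k))"
      have "(\<Sum>b\<in>B. scale (e b) b) = (\<Sum>b\<in>B. if b = x then x else 0)" unfolding e_def by (intro sum.cong) auto
      also have "\<dots> = x" using insert.prems fB by simp
      finally have 2: "(\<forall>b. b \<notin> B \<longrightarrow> e b = 0) \<and> x - (\<Sum>b\<in>B. scale (e b) b) \<in> I"
        using subspace_0[OF assms(2)] insert.prems by (auto simp: e_def)
      have "d = e" by (rule ex1_eq[OF un[of x]], rule 1, rule 2)
      then have "d x = e x" by simp
      then show False using insert.hyps by (simp add: d_def e_def)
    qed
    have "{i + (\<Sum>b\<in>insert x A. scale (c b) b) | i c. i \<in> I} = adj scale ?V x"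
    proof (intro set_eqI iffI)
      fix y assume "y \<in> {i + (\<Sum>b\<in>insert x A. scale (c b) b) | i c. i \<in> I}"
      then obtain i c where "y = i + (\<Sum>b\<in>insert x A. scale (c b) b)" "i \<in> I" by blast
      then have "y = (i + (\<Sum>b\<in>A. scale (c b) b)) + scale (c x) x" "i \<in> I"
        using insert.hyps by (simp_all add: algebra_simps)
      then show "y \<in> adj scale ?V x" by (blast intro: adjI)
    next
      fix y assume "y \<in> adj scale ?V x"
      then obtain i c e where y: "y = i + (\<Sum>b\<in>A. scale (c b) b) + scale e x" "i \<in> I" by (auto simp: adj_def)
      have "(\<Sum>b\<in>A. scale ((c(x := e)) b) b) = (\<Sum>b\<in>A. scale (c b) b)" using insert.hyps by (intro sum.cong) auto
      then have "y = i + (\<Sum>b\<in>insert x A. scale ((c(x := e)) b) b)"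
        using y(1) insert.hyps by (simp add: algebra_simps)
      then show "y \<in> {i + (\<Sum>b\<in>insert x A. scale (c b) b) | i c. i \<in> I}" using y(2) by blast
    qed
    moreover have "fd scale I ?V (card A)" using insert.IH insert.prems by simp
    ultimately show ?case using fd_step'[OF _ assms(2) x] insert.hyps by simp
  qed
  from this[OF fB] have "fd scale I {i + (\<Sum>b\<in>B. scale (c b) b) | i c. i \<in> I} (card B)" by simp
  moreover have "{i + (\<Sum>b\<in>B. scale (c b) b) | i c. i \<in> I} = UNIV"
  proof -
    have "g \<in> {i + (\<Sum>b\<in>B. scale (c b) b) | i c. i \<in> I}" for g
    proof -
      obtain c where "g - (\<Sum>b\<in>B. scale (c b) b) \<in> I"
        using ex1_implies_ex[OF un[of g]] by (elim exE conjE) (rule that)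
      moreover have "g = (g - (\<Sum>b\<in>B. scale (c b) b)) + (\<Sum>b\<in>B. scale (c b) b)" by simp
      ultimately show ?thesis by blast
    qed
    then show ?thesis by blast
  qed
  ultimately show ?thesis by simp
qed

end

section \<open>Ring homomorphisms\<close>

definition rhom :: "('a::comm_ring_1 \<Rightarrow> 'b::comm_ring_1) \<Rightarrow> bool" where
  "rhom h \<longleftrightarrow> h 1 = 1 \<and> (\<forall>x y. h (x + y) = h x + h y) \<and> (\<forall>x y. h (x * y) = h x * h y)"

lemma rhomI: "h 1 = 1 \<Longrightarrow> (\<And>x y. h (x + y) = h x + h y) \<Longrightarrow> (\<And>x y. h (x * y) = h x * h y) \<Longrightarrow> rhom h"
  by (simp add: rhom_def)

lemma rhom_1: "rhom h \<Longrightarrow> h 1 = 1"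
  and rhom_add: "rhom h \<Longrightarrow> h (x + y) = h x + h y"
  and rhom_mult: "rhom h \<Longrightarrow> h (x * y) = h x * h y"
  by (simp_all add: rhom_def)

lemma rhom_0: assumes "rhom h" shows "h 0 = 0"
  using rhom_add[OF assms, of 0 0] by simp

lemma rhom_minus: assumes "rhom h" shows "h (- x) = - h x"
  using rhom_add[OF assms, of x "- x"] rhom_0[OF assms] by (simp add: eq_neg_iff_add_eq_0 add.commute)

lemma rhom_diff: "rhom h \<Longrightarrow> h (x - y) = h x - h y"
  using rhom_add[of h x "- y"] rhom_minus[of h y] by simp

lemma rhom_power: "rhom h \<Longrightarrow> h (x ^ n) = h x ^ n"
  by (induction n) (simp_all add: rhom_1 rhom_mult)

lemma rhom_sum: "rhom h \<Longrightarrow> h (sum f A) = (\<Sum>x\<in>A. h (f x))"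
  by (induction A rule: infinite_finite_induct) (simp_all add: rhom_0 rhom_add)

lemma rhom_of_nat: "rhom h \<Longrightarrow> h (of_nat n) = of_nat n"
  by (induction n) (simp_all add: rhom_0 rhom_1 rhom_add)

lemma rhom_comp: "rhom h \<Longrightarrow> rhom k \<Longrightarrow> rhom (\<lambda>x. h (k x))"
  by (simp add: rhom_def)

lemma rhom_id: "rhom (\<lambda>x. x)"
  by (simp add: rhom_def)

lemma rhom_dvd: "rhom h \<Longrightarrow> a dvd b \<Longrightarrow> h a dvd h b"
  by (auto simp: dvd_def rhom_mult)

lemmas rhom_simps = rhom_0 rhom_1 rhom_add rhom_mult rhom_minus rhom_diff rhom_power

section \<open>The local ring\<close>

text \<open>The coefficient of \<open>u^i w^j\<close>; w is the outer variable, hence the exchanged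
  indices in the body.\<close>

definition c2 :: "local_ring \<Rightarrow> nat \<Rightarrow> nat \<Rightarrow> complex" where
  "c2 x i j = fps_nth (fps_nth x j) i"

lemma c2_ext: "(\<And>i j. c2 x i j = c2 y i j) \<Longrightarrow> x = y"
  by (simp add: c2_def fps_ext)

lemma c2_add [simp]: "c2 (x + y) i j = c2 x i j + c2 y i j"
  and c2_diff [simp]: "c2 (x - y) i j = c2 x i j - c2 y i j"
  and c2_0 [simp]: "c2 0 i j = 0"
  and c2_uminus [simp]: "c2 (- x) i j = - c2 x i j"
  by (simp_all add: c2_def)

lemma c2_sum: "c2 (sum f A) i j = (\<Sum>x\<in>A. c2 (f x) i j)"
  by (induction A rule: infinite_finite_induct) simp_all

lemma c2_const [simp]: "c2 (const2 c) i j = (if i = 0 \<and> j = 0 then c else 0)"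
  and c2_const_mult [simp]: "c2 (const2 c * x) i j = c * c2 x i j"
  by (simp_all add: c2_def const2_def)

lemma c2_1: "c2 1 i j = (if i = 0 \<and> j = 0 then 1 else 0)"
  by (simp add: c2_def)

lemma c2_u [simp]: "c2 (var_u * x) i j = (if i = 0 then 0 else c2 x (i - 1) j)"
  and c2_w [simp]: "c2 (var_w * x) i j = (if j = 0 then 0 else c2 x i (j - 1))"
  by (simp_all add: c2_def var_u_def var_w_def)

lemma c2_u_power: "c2 (var_u ^ k * x) i j = (if i < k then 0 else c2 x (i - k) j)"
  by (induction k arbitrary: i) (auto simp: mult.assoc)

lemma c2_w_power: "c2 (var_w ^ k * x) i j = (if j < k then 0 else c2 x i (j - k))"
  by (induction k arbitrary: j) (auto simp: mult.assoc)

lemma c2_monom: "c2 (const2 c * var_u ^ k * var_w ^ l) i j = (if i = k \<and> j = l then c else 0)"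
proof -
  have "c2 (const2 c * var_u ^ k * var_w ^ l) i j = c2 (var_u ^ k * (var_w ^ l * const2 c)) i j"
    by (simp add: ac_simps)
  then show ?thesis by (auto simp: c2_u_power c2_w_power)
qed

lemma c2_mult: "c2 (x * y) i j = (\<Sum>l=0..j. \<Sum>k=0..i. c2 x k l * c2 y (i - k) (j - l))"
  by (simp add: c2_def fps_mult_nth fps_sum_nth)

lemma const2_hom: "rhom const2"
  by (simp add: rhom_def const2_def)

lemmas const2_simps = rhom_simps[OF const2_hom]

definition sc :: "complex \<Rightarrow> local_ring \<Rightarrow> local_ring" where
  "sc c x = const2 c * x"

interpretation O: vspace sc
  by unfold_locales (simp_all add: sc_def const2_simps algebra_simps)

text \<open>The \<open>n\<close>-th power of the maximal ideal \<open>(u, w)\<close>. This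
  filtration takes the place of a topology: series are equal if they agree modulo every
  \<open>Fil n\<close>.\<close>

definition Fil :: "nat \<Rightarrow> local_ring set" where
  "Fil n = {x. \<forall>i j. i + j < n \<longrightarrow> c2 x i j = 0}"

lemma Fil_add: "x \<in> Fil n \<Longrightarrow> y \<in> Fil n \<Longrightarrow> x + y \<in> Fil n"
  and Fil_diff: "x \<in> Fil n \<Longrightarrow> y \<in> Fil n \<Longrightarrow> x - y \<in> Fil n"
  and Fil_0: "0 \<in> Fil n"
  and Fil_UNIV: "x \<in> Fil 0"
  by (auto simp: Fil_def)

lemma Fil_mono: "x \<in> Fil n \<Longrightarrow> m \<le> n \<Longrightarrow> x \<in> Fil m"
  by (auto simp: Fil_def)

lemma Fil_mult: "x \<in> Fil m \<Longrightarrow> y \<in> Fil n \<Longrightarrow> x * y \<in> Fil (m + n)"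
  unfolding Fil_def
proof (intro CollectI allI impI)
  fix i j assume x: "x \<in> {x. \<forall>i j. i + j < m \<longrightarrow> c2 x i j = 0}" "y \<in> {x. \<forall>i j. i + j < n \<longrightarrow> c2 x i j = 0}"
    and ij: "i + j < m + n"
  have "c2 x k l * c2 y (i - k) (j - l) = 0" if "k \<le> i" "l \<le> j" for k l
  proof (cases "k + l < m")
    case False
    then have "(i - k) + (j - l) < n" using ij that by simp
    then show ?thesis using x by simp
  qed (use x in simp)
  then show "c2 (x * y) i j = 0" unfolding c2_mult by (intro sum.neutral ballI) auto
qed

lemma Fil_mult_left: "y \<in> Fil n \<Longrightarrow> x * y \<in> Fil n"
  using Fil_mult[OF Fil_UNIV, of y n x] by simp

lemma Fil_power: "x \<in> Fil (Suc 0) \<Longrightarrow> x ^ n \<in> Fil n"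
  by (induction n) (use Fil_mult[of x "Suc 0"] in \<open>auto simp: Fil_UNIV\<close>)

lemma Fil_Inter: "(\<And>n. x \<in> Fil n) \<Longrightarrow> x = 0"
proof (rule c2_ext)
  fix i j assume "\<And>n. x \<in> Fil n"
  then have "x \<in> Fil (Suc (i + j))" .
  then show "c2 x i j = c2 0 i j" by (auto simp: Fil_def)
qed

lemma Fil_eqI: "(\<And>n. x - y \<in> Fil n) \<Longrightarrow> x = y"
  using Fil_Inter[of "x - y"] by simp

lemma u_Fil: "var_u \<in> Fil (Suc 0)" and w_Fil: "var_w \<in> Fil (Suc 0)"
  using c2_u[of 1] c2_w[of 1] by (auto simp: Fil_def)

lemma Fil_1: "x \<in> Fil (Suc 0) \<longleftrightarrow> c2 x 0 0 = 0"
  by (auto simp: Fil_def)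

lemma Fil_decomp:
  assumes "x \<in> Fil (Suc n)"
  shows "\<exists>a b. a \<in> Fil n \<and> b \<in> Fil n \<and> x = var_u * a + var_w * b"
proof -
  define a where "a = Abs_fps (\<lambda>j. Abs_fps (\<lambda>i. if j = 0 then c2 x (Suc i) 0 else 0))"
  define b where "b = Abs_fps (\<lambda>j. Abs_fps (\<lambda>i. c2 x i (Suc j)))"
  have a: "c2 a i j = (if j = 0 then c2 x (Suc i) 0 else 0)" and b: "c2 b i j = c2 x i (Suc j)" for i j
    by (simp_all add: a_def b_def c2_def)
  have "x = var_u * a + var_w * b"
    by (rule c2_ext) (use assms in \<open>auto simp: a b Fil_def gr0_conv_Suc\<close>)
  moreover have "a \<in> Fil n" "b \<in> Fil n" using assms by (auto simp: Fil_def a b)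
  ultimately show ?thesis by blast
qed

lemma O_approx:
  assumes "\<And>c. P (const2 c)" "P var_u" "P var_w" "\<And>x y. P x \<Longrightarrow> P y \<Longrightarrow> P (x + y)" "\<And>x y. P x \<Longrightarrow> P y \<Longrightarrow> P (x * y)"
  shows "\<exists>y. P y \<and> x - y \<in> Fil n"
proof (induction n arbitrary: x)
  case 0
  then show ?case using assms(1) Fil_UNIV by blast
next
  case (Suc n)
  have "x - const2 (c2 x 0 0) \<in> Fil (Suc 0)" by (simp add: Fil_def)
  then obtain a b where ab: "x - const2 (c2 x 0 0) = var_u * a + var_w * b" using Fil_decomp by blast
  obtain a' b' where a': "P a'" "a - a' \<in> Fil n" and b': "P b'" "b - b' \<in> Fil n" using Suc by metis
  have "x - (const2 (c2 x 0 0) + (var_u * a' + var_w * b')) = var_u * (a - a') + var_w * (b - b')"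
    using ab by (simp add: algebra_simps)
  also have "\<dots> \<in> Fil (Suc n)"
    using Fil_mult[OF u_Fil a'(2)] Fil_mult[OF w_Fil b'(2)] by (simp add: Fil_add)
  finally have "x - (const2 (c2 x 0 0) + (var_u * a' + var_w * b')) \<in> Fil (Suc n)" .
  moreover have "P (const2 (c2 x 0 0) + (var_u * a' + var_w * b'))" by (intro assms a'(1) b'(1))
  ultimately show ?case by (intro exI conjI)
qed

text \<open>Unlike \<open>O_approx\<close>, this density statement asks for closure under sums only;
  it is the form needed to prove that \<open>phi\<close> is multiplicative.\<close>

lemma O_monom_approx:
  assumes "\<And>c k l. P (const2 c * var_u ^ k * var_w ^ l)" "\<And>x y. P x \<Longrightarrow> P y \<Longrightarrow> P (x + y)"
  shows "\<exists>y. P y \<and> x - y \<in> Fil n"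
proof -
  have P0: "P 0" using assms(1)[of 0] by (simp add: const2_simps)
  have "P (sum f A)" if "finite A" "\<And>z. z \<in> A \<Longrightarrow> P (f z)" for f and A :: "nat set"
    using that by (induction A rule: finite_induct) (auto simp: P0 assms(2))
  then have "P (\<Sum>l<n. \<Sum>k<n. const2 (c2 x k l) * var_u ^ k * var_w ^ l)"
    by (simp add: assms(1))
  moreover have "x - (\<Sum>l<n. \<Sum>k<n. const2 (c2 x k l) * var_u ^ k * var_w ^ l) \<in> Fil n"
  proof (unfold Fil_def, intro CollectI allI impI)
    fix i j assume "i + j < n"
    then have "(\<Sum>l<n. \<Sum>k<n. if i = k \<and> j = l then c2 x k l else 0) = c2 x i j"
    proof -
      have "(\<Sum>l<n. \<Sum>k<n. if i = k \<and> j = l then c2 x k l else 0) = (\<Sum>l<n. if j = l then (\<Sum>k<n. if i = k then c2 x k l else 0) else 0)"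
        by (intro sum.cong) auto
      also have "\<dots> = c2 x i j" using \<open>i + j < n\<close> by simp
      finally show ?thesis .
    qed
    then show "c2 (x - (\<Sum>l<n. \<Sum>k<n. const2 (c2 x k l) * var_u ^ k * var_w ^ l)) i j = 0"
      by (simp add: c2_sum c2_monom)
  qed
  ultimately show ?thesis by blast
qed

text \<open>Continuity argument: the maps may lower the order by a constant \<open>d\<close>, which
  is 0 for ring homomorphisms and 1 for derivations, so agreement on a dense set suffices.\<close>

lemma O_limit:
  assumes "\<And>x y. P x \<Longrightarrow> P y \<Longrightarrow> P (x + y)" "\<And>x n. \<exists>y. P y \<and> x - y \<in> Fil n"
    "\<And>x. P x \<Longrightarrow> F x = G x" "\<And>x y. F (x - y) = F x - F y" "\<And>x y. G (x - y) = G x - (G y :: local_ring)"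
    "\<And>x n. x \<in> Fil (n + d) \<Longrightarrow> F x \<in> Fil n" "\<And>x n. x \<in> Fil (n + d) \<Longrightarrow> G x \<in> Fil n"
  shows "F x = G x"
proof (rule Fil_eqI)
  fix n
  obtain y where y: "P y" "x - y \<in> Fil (n + d)" using assms(2) by blast
  have "F x - G x = F (x - y) - G (x - y)" using assms(3)[OF y(1)] by (simp add: assms(4,5))
  also have "\<dots> \<in> Fil n" using assms(6)[OF y(2)] assms(7)[OF y(2)] by (rule Fil_diff)
  finally show "F x - G x \<in> Fil n" .
qed

lemma hom_Fil:
  assumes "rhom F" "F var_u \<in> Fil (Suc 0)" "F var_w \<in> Fil (Suc 0)"
  shows "x \<in> Fil n \<Longrightarrow> F x \<in> Fil n"
proof (induction n arbitrary: x)
  case (Suc n)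
  obtain a b where ab: "a \<in> Fil n" "b \<in> Fil n" "x = var_u * a + var_w * b" using Fil_decomp[OF Suc.prems] by blast
  have "F x = F var_u * F a + F var_w * F b" using assms(1) by (simp add: ab rhom_simps)
  then show ?case using Fil_mult[OF assms(2) Suc.IH[OF ab(1)]] Fil_mult[OF assms(3) Suc.IH[OF ab(2)]]
    by (simp add: Fil_add)
qed (simp add: Fil_UNIV)

lemma hom_ext:
  assumes F: "rhom F" "F var_u \<in> Fil (Suc 0)" "F var_w \<in> Fil (Suc 0)" and G: "rhom G"
    and eq: "\<And>c. F (const2 c) = G (const2 c)" "F var_u = G var_u" "F var_w = G var_w"
  shows "F x = G x"
proof (rule O_limit[where P = "\<lambda>x. F x = G x" and d = 0 and x = x and F = F and G = G])
  show "\<exists>y. F y = G y \<and> x - y \<in> Fil n" for x n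
    by (rule O_approx) (use F G eq in \<open>auto simp: rhom_simps\<close>)
  show "x \<in> Fil (n + 0) \<Longrightarrow> F x \<in> Fil n" for x n using hom_Fil[OF F, of x n] by simp
  show "x \<in> Fil (n + 0) \<Longrightarrow> G x \<in> Fil n" for x n using hom_Fil[OF G, of x n] F eq by simp
qed (use F G in \<open>auto simp: rhom_simps\<close>)

subsection \<open>Substitution\<close>

text \<open>Substitution of \<open>a\<close> for u and \<open>b\<close> for w. If both lack a
  constant term, \<open>a^k b^l\<close> has order at least \<open>k + l\<close>, so truncating the
  sums at \<open>i + j\<close> changes nothing.\<close>

definition phi :: "local_ring \<Rightarrow> local_ring \<Rightarrow> local_ring \<Rightarrow> local_ring" where
  "phi a b x = Abs_fps (\<lambda>j. Abs_fps (\<lambda>i. \<Sum>l\<le>i+j. \<Sum>k\<le>i+j. c2 x k l * c2 (a ^ k * b ^ l) i j))"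

context
  fixes a b :: local_ring
  assumes ab: "a \<in> Fil (Suc 0)" "b \<in> Fil (Suc 0)"
begin

lemma ab_power: "a ^ k * b ^ l \<in> Fil (k + l)"
  using Fil_mult[OF Fil_power[OF ab(1)] Fil_power[OF ab(2)]] .

lemma c2_phi:
  assumes "i + j \<le> n"
  shows "c2 (phi a b x) i j = (\<Sum>l\<le>n. \<Sum>k\<le>n. c2 x k l * c2 (a ^ k * b ^ l) i j)"
proof -
  have z: "c2 (a ^ k * b ^ l) i j = 0" if "k + l > i + j" for k l using ab_power[of k l] that by (auto simp: Fil_def)
  have "(\<Sum>l\<le>n. \<Sum>k\<le>n. c2 x k l * c2 (a ^ k * b ^ l) i j) = (\<Sum>l\<le>n. \<Sum>k\<le>i+j. c2 x k l * c2 (a ^ k * b ^ l) i j)"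
    using assms by (intro sum.cong refl sum.mono_neutral_right) (auto simp: z)
  also have "\<dots> = (\<Sum>l\<le>i+j. \<Sum>k\<le>i+j. c2 x k l * c2 (a ^ k * b ^ l) i j)"
    using assms by (intro sum.mono_neutral_right) (auto simp: z intro!: sum.neutral)
  finally show ?thesis by (simp add: phi_def c2_def)
qed

lemma phi_add: "phi a b (x + y) = phi a b x + phi a b y"
  by (rule c2_ext) (simp add: c2_phi[OF order_refl] algebra_simps sum.distrib)

lemma phi_diff: "phi a b (x - y) = phi a b x - phi a b y"
  by (rule c2_ext) (simp add: c2_phi[OF order_refl] algebra_simps sum_subtractf)

lemma phi_Fil: "x \<in> Fil n \<Longrightarrow> phi a b x \<in> Fil n"
  unfolding Fil_def
proof (intro CollectI allI impI)
  fix i j assume x: "x \<in> {x. \<forall>i j. i + j < n \<longrightarrow> c2 x i j = 0}" and ij: "i + j < n"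
  have "c2 x k l * c2 (a ^ k * b ^ l) i j = 0" for k l
    using x ij ab_power[of k l] by (cases "k + l < n") (auto simp: Fil_def)
  then show "c2 (phi a b x) i j = 0" by (simp only: c2_phi[OF order_refl] sum.neutral_const)
qed

lemma phi_monom: "phi a b (const2 c * var_u ^ k * var_w ^ l) = const2 c * a ^ k * b ^ l"
proof (rule c2_ext)
  fix i j
  define n where "n = i + j + k + l"
  have "c2 (phi a b (const2 c * var_u ^ k * var_w ^ l)) i j =
      (\<Sum>l'\<le>n. \<Sum>k'\<le>n. c2 (const2 c * var_u ^ k * var_w ^ l) k' l' * c2 (a ^ k' * b ^ l') i j)"
    by (rule c2_phi) (simp add: n_def)
  also have "\<dots> = (\<Sum>l'\<le>n. if l' = l then (\<Sum>k'\<le>n. if k' = k then c * c2 (a ^ k' * b ^ l') i j else 0) else 0)"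
    by (intro sum.cong refl) (auto simp: c2_monom mult_delta_left)
  also have "\<dots> = c * c2 (a ^ k * b ^ l) i j" by (simp add: n_def)
  finally show "c2 (phi a b (const2 c * var_u ^ k * var_w ^ l)) i j = c2 (const2 c * a ^ k * b ^ l) i j"
    by (simp add: mult.assoc)
qed

lemma phi_const: "phi a b (const2 c) = const2 c"
  and phi_u: "phi a b var_u = a"
  and phi_w: "phi a b var_w = b"
  using phi_monom[of c 0 0] phi_monom[of 1 1 0] phi_monom[of 1 0 1] by (simp_all add: const2_simps)

text \<open>The product formula is explicit for two monomials and passes to arbitrary series by
  continuity, one factor at a time.\<close>

lemma phi_hom: "rhom (phi a b)"
proof (rule rhomI)
  show "phi a b 1 = 1" using phi_const[of 1] by (simp add: const2_simps)
  show "phi a b (x + y) = phi a b x + phi a b y" for x y by (rule phi_add)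
  have mm: "phi a b (const2 c * var_u ^ k * var_w ^ l * (const2 c' * var_u ^ k' * var_w ^ l')) =
      phi a b (const2 c * var_u ^ k * var_w ^ l) * phi a b (const2 c' * var_u ^ k' * var_w ^ l')" for c k l c' k' l'
  proof -
    have "const2 c * var_u ^ k * var_w ^ l * (const2 c' * var_u ^ k' * var_w ^ l') =
      const2 (c * c') * var_u ^ (k + k') * var_w ^ (l + l')" by (simp add: const2_simps power_add ac_simps)
    then have "phi a b (const2 c * var_u ^ k * var_w ^ l * (const2 c' * var_u ^ k' * var_w ^ l')) =
      const2 (c * c') * a ^ (k + k') * b ^ (l + l')" by (simp only: phi_monom)
    then show ?thesis by (simp only: phi_monom) (simp add: const2_simps power_add ac_simps)
  qed
  have m: "phi a b (const2 c * var_u ^ k * var_w ^ l * x) = phi a b (const2 c * var_u ^ k * var_w ^ l) * phi a b x" for c k l x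
  proof (rule O_limit[where d = 0 and x = x and P = "\<lambda>x. phi a b (const2 c * var_u ^ k * var_w ^ l * x) = phi a b (const2 c * var_u ^ k * var_w ^ l) * phi a b x"
      and F = "\<lambda>x. phi a b (const2 c * var_u ^ k * var_w ^ l * x)" and G = "\<lambda>x. phi a b (const2 c * var_u ^ k * var_w ^ l) * phi a b x"])
    show "\<exists>y. phi a b (const2 c * var_u ^ k * var_w ^ l * y) = phi a b (const2 c * var_u ^ k * var_w ^ l) * phi a b y \<and> x - y \<in> Fil n" for x n
      by (rule O_monom_approx) (simp_all only: mm distrib_left phi_add)
  qed (simp_all add: distrib_left phi_add right_diff_distrib phi_diff Fil_mult_left phi_Fil)
  show "phi a b (x * y) = phi a b x * phi a b y" for x y
  proof (rule O_limit[where d = 0 and x = x and P = "\<lambda>x. phi a b (x * y) = phi a b x * phi a b y"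
      and F = "\<lambda>x. phi a b (x * y)" and G = "\<lambda>x. phi a b x * phi a b y"])
    show "\<exists>x'. phi a b (x' * y) = phi a b x' * phi a b y \<and> x - x' \<in> Fil n" for x n
      by (rule O_monom_approx) (simp_all only: m distrib_right phi_add)
    show "z \<in> Fil (n + 0) \<Longrightarrow> phi a b (z * y) \<in> Fil n" for z n
      using Fil_mult_left[of z n y] by (simp add: phi_Fil mult.commute)
    show "z \<in> Fil (n + 0) \<Longrightarrow> phi a b z * phi a b y \<in> Fil n" for z n
      using Fil_mult_left[OF phi_Fil, of z n "phi a b y"] by (simp add: mult.commute)
  qed (simp_all add: distrib_right phi_add left_diff_distrib phi_diff)
qed

end

lemma phi_unique:
  assumes "rhom F" "\<And>c. F (const2 c) = const2 c" "F var_u \<in> Fil (Suc 0)" "F var_w \<in> Fil (Suc 0)"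
  shows "F x = phi (F var_u) (F var_w) x"
  by (rule hom_ext) (use assms in \<open>simp_all add: phi_hom phi_const phi_u phi_w\<close>)

lemma phi_phi:
  assumes "a \<in> Fil (Suc 0)" "b \<in> Fil (Suc 0)" "c \<in> Fil (Suc 0)" "d \<in> Fil (Suc 0)"
  shows "phi a b (phi c d x) = phi (phi a b c) (phi a b d) x"
  using phi_unique[of "\<lambda>x. phi a b (phi c d x)" x] assms
  by (simp add: rhom_comp phi_hom phi_const phi_u phi_w phi_Fil)

lemma phi_id: "phi var_u var_w x = x"
  by (rule hom_ext[OF phi_hom[OF u_Fil w_Fil]]) (simp_all add: phi_const phi_u phi_w u_Fil w_Fil rhom_id)

subsection \<open>Derivations\<close>

lemma c2_du: "c2 (du x) i j = of_nat (Suc i) * c2 x (Suc i) j"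
  and c2_dw: "c2 (dw x) i j = of_nat (Suc j) * c2 x i (Suc j)"
  by (simp_all add: c2_def du_def dw_def fps_of_nat[symmetric])

lemma du_add: "du (x + y) = du x + du y"
  and dw_add: "dw (x + y) = dw x + dw y"
  and du_diff: "du (x - y) = du x - du y"
  and dw_diff: "dw (x - y) = dw x - dw y"
  by (rule c2_ext, simp add: c2_du c2_dw algebra_simps)+

lemma dw_mult: "dw (x * y) = x * dw y + dw x * y"
  by (simp add: dw_def)

lemma du_mult: "du (x * y) = x * du y + du x * y"
  by (simp add: du_def fps_eq_iff[of _ "_ + _"] fps_mult_nth fps_deriv_sum sum.distrib)

lemma du_const: "du (const2 c) = 0" and dw_const: "dw (const2 c) = 0"
  by (rule c2_ext, simp add: c2_du c2_dw)+

lemma du_u: "du var_u = 1" and dw_u: "dw var_u = 0" and du_w: "du var_w = 0" and dw_w: "dw var_w = 1"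
  using c2_u[of 1] c2_w[of 1] by (auto intro!: c2_ext simp: c2_du c2_dw c2_1)

lemma du_Fil: "x \<in> Fil (Suc n) \<Longrightarrow> du x \<in> Fil n" and dw_Fil: "x \<in> Fil (Suc n) \<Longrightarrow> dw x \<in> Fil n"
  by (auto simp: Fil_def c2_du c2_dw)

text \<open>Stated for any derivation over the constants that lowers the order by at most one, so
  that it covers \<open>du\<close> and \<open>dw\<close> at once.\<close>

lemma phi_chain:
  assumes ab: "a \<in> Fil (Suc 0)" "b \<in> Fil (Suc 0)"
    and D: "\<And>x y. D (x + y) = D x + D y" "\<And>x y. D (x * y) = x * D y + D x * y" "\<And>c. D (const2 c) = 0"
      "\<And>x n. x \<in> Fil (Suc n) \<Longrightarrow> D x \<in> Fil n"
  shows "D (phi a b x) = phi a b (du x) * D a + phi a b (dw x) * D b"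
proof (rule O_limit[where d = 1 and P = "\<lambda>x. D (phi a b x) = phi a b (du x) * D a + phi a b (dw x) * D b"
      and x = x and F = "\<lambda>x. D (phi a b x)" and G = "\<lambda>x. phi a b (du x) * D a + phi a b (dw x) * D b"])
  note simps = phi_hom[OF ab] rhom_simps phi_const[OF ab] phi_u[OF ab] phi_w[OF ab] D du_add dw_add du_mult dw_mult du_const
    dw_const du_u du_w dw_u dw_w
  show "\<exists>y. D (phi a b y) = phi a b (du y) * D a + phi a b (dw y) * D b \<and> x - y \<in> Fil n" for x n
    by (rule O_approx) (simp_all add: simps algebra_simps)
  have D0: "D 0 = 0" using D(1)[of 0 0] by simp
  have "D (x - y) = D x - D y" for x y using D(1)[of "x - y" y] by (simp add: algebra_simps)
  then show "D (phi a b (x - y)) = D (phi a b x) - D (phi a b y)" for x y by (simp add: simps)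
  show "x \<in> Fil (n + 1) \<Longrightarrow> phi a b (du x) * D a + phi a b (dw x) * D b \<in> Fil n" for x n
    using Fil_mult_left[of "phi a b (du x)" n "D a"] Fil_mult_left[of "phi a b (dw x)" n "D b"]
    by (simp add: Fil_add phi_Fil[OF ab] du_Fil dw_Fil mult.commute)
qed (simp_all add: D phi_Fil[OF ab] phi_hom[OF ab] rhom_simps du_add dw_add du_diff dw_diff algebra_simps)

subsection \<open>Power series in one variable\<close>

definition ou :: "complex fps \<Rightarrow> local_ring" where "ou e = fps_const e"
definition ow :: "complex fps \<Rightarrow> local_ring" where "ow e = Abs_fps (\<lambda>n. fps_const (fps_nth e n))"

lemma c2_ou: "c2 (ou e) i j = (if j = 0 then fps_nth e i else 0)"
  and c2_ow: "c2 (ow e) i j = (if i = 0 then fps_nth e j else 0)"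
  by (simp_all add: c2_def ou_def ow_def)

lemma ou_hom: "rhom ou" by (simp add: rhom_def ou_def)

lemma ow_hom: "rhom ow"
proof (rule rhomI)
  show "ow (x * y) = ow x * ow y" for x y
  proof (rule c2_ext)
    fix i j
    show "c2 (ow (x * y)) i j = c2 (ow x * ow y) i j"
      by (cases i) (auto simp: c2_ow c2_mult fps_mult_nth intro!: sum.neutral[symmetric])
  qed
qed (auto intro!: c2_ext simp: c2_ow c2_1)

lemma ou_const: "ou (fps_const c) = const2 c"
  and ou_X: "ou fps_X = var_u"
  and ou_nth0: "fps_nth (ou e) 0 = e"
  by (simp_all add: ou_def var_u_def const2_def)

lemma ow_const: "ow (fps_const c) = const2 c"
  by (rule c2_ext) (simp add: c2_ow)

lemma ow_X: "ow fps_X = var_w"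
  using c2_w[of 1] by (intro c2_ext) (auto simp: c2_ow c2_1)

lemma ow_Fil: "fps_nth e 0 = 0 \<Longrightarrow> ow e \<in> Fil (Suc 0)" and ou_Fil: "fps_nth e 0 = 0 \<Longrightarrow> ou e \<in> Fil (Suc 0)"
  by (simp_all add: Fil_1 c2_ow c2_ou)

lemma nth0_hom: "rhom (\<lambda>x :: 'a::comm_ring_1 fps. fps_nth x 0)"
  by (simp add: rhom_def fps_mult_nth)

lemma c2_00_hom: "rhom (\<lambda>x. c2 x 0 0)"
  by (simp add: rhom_def c2_1 c2_mult)

text \<open>\<open>br a b\<close> restricts to the parametrized branch \<open>(u, w) = (a, b)\<close>.\<close>

definition br :: "complex fps \<Rightarrow> complex fps \<Rightarrow> local_ring \<Rightarrow> complex fps" where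
  "br a b x = fps_nth (phi (ou a) (ou b) x) 0"

context
  fixes a b :: "complex fps"
  assumes ab: "fps_nth a 0 = 0" "fps_nth b 0 = 0"
begin

lemma br_hom: "rhom (br a b)"
  unfolding br_def by (rule rhom_comp[OF nth0_hom phi_hom]) (simp_all add: ou_Fil ab)

lemma br_const: "br a b (const2 c) = fps_const c" and br_u: "br a b var_u = a" and br_w: "br a b var_w = b"
  by (simp_all add: br_def phi_const phi_u phi_w ou_Fil ab) (simp_all add: const2_def ou_def)

end

text \<open>\<open>fps_nth x 0\<close> is the restriction of \<open>x\<close> to
  \<open>w = 0\<close>; substituting and then restricting means following the image of this
  axis.\<close>

lemma phi_nth0:
  assumes "p \<in> Fil (Suc 0)" "q \<in> Fil (Suc 0)"
  shows "fps_nth (phi p q x) 0 = br (fps_nth p 0) (fps_nth q 0) x"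
proof -
  have *: "ou (fps_nth (phi p q x) 0) = phi (ou (fps_nth p 0)) (ou (fps_nth q 0)) x"
    using phi_unique[of "\<lambda>x. ou (fps_nth (phi p q x) 0)" x] assms
    by (simp add: rhom_comp[OF ou_hom rhom_comp[OF nth0_hom phi_hom]] phi_const phi_u phi_w ou_Fil Fil_1 c2_def)
       (simp add: const2_def ou_def)
  show ?thesis unfolding br_def *[symmetric] by (simp add: ou_def)
qed

lemma br_phi:
  assumes "fps_nth a 0 = 0" "fps_nth b 0 = 0" "c \<in> Fil (Suc 0)" "d \<in> Fil (Suc 0)"
  shows "br a b (phi c d x) = br (br a b c) (br a b d) x"
proof -
  have ab: "ou a \<in> Fil (Suc 0)" "ou b \<in> Fil (Suc 0)" using assms by (simp_all add: ou_Fil)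
  show ?thesis unfolding br_def[of a b "phi c d x"] phi_phi[OF ab assms(3,4)]
    by (subst phi_nth0) (use assms ab in \<open>auto simp: phi_Fil br_def\<close>)
qed

lemma br_nth0:
  assumes "fps_nth a 0 = 0" "fps_nth b 0 = 0"
  shows "fps_nth (br a b x) 0 = c2 x 0 0"
proof -
  have "x - const2 (c2 x 0 0) \<in> Fil (Suc 0)" by (simp add: Fil_1)
  then have "phi (ou a) (ou b) (x - const2 (c2 x 0 0)) \<in> Fil (Suc 0)" by (intro phi_Fil ou_Fil assms)
  then have "fps_nth (br a b (x - const2 (c2 x 0 0))) 0 = 0" by (simp add: Fil_1 c2_def br_def)
  then show ?thesis using br_hom[OF assms] br_const[OF assms] by (simp add: rhom_simps)
qed

lemma br_chain:
  assumes "fps_nth a 0 = 0" "fps_nth b 0 = 0"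
  shows "fps_deriv (br a b x) = br a b (du x) * fps_deriv a + br a b (dw x) * fps_deriv b"
proof -
  have ab: "ou a \<in> Fil (Suc 0)" "ou b \<in> Fil (Suc 0)" using assms by (simp_all add: ou_Fil)
  have d: "fps_nth (du y) 0 = fps_deriv (fps_nth y 0)" for y by (simp add: du_def)
  have "fps_deriv (br a b x) = fps_nth (du (phi (ou a) (ou b) x)) 0" by (simp add: br_def d)
  also have "\<dots> = br a b (du x) * fps_deriv a + br a b (dw x) * fps_deriv b"
    using phi_chain[where D = du, OF ab du_add du_mult du_const du_Fil] by (simp add: br_def d ou_nth0)
  finally show ?thesis .
qed

section \<open>Colengths in the local ring\<close>

lemma linI:
  assumes "vspace s" "vspace s'" "\<And>x y. T (x + y) = T x + T y" "\<And>c x. T (s c x) = s' c (T x)"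
  shows "Vector_Spaces.linear s s' T"
proof -
  interpret A: vspace s by fact
  interpret B: vspace s' by fact
  show ?thesis by unfold_locales (simp_all add: assms)
qed

lemma linear_mult: "Vector_Spaces.linear sc sc (\<lambda>x. a * x)"
  by (rule linI) (simp_all add: O.vspace_axioms sc_def algebra_simps)

lemma linear_hom: "rhom F \<Longrightarrow> (\<And>c. F (const2 c) = const2 c) \<Longrightarrow> Vector_Spaces.linear sc sc F"
  by (rule linI) (simp_all add: O.vspace_axioms sc_def rhom_simps)

definition is_ideal :: "'a::comm_ring_1 set \<Rightarrow> bool" where
  "is_ideal I \<longleftrightarrow> 0 \<in> I \<and> (\<forall>x\<in>I. \<forall>y\<in>I. x + y \<in> I) \<and> (\<forall>a. \<forall>x\<in>I. a * x \<in> I)"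

lemma ideal_0: "is_ideal I \<Longrightarrow> 0 \<in> I"
  and ideal_add: "is_ideal I \<Longrightarrow> x \<in> I \<Longrightarrow> y \<in> I \<Longrightarrow> x + y \<in> I"
  and ideal_mult: "is_ideal I \<Longrightarrow> x \<in> I \<Longrightarrow> a * x \<in> I"
  by (simp_all add: is_ideal_def)

lemma ideal_mult': "is_ideal I \<Longrightarrow> x \<in> I \<Longrightarrow> x * a \<in> I"
  using ideal_mult[of I x a] by (simp add: mult.commute)

lemma ideal_diff: "is_ideal I \<Longrightarrow> x \<in> I \<Longrightarrow> y \<in> I \<Longrightarrow> x - y \<in> I"
  using ideal_add[of I x "(- 1) * y"] ideal_mult[of I y "- 1"] by simp

lemma ideal_subspace: "is_ideal I \<Longrightarrow> O.subspace I"
  by (simp add: is_ideal_def O.subspace_def sc_def)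

definition id2 :: "'a::comm_ring_1 \<Rightarrow> 'a \<Rightarrow> 'a set" where
  "id2 a b = {a * x + b * y | x y. True}"

definition id3 :: "'a::comm_ring_1 \<Rightarrow> 'a \<Rightarrow> 'a \<Rightarrow> 'a set" where
  "id3 a b c = {a * x + b * y + c * z | x y z. True}"

lemma id2I: "z = a * x + b * y \<Longrightarrow> z \<in> id2 a b"
  by (auto simp: id2_def)

lemma id3I: "t = a * x + b * y + c * z \<Longrightarrow> t \<in> id3 a b c"
  by (auto simp: id3_def)

lemma id2E: assumes "z \<in> id2 a b" obtains x y where "z = a * x + b * y"
  using assms by (auto simp: id2_def)

lemma id3E: assumes "t \<in> id3 a b c" obtains x y z where "t = a * x + b * y + c * z"
  using assms by (auto simp: id3_def)

lemma ideal_id2: "is_ideal (id2 a b)"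
  unfolding is_ideal_def
proof (intro conjI ballI allI)
  show "0 \<in> id2 a b" by (rule id2I[of _ _ 0 _ 0]) simp
  fix s assume "s \<in> id2 a b"
  then obtain x y where s: "s = a * x + b * y" by (rule id2E)
  show "d * s \<in> id2 a b" for d by (rule id2I[of _ _ "d * x" _ "d * y"]) (simp add: s algebra_simps)
  fix t assume "t \<in> id2 a b"
  then obtain x' y' where t: "t = a * x' + b * y'" by (rule id2E)
  show "s + t \<in> id2 a b" by (rule id2I[of _ _ "x + x'" _ "y + y'"]) (simp add: s t algebra_simps)
qed

lemma ideal_id3: "is_ideal (id3 a b c)"
  unfolding is_ideal_def
proof (intro conjI ballI allI)
  show "0 \<in> id3 a b c" by (rule id3I[of _ _ 0 _ 0 _ 0]) simp
  fix s assume "s \<in> id3 a b c"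
  then obtain x y z where s: "s = a * x + b * y + c * z" by (rule id3E)
  show "d * s \<in> id3 a b c" for d
    by (rule id3I[of _ _ "d * x" _ "d * y" _ "d * z"]) (simp add: s algebra_simps)
  fix t assume "t \<in> id3 a b c"
  then obtain x' y' z' where t: "t = a * x' + b * y' + c * z'" by (rule id3E)
  show "s + t \<in> id3 a b c"
    by (rule id3I[of _ _ "x + x'" _ "y + y'" _ "z + z'"]) (simp add: s t algebra_simps)
qed

lemma id2_gen: "a \<in> id2 a b" "b \<in> id2 a b"
  by (rule id2I[of _ _ 1 _ 0], simp, rule id2I[of _ _ 0 _ 1], simp)

lemma id3_gen: "a \<in> id3 a b c" "b \<in> id3 a b c" "c \<in> id3 a b c"
  by (rule id3I[of _ _ 1 _ 0 _ 0], simp, rule id3I[of _ _ 0 _ 1 _ 0], simp, rule id3I[of _ _ 0 _ 0 _ 1], simp)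

lemma id2_least:
  assumes "is_ideal I" "a \<in> I" "b \<in> I"
  shows "id2 a b \<subseteq> I"
proof
  fix z assume "z \<in> id2 a b"
  then obtain x y where "z = a * x + b * y" by (rule id2E)
  then show "z \<in> I" using assms by (simp add: ideal_add ideal_mult')
qed

lemma id3_least:
  assumes "is_ideal I" "a \<in> I" "b \<in> I" "c \<in> I"
  shows "id3 a b c \<subseteq> I"
proof
  fix t assume "t \<in> id3 a b c"
  then obtain x y z where "t = a * x + b * y + c * z" by (rule id3E)
  then show "t \<in> I" using assms by (simp add: ideal_add ideal_mult')
qed

lemma subspace_id2: "O.subspace (id2 a b)" and subspace_id3: "O.subspace (id3 a b c)"
  by (rule ideal_subspace[OF ideal_id2], rule ideal_subspace[OF ideal_id3])

abbreviation cd :: "local_ring set \<Rightarrow> nat \<Rightarrow> bool" where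
  "cd I n \<equiv> fd sc I UNIV n"

lemma cd_pull:
  assumes "cd J n" "O.subspace J" "Vector_Spaces.linear sc sc T" "surj T"
  shows "cd {v. T v \<in> J} n"
proof -
  have "fd sc {v \<in> UNIV. T v \<in> J} {v \<in> UNIV. T v \<in> UNIV} n"
    by (rule O.fd_pull[OF assms(1) O.vspace_axioms assms(2,3)]) (simp_all add: assms(4) O.subspace_UNIV)
  then show ?thesis by simp
qed

lemma cd_push:
  assumes "cd {v. T v \<in> J} n" "O.subspace J" "Vector_Spaces.linear sc sc T" "surj T" "O.subspace {v. T v \<in> J}"
  shows "cd J n"
proof -
  have 1: "fd sc J {T v + j | v j. v \<in> UNIV \<and> j \<in> J} n"
    by (rule O.fd_push[OF assms(1,5) O.vspace_axioms assms(3,2)]) simp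
  have "x \<in> {T v + j | v j. v \<in> UNIV \<and> j \<in> J}" for x
  proof -
    obtain v where "x = T v" using assms(4) by (metis surjD)
    then have "x = T v + 0" by simp
    then show ?thesis using O.subspace_0[OF assms(2)] by (intro CollectI exI[of _ v] exI[of _ 0]) simp
  qed
  then have "{T v + j | v j. v \<in> UNIV \<and> j \<in> J} = UNIV" by (rule UNIV_eq_I[symmetric])
  with 1 show ?thesis by simp
qed

text \<open>Additivity of intersection multiplicities: multiplication by \<open>a\<close> induces an
  isomorphism from the ring modulo \<open>(b, p)\<close> onto \<open>(a, p)/(a b, p)\<close>.
  Injectivity needs \<open>p\<close> to be a non-zero-divisor modulo \<open>a\<close>.\<close>

lemma cd_mult:
  assumes m: "cd (id2 a p) m" and n: "cd (id2 b p) n" and nz: "\<And>z. a dvd p * z \<Longrightarrow> a dvd z" and "a \<noteq> 0"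
  shows "cd (id2 (a * b) p) (m + n)"
proof -
  have iff: "a * x \<in> id2 (a * b) p \<longleftrightarrow> x \<in> id2 b p" for x
  proof
    assume "a * x \<in> id2 (a * b) p"
    then obtain y z where yz: "a * x = a * b * y + p * z" by (rule id2E)
    then have "p * z = a * (x - b * y)" by (simp add: algebra_simps)
    then have "a dvd z" by (rule nz[OF dvdI])
    then obtain z' where "z = a * z'" by (elim dvdE)
    then have "a * x = a * (b * y + p * z')" using yz by (simp add: algebra_simps)
    then show "x \<in> id2 b p" using \<open>a \<noteq> 0\<close> by (intro id2I[of _ _ y _ z']) simp
  next
    assume "x \<in> id2 b p"
    then obtain y z where "x = b * y + p * z" by (rule id2E)
    then show "a * x \<in> id2 (a * b) p" by (intro id2I[of _ _ y _ "a * z"]) (simp add: algebra_simps)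
  qed
  have 1: "fd sc (id2 (a * b) p) {a * v + j | v j. v \<in> UNIV \<and> j \<in> id2 (a * b) p} n"
    by (rule O.fd_push[OF n subspace_id2 O.vspace_axioms linear_mult subspace_id2]) (rule iff)
  have "{a * v + j | v j. v \<in> UNIV \<and> j \<in> id2 (a * b) p} = id2 a p"
  proof (intro subset_antisym subsetI)
    fix x assume "x \<in> {a * v + j | v j. v \<in> UNIV \<and> j \<in> id2 (a * b) p}"
    then obtain v j where "x = a * v + j" "j \<in> id2 (a * b) p" by blast
    moreover from this(2) obtain y z where "j = a * b * y + p * z" by (rule id2E)
    ultimately show "x \<in> id2 a p" by (intro id2I[of _ _ "v + b * y" _ z]) (simp add: algebra_simps)
  next
    fix x assume "x \<in> id2 a p"
    then obtain y z where x: "x = a * y + p * z" by (rule id2E)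
    have "p * z \<in> id2 (a * b) p" by (rule id2I[of _ _ 0 _ z]) simp
    with x show "x \<in> {a * v + j | v j. v \<in> UNIV \<and> j \<in> id2 (a * b) p}" by blast
  qed
  with 1 have "fd sc (id2 (a * b) p) (id2 a p) n" by simp
  from O.fd_trans[OF m this] show ?thesis by (simp add: add.commute)
qed

lemma w_dvd: "var_w dvd x \<longleftrightarrow> fps_nth x 0 = 0"
proof
  assume "fps_nth x 0 = 0"
  then have "x = var_w * Abs_fps (\<lambda>n. fps_nth x (Suc n))"
    by (intro c2_ext) (auto simp: c2_def[of x] c2_def[of "Abs_fps _"] gr0_conv_Suc)
  then show "var_w dvd x" by (rule dvdI)
next
  assume "var_w dvd x"
  then obtain y where "x = var_w * y" by (elim dvdE)
  then show "fps_nth x 0 = 0" by (simp add: var_w_def)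
qed

lemma O_unit: "c2 x 0 0 \<noteq> 0 \<Longrightarrow> \<exists>y. x * y = 1"
proof -
  assume "c2 x 0 0 \<noteq> 0"
  then have "fps_nth x 0 * inverse (fps_nth x 0) = 1"
    using inverse_mult_eq_1[of "fps_nth x 0"] by (simp add: c2_def mult.commute)
  then show ?thesis using fps_right_inverse by blast
qed

lemma fps_unit_factor:
  fixes e :: "complex fps"
  assumes "e \<noteq> 0"
  shows "\<exists>f. fps_nth f 0 \<noteq> 0 \<and> e = fps_X ^ subdegree e * f"
  using subdegree_decompose[of e] assms
  by (intro exI[of _ "fps_shift (subdegree e) e"]) (simp add: mult.commute)

lemma fps_dvd_low:
  fixes e f :: "complex fps"
  assumes "e \<noteq> 0" "\<And>i. i < subdegree e \<Longrightarrow> fps_nth f i = 0"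
  shows "e dvd f"
proof (cases "f = 0")
  case False
  then have "subdegree e \<le> subdegree f" using assms by (intro subdegree_geI) auto
  then show ?thesis using assms False by (simp add: fps_dvd_iff)
qed simp

text \<open>Modulo w the ring is a power series ring in u, where an ideal is determined by an order;
  \<open>I k\<close> consists of the series whose restriction to \<open>w = 0\<close> has order at
  least \<open>k\<close>.\<close>

lemma cd_w:
  assumes "fps_nth x 0 \<noteq> 0"
  shows "cd (id2 var_w x) (subdegree (fps_nth x 0))"
proof -
  define I where "I k = {y :: local_ring. \<forall>i<k. c2 y i 0 = 0}" for k
  have sub: "O.subspace (I k)" for k by (simp add: I_def O.subspace_def sc_def)
  have step: "fd sc (I (Suc k)) (I k) 1" for k
  proof -
    have "adj sc (I (Suc k)) (var_u ^ k) = I k"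
    proof (intro subset_antisym subsetI)
      fix y assume "y \<in> adj sc (I (Suc k)) (var_u ^ k)"
      then show "y \<in> I k" using c2_u_power[of k 1] by (auto elim!: adjE simp: I_def sc_def)
    next
      fix y assume y: "y \<in> I k"
      have "y - sc (c2 y k 0) (var_u ^ k) \<in> I (Suc k)"
        using y c2_u_power[of k 1] by (auto simp: I_def sc_def less_Suc_eq c2_1)
      then show "y \<in> adj sc (I (Suc k)) (var_u ^ k)" by (rule adjI[where c = "c2 y k 0"]) simp
    qed
    moreover have "var_u ^ k \<notin> I (Suc k)" using c2_u_power[of k 1 k] by (auto simp: I_def c2_1)
    ultimately show ?thesis using fd_step[OF fd_refl, of "var_u ^ k" "I (Suc k)" sc] by simp
  qed
  have all: "cd (I k) k" for k
  proof (induction k)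
    case 0
    then show ?case by (simp add: I_def fd_refl)
  next
    case (Suc k)
    then show ?case using O.fd_trans[OF Suc step] by simp
  qed
  have "id2 var_w x = I (subdegree (fps_nth x 0))"
  proof (intro subset_antisym subsetI)
    fix y assume "y \<in> id2 var_w x"
    then obtain a b where y: "y = var_w * a + x * b" by (rule id2E)
    have "c2 y i 0 = fps_nth (fps_nth x 0 * fps_nth b 0) i" for i by (simp add: y c2_def var_w_def)
    moreover have "fps_nth (fps_nth x 0 * fps_nth b 0) i = 0" if "i < subdegree (fps_nth x 0)" for i
    proof -
      have "fps_nth (fps_nth x 0) k = 0" if "k \<in> {0..i}" for k
        using that \<open>i < subdegree (fps_nth x 0)\<close> by (intro nth_less_subdegree_zero) simp
      then show ?thesis by (simp add: fps_mult_nth)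
    qed
    ultimately show "y \<in> I (subdegree (fps_nth x 0))" by (simp add: I_def)
  next
    fix y assume "y \<in> I (subdegree (fps_nth x 0))"
    then have "fps_nth x 0 dvd fps_nth y 0" using assms by (intro fps_dvd_low) (auto simp: I_def c2_def)
    then obtain q where q: "fps_nth y 0 = fps_nth x 0 * q" by (elim dvdE)
    have "var_w dvd y - x * ou q" by (simp add: w_dvd q ou_nth0)
    then obtain a where "y - x * ou q = var_w * a" by (elim dvdE)
    then show "y \<in> id2 var_w x" by (intro id2I[of _ _ a _ "ou q"]) (simp add: algebra_simps)
  qed
  then show ?thesis using all by simp
qed

lemma fps_hom_ext:
  assumes F: "rhom F" and G: "rhom G" and eq: "\<And>c. F (fps_const c) = G (fps_const c)" "F fps_X = G fps_X"
    and X: "F fps_X \<in> Fil (Suc 0)"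
  shows "F (e :: complex fps) = G e"
proof (rule Fil_eqI)
  show "F e - G e \<in> Fil n" for n
  proof (induction n arbitrary: e)
    case (Suc n)
    have e: "e = fps_const (fps_nth e 0) + fps_X * fps_shift 1 e"
      by (rule fps_ext) (auto simp: fps_eq_iff gr0_conv_Suc)
    have "F e - G e = F fps_X * (F (fps_shift 1 e) - G (fps_shift 1 e))"
      by (subst (1 2) e) (simp add: rhom_simps[OF F] rhom_simps[OF G] eq algebra_simps)
    then show ?case using Fil_mult[OF X Suc[of "fps_shift 1 e"]] by simp
  qed (rule Fil_UNIV)
qed

text \<open>The automorphism \<open>u \<mapsto> w + \<rho>(u)\<close>, \<open>w \<mapsto> u\<close> turns the smooth germ \<open>u - \<rho>(w)\<close> into \<open>w\<close>.\<close>

context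
  fixes r :: "complex fps"
  assumes r: "fps_nth r 0 = 0"
begin

lemma theta_Fil: "var_w + ou r \<in> Fil (Suc 0)" "var_u - ow r \<in> Fil (Suc 0)"
  using r u_Fil w_Fil by (auto intro!: Fil_add Fil_diff ou_Fil ow_Fil)

abbreviation theta :: "local_ring \<Rightarrow> local_ring" where "theta \<equiv> phi (var_w + ou r) var_u"

lemma theta_ow: "theta (ow e) = ou e"
  by (rule fps_hom_ext)
     (simp_all add: rhom_comp[OF phi_hom ow_hom] ou_hom theta_Fil u_Fil ow_const ou_const phi_const ow_X ou_X phi_w)

lemma theta_inv_ou: "phi var_w (var_u - ow r) (ou e) = ow e"
  by (rule fps_hom_ext)
     (simp_all add: rhom_comp[OF phi_hom ou_hom] ow_hom theta_Fil w_Fil ow_const ou_const phi_const ow_X ou_X phi_u)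

lemma theta_inv: "theta (phi var_w (var_u - ow r) x) = x" "phi var_w (var_u - ow r) (theta x) = x"
  by (simp_all add: phi_phi theta_Fil u_Fil w_Fil phi_u phi_w phi_id theta_ow theta_inv_ou
      rhom_simps[OF phi_hom])

lemma theta_brp: "theta (var_u - ow r) = var_w"
  by (simp add: rhom_simps[OF phi_hom] theta_Fil u_Fil phi_u theta_ow)

lemma theta_nth0: "fps_nth (theta x) 0 = br r fps_X x"
  by (subst phi_nth0) (simp_all add: theta_Fil u_Fil ou_nth0, simp add: var_w_def var_u_def)

lemma brp_dvd: "(var_u - ow r) dvd x \<longleftrightarrow> br r fps_X x = 0"
proof -
  have h: "rhom theta" "rhom (phi var_w (var_u - ow r))" by (simp_all add: phi_hom theta_Fil u_Fil w_Fil)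
  have "(var_u - ow r) dvd x \<longleftrightarrow> var_w dvd theta x"
    using rhom_dvd[OF h(1), of "var_u - ow r" x] rhom_dvd[OF h(2), of var_w "theta x"]
    by (auto simp: theta_brp theta_inv phi_w theta_Fil w_Fil)
  then show ?thesis by (simp add: w_dvd theta_nth0)
qed

lemma cd_brp:
  assumes "br r fps_X x \<noteq> 0"
  shows "cd (id2 (var_u - ow r) x) (subdegree (br r fps_X x))"
proof -
  have h: "rhom theta" "rhom (phi var_w (var_u - ow r))" by (simp_all add: phi_hom theta_Fil u_Fil w_Fil)
  have "{v. theta v \<in> id2 var_w (theta x)} = id2 (var_u - ow r) x"
  proof (intro subset_antisym subsetI)
    fix v assume "v \<in> {v. theta v \<in> id2 var_w (theta x)}"
    then obtain a b where "theta v = var_w * a + theta x * b" by (auto elim: id2E)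
    then have "phi var_w (var_u - ow r) (theta v) = phi var_w (var_u - ow r) (var_w * a + theta x * b)" by simp
    then have "v = (var_u - ow r) * phi var_w (var_u - ow r) a + x * phi var_w (var_u - ow r) b"
      unfolding theta_inv(2) by (simp add: rhom_simps[OF h(2)] phi_w theta_Fil w_Fil theta_inv)
    then show "v \<in> id2 (var_u - ow r) x" by (rule id2I)
  next
    fix v assume "v \<in> id2 (var_u - ow r) x"
    then obtain a b where "v = (var_u - ow r) * a + x * b" by (rule id2E)
    then have "theta v = var_w * theta a + theta x * theta b"
      by (simp add: rhom_simps[OF h(1)] theta_brp[unfolded rhom_diff[OF h(1)]])
    then show "v \<in> {v. theta v \<in> id2 var_w (theta x)}" by (auto intro: id2I)
  qed
  moreover have "cd {v. theta v \<in> id2 var_w (theta x)} (subdegree (br r fps_X x))"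
  proof (rule cd_pull)
    show "cd (id2 var_w (theta x)) (subdegree (br r fps_X x))"
      using cd_w[of "theta x"] assms by (simp add: theta_nth0)
    show "Vector_Spaces.linear sc sc theta" by (rule linear_hom[OF h(1)]) (simp add: phi_const theta_Fil u_Fil)
    show "surj theta" using theta_inv(1) by (rule surjI)
  qed (rule subspace_id2)
  ultimately show ?thesis by simp
qed

end

lemma cd_1: "cd (id2 1 x) 0"
proof -
  have "id2 1 x = (UNIV :: local_ring set)" by (auto intro!: id2I[of _ 1 _ x 0])
  then show ?thesis by (simp add: fd_refl)
qed

lemma cd_branch_product:
  assumes "\<And>r. r \<in> set rs \<Longrightarrow> fps_nth r 0 = 0 \<and> br r fps_X x \<noteq> 0"
  shows "cd (id2 (\<Prod>r\<leftarrow>rs. var_u - ow r) x) (\<Sum>r\<leftarrow>rs. subdegree (br r fps_X x))"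
  using assms
proof (induction rs)
  case Nil
  then show ?case by (simp add: cd_1)
next
  case (Cons r rs)
  have r: "fps_nth r 0 = 0" "br r fps_X x \<noteq> 0" using Cons.prems[of r] by auto
  have nz: "(var_u - ow r) dvd z" if "(var_u - ow r) dvd x * z" for z
    using that r by (simp add: brp_dvd rhom_simps[OF br_hom])
  have "var_u - ow r \<noteq> 0" using theta_brp[OF r(1)] r(1) c2_w[of 1 0 1]
    by (metis c2_0 c2_1 diff_self_eq_0 mult.right_neutral phi_hom rhom_0 theta_Fil(1) u_Fil zero_neq_one)
  then show ?case using cd_mult[OF cd_brp[OF r] Cons.IH nz] Cons.prems by auto
qed

lemma id2_unit: assumes "e * f = 1" shows "id2 (e * a) x = id2 a x"
proof (intro subset_antisym id2_least ideal_id2)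
  show "e * a \<in> id2 a x" by (intro ideal_mult ideal_id2 id2_gen)
  have "f * (e * a) \<in> id2 (e * a) x" by (intro ideal_mult ideal_id2 id2_gen)
  then show "a \<in> id2 (e * a) x" using assms by (simp add: mult.assoc[symmetric] mult.commute[of f])
qed (rule id2_gen)+

subsection \<open>The base change \<open>w \<mapsto> w\<^sup>N\<close>\<close>

definition pw :: "nat \<Rightarrow> local_ring \<Rightarrow> local_ring" where
  "pw N = phi var_u (var_w ^ N)"

text \<open>The coordinates of \<open>x\<close> in the basis \<open>1, w, ..., w^(N - 1)\<close> of
  the local ring over the image of \<open>pw N\<close>, see \<open>pj_decomp\<close>.\<close>

definition pj :: "nat \<Rightarrow> nat \<Rightarrow> local_ring \<Rightarrow> local_ring" where
  "pj N l x = Abs_fps (\<lambda>n. fps_nth x (n * N + l))"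

lemma c2_pj: "c2 (pj N l x) i j = c2 x i (j * N + l)"
  by (simp add: pj_def c2_def)

context
  fixes N :: nat
  assumes N: "N > 0"
begin

lemma wN_Fil: "var_w ^ N \<in> Fil (Suc 0)"
  using Fil_power[OF w_Fil[unfolded One_nat_def], of N] N by (auto intro: Fil_mono)

lemma pw_hom: "rhom (pw N)"
  unfolding pw_def by (rule phi_hom[OF u_Fil wN_Fil])

lemma pw_const: "pw N (const2 c) = const2 c" and pw_u: "pw N var_u = var_u" and pw_w: "pw N var_w = var_w ^ N"
  unfolding pw_def by (simp_all add: phi_const phi_u phi_w u_Fil wN_Fil)

lemma pw_compose: "pw N x = fps_compose x (fps_X ^ N)"
proof -
  have X0: "fps_nth (fps_X ^ N :: local_ring) 0 = 0" using N by simp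
  have h: "rhom (\<lambda>x :: local_ring. fps_compose x (fps_X ^ N))"
    by (simp add: rhom_def fps_compose_add_distrib fps_compose_mult_distrib[OF X0])
  have w: "fps_compose var_w (fps_X ^ N) = var_w ^ N"
    unfolding var_w_def by (rule fps_X_fps_compose_startby0[OF X0])
  show ?thesis unfolding pw_def
    using phi_unique[OF h, of x] by (simp add: w wN_Fil u_Fil) (simp add: const2_def var_u_def wN_Fil u_Fil[unfolded var_u_def])
qed

lemma c2_pw: "c2 (pw N x) i j = (if N dvd j then c2 x i (j div N) else 0)"
proof -
  have "fps_nth (pw N x) j = (\<Sum>k=0..j. fps_nth x k * (if j = N * k then 1 else 0))"
    by (simp add: pw_compose fps_compose_nth power_mult[symmetric] fps_X_power_nth)
  also have "\<dots> = (\<Sum>k=0..j. if j = N * k then fps_nth x k else 0)" by (intro sum.cong) auto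
  also have "\<dots> = (if N dvd j then fps_nth x (j div N) else 0)"
  proof (cases "N dvd j")
    case True
    then obtain m where m: "j = N * m" by (elim dvdE)
    then have "m \<le> j" using N by simp
    have "(\<Sum>k=0..j. if j = N * k then fps_nth x k else 0) = (\<Sum>k=0..j. if m = k then fps_nth x k else 0)"
      using N m by (intro sum.cong) auto
    then show ?thesis using \<open>m \<le> j\<close> N m by simp
  next
    case False
    then show ?thesis by (auto intro!: sum.neutral)
  qed
  finally show ?thesis by (simp add: c2_def)
qed

lemma pj_add: "pj N l (x + y) = pj N l x + pj N l y"
  by (rule c2_ext) (simp add: c2_pj)

lemma pj_linear: "Vector_Spaces.linear sc sc (pj N l)"
  by (rule linI) (auto simp: O.vspace_axioms pj_add sc_def c2_pj intro!: c2_ext)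

lemma pj_mult: assumes "l < N" shows "pj N l (pw N a * x) = a * pj N l x"
proof (rule c2_ext)
  fix i j
  have j: "(\<lambda>m. m * N) ` {0..j} \<subseteq> {0..j * N + l}" by auto (metis le_add1 mult_le_mono1 le_trans)
  have "c2 (pj N l (pw N a * x)) i j = (\<Sum>m=0..j * N + l. \<Sum>k=0..i. c2 (pw N a) k m * c2 x (i - k) (j * N + l - m))"
    by (simp add: c2_pj c2_mult)
  also have "\<dots> = (\<Sum>m\<in>(\<lambda>m. m * N) ` {0..j}. \<Sum>k=0..i. c2 (pw N a) k m * c2 x (i - k) (j * N + l - m))"
  proof (rule sum.mono_neutral_right[OF _ j], simp, intro ballI sum.neutral)
    fix m k assume m: "m \<in> {0..j * N + l} - (\<lambda>m. m * N) ` {0..j}"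
    have "\<not> N dvd m"
    proof
      assume "N dvd m"
      then obtain q where q: "m = q * N" by (metis dvdE mult.commute)
      then have "q * N < (j + 1) * N" using m assms by simp
      then have "q \<le> j" by (simp only: mult_less_cancel2) simp
      then show False using m q by auto
    qed
    then show "c2 (pw N a) k m * c2 x (i - k) (j * N + l - m) = 0" by (simp add: c2_pw)
  qed
  also have "\<dots> = (\<Sum>m=0..j. \<Sum>k=0..i. c2 (pw N a) k (m * N) * c2 x (i - k) (j * N + l - m * N))"
    by (subst sum.reindex) (use N in \<open>auto simp: inj_on_def\<close>)
  also have "\<dots> = (\<Sum>m=0..j. \<Sum>k=0..i. c2 a k m * c2 x (i - k) ((j - m) * N + l))"
  proof (intro sum.cong refl)
    fix m k assume "m \<in> {0..j}"
    then have "j * N + l - m * N = (j - m) * N + l" by (simp add: diff_mult_distrib)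
    then show "c2 (pw N a) k (m * N) * c2 x (i - k) (j * N + l - m * N) = c2 a k m * c2 x (i - k) ((j - m) * N + l)"
      using N by (simp add: c2_pw)
  qed
  also have "\<dots> = c2 (a * pj N l x) i j" by (simp add: c2_mult c2_pj)
  finally show "c2 (pj N l (pw N a * x)) i j = c2 (a * pj N l x) i j" .
qed

lemma c2_w_pw: "c2 (var_w ^ l * pw N y) i j = (if l \<le> j \<and> N dvd j - l then c2 y i ((j - l) div N) else 0)"
  by (simp add: c2_w_power c2_pw)

lemma pj_decomp: "x = (\<Sum>l<N. var_w ^ l * pw N (pj N l x))"
proof (rule c2_ext)
  fix i j
  have "c2 (\<Sum>l<N. var_w ^ l * pw N (pj N l x)) i j = (\<Sum>l<N. if l = j mod N then c2 x i j else 0)"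
    unfolding c2_sum
  proof (intro sum.cong refl)
    fix l assume "l \<in> {..<N}"
    then have l: "l \<le> j \<and> N dvd j - l \<longleftrightarrow> l = j mod N"
      by (metis lessThan_iff mod_eq_dvd_iff_nat mod_less mod_less_eq_dividend)
    moreover have "(j - j mod N) div N * N + j mod N = j" by (metis minus_mod_eq_mult_div div_mult_mod_eq mult.commute nonzero_mult_div_cancel_left N less_not_refl)
    ultimately show "c2 (var_w ^ l * pw N (pj N l x)) i j = (if l = j mod N then c2 x i j else 0)"
      by (auto simp: c2_w_pw c2_pj)
  qed
  also have "\<dots> = c2 x i j" using N by simp
  finally show "c2 x i j = c2 (\<Sum>l<N. var_w ^ l * pw N (pj N l x)) i j" by simp
qed

lemma pj_single: assumes "l < N" "m < N" shows "pj N l (var_w ^ m * pw N a) = (if l = m then a else 0)"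
proof (rule c2_ext)
  fix i j
  have "m \<le> j * N + l \<and> N dvd j * N + l - m \<longleftrightarrow> l = m"
  proof
    assume "m \<le> j * N + l \<and> N dvd j * N + l - m"
    then have "(j * N + l) mod N = m mod N" by (metis mod_eq_dvd_iff_nat)
    then show "l = m" using assms by simp
  qed simp
  then show "c2 (pj N l (var_w ^ m * pw N a)) i j = c2 (if l = m then a else 0) i j"
    using N by (simp add: c2_pj c2_w_pw)
qed

lemma pj_id2: "y \<in> id2 (pw N h) (pw N p) \<longleftrightarrow> (\<forall>l<N. pj N l y \<in> id2 h p)"
proof
  assume "y \<in> id2 (pw N h) (pw N p)"
  then obtain a b where "y = pw N h * a + pw N p * b" by (rule id2E)
  then have "pj N l y = h * pj N l a + p * pj N l b" if "l < N" for l using that by (simp add: pj_add pj_mult)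
  then show "\<forall>l<N. pj N l y \<in> id2 h p" by (auto intro: id2I)
next
  assume *: "\<forall>l<N. pj N l y \<in> id2 h p"
  have "var_w ^ l * pw N (pj N l y) \<in> id2 (pw N h) (pw N p)" if l: "l < N" for l
  proof -
    have "pj N l y \<in> id2 h p" using * l by simp
    then obtain a b where "pj N l y = h * a + p * b" by (rule id2E)
    then have "pw N (pj N l y) = pw N h * pw N a + pw N p * pw N b" by (simp add: rhom_simps[OF pw_hom])
    then show ?thesis by (intro ideal_mult ideal_id2) (rule id2I)
  qed
  then have "(\<Sum>l<k. var_w ^ l * pw N (pj N l y)) \<in> id2 (pw N h) (pw N p)" if "k \<le> N" for k
    using that by (induction k) (auto intro: ideal_add[OF ideal_id2] ideal_0[OF ideal_id2])
  from this[of N] show "y \<in> id2 (pw N h) (pw N p)" using pj_decomp[of y] by simp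
qed

text \<open>The ring is free of rank \<open>N\<close> over the image of \<open>pw N\<close>, so
  membership in the extended ideal is tested coordinatewise and the colength is multiplied by
  \<open>N\<close>; \<open>W j\<close> imposes the conditions on the first \<open>j\<close>
  coordinates only. Finiteness before the base change is part of the conclusion.\<close>

lemma cd_pw:
  assumes "cd (id2 (pw N h) (pw N p)) n'"
  shows "\<exists>n. cd (id2 h p) n \<and> n' = N * n"
proof -
  define W where "W j = {y. \<forall>l<j. pj N l y \<in> id2 h p}" for j
  have WN: "W N = id2 (pw N h) (pw N p)" by (auto simp: W_def pj_id2)
  have sub: "O.subspace (W j)" for j
  proof -
    have "O.subspace {y. pj N l y \<in> id2 h p}" for l
    proof -
      interpret T: Vector_Spaces.linear sc sc "pj N l" by (rule pj_linear)
      show ?thesis using subspace_id2[of h p] by (simp add: O.subspace_def T.zero T.add T.scale)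
    qed
    then show ?thesis by (simp add: W_def O.subspace_def)
  qed
  have "W N \<subseteq> W 1" using N by (auto simp: W_def)
  then obtain n where "cd (W 1) n" using O.fd_split[OF assms[folded WN] sub sub] by blast
  then have n: "cd (id2 h p) n"
    using cd_push[of "pj N 0" "id2 h p" n] sub[of 1] N pj_single[of 0 0]
    by (auto simp: W_def pj_linear subspace_id2 intro!: surjI[of _ "\<lambda>a. pw N a"])
  have step: "fd sc (W (Suc j)) (W j) n" if j: "j < N" for j
  proof -
    have "fd sc {v \<in> W j. pj N j v \<in> id2 h p} {v \<in> W j. pj N j v \<in> UNIV} n"
    proof (rule O.fd_pull[OF n O.vspace_axioms subspace_id2 pj_linear sub], rule subsetI)
      fix a
      have "var_w ^ j * pw N a \<in> W j" "pj N j (var_w ^ j * pw N a) = a"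
        using j by (auto simp: W_def pj_single ideal_0[OF ideal_id2])
      then show "a \<in> pj N j ` W j" by (metis imageI)
    qed
    moreover have "{v \<in> W j. pj N j v \<in> id2 h p} = W (Suc j)" by (auto simp: W_def less_Suc_eq)
    ultimately show ?thesis by simp
  qed
  have "cd (W j) (j * n)" if "j \<le> N" for j
    using that
  proof (induction j)
    case 0
    then show ?case by (simp add: W_def fd_refl)
  next
    case (Suc j)
    then show ?case using O.fd_trans[OF Suc.IH step] by simp
  qed
  from O.fd_unique[OF this[OF order_refl] assms[folded WN] sub] n show ?thesis by auto
qed

lemma br_pw: "fps_nth r 0 = 0 \<Longrightarrow> br r fps_X (pw N x) = br r (fps_X ^ N) x"
  unfolding pw_def using N
  by (subst br_phi) (simp_all add: u_Fil wN_Fil br_u br_w rhom_power[OF br_hom])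

text \<open>Intersection multiplicity as a sum of orders along Puiseux branches: after
  \<open>w \<mapsto> w^N\<close> the curve \<open>h = 0\<close> is a union of smooth branches, and
  the way back divides the total by \<open>N\<close>.\<close>

lemma cd_branches:
  assumes "\<And>r. r \<in> set rs \<Longrightarrow> fps_nth r 0 = 0 \<and> br r (fps_X ^ N) p \<noteq> 0"
    "pw N h = e * (\<Prod>r\<leftarrow>rs. var_u - ow r)" "e * f = 1"
  shows "\<exists>n. cd (id2 h p) n \<and> N * n = (\<Sum>r\<leftarrow>rs. subdegree (br r (fps_X ^ N) p))"
proof -
  have "map (\<lambda>r. subdegree (br r fps_X (pw N p))) rs = map (\<lambda>r. subdegree (br r (fps_X ^ N) p)) rs"
    using assms(1) by (simp add: br_pw)
  moreover have "cd (id2 (pw N h) (pw N p)) (\<Sum>r\<leftarrow>rs. subdegree (br r fps_X (pw N p)))"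
    unfolding assms(2) id2_unit[OF assms(3)] by (rule cd_branch_product) (use assms(1) br_pw in auto)
  ultimately show ?thesis using cd_pw by metis
qed

end

section \<open>Weierstrass preparation and Puiseux series\<close>

text \<open>Coefficients in w of a Weierstrass quotient of \<open>a\<close> by \<open>h\<close>.
  \<open>W\<close> will divide by \<open>h(u, 0)\<close> and discard a remainder of low degree in u;
  apart from the new coefficient, only earlier ones enter into the coefficient of \<open>w^n\<close>
  of the product.\<close>

fun weier_quot :: "(nat \<Rightarrow> 'a::comm_ring_1) \<Rightarrow> ('a \<Rightarrow> 'a) \<Rightarrow> (nat \<Rightarrow> 'a) \<Rightarrow> nat \<Rightarrow> 'a" where
  "weier_quot a W h n = W (a n - (\<Sum>k<n. weier_quot a W h k * h (n - k)))"

declare weier_quot.simps [simp del]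

lemma weierstrass_division:
  fixes h a :: local_ring
  assumes h: "fps_nth h 0 \<noteq> 0" and r: "r = subdegree (fps_nth h 0)"
  shows "\<exists>q R. a = q * h + R \<and> (\<forall>i j. r \<le> i \<longrightarrow> c2 R i j = 0)"
proof -
  obtain e where e: "fps_nth e 0 \<noteq> 0" "fps_nth h 0 = fps_X ^ r * e" using fps_unit_factor[OF h] r by auto
  have ie: "inverse e * e = 1" using e(1) by (rule inverse_mult_eq_1)
  define W where "W x = fps_shift r x * inverse e" for x :: "complex fps"
  define Q where "Q = weier_quot (fps_nth a) W (fps_nth h)"
  define x where "x n = fps_nth a n - (\<Sum>k<n. Q k * fps_nth h (n - k))" for n
  have Q: "Q n = W (x n)" for n unfolding Q_def x_def by (subst weier_quot.simps) simp
  have "fps_nth (a - Abs_fps Q * h) n = x n - fps_shift r (x n) * fps_X ^ r" for n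
  proof -
    have "(\<Sum>k=0..n. Q k * fps_nth h (n - k)) = (\<Sum>k<n. Q k * fps_nth h (n - k)) + Q n * fps_nth h 0"
      by (simp add: atLeast0AtMost lessThan_Suc_atMost[symmetric])
    moreover have "Q n * fps_nth h 0 = fps_shift r (x n) * fps_X ^ r * (inverse e * e)"
      by (simp add: Q W_def e ac_simps)
    ultimately show ?thesis by (simp add: fps_mult_nth x_def ie)
  qed
  then have "c2 (a - Abs_fps Q * h) i n = 0" if "r \<le> i" for i n
    using that by (simp add: c2_def fps_X_power_mult_right_nth)
  then show ?thesis by (intro exI[of _ "Abs_fps Q"] exI[of _ "a - Abs_fps Q * h"]) simp
qed

lemma bounded_u_degree:
  assumes "\<And>i j. r \<le> i \<Longrightarrow> c2 R i j = 0"
  shows "R = (\<Sum>i<r. ow (Abs_fps (c2 R i)) * var_u ^ i)"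
proof (rule c2_ext)
  fix i j
  have "c2 (ow (Abs_fps (c2 R k)) * var_u ^ k) i j = (if i = k then c2 R k j else 0)" for k
    using c2_u_power[of k "ow (Abs_fps (c2 R k))" i j] by (auto simp: mult.commute c2_ow)
  then have "c2 (\<Sum>i<r. ow (Abs_fps (c2 R i)) * var_u ^ i) i j = (if i < r then c2 R i j else 0)"
    by (simp add: c2_sum)
  then show "c2 R i j = c2 (\<Sum>i<r. ow (Abs_fps (c2 R i)) * var_u ^ i) i j" using assms by auto
qed

text \<open>Divide \<open>u^r\<close> by \<open>h\<close>. On \<open>w = 0\<close> the remainder has
  degree below \<open>r\<close> and is divisible by \<open>u^r\<close>, so it vanishes there. Hence
  the quotient is invertible, and the lower coefficients have no constant term.\<close>

lemma weierstrass_preparation: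
  assumes h: "fps_nth h 0 \<noteq> 0" and r: "r = subdegree (fps_nth h 0)"
  shows "\<exists>e f c. e * f = 1 \<and> e * h = var_u ^ r + (\<Sum>i<r. ow (c i) * var_u ^ i) \<and> (\<forall>i<r. fps_nth (c i) 0 = 0)"
proof -
  obtain q R where qR: "var_u ^ r = q * h + R" and R: "\<And>i j. r \<le> i \<Longrightarrow> c2 R i j = 0"
    using weierstrass_division[OF h r, of "var_u ^ r"] by blast
  obtain e where e: "fps_nth e 0 \<noteq> 0" "fps_nth h 0 = fps_X ^ r * e" using fps_unit_factor[OF h] r by auto
  have u0: "fps_nth (var_u ^ r) 0 = fps_X ^ r"
    by (simp add: rhom_power[OF nth0_hom]) (simp add: var_u_def)
  have "fps_X ^ r = fps_nth q 0 * (fps_X ^ r * e) + fps_nth R 0"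
    using arg_cong[OF qR, of "\<lambda>x. fps_nth x 0"] by (simp add: u0 e)
  then have eq: "fps_nth R 0 = fps_X ^ r * (1 - fps_nth q 0 * e)" by (simp add: algebra_simps)
  have low: "c2 R i 0 = 0" if "i < r" for i using that by (simp add: c2_def eq fps_X_power_mult_nth)
  have "fps_nth R 0 = 0"
    by (rule fps_ext) (metis R low c2_def fps_zero_nth not_le)
  then have "fps_nth q 0 * e = 1" using eq by simp
  then have "fps_nth (fps_nth q 0) 0 * fps_nth e 0 = 1" by (metis fps_mult_nth_0 fps_one_nth)
  then have "c2 q 0 0 \<noteq> 0" by (auto simp: c2_def)
  then obtain f where f: "q * f = 1" using O_unit by blast
  define c where "c i = - Abs_fps (c2 R i)" for i
  have "q * h = var_u ^ r - R" using qR by simp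
  also have "\<dots> = var_u ^ r + (\<Sum>i<r. ow (c i) * var_u ^ i)"
    by (subst bounded_u_degree[OF R]) (simp_all add: c_def rhom_minus[OF ow_hom] sum_negf)
  finally show ?thesis using f low by (intro exI[of _ q] exI[of _ f] exI[of _ c]) (simp add: c_def)
qed

lemma poly_map_pCons:
  assumes "rhom h"
  shows "poly (map_poly h (pCons a p)) v = h a + v * poly (map_poly h p) v"
  by (cases "pCons a p = 0") (simp_all add: map_poly_pCons rhom_0[OF assms])

lemma poly_map_hom:
  assumes h: "rhom h"
  shows "rhom (\<lambda>p. poly (map_poly h p) v)"
proof (rule rhomI)
  note pc = poly_map_pCons[OF h]
  show "poly (map_poly h 1) v = 1" using pc[of 1 0] by (simp add: one_pCons rhom_simps[OF h])
  have add: "poly (map_poly h (p + q)) v = poly (map_poly h p) v + poly (map_poly h q) v" for p q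
    by (induction p q rule: poly_induct2) (simp_all add: pc rhom_simps[OF h] algebra_simps)
  show "poly (map_poly h (p + q)) v = poly (map_poly h p) v + poly (map_poly h q) v" for p q by (rule add)
  have sm: "poly (map_poly h (smult c q)) v = h c * poly (map_poly h q) v" for c q
    by (induction q) (simp_all add: pc rhom_simps[OF h] algebra_simps)
  show "poly (map_poly h (p * q)) v = poly (map_poly h p) v * poly (map_poly h q) v" for p q
    by (induction p) (simp_all add: add sm pc rhom_simps[OF h] algebra_simps)
qed

lemma poly_map_pcompose:
  assumes h: "rhom h"
  shows "poly (map_poly h (pcompose p q)) y = poly (map_poly h p) (poly (map_poly h q) y)"
proof (induction p)
  case (pCons a p)
  have "poly (map_poly h [:a:]) y = h a" using poly_map_pCons[OF h, of a 0 y] by simp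
  then show ?case using pCons
    by (simp add: pcompose_pCons rhom_simps[OF poly_map_hom[OF h]] poly_map_pCons[OF h])
qed simp

definition wp :: "nat \<Rightarrow> (nat \<Rightarrow> 'a::comm_ring_1) \<Rightarrow> 'a poly" where
  "wp r c = monom 1 r + (\<Sum>i<r. monom (c i) i)"

text \<open>The value of \<open>wp r c\<close> at \<open>y\<close>, written out so that ring
  homomorphisms can be pushed through it.\<close>

definition we :: "nat \<Rightarrow> (nat \<Rightarrow> 'a::comm_ring_1) \<Rightarrow> 'a \<Rightarrow> 'a" where
  "we r c y = y ^ r + (\<Sum>i<r. c i * y ^ i)"

lemma poly_map_monom: "rhom h \<Longrightarrow> poly (map_poly h (monom a n)) v = h a * v ^ n"
  by (induction n) (simp_all add: monom_0 monom_Suc poly_map_pCons rhom_0)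

lemma poly_map_wp: "rhom h \<Longrightarrow> poly (map_poly h (wp r c)) y = we r (\<lambda>i. h (c i)) y"
  by (simp add: wp_def we_def rhom_add[OF poly_map_hom] rhom_sum[OF poly_map_hom] poly_map_monom rhom_1)

lemma hom_we: "rhom h \<Longrightarrow> h (we r c y) = we r (\<lambda>i. h (c i)) (h y)"
  by (simp add: we_def rhom_simps rhom_sum)

lemma coeff_wp: "coeff (wp r c) i = (if i = r then 1 else if i < r then c i else 0)"
  by (simp add: wp_def coeff_sum)

lemma degree_wp: "degree (wp r c) = (r::nat)" for c :: "nat \<Rightarrow> 'a::comm_ring_1"
  by (rule order.antisym) (auto intro!: degree_le le_degree simp: coeff_wp)

lemma monic_wp: "degree p = r \<Longrightarrow> coeff p r = 1 \<Longrightarrow> p = wp r (coeff p)"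
  by (rule poly_eqI) (auto simp: coeff_wp coeff_eq_0)

subsection \<open>Ramification\<close>

definition tw :: "nat \<Rightarrow> complex fps \<Rightarrow> complex fps" where
  "tw N c = fps_compose c (fps_X ^ N)"

context
  fixes N :: nat
  assumes N: "N > 0"
begin

lemma tw_hom: "rhom (tw N)"
proof -
  have X0: "fps_nth (fps_X ^ N :: complex fps) 0 = 0" using N by simp
  show ?thesis unfolding tw_def by (simp add: rhom_def fps_compose_add_distrib fps_compose_mult_distrib[OF X0])
qed

lemma tw_const: "tw N (fps_const c) = fps_const c"
  by (simp add: tw_def)

lemma tw_X: "tw N fps_X = fps_X ^ N"
  unfolding tw_def by (rule fps_X_fps_compose_startby0) (use N in simp)

lemma pw_ow: "pw N (ow e) = ow (tw N e)"
  by (rule fps_hom_ext)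
     (simp_all add: rhom_comp[OF pw_hom ow_hom] rhom_comp[OF ow_hom tw_hom] N ow_const tw_const pw_const ow_X tw_X pw_w
       rhom_power[OF ow_hom] wN_Fil)

lemma c2_tw: "fps_nth (tw N e) j = (if N dvd j then fps_nth e (j div N) else 0)"
  using arg_cong[OF pw_ow[of e], of "\<lambda>x. c2 x 0 j"] N by (auto simp: c2_pw c2_ow split: if_splits)

lemma tw_nth0: "fps_nth (tw N e) 0 = fps_nth e 0"
  by (simp add: c2_tw)

lemma subdegree_tw: "e \<noteq> 0 \<Longrightarrow> subdegree (tw N e) = N * subdegree e"
proof (rule subdegreeI)
  assume "e \<noteq> 0"
  then show "fps_nth (tw N e) (N * subdegree e) \<noteq> 0" using N by (simp add: c2_tw)
  fix i assume "i < N * subdegree e"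
  then show "fps_nth (tw N e) i = 0" using N
    by (auto simp: c2_tw elim!: dvdE intro: nth_less_subdegree_zero)
qed

lemma tw_tw: "M > 0 \<Longrightarrow> tw M (tw N e) = tw (N * M) e"
  using N by (intro fps_ext) (auto simp: c2_tw Submission.c2_tw elim!: dvdE)

lemma br_ow: "fps_nth r 0 = 0 \<Longrightarrow> br r (fps_X ^ N) (ow e) = tw N e"
proof -
  assume r: "fps_nth r 0 = 0"
  have X0: "fps_nth (fps_X ^ N :: complex fps) 0 = 0" using N by simp
  have "ou (br r (fps_X ^ N) (ow e)) = ou (tw N e)"
    by (rule fps_hom_ext[where F = "\<lambda>e. ou (br r (fps_X ^ N) (ow e))" and G = "\<lambda>e. ou (tw N e)"])
       (use rhom_comp[OF ou_hom rhom_comp[OF br_hom[OF r X0] ow_hom]] rhom_comp[OF ou_hom tw_hom] in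
         \<open>simp_all add: ow_const br_const[OF r X0] tw_const ow_X br_w[OF r X0] tw_X ou_Fil[OF X0]\<close>)
  then show ?thesis by (metis ou_nth0)
qed

end

lemma coeff_linear_power_pred: "coeff ([:c, 1:] ^ Suc n) n = of_nat (Suc n) * (c :: 'a::comm_ring_1)"
proof (induction n)
  case (Suc n)
  have top: "coeff ([:c, 1:] ^ k) k = 1" for k by (induction k) (auto simp: coeff_pCons coeff_eq_0 degree_linear_power split: nat.splits)
  have "[:c, 1:] ^ Suc (Suc n) = smult c ([:c, 1:] ^ Suc n) + pCons 0 ([:c, 1:] ^ Suc n)" by simp
  then have "coeff ([:c, 1:] ^ Suc (Suc n)) (Suc n) = c * coeff ([:c, 1:] ^ Suc n) (Suc n) + coeff ([:c, 1:] ^ Suc n) n"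
    by (simp only: coeff_add coeff_smult coeff_pCons_Suc)
  then show ?case unfolding Suc top by (simp add: algebra_simps)
qed simp

text \<open>A root of full multiplicity would make \<open>Q\<close> a multiple of
  \<open>(x - z)^(n + 1)\<close>, whose coefficient of degree \<open>n\<close> is a nonzero multiple
  of \<open>z\<close>; so \<open>z = 0\<close> and \<open>Q\<close> is a monomial. This strict drop
  of multiplicity drives the induction in \<open>puiseux_root\<close>.\<close>

lemma order_less_degree:
  fixes Q :: "complex poly"
  assumes "degree Q = Suc n" "coeff Q n = 0" "i \<le> n" "coeff Q i \<noteq> 0"
  shows "order z Q < Suc n"
proof (rule ccontr)
  assume "\<not> order z Q < Suc n"
  moreover have Q0: "Q \<noteq> 0" using assms by auto
  ultimately have "order z Q = Suc n" using order_degree[OF Q0, of z] assms by simp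
  then have "[:- z, 1:] ^ Suc n dvd Q" using order_1[of z Q] by simp
  then obtain T where T: "Q = [:- z, 1:] ^ Suc n * T" by (elim dvdE)
  then have T0: "T \<noteq> 0" using Q0 by auto
  have "degree Q = Suc n + degree T" unfolding T using T0
    by (subst degree_mult_eq) (auto simp: degree_linear_power simp del: power_Suc)
  then obtain t where t: "T = [:t:]" using assms degree_eq_zeroE by (metis add_cancel_left_right)
  have Q: "coeff Q k = t * coeff ([:- z, 1:] ^ Suc n) k" for k by (simp add: T t del: power_Suc)
  have "t \<noteq> 0" using T0 t by simp
  then have "coeff ([:- z, 1:] ^ Suc n) n = 0" using assms(2) Q by simp
  then have "of_nat (Suc n) * (- z) = 0" unfolding coeff_linear_power_pred .
  then have "z = 0" by (simp del: of_nat_Suc)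
  then have "[:- z, 1:] ^ Suc n = monom 1 (Suc n)" by (simp add: monom_altdef)
  then show False using assms Q by simp
qed

lemma pcompose_rhom: "rhom (\<lambda>p. pcompose p q)"
  by (rule rhomI) (simp_all add: pcompose_add pcompose_mult pcompose_1)

text \<open>Newton's algorithm, by induction on the degree. Once the second coefficient is removed,
  rescaling along the lowest slope of the Newton polygon leads to a reduced polynomial with a root
  of multiplicity \<open>m < r\<close>; Weierstrass preparation at that root leaves a polynomial of
  degree \<open>m\<close>.\<close>

theorem puiseux_root:
  assumes "r > 0"
  shows "\<exists>N>0. \<exists>y. we r (\<lambda>i. tw N (c i)) y = 0"
  using assms
proof (induction r arbitrary: c rule: less_induct)
  case (less r)
  show ?case
  proof (cases "r = 1")
    case True
    then show ?thesis by (intro exI[of _ 1] conjI exI[of _ "- tw 1 (c 0)"]) (simp_all add: we_def)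
  next
    case False
    then obtain n where n: "r = Suc n" "n > 0" using less.prems by (cases r) auto
    have centred: "\<exists>N>0. \<exists>y. we r (\<lambda>i. tw N (c i)) y = 0" if c: "c n = 0" for c
    proof (cases "\<forall>i<r. c i = 0")
      case True
      then show ?thesis using n
        by (intro exI[of _ 1] conjI exI[of _ 0]) (simp_all add: we_def rhom_0[OF tw_hom])
    next
      case False
      define Z where "Z = {i. i < r \<and> c i \<noteq> 0}"
      \<comment> \<open>Slopes of the Newton polygon towards its vertex at degree \<open>r\<close>.
        The smallest one is \<open>P / q\<close>, which becomes integral after the ramification of
        index \<open>q\<close>.\<close>
      define s where "s i = real (subdegree (c i)) / real (r - i)" for i
      have "finite Z" "Z \<noteq> {}" using False by (auto simp: Z_def)
      then obtain i0 where i0: "i0 \<in> Z" "\<And>i. i \<in> Z \<Longrightarrow> s i0 \<le> s i"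
        using arg_min_if_finite(1,2)[of Z s] by (metis not_le)
      define q where "q = r - i0"
      define P where "P = subdegree (c i0)"
      have q: "q > 0" using i0 by (simp add: q_def Z_def)
      have slope: "P * (r - i) \<le> q * subdegree (c i)" if "i \<in> Z" for i
      proof -
        have "real P * real (r - i) \<le> real q * real (subdegree (c i))"
          using i0(2)[OF that] that i0(1) by (simp add: s_def P_def q_def Z_def field_simps)
        then show ?thesis by (metis of_nat_le_iff of_nat_mult)
      qed
      define d where "d i = fps_shift (P * (r - i)) (tw q (c i))" for i
      have d: "tw q (c i) = fps_X ^ (P * (r - i)) * d i" if "i < r" for i
      proof (cases "c i = 0")
        case True
        then show ?thesis by (simp add: d_def rhom_0[OF tw_hom[OF q]])
      next
        case False
        then have "P * (r - i) \<le> subdegree (tw q (c i))" using slope that q by (simp add: subdegree_tw Z_def)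
        then have "tw q (c i) = fps_shift (P * (r - i)) (tw q (c i)) * fps_X ^ (P * (r - i))"
          by (rule fps_shift_times_fps_X_power[symmetric])
        then show ?thesis unfolding d_def by (simp only: mult.commute)
      qed
      \<comment> \<open>Replacing the unknown by \<open>t^(M P) y\<close> makes all terms divisible
        by the same power of the parameter t.\<close>
      have scale: "we r (\<lambda>i. tw (q * M) (c i)) (fps_X ^ (M * P) * y) = fps_X ^ (M * P * r) * we r (\<lambda>i. tw M (d i)) y"
        if M: "M > 0" for M y
      proof -
        have "tw (q * M) (c i) * (fps_X ^ (M * P) * y) ^ i = fps_X ^ (M * P * r) * (tw M (d i) * y ^ i)" if i: "i < r" for i
        proof -
          have "tw (q * M) (c i) = tw M (tw q (c i))" by (rule tw_tw[OF q M, symmetric])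
          also have "\<dots> = fps_X ^ (M * (P * (r - i))) * tw M (d i)"
            by (simp add: d[OF i] rhom_simps[OF tw_hom[OF M]] tw_X[OF M] power_mult)
          moreover have "M * (P * (r - i)) + M * P * i = M * P * r"
          proof -
            have "M * P * ((r - i) + i) = M * (P * (r - i)) + M * P * i" by (simp add: algebra_simps)
            then show ?thesis using i by simp
          qed
          ultimately show ?thesis
            by (simp add: power_mult_distrib power_mult[symmetric] ac_simps power_add[symmetric])
        qed
        then have "(\<Sum>i<r. tw (q * M) (c i) * (fps_X ^ (M * P) * y) ^ i) = fps_X ^ (M * P * r) * (\<Sum>i<r. tw M (d i) * y ^ i)"
          unfolding sum_distrib_left by (intro sum.cong) auto
        then show ?thesis
          by (simp add: we_def power_mult_distrib power_mult[symmetric] distrib_left)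
      qed
      define Q where "Q = wp r (\<lambda>i. fps_nth (d i) 0)"
      have "\<not> constant (poly Q)" using n by (simp add: constant_degree Q_def degree_wp)
      then obtain z where z: "poly Q z = 0" using fundamental_theorem_of_algebra by blast
      define m where "m = order z Q"
      have Q0: "Q \<noteq> 0" using n degree_wp[of r "\<lambda>i. fps_nth (d i) 0"] by (auto simp: Q_def)
      have "m > 0" using z Q0 order_root[of Q z] by (auto simp: m_def)
      have "m < r" unfolding m_def n(1)
      proof (rule order_less_degree)
        show "degree Q = Suc n" by (simp add: Q_def degree_wp n)
        show "coeff Q n = 0" by (simp add: Q_def coeff_wp n d_def c rhom_0[OF tw_hom[OF q]])
        show "i0 \<le> n" using i0 n by (simp add: Z_def)
        have "c i0 \<noteq> 0" "i0 < r" using i0 by (auto simp: Z_def)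
        then have "fps_nth (tw q (c i0)) (q * P) \<noteq> 0"
          using q by (simp add: c2_tw P_def)
        then show "coeff Q i0 \<noteq> 0" using \<open>i0 < r\<close> by (simp add: Q_def coeff_wp d_def q_def mult.commute)
      qed
      \<comment> \<open>The rescaled polynomial, recentred at the root \<open>z\<close> and read as
        a germ in u with parameter w; its order on \<open>w = 0\<close> is the multiplicity
        \<open>m\<close>.\<close>
      define g where "g = we r (\<lambda>i. ow (d i)) (var_u + const2 z)"
      define E where "E = (\<lambda>p. poly (map_poly fps_const p) (fps_X + fps_const z))"
      have fc: "rhom (fps_const :: complex \<Rightarrow> _)" by (simp add: rhom_def)
      have E: "rhom E" unfolding E_def by (rule poly_map_hom[OF fc])
      have g0: "fps_nth g 0 = E Q"
      proof -
        have "fps_nth (var_u + const2 z) 0 = fps_X + fps_const z" by (simp add: var_u_def const2_def)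
        then show ?thesis
          by (simp add: g_def E_def Q_def hom_we[OF nth0_hom] poly_map_wp[OF fc]) (simp add: ow_def)
      qed
      obtain T where T: "Q = [:- z, 1:] ^ m * T" "\<not> [:- z, 1:] dvd T"
        using order_decomp[OF Q0, of z] by (auto simp: m_def)
      have "E [:- z, 1:] = fps_X" using rhom_1[OF fc]
        by (simp add: E_def poly_map_pCons[OF fc] one_pCons[symmetric])
      then have g0': "fps_nth g 0 = fps_X ^ m * E T" by (simp add: g0 T(1) rhom_simps[OF E])
      have "fps_nth (E p) 0 = poly p z" for p
        by (induction p) (simp_all add: E_def poly_map_pCons[OF fc])
      then have ET: "fps_nth (E T) 0 \<noteq> 0" using T(2) by (simp add: poly_eq_0_iff_dvd)
      then have "E T \<noteq> 0" "subdegree (E T) = 0" by auto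
      then have g: "fps_nth g 0 \<noteq> 0" "subdegree (fps_nth g 0) = m" by (auto simp: g0')
      obtain e f c' where e: "e * f = 1" "e * g = we m (\<lambda>i. ow (c' i)) var_u"
        and c': "\<And>i. i < m \<Longrightarrow> fps_nth (c' i) 0 = 0"
        using weierstrass_preparation[OF g(1) g(2)[symmetric]] by (auto simp: we_def)
      obtain M y where M: "M > 0" and y: "we m (\<lambda>i. tw M (c' i)) y = 0"
        using less.IH[OF \<open>m < r\<close> \<open>m > 0\<close>, of c'] by blast
      have "fps_nth (we m (\<lambda>i. tw M (c' i)) y) 0 = fps_nth y 0 ^ m"
        by (simp only: hom_we[OF nth0_hom]) (simp add: we_def tw_nth0[OF M] c')
      then have y0: "fps_nth y 0 = 0" using y \<open>m > 0\<close> by simp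
      have X0: "fps_nth (fps_X ^ M :: complex fps) 0 = 0" using M by simp
      note B = br_hom[OF y0 X0]
      have "br y (fps_X ^ M) e * br y (fps_X ^ M) g = 0"
        using y by (simp add: rhom_mult[OF B, symmetric] e(2) hom_we[OF B] br_ow[OF M y0] br_u[OF y0 X0])
      moreover have "br y (fps_X ^ M) e \<noteq> 0"
        using arg_cong[OF e(1), of "br y (fps_X ^ M)"] by (auto simp: rhom_simps[OF B])
      ultimately have "br y (fps_X ^ M) g = 0" by simp
      then have "we r (\<lambda>i. tw M (d i)) (y + fps_const z) = 0"
        by (simp add: g_def hom_we[OF B] br_ow[OF M y0] rhom_simps[OF B] br_u[OF y0 X0] br_const[OF y0 X0])
      then have "we r (\<lambda>i. tw (q * M) (c i)) (fps_X ^ (M * P) * (y + fps_const z)) = 0"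
        by (simp add: scale[OF M])
      then show ?thesis using q M by (intro exI[of _ "q * M"]) auto
    qed
    \<comment> \<open>Tschirnhaus shift: translating the unknown by \<open>c n / r\<close> removes
      the coefficient of degree \<open>n\<close>.\<close>
    define s where "s = fps_const (1 / of_nat r) * c n"
    define p where "p = pcompose (wp r c) [:- s, 1:]"
    have dp: "degree p = r" by (simp add: p_def degree_pcompose degree_wp)
    have rs: "of_nat r * s = c n"
    proof -
      have "of_nat r * fps_const (1 / of_nat r :: complex) = 1"
        using n by (simp add: fps_of_nat[symmetric] del: of_nat_Suc)
      then show ?thesis by (simp add: s_def mult.assoc[symmetric])
    qed
    have "wp r c = monom 1 r + monom (c n) n + (\<Sum>i<n. monom (c i) i)" by (simp add: wp_def n(1) algebra_simps)
    then have p: "p = [:- s, 1:] ^ r + smult (c n) ([:- s, 1:] ^ n) + pcompose (\<Sum>i<n. monom (c i) i) [:- s, 1:]"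
      by (simp add: p_def pcompose_add monom_altdef pcompose_smult rhom_power[OF pcompose_rhom] pcompose_pCons)
    have low: "coeff (pcompose (\<Sum>i<n. monom (c i) i) [:- s, 1:]) k = 0" if "k \<ge> n" for k
    proof (rule coeff_eq_0)
      have "degree (\<Sum>i<n. monom (c i) i) \<le> n - 1"
        by (intro degree_sum_le) (auto intro: order_trans[OF degree_monom_le])
      then show "degree (pcompose (\<Sum>i<n. monom (c i) i) [:- s, 1:]) < k"
        using that n by (simp add: degree_pcompose)
    qed
    have top: "coeff ([:- s, 1:] ^ k) k = 1" for k using coeff_linear_power[of "-s" k] by simp
    have "coeff p n = 0" unfolding p using low[of n] rs top[of n] coeff_linear_power_pred[of "- s" n]
      by (simp add: n(1) del: of_nat_Suc power_Suc)
    moreover have "coeff p r = 1" unfolding p using low[of r] top[of r] n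
      by (simp add: coeff_eq_0 degree_linear_power del: power_Suc)
    ultimately obtain N y where N: "N > 0" and y: "we r (\<lambda>i. tw N (coeff p i)) y = 0"
      using centred[of "coeff p"] by blast
    have pp: "p = wp r (coeff p)" by (rule monic_wp) fact+
    have "0 = poly (map_poly (tw N) p) y"
      by (subst pp) (simp add: poly_map_wp[OF tw_hom[OF N]] y)
    also have "\<dots> = we r (\<lambda>i. tw N (c i)) (poly (map_poly (tw N) [:- s, 1:]) y)"
      by (simp add: p_def poly_map_pcompose[OF tw_hom[OF N]] poly_map_wp[OF tw_hom[OF N]])
    finally show ?thesis using N by metis
  qed
qed

text \<open>After ramification a Puiseux root \<open>y\<close> splits off the factor
  \<open>u - y(w)\<close>, which lowers the order of \<open>h(u, 0)\<close> by one; the ramification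
  indices multiply along the induction.\<close>

theorem branch_factorization:
  assumes "fps_nth h 0 \<noteq> 0"
  shows "\<exists>N>0. \<exists>rs e f. (\<forall>r\<in>set rs. fps_nth r 0 = 0) \<and> pw N h = e * (\<Prod>r\<leftarrow>rs. var_u - ow r) \<and> e * f = 1"
  using assms
proof (induction "subdegree (fps_nth h 0)" arbitrary: h)
  case 0
  then have "fps_nth (fps_nth h 0) 0 \<noteq> 0" by (metis nth_subdegree_nonzero)
  then obtain f where "h * f = 1" using O_unit[of h] by (auto simp: c2_def)
  moreover have "pw 1 h = h" by (simp add: pw_def phi_id)
  ultimately show ?case by (intro exI[of _ 1] conjI exI[of _ "[]"] exI[of _ h] exI[of _ f]) auto
next
  case (Suc m)
  define r where "r = Suc m"
  obtain e f c where e: "e * f = 1" "e * h = we r (\<lambda>i. ow (c i)) var_u"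
    and c: "\<And>i. i < r \<Longrightarrow> fps_nth (c i) 0 = 0"
    using weierstrass_preparation[OF Suc.prems, of r] Suc.hyps(2) by (auto simp: we_def r_def)
  obtain N y where N: "N > 0" and y: "we r (\<lambda>i. tw N (c i)) y = 0"
    using puiseux_root[of r c] by (auto simp: r_def)
  have "fps_nth (we r (\<lambda>i. tw N (c i)) y) 0 = fps_nth y 0 ^ r"
    by (simp only: hom_we[OF nth0_hom]) (simp add: we_def tw_nth0[OF N] c)
  then have y0: "fps_nth y 0 = 0" using y by (simp add: r_def del: power_Suc)
  have X0: "fps_nth (fps_X ^ N :: complex fps) 0 = 0" using N by simp
  note B = br_hom[OF y0 X0]
  have "br y (fps_X ^ N) e * br y (fps_X ^ N) h = 0"
    using y by (simp add: rhom_mult[OF B, symmetric] e(2) hom_we[OF B] br_ow[OF N y0] br_u[OF y0 X0])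
  moreover have "br y (fps_X ^ N) e \<noteq> 0"
    using arg_cong[OF e(1), of "br y (fps_X ^ N)"] by (auto simp: rhom_simps[OF B])
  ultimately have "br y fps_X (pw N h) = 0" using br_pw[OF N y0] by simp
  then obtain k where k: "pw N h = (var_u - ow y) * k" using brp_dvd[OF y0] by (auto elim: dvdE)
  have "fps_nth (pw N h) 0 = fps_nth h 0"
    by (rule fps_ext) (use c2_pw[OF N, of h _ 0] in \<open>simp add: c2_def\<close>)
  moreover have "fps_nth (var_u - ow y) 0 = fps_X" using y0 by (simp add: var_u_def ow_def)
  ultimately have hk: "fps_nth h 0 = fps_X * fps_nth k 0" using k by (simp add: fps_mult_nth_0)
  then have k0: "fps_nth k 0 \<noteq> 0" using Suc.prems by auto
  then have "m = subdegree (fps_nth k 0)" using hk Suc.hyps(2) by simp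
  then obtain M rs e' f' where M: "M > 0" "\<forall>r\<in>set rs. fps_nth r 0 = 0"
    "pw M k = e' * (\<Prod>r\<leftarrow>rs. var_u - ow r)" "e' * f' = 1"
    using Suc.hyps(1)[of k] k0 by blast
  have "pw M (pw N h) = pw (M * N) h"
    unfolding pw_def using N M
    by (simp add: phi_phi u_Fil wN_Fil phi_u phi_w rhom_power[OF phi_hom] power_mult)
  moreover have "pw M (var_u - ow y) = var_u - ow (tw M y)"
    by (simp add: rhom_simps[OF pw_hom[OF M(1)]] pw_u[OF M(1)] pw_ow[OF M(1)])
  ultimately have "pw (M * N) h = e' * (\<Prod>r\<leftarrow>tw M y # rs. var_u - ow r)"
    using k M by (simp add: rhom_mult[OF pw_hom[OF M(1)]] ac_simps)
  moreover have "fps_nth (tw M y) 0 = 0" using y0 by (simp add: tw_nth0[OF M(1)])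
  ultimately show ?case using M N
    by (intro exI[of _ "M * N"] conjI exI[of _ "tw M y # rs"] exI[of _ e'] exI[of _ f']) auto
qed

section \<open>Milnor and Tjurina numbers of the union with a smooth germ\<close>

text \<open>Bases modulo \<open>I\<close> correspond to chains for \<open>fd\<close>, whose length
  is unique; this gives the definite description its meaning.\<close>

lemma quotient_dim_eq:
  assumes "cd I n" "O.subspace I"
  shows "quotient_dim I = n"
proof -
  have eq: "(\<exists>B. finite B \<and> card B = m \<and>
     (\<forall>g. \<exists>!c. (\<forall>b. b \<notin> B \<longrightarrow> c b = 0) \<and> g - (\<Sum>b\<in>B. const2 (c b) * b) \<in> I)) \<longleftrightarrow> (\<exists>B. O.basis_mod B I UNIV \<and> card B = m)" for m
    unfolding O.basis_mod_def sc_def by auto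
  show ?thesis unfolding quotient_dim_def eq
  proof (rule the_equality)
    show "\<exists>B. O.basis_mod B I UNIV \<and> card B = n" using O.fd_basis[OF assms] by auto
    fix m assume "\<exists>B. O.basis_mod B I UNIV \<and> card B = m"
    then show "m = n" using O.basis_mod_fd[OF _ assms(2)] O.fd_unique[OF _ assms(1) assms(2)] by auto
  qed
qed

lemma module_mult: "module ((*) :: 'a::comm_ring_1 \<Rightarrow> 'a \<Rightarrow> 'a)"
  by unfold_locales (simp_all add: algebra_simps)

lemma span_2: "module.span (*) {a, b} = id2 a b"
  unfolding module.span_insert[OF module_mult] module.span_empty[OF module_mult]
  by (auto simp: id2_def algebra_simps)

lemma span_3: "module.span (*) {a, b, c} = id3 a b c"
  unfolding module.span_insert[OF module_mult, of a] span_2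
proof (intro subset_antisym subsetI)
  fix x assume "x \<in> {x. \<exists>k. x - k * a \<in> id2 b c}"
  then obtain k y z where "x - k * a = b * y + c * z" by (auto elim: id2E)
  then show "x \<in> id3 a b c" by (intro id3I[of _ _ k _ y _ z]) (simp add: algebra_simps)
next
  fix x assume "x \<in> id3 a b c"
  then obtain k y z where "x = a * k + b * y + c * z" by (rule id3E)
  then have "x - k * a \<in> id2 b c" by (intro id2I[of _ _ y _ z]) (simp add: algebra_simps)
  then show "x \<in> {x. \<exists>k. x - k * a \<in> id2 b c}" by blast
qed

lemma id2_commute: "id2 a b = id2 b a"
  by (intro subset_antisym id2_least ideal_id2 id2_gen)

lemma u_power_nth0: "fps_nth (var_u ^ k) 0 = fps_X ^ k"
  by (simp add: rhom_power[OF nth0_hom]) (simp add: var_u_def)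

lemma w_dvd_mult: "fps_nth p 0 \<noteq> 0 \<Longrightarrow> var_w dvd p * z \<Longrightarrow> var_w dvd z"
  by (simp add: w_dvd)

lemma w_nonzero: "var_w \<noteq> 0"
  by (simp add: var_w_def)

lemma cd_powers: "cd (id2 (var_w ^ k) (var_u ^ l)) (k * l)"
proof (induction k)
  case 0
  then show ?case by (simp add: cd_1)
next
  case (Suc k)
  have u: "fps_nth (var_u ^ l) 0 \<noteq> 0" by (simp add: u_power_nth0)
  show ?case using cd_mult[OF cd_w[OF u] Suc w_dvd_mult[OF u] w_nonzero] by (simp add: u_power_nth0)
qed

lemma ideal_finite_cd:
  assumes "is_ideal I" "var_u ^ k \<in> I" "var_w ^ k \<in> I"
  shows "\<exists>n. cd I n"
  using O.fd_split[OF cd_powers subspace_id2 ideal_subspace[OF assms(1)] id2_least[OF assms(1,3,2)]] by auto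

lemma cd_superset:
  assumes "cd I n" "is_ideal I" "is_ideal J" "I \<subseteq> J"
  shows "\<exists>m. cd J m"
  using O.fd_split[OF assms(1) ideal_subspace[OF assms(2)] ideal_subspace[OF assms(3)] assms(4)] by auto

lemma subdegree_fps_deriv:
  fixes e :: "complex fps"
  assumes "e \<noteq> 0" "fps_nth e 0 = 0"
  shows "fps_deriv e \<noteq> 0" "subdegree (fps_deriv e) = subdegree e - 1" "subdegree e \<ge> 1"
proof -
  show 1: "subdegree e \<ge> 1" using assms by (metis less_one not_le nth_subdegree_nonzero)
  have nz: "fps_nth (fps_deriv e) (subdegree e - 1) \<noteq> 0"
    using 1 assms(1) by (simp add: fps_deriv_nth del: of_nat_Suc)
  then show "fps_deriv e \<noteq> 0" by (metis fps_zero_nth)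
  show "subdegree (fps_deriv e) = subdegree e - 1"
  proof (rule subdegreeI[OF nz])
    fix k assume "k < subdegree e - 1"
    then have "fps_nth e (Suc k) = 0" by (intro nth_less_subdegree_zero) simp
    then show "fps_nth (fps_deriv e) k = 0" by (simp add: fps_deriv_nth)
  qed
qed

lemma subdegree_X_deriv:
  fixes e :: "complex fps"
  assumes "e \<noteq> 0" "fps_nth e 0 = 0"
  shows "fps_X * fps_deriv e \<noteq> 0" "subdegree (fps_X * fps_deriv e) = subdegree e"
  using subdegree_fps_deriv[OF assms] by (simp_all)

text \<open>For the union of a curve germ \<open>g\<close> with the smooth germ \<open>w\<close>: \<open>i\<close> is the intersection
  multiplicity, and \<open>m\<close> the colength of the ideal of all \<open>\<theta>(w)\<close>, \<open>\<theta>\<close> a logarithmic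
  derivation of \<open>g\<close>, restricted to \<open>w = 0\<close>.\<close>

context
  fixes g :: local_ring and K i :: nat
  assumes g00: "c2 g 0 0 = 0" and g0: "fps_nth g 0 \<noteq> 0" and i: "i = subdegree (fps_nth g 0)"
    and fin: "var_u ^ K \<in> id3 (var_w * g) (var_w * du g) (g + var_w * dw g)"
      "var_w ^ K \<in> id3 (var_w * g) (var_w * du g) (g + var_w * dw g)"
begin

abbreviation "T1 \<equiv> id3 (var_w * g) (var_w * du g) (g + var_w * dw g)"
abbreviation "T2 \<equiv> id3 g (var_w * du g) (var_w * dw g)"
abbreviation "T0 \<equiv> id3 g (du g) (dw g)"

lemma du_wg: "du (var_w * g) = var_w * du g" and dw_wg: "dw (var_w * g) = g + var_w * dw g"
  by (simp_all add: du_mult dw_mult du_w dw_w)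

text \<open>Consider \<open>T1 \<subseteq> T2 \<subseteq> (w, g)\<close>. The quotient
  \<open>T2/T1\<close> is generated by \<open>g\<close> and is the ring modulo the colon ideal;
  \<open>(w, g)/T2\<close> is generated by w and is the ring modulo \<open>T0\<close>, since
  \<open>g\<close> is a non-zero-divisor modulo w; and the ring modulo \<open>(w, g)\<close> has
  dimension \<open>i\<close>.\<close>

lemma tjurina_union:
  "\<exists>t m. cd T0 t \<and> cd T1 (t + i + m) \<and> cd {x. x * g \<in> T1} m"
proof -
  obtain n where n: "cd T1 n" using ideal_finite_cd[OF ideal_id3 fin] by blast
  have ideal: "is_ideal {x. x * g \<in> T1}"
    using ideal_id3[of "var_w * g" "var_w * du g" "g + var_w * dw g"]
    by (simp add: is_ideal_def distrib_right mult.assoc)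
  have "T1 \<subseteq> {x. x * g \<in> T1}" using ideal_mult'[OF ideal_id3] by blast
  then obtain m where m: "cd {x. x * g \<in> T1} m" using cd_superset[OF n ideal_id3 ideal] by blast
  have "fd sc T1 {g * v + j | v j. v \<in> UNIV \<and> j \<in> T1} m"
    by (rule O.fd_push[OF m ideal_subspace[OF ideal] O.vspace_axioms linear_mult subspace_id3]) (simp add: mult.commute)
  moreover have "{g * v + j | v j. v \<in> UNIV \<and> j \<in> T1} = T2"
  proof (intro subset_antisym subsetI)
    fix x assume "x \<in> {g * v + j | v j. v \<in> UNIV \<and> j \<in> T1}"
    then obtain v j where x: "x = g * v + j" "j \<in> T1" by blast
    from x(2) obtain a b c where "j = var_w * g * a + var_w * du g * b + (g + var_w * dw g) * c" by (rule id3E)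
    then show "x \<in> T2"
      by (intro id3I[of _ _ "v + var_w * a + c" _ b _ c]) (simp add: x algebra_simps)
  next
    fix x assume "x \<in> T2"
    then obtain a b c where "x = g * a + var_w * du g * b + var_w * dw g * c" by (rule id3E)
    then have x: "x = g * (a - c) + (var_w * g * 0 + var_w * du g * b + (g + var_w * dw g) * c)"
      by (simp add: algebra_simps)
    have "var_w * g * 0 + var_w * du g * b + (g + var_w * dw g) * c \<in> T1" by (rule id3I) (rule refl)
    with x show "x \<in> {g * v + j | v j. v \<in> UNIV \<and> j \<in> T1}" by blast
  qed
  ultimately have T12: "fd sc T1 T2 m" by simp
  have T1T0: "T1 \<subseteq> T0"
    by (intro id3_least ideal_id3 ideal_add ideal_mult id3_gen)
  then obtain t where t: "cd T0 t" using cd_superset[OF n ideal_id3 ideal_id3] by blast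
  have iff: "var_w * x \<in> T2 \<longleftrightarrow> x \<in> T0" for x
  proof
    assume "var_w * x \<in> T2"
    then obtain a b c where x: "var_w * x = g * a + var_w * du g * b + var_w * dw g * c" by (rule id3E)
    then have "g * a = var_w * (x - du g * b - dw g * c)" by (simp add: algebra_simps)
    then have "var_w dvd a" using w_dvd_mult[OF g0] by simp
    then obtain a' where "a = var_w * a'" by (elim dvdE)
    then have "var_w * x = var_w * (g * a' + du g * b + dw g * c)" using x by (simp add: algebra_simps)
    then show "x \<in> T0" using w_nonzero by (intro id3I[of _ _ a' _ b _ c]) simp
  next
    assume "x \<in> T0"
    then obtain a b c where "x = g * a + du g * b + dw g * c" by (rule id3E)
    then show "var_w * x \<in> T2" by (intro id3I[of _ _ "var_w * a" _ b _ c]) (simp add: algebra_simps)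
  qed
  have "fd sc T2 {var_w * v + j | v j. v \<in> UNIV \<and> j \<in> T2} t"
    by (rule O.fd_push[OF t subspace_id3 O.vspace_axioms linear_mult subspace_id3]) (rule iff)
  moreover have "{var_w * v + j | v j. v \<in> UNIV \<and> j \<in> T2} = id2 var_w g"
  proof (intro subset_antisym subsetI)
    fix x assume "x \<in> {var_w * v + j | v j. v \<in> UNIV \<and> j \<in> T2}"
    then obtain v j where x: "x = var_w * v + j" "j \<in> T2" by blast
    from x(2) obtain a b c where "j = g * a + var_w * du g * b + var_w * dw g * c" by (rule id3E)
    then show "x \<in> id2 var_w g"
      by (intro id2I[of _ _ "v + du g * b + dw g * c" _ a]) (simp add: x algebra_simps)
  next
    fix x assume "x \<in> id2 var_w g"
    then obtain a b where x: "x = var_w * a + g * b" by (rule id2E)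
    have "g * b \<in> T2" by (intro ideal_mult' ideal_id3 id3_gen)
    with x show "x \<in> {var_w * v + j | v j. v \<in> UNIV \<and> j \<in> T2}" by blast
  qed
  ultimately have "fd sc T2 (id2 var_w g) t" by simp
  then have "cd T2 (t + i)" using O.fd_trans[OF cd_w[OF g0]] i by simp
  from O.fd_trans[OF this T12] have "cd T1 (t + i + m)" by (simp add: ac_simps)
  then show ?thesis using t m by blast
qed

text \<open>Along a branch of \<open>\<partial>\<^sub>u g = 0\<close>, the orders of \<open>g\<close> and \<open>w \<partial>\<^sub>w g\<close> agree, since the former is
  obtained from the latter by integration.\<close>

lemma branch_orders:
  assumes N: "N > 0" and r: "fps_nth r 0 = 0" and h: "br r (fps_X ^ N) (du g) = 0"
  shows "br r (fps_X ^ N) (dw g) \<noteq> 0"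
    "br r (fps_X ^ N) (var_w * dw g) \<noteq> 0" "br r (fps_X ^ N) (g + var_w * dw g) \<noteq> 0"
    "subdegree (br r (fps_X ^ N) (var_w * dw g)) = subdegree (br r (fps_X ^ N) (g + var_w * dw g))"
proof -
  define \<gamma> where "\<gamma> = br r (fps_X ^ N)"
  have X0: "fps_nth (fps_X ^ N :: complex fps) 0 = 0" using N by simp
  have hom: "rhom \<gamma>" unfolding \<gamma>_def by (rule br_hom[OF r X0])
  have w: "\<gamma> var_w = fps_X ^ N" unfolding \<gamma>_def by (rule br_w[OF r X0])
  have h: "\<gamma> (du g) = 0" using h by (simp add: \<gamma>_def)
  have Xd: "fps_X * fps_deriv (fps_X ^ N :: complex fps) = of_nat N * fps_X ^ N"
  proof (induction N)
    case (Suc n)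
    have "fps_X * fps_deriv (fps_X ^ Suc n :: complex fps) = fps_X * (fps_X * fps_deriv (fps_X ^ n)) + fps_X ^ Suc n"
      by (simp only: power_Suc fps_deriv_mult fps_deriv_fps_X) (simp add: algebra_simps)
    then show ?case unfolding Suc by (simp add: algebra_simps)
  qed simp
  have N0: "(of_nat N :: complex fps) \<noteq> 0" "subdegree (of_nat N :: complex fps) = 0"
    using N by (simp_all add: fps_of_nat[symmetric] del: fps_of_nat)
  have chain: "fps_deriv (\<gamma> x) = \<gamma> (du x) * fps_deriv r + \<gamma> (dw x) * fps_deriv (fps_X ^ N)" for x
    unfolding \<gamma>_def by (rule br_chain[OF r X0])
  have ch: "fps_X * fps_deriv (\<gamma> x) = of_nat N * (fps_X ^ N * \<gamma> (dw x))" if "\<gamma> (du x) = 0" for x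
  proof -
    have "fps_X * fps_deriv (\<gamma> x) = (fps_X * fps_deriv (fps_X ^ N)) * \<gamma> (dw x)"
      unfolding chain that by (simp add: ac_simps)
    then show ?thesis unfolding Xd by (simp add: ac_simps)
  qed
  have 1: "fps_X * fps_deriv (\<gamma> g) = of_nat N * (fps_X ^ N * \<gamma> (dw g))" by (rule ch[OF h])
  \<comment> \<open>The same relation with \<open>w g\<close> in place of \<open>g\<close>, whose
    derivative in w is \<open>g + w g_w\<close>.\<close>
  have "\<gamma> (du (var_w * g)) = 0" by (simp add: du_wg rhom_mult[OF hom] h)
  from ch[OF this] have 2: "fps_X * fps_deriv (fps_X ^ N * \<gamma> g) = of_nat N * (fps_X ^ N * \<gamma> (g + var_w * dw g))"
    unfolding dw_wg by (simp add: rhom_mult[OF hom] w)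
  \<comment> \<open>A branch inside \<open>g = 0\<close> would lie in the singular locus of
    \<open>w g\<close>, but the Tjurina ideal of \<open>w g\<close> contains a power of w, which
    does not vanish on the branch.\<close>
  have g0: "\<gamma> g \<noteq> 0"
  proof
    assume g: "\<gamma> g = 0"
    then have dwg: "\<gamma> (dw g) = 0" using 1 N0 by simp
    obtain a b c where "var_w ^ K = var_w * g * a + var_w * du g * b + (g + var_w * dw g) * c"
      using fin(2) by (rule id3E)
    then have "\<gamma> (var_w ^ K) = 0" by (simp add: rhom_simps[OF hom] g dwg h)
    then show False by (simp add: rhom_power[OF hom] w)
  qed
  have g00': "fps_nth (\<gamma> g) 0 = 0" unfolding \<gamma>_def using br_nth0[OF r X0] g00 by simp
  have "fps_X ^ N * \<gamma> g \<noteq> 0" "fps_nth (fps_X ^ N * \<gamma> g) 0 = 0" using g0 g00' by simp_all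
  note 3 = subdegree_X_deriv[OF g0 g00'] subdegree_X_deriv[OF this]
  have 4: "fps_X ^ N * \<gamma> (dw g) \<noteq> 0" "fps_X ^ N * \<gamma> (g + var_w * dw g) \<noteq> 0"
    using 3(1,3) unfolding 1 2 by auto
  have 5: "subdegree (fps_X ^ N * \<gamma> (dw g)) = subdegree (\<gamma> g)"
    using 3(2) 4(1) N0 unfolding 1 by (subst (asm) subdegree_mult) auto
  have 6: "subdegree (fps_X ^ N * \<gamma> (g + var_w * dw g)) = N + subdegree (\<gamma> g)"
    using 3(4) 4(2) N0 g0 unfolding 2 by (subst (asm) subdegree_mult) auto
  show "br r (fps_X ^ N) (dw g) \<noteq> 0" "br r (fps_X ^ N) (g + var_w * dw g) \<noteq> 0"
    using 4 by (auto simp: \<gamma>_def)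
  have w': "\<gamma> (var_w * dw g) = fps_X ^ N * \<gamma> (dw g)" by (simp add: rhom_mult[OF hom] w)
  then show "br r (fps_X ^ N) (var_w * dw g) \<noteq> 0" using 4 by (auto simp: \<gamma>_def)
  show "subdegree (br r (fps_X ^ N) (var_w * dw g)) = subdegree (br r (fps_X ^ N) (g + var_w * dw g))"
    using 5 6 w' 4 by (simp add: \<gamma>_def)
qed

text \<open>By additivity the colength of \<open>(w g_u, g + w g_w)\<close> is \<open>i\<close> plus
  that of \<open>(g_u, g + w g_w)\<close>. By \<open>branch_orders\<close> the latter equals the
  colength of \<open>(g_u, w g_w)\<close>, which is \<open>i - 1 + \<mu>\<close> because
  \<open>g_u\<close> restricts on \<open>w = 0\<close> to the derivative of the restriction of
  \<open>g\<close>.\<close>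

lemma milnor_union:
  "\<exists>\<mu>. cd (id2 (du g) (dw g)) \<mu> \<and> cd (id2 (var_w * du g) (g + var_w * dw g)) (\<mu> + 2 * i - 1) \<and> i \<ge> 1"
proof -
  have dg: "fps_nth (du g) 0 = fps_deriv (fps_nth g 0)" by (simp add: du_def)
  have "fps_nth (fps_nth g 0) 0 = 0" using g00 by (simp add: c2_def)
  note sd = subdegree_fps_deriv[OF g0 this]
  have h0: "fps_nth (du g) 0 \<noteq> 0" using sd by (simp add: dg)
  obtain N rs e f where N: "N > 0" and rs: "\<And>r. r \<in> set rs \<Longrightarrow> fps_nth r 0 = 0"
    and fac: "pw N (du g) = e * (\<Prod>r\<leftarrow>rs. var_u - ow r)" and e: "e * f = 1"
    using branch_factorization[OF h0] by blast
  have z: "br r (fps_X ^ N) (du g) = 0" if "r \<in> set rs" for r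
  proof -
    have "(var_u - ow r) dvd (\<Prod>r\<leftarrow>rs. var_u - ow r)"
      using that by (induction rs) auto
    then have "(var_u - ow r) dvd pw N (du g)" unfolding fac by simp
    then show ?thesis using brp_dvd[OF rs[OF that]] br_pw[OF N rs[OF that]] by simp
  qed
  note bo = branch_orders[OF N rs z]
  obtain \<mu> where \<mu>: "cd (id2 (du g) (dw g)) \<mu>"
    using cd_branches[OF N _ fac e, of "dw g"] rs bo by blast
  obtain n1 where n1: "cd (id2 (du g) (var_w * dw g)) n1"
      "N * n1 = (\<Sum>r\<leftarrow>rs. subdegree (br r (fps_X ^ N) (var_w * dw g)))"
    using cd_branches[OF N _ fac e, of "var_w * dw g"] rs bo by blast
  obtain n2 where n2: "cd (id2 (du g) (g + var_w * dw g)) n2"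
      "N * n2 = (\<Sum>r\<leftarrow>rs. subdegree (br r (fps_X ^ N) (g + var_w * dw g)))"
    using cd_branches[OF N _ fac e, of "g + var_w * dw g"] rs bo by blast
  have "map (\<lambda>r. subdegree (br r (fps_X ^ N) (var_w * dw g))) rs = map (\<lambda>r. subdegree (br r (fps_X ^ N) (g + var_w * dw g))) rs"
    using bo(4) by simp
  then have "N * n1 = N * n2" using n1(2) n2(2) by presburger
  then have n12: "n1 = n2" using N by simp
  have "cd (id2 var_w (du g)) (i - 1)" using cd_w[OF h0] sd i by (simp add: dg)
  moreover have "cd (id2 (dw g) (du g)) \<mu>" using \<mu> by (simp add: id2_commute)
  ultimately have "cd (id2 (var_w * dw g) (du g)) (i - 1 + \<mu>)"
    by (rule cd_mult[OF _ _ w_dvd_mult[OF h0] w_nonzero])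
  then have n1': "n1 = i - 1 + \<mu>" using O.fd_unique[OF n1(1) _ subspace_id2] by (simp add: id2_commute)
  have p0: "fps_nth (g + var_w * dw g) 0 = fps_nth g 0" by (simp add: var_w_def)
  have p: "fps_nth (g + var_w * dw g) 0 \<noteq> 0" unfolding p0 by (rule g0)
  have "cd (id2 var_w (g + var_w * dw g)) i" using cd_w[OF p] unfolding p0 i[symmetric] .
  from cd_mult[OF this n2(1) w_dvd_mult[OF p] w_nonzero]
  have "cd (id2 (var_w * du g) (g + var_w * dw g)) (i + n2)" .
  moreover have "i + n2 = \<mu> + 2 * i - 1" using n12 n1' sd(3) i by simp
  ultimately show ?thesis using \<mu> sd(3) i by auto
qed

end

section \<open>Polynomials in three variables\<close>

definition SC :: "complex \<Rightarrow> S" where "SC c = [:[:[:c:]:]:]"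

definition xv :: "3 \<Rightarrow> S" where
  "xv i = (if i = 1 then [:[:[:0, 1:]:]:] else if i = 2 then [:[:0, 1:]:] else [:0, 1:])"

definition cf :: "S \<Rightarrow> nat \<Rightarrow> nat \<Rightarrow> nat \<Rightarrow> complex" where
  "cf f i j k = coeff (coeff (coeff f k) j) i"

lemma cf_ext: "(\<And>i j k. cf f i j k = cf g i j k) \<Longrightarrow> f = g"
  by (simp add: cf_def poly_eq_iff)

lemma cf_add [simp]: "cf (f + g) i j k = cf f i j k + cf g i j k"
  and cf_0 [simp]: "cf 0 i j k = 0"
  and cf_diff [simp]: "cf (f - g) i j k = cf f i j k - cf g i j k"
  and cf_SC: "cf (SC c) i j k = (if i = 0 \<and> j = 0 \<and> k = 0 then c else 0)"
  and cf_SC_mult [simp]: "cf (SC c * f) i j k = c * cf f i j k"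
  by (simp_all add: cf_def SC_def coeff_pCons split: nat.splits)

lemma cf_x1: "cf (xv 1 * f) i j k = (if i = 0 then 0 else cf f (i - 1) j k)"
  and cf_x2: "cf (xv 2 * f) i j k = (if j = 0 then 0 else cf f i (j - 1) k)"
  and cf_x3: "cf (xv 3 * f) i j k = (if k = 0 then 0 else cf f i j (k - 1))"
  by (simp_all add: cf_def xv_def coeff_pCons split: nat.splits)

lemma SC_hom: "rhom SC"
  by (simp add: rhom_def SC_def one_pCons)

lemmas SC_simps = rhom_simps[OF SC_hom]

lemma SC_eq_0 [simp]: "SC a = 0 \<longleftrightarrow> a = 0"
  by (simp add: SC_def)

lemma S_induct [case_names const add var]:
  assumes C: "\<And>c. P (SC c)" and A: "\<And>f g. P f \<Longrightarrow> P g \<Longrightarrow> P (f + g)"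
    and V: "\<And>i f. P f \<Longrightarrow> P (xv i * f)"
  shows "P f"
proof -
  have 1: "P [:[:p:]:]" for p :: "complex poly"
  proof (induction p)
    case 0
    then show ?case using C[of 0] by (simp add: SC_def)
  next
    case (pCons a p)
    have "[:[:pCons a p:]:] = SC a + xv 1 * [:[:p:]:]" by (simp add: SC_def xv_def)
    then show ?case using A C V pCons by metis
  qed
  have 2: "P [:q:]" for q :: "complex poly poly"
  proof (induction q)
    case 0
    then show ?case using C[of 0] by (simp add: SC_def)
  next
    case (pCons a p)
    have "[:pCons a p:] = [:[:a:]:] + xv 2 * [:p:]" by (simp add: xv_def)
    then show ?case using A 1 V pCons by metis
  qed
  show ?thesis
  proof (induction f)
    case 0
    then show ?case using C[of 0] by (simp add: SC_def)
  next
    case (pCons a p)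
    have "pCons a p = [:a:] + xv 3 * p" by (simp add: xv_def)
    then show ?case using A 2 V pCons by metis
  qed
qed

lemma S_hom_ext:
  assumes F: "rhom F" and G: "rhom G" and "\<And>c. F (SC c) = G (SC c)" "\<And>i. F (xv i) = G (xv i)"
  shows "F f = G f"
  by (induction f rule: S_induct) (simp_all add: assms rhom_simps[OF F] rhom_simps[OF G])

lemma eval_hom: "rhom \<iota> \<Longrightarrow> rhom (\<lambda>f. eval_S \<iota> f v)"
  unfolding eval_S_def by (intro poly_map_hom)

lemma eval_const: assumes "rhom \<iota>" shows "eval_S \<iota> (SC c) v = \<iota> c"
  unfolding eval_S_def SC_def
  by (simp add: poly_map_pCons poly_map_hom assms)

lemma eval_var: assumes "rhom \<iota>" shows "eval_S \<iota> (xv i) v = v $ i"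
  using exhaust_3[of i] unfolding eval_S_def
  by (auto simp: xv_def poly_map_pCons poly_map_hom assms rhom_0 rhom_1 one_pCons[symmetric] rhom_1[OF poly_map_hom])

lemma eval_unique:
  assumes "rhom F" "rhom \<iota>" "\<And>c. F (SC c) = \<iota> c"
  shows "F f = eval_S \<iota> f (\<chi> i. F (xv i))"
  by (rule S_hom_ext) (simp_all add: assms eval_hom eval_const eval_var)

lemma hom_eval:
  assumes "rhom h" "rhom \<iota>"
  shows "h (eval_S \<iota> f v) = eval_S (\<lambda>c. h (\<iota> c)) f (\<chi> i. h (v $ i))"
  using eval_unique[of "\<lambda>f. h (eval_S \<iota> f v)" "\<lambda>c. h (\<iota> c)" f] assms
  by (simp add: rhom_comp[OF assms(1) eval_hom[OF assms(2)]] rhom_comp eval_const eval_var)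

lemma eval_id: "eval_S SC f (\<chi> i. xv i) = f"
  using eval_unique[OF rhom_id SC_hom, of f] by simp

subsection \<open>Derivatives\<close>

definition pd :: "3 \<Rightarrow> S \<Rightarrow> S" where
  "pd i = (if i = 1 then dx else if i = 2 then dy else dz)"

lemma cf_dx: "cf (dx f) i j k = of_nat (Suc i) * cf f (Suc i) j k"
  and cf_dy: "cf (dy f) i j k = of_nat (Suc j) * cf f i (Suc j) k"
  and cf_dz: "cf (dz f) i j k = of_nat (Suc k) * cf f i j (Suc k)"
  by (simp_all add: cf_def dx_def dy_def dz_def coeff_map_poly coeff_pderiv map_poly_0 of_nat_poly
      del: of_nat_Suc)

lemma pd_simps: "pd 1 = dx" "pd 2 = dy" "pd 3 = dz"
  by (simp_all add: pd_def)

lemma pd_add: "pd i (f + g) = pd i f + pd i g"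
  and pd_SC: "pd i (SC c) = 0"
  and pd_SC_mult: "pd i (SC c * f) = SC c * pd i f"
  using exhaust_3[of i]
  by (auto intro!: cf_ext simp: pd_simps cf_dx cf_dy cf_dz cf_SC ring_distribs mult.left_commute[of c])

lemma pd_var_mult: "pd i (xv j * f) = xv j * pd i f + (if i = j then f else 0)"
proof (rule cf_ext)
  fix a b c
  show "cf (pd i (xv j * f)) a b c = cf (xv j * pd i f + (if i = j then f else 0)) a b c"
    using exhaust_3[of i] exhaust_3[of j]
    by (elim disjE) (auto simp: pd_simps cf_dx cf_dy cf_dz cf_x1 cf_x2 cf_x3 gr0_conv_Suc ring_distribs)
qed

lemma pd_mult: "pd i (f * g) = f * pd i g + pd i f * g"
proof (induction f rule: S_induct)
  case (var j f)
  then show ?case by (simp add: mult.assoc pd_var_mult) (simp add: algebra_simps)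
qed (simp_all add: pd_SC_mult pd_SC pd_add distrib_right)

lemma pd_xv: "pd i (xv j) = (if i = j then 1 else 0)"
  using pd_var_mult[of i j 1] pd_SC[of i 1] by (simp add: SC_simps)

lemma eval_chain:
  assumes "rhom \<iota>" "\<And>x y. D (x + y) = D x + D y" "\<And>x y. D (x * y) = x * D y + D x * y" "\<And>c. D (\<iota> c) = 0"
  shows "D (eval_S \<iota> f v) = (\<Sum>i\<in>UNIV. eval_S \<iota> (pd i f) v * D (v $ i))"
proof (induction f rule: S_induct)
  case (const c)
  then show ?case by (simp add: eval_const[OF assms(1)] assms pd_SC rhom_0[OF eval_hom[OF assms(1)]])
next
  case (add f g)
  then show ?case
    by (simp add: rhom_add[OF eval_hom[OF assms(1)]] assms(2) pd_add sum.distrib distrib_right)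
next
  case (var j f)
  have "(\<Sum>i\<in>UNIV. eval_S \<iota> (pd i (xv j * f)) v * D (v $ i)) =
      (\<Sum>i\<in>UNIV. v $ j * (eval_S \<iota> (pd i f) v * D (v $ i)) + (if i = j then eval_S \<iota> f v * D (v $ j) else 0))"
    by (intro sum.cong refl)
       (simp add: pd_var_mult rhom_simps[OF eval_hom[OF assms(1)]] eval_var[OF assms(1)] distrib_right mult.assoc)
  also have "\<dots> = v $ j * D (eval_S \<iota> f v) + eval_S \<iota> f v * D (v $ j)"
    by (simp add: sum.distrib sum_distrib_left[symmetric] var)
  finally show ?case
    by (simp add: rhom_mult[OF eval_hom[OF assms(1)]] eval_var[OF assms(1)] assms(3) algebra_simps)
qed

subsection \<open>Homogeneous components\<close>

text \<open>The degree is read off after the substitution \<open>(x, y, z) \<mapsto> (Tx, Ty, Tz)\<close> with a new variable \<open>T\<close>.\<close>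

definition hs :: "S \<Rightarrow> S poly" where
  "hs f = eval_S (\<lambda>c. [:SC c:]) f (\<chi> i. monom (xv i) 1)"

definition hp :: "int \<Rightarrow> S \<Rightarrow> S" where
  "hp d f = (if d < 0 then 0 else coeff (hs f) (nat d))"

lemma const_SC_hom: "rhom (\<lambda>c. [:SC c:])"
  by (simp add: rhom_def SC_simps one_pCons)

lemma hs_hom: "rhom hs"
  unfolding hs_def by (rule eval_hom[OF const_SC_hom])

lemma hs_SC: "hs (SC c) = [:SC c:]" and hs_xv: "hs (xv i) = monom (xv i) 1"
  by (simp_all add: hs_def eval_const[OF const_SC_hom] eval_var[OF const_SC_hom])

lemma cf_hs: "cf (coeff (hs f) n) i j k = (if i + j + k = n then cf f i j k else 0)"
proof (induction f arbitrary: n i j k rule: S_induct)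
  case (const c)
  then show ?case by (auto simp: hs_SC coeff_pCons cf_SC split: nat.splits)
next
  case (var l f)
  have *: "coeff (hs (xv l * f)) n = (if n = 0 then 0 else xv l * coeff (hs f) (n - 1))"
    by (simp add: rhom_mult[OF hs_hom] hs_xv coeff_monom_mult)
  show ?case using exhaust_3[of l] unfolding *
    by (elim disjE) (auto simp: cf_x1 cf_x2 cf_x3 var)
qed (simp add: rhom_add[OF hs_hom])

lemma hs_1: "poly (hs f) 1 = f"
proof -
  have h: "rhom (\<lambda>f. poly (hs f) 1)" by (simp add: rhom_def rhom_simps[OF hs_hom])
  show ?thesis by (rule S_hom_ext[OF h rhom_id]) (simp_all add: hs_SC hs_xv poly_monom)
qed

lemma cf_hp: "cf (hp d f) i j k = (if int (i + j + k) = d then cf f i j k else 0)"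
  by (auto simp: hp_def cf_hs)

lemma homogeneous_cf: "homogeneous d f \<longleftrightarrow> (\<forall>i j k. int i + int j + int k \<noteq> d \<longrightarrow> cf f i j k = 0)"
  unfolding homogeneous_def cf_def[symmetric] by auto

lemma homogeneous_iff: "homogeneous d f \<longleftrightarrow> hp d f = f"
proof
  assume "homogeneous d f"
  then show "hp d f = f" by (auto intro!: cf_ext simp: cf_hp homogeneous_cf)
next
  assume *: "hp d f = f"
  show "homogeneous d f" unfolding homogeneous_cf
  proof (intro allI impI)
    fix i j k assume "int i + int j + int k \<noteq> d"
    then show "cf f i j k = 0" using cf_hp[of d f i j k] * by simp
  qed
qed

lemma homogeneous_neg: "d < 0 \<Longrightarrow> homogeneous d f \<longleftrightarrow> f = 0"
  by (auto simp: homogeneous_iff hp_def)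

lemma homogeneous_hs: "homogeneous (int n) f \<longleftrightarrow> hs f = monom f n"
proof
  assume "homogeneous (int n) f"
  then have "cf (coeff (hs f) m) i j k = cf (if m = n then f else 0) i j k" for m i j k
    by (auto simp: cf_hs homogeneous_cf)
  then have "coeff (hs f) m = (if m = n then f else 0)" for m by (intro cf_ext)
  then show "hs f = monom f n" by (intro poly_eqI) auto
qed (simp add: homogeneous_iff hp_def)

lemma hp_hom: "homogeneous d (hp d f)"
  by (auto simp: homogeneous_cf cf_hp)

lemma hp_add: "hp d (f + g) = hp d f + hp d g"
  and hp_0: "hp d 0 = 0"
  by (simp_all add: hp_def rhom_simps[OF hs_hom])

lemma hp_sum: "hp d (sum f A) = (\<Sum>a\<in>A. hp d (f a))"
  by (induction A rule: infinite_finite_induct) (simp_all add: hp_0 hp_add)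

lemma hp_self: "homogeneous d f \<Longrightarrow> hp e f = (if e = d then f else 0)"
  by (auto intro!: cf_ext simp: cf_hp homogeneous_cf)

lemma hp_mult:
  assumes "homogeneous e g"
  shows "hp d (g * f) = g * hp (d - e) f"
proof (cases "e < 0")
  case True
  then show ?thesis using assms by (simp add: homogeneous_neg hp_0)
next
  case False
  then obtain n where e: "e = int n" by (metis nonneg_int_cases not_less)
  then have "hs (g * f) = monom g n * hs f" using assms homogeneous_hs by (simp add: rhom_mult[OF hs_hom])
  then show ?thesis by (auto simp: hp_def e coeff_monom_mult nat_diff_distrib)
qed

lemma hp_decomp: "\<exists>N. \<forall>n\<ge>N. f = (\<Sum>d\<le>n. hp (int d) f)"
proof (intro exI allI impI)
  fix n assume "n \<ge> degree (hs f)"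
  then have "poly (hs f) 1 = (\<Sum>d\<le>n. coeff (hs f) d)"
    unfolding poly_altdef by (simp add: sum.mono_neutral_left coeff_eq_0)
  then show "f = (\<Sum>d\<le>n. hp (int d) f)" by (simp add: hs_1 hp_def)
qed

lemma homogeneous_0: "homogeneous d 0"
  and homogeneous_add: "homogeneous d f \<Longrightarrow> homogeneous d g \<Longrightarrow> homogeneous d (f + g)"
  by (simp_all add: homogeneous_iff hp_0 hp_add)

lemma homogeneous_mult: "homogeneous d f \<Longrightarrow> homogeneous e g \<Longrightarrow> homogeneous (d + e) (f * g)"
  by (simp add: homogeneous_iff[of "d + e"] hp_mult hp_self)

lemma homogeneous_SC: "homogeneous 0 (SC c)"
  by (auto simp: homogeneous_cf cf_SC)

lemma homogeneous_SC_mult: "homogeneous d f \<Longrightarrow> homogeneous d (SC c * f)"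
  using homogeneous_mult[OF homogeneous_SC, of d f c] by simp

lemma homogeneous_diff: "homogeneous d f \<Longrightarrow> homogeneous d g \<Longrightarrow> homogeneous d (f - g)"
  using homogeneous_add[OF _ homogeneous_SC_mult[of d g "-1"], of f] by (simp add: SC_simps)

lemma homogeneous_sum: "(\<And>a. a \<in> A \<Longrightarrow> homogeneous d (f a)) \<Longrightarrow> homogeneous d (sum f A)"
  by (induction A rule: infinite_finite_induct) (simp_all add: homogeneous_0 homogeneous_add)

lemma homogeneous_1: "homogeneous 0 1"
  using homogeneous_SC[of 1] by (simp add: SC_simps)

lemma homogeneous_power: "homogeneous d f \<Longrightarrow> homogeneous (int n * d) (f ^ n)"
  by (induction n) (auto simp: homogeneous_1 algebra_simps intro!: homogeneous_mult)

lemma homogeneous_xv: "homogeneous 1 (xv i)"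
  using homogeneous_hs[of 1 "xv i"] by (simp add: hs_xv)

lemma homogeneous_const: "homogeneous 0 f \<Longrightarrow> f = SC (cf f 0 0 0)"
  by (auto intro!: cf_ext simp: cf_SC homogeneous_cf)

lemma homogeneous_pd: "homogeneous d f \<Longrightarrow> homogeneous (d - 1) (pd i f)"
  using exhaust_3[of i] by (auto simp: homogeneous_cf pd_simps cf_dx cf_dy cf_dz)

lemma homogeneous_unique: "homogeneous d f \<Longrightarrow> homogeneous e f \<Longrightarrow> f \<noteq> 0 \<Longrightarrow> d = e"
  using hp_self homogeneous_iff by metis

lemma eval_homogeneous:
  assumes "homogeneous (int n) f" "rhom \<iota>"
  shows "eval_S \<iota> f (\<chi> i. c * v $ i) = c ^ n * eval_S \<iota> f v"
proof -
  define h where "h = (\<lambda>a. eval_S \<iota> a v)"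
  have h: "rhom h" unfolding h_def by (rule eval_hom[OF assms(2)])
  have "poly (map_poly h (hs f)) c = eval_S (\<lambda>a. poly (map_poly h [:SC a:]) c) f (\<chi> i. poly (map_poly h (monom (xv i) 1)) c)"
    unfolding hs_def using hom_eval[OF poly_map_hom[OF h] const_SC_hom] by simp
  also have "\<dots> = eval_S \<iota> f (\<chi> i. c * v $ i)"
    using poly_map_pCons[OF h, of _ 0 c]
    by (simp add: poly_map_monom[OF h]) (simp add: h_def eval_const[OF assms(2)] eval_var[OF assms(2)] mult.commute)
  also have "poly (map_poly h (hs f)) c = h f * c ^ n"
    using assms(1) homogeneous_hs[of n f] by (simp add: poly_map_monom[OF h])
  finally show ?thesis by (simp add: h_def mult.commute)
qed

lemma euler:
  assumes "homogeneous (int n) f"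
  shows "(\<Sum>i\<in>UNIV. xv i * pd i f) = of_nat n * f"
proof (rule cf_ext)
  fix i j k
  have "cf (\<Sum>i\<in>UNIV. xv i * pd i f) i j k = of_nat (i + j + k) * cf f i j k"
    by (cases i; cases j; cases k) (simp_all add: sum_3 cf_x1 cf_x2 cf_x3 pd_simps cf_dx cf_dy cf_dz ring_distribs)
  also have "\<dots> = of_nat n * cf f i j k"
    using assms unfolding homogeneous_cf
    by (cases "i + j + k = n") (auto simp flip: of_nat_add)
  finally show "cf (\<Sum>i\<in>UNIV. xv i * pd i f) i j k = cf (of_nat n * f) i j k"
    by (simp add: rhom_of_nat[OF SC_hom, symmetric])
qed

text \<open>Over a domain the lowest exponents add up just as the degrees do; if both sums are
  \<open>n\<close>, lowest exponent and degree coincide in each factor. Applied to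
  \<open>hs\<close>, this shows that factors of homogeneous polynomials are homogeneous.\<close>

lemma monom_factor:
  fixes p q :: "'a::idom poly"
  assumes "p * q = monom c n" "c \<noteq> 0"
  shows "\<exists>m. p = monom (coeff p m) m"
proof -
  have nz: "p \<noteq> 0" "q \<noteq> 0" using assms by auto
  define lo where "lo = (\<lambda>p :: 'a poly. LEAST i. coeff p i \<noteq> 0)"
  have lo: "coeff p (lo p) \<noteq> 0" "\<And>i. i < lo p \<Longrightarrow> coeff p i = 0" if "p \<noteq> 0" for p
  proof -
    have "\<exists>i. coeff p i \<noteq> 0" using that by (simp add: poly_eq_iff)
    then show "coeff p (lo p) \<noteq> 0" unfolding lo_def by (rule LeastI_ex)
    show "\<And>i. i < lo p \<Longrightarrow> coeff p i = 0" unfolding lo_def using not_less_Least by blast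
  qed
  have "coeff (p * q) (lo p + lo q) = coeff p (lo p) * coeff q (lo q)"
  proof -
    have "coeff (p * q) (lo p + lo q) = (\<Sum>i\<le>lo p + lo q. if i = lo p then coeff p (lo p) * coeff q (lo q) else 0)"
      unfolding coeff_mult
    proof (intro sum.cong refl)
      fix i assume "i \<in> {..lo p + lo q}"
      then consider "i < lo p" | "i = lo p" | "lo p + lo q - i < lo q" "i \<noteq> lo p" by fastforce
      then show "coeff p i * coeff q (lo p + lo q - i) = (if i = lo p then coeff p (lo p) * coeff q (lo q) else 0)"
        by cases (use lo nz in auto)
    qed
    then show ?thesis by simp
  qed
  then have 1: "lo p + lo q = n" using lo nz assms by (metis coeff_monom mult_eq_0_iff)
  have "degree p + degree q = n" using assms nz by (metis degree_monom_eq degree_mult_eq)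
  moreover have "lo p \<le> degree p" "lo q \<le> degree q" using lo nz by (simp_all add: le_degree)
  ultimately have "lo p = degree p" using 1 by simp
  then have "p = monom (coeff p (degree p)) (degree p)" using lo(2)[OF nz(1)]
    by (intro poly_eqI) (metis coeff_eq_0 coeff_monom linorder_neqE_nat)
  then show ?thesis by blast
qed

lemma homogeneous_factor:
  assumes "homogeneous d (f * g)" "f * g \<noteq> 0"
  shows "\<exists>n. homogeneous (int n) f"
proof -
  have "d \<ge> 0" using assms homogeneous_neg not_less by blast
  then obtain n where "hs (f * g) = monom (f * g) n" using assms homogeneous_hs by (metis nonneg_int_cases)
  then have "hs f * hs g = monom (f * g) n" by (simp add: rhom_mult[OF hs_hom])
  then obtain m where m: "hs f = monom (coeff (hs f) m) m" using monom_factor assms by blast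
  then have "f = coeff (hs f) m" using hs_1[of f] by (metis mult.right_neutral poly_monom power_one)
  with m show ?thesis unfolding homogeneous_hs by metis
qed

lemma homogeneous_unit: "f dvd 1 \<longleftrightarrow> (\<exists>c. c \<noteq> 0 \<and> f = SC c)"
proof
  assume "f dvd 1"
  then obtain g where g: "f * g = 1" by (metis dvdE)
  then obtain n m where n: "homogeneous (int n) f" "homogeneous (int m) g"
    using homogeneous_factor[of 0 f g] homogeneous_factor[of 0 g f] homogeneous_1 by (auto simp: mult.commute)
  then have "int n + int m = 0" using homogeneous_mult[OF n] homogeneous_unique[of _ 1 0] g homogeneous_1 by auto
  then have "n = 0" by simp
  then have "homogeneous 0 f" using n(1) by simp
  then have "f = SC (cf f 0 0 0)" by (rule homogeneous_const)
  moreover have "f \<noteq> 0" using g by auto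
  ultimately show "\<exists>c. c \<noteq> 0 \<and> f = SC c" by (metis SC_eq_0)
next
  assume "\<exists>c. c \<noteq> 0 \<and> f = SC c"
  then obtain c where "c \<noteq> 0" "f = SC c" by blast
  then have "f * SC (inverse c) = 1" by (simp add: SC_simps[symmetric] rhom_1[OF SC_hom, symmetric])
  then show "f dvd 1" by (metis dvdI)
qed

section \<open>Linear forms and restriction to a line\<close>

definition scS :: "complex \<Rightarrow> S \<Rightarrow> S" where "scS c f = SC c * f"

interpretation VS: vspace scS
  by unfold_locales (simp_all add: scS_def SC_simps algebra_simps)

interpretation VP: vspace "smult :: complex \<Rightarrow> complex poly \<Rightarrow> complex poly"
  by unfold_locales (simp_all add: smult_add_right smult_add_left)

definition Hm :: "int \<Rightarrow> S set" where "Hm d = {f. homogeneous d f}"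

lemma subspace_Hm: "VS.subspace (Hm d)"
  by (simp add: VS.subspace_def Hm_def homogeneous_0 homogeneous_add homogeneous_SC_mult scS_def)

text \<open>Binary forms of degree \<open>k\<close> in an affine coordinate. The integer index makes
  the space zero for negative \<open>k\<close>.\<close>

definition Pl :: "int \<Rightarrow> complex poly set" where
  "Pl k = {q. \<forall>i. int i > k \<longrightarrow> coeff q i = 0}"

lemma subspace_Pl: "VP.subspace (Pl k)"
  by (simp add: VP.subspace_def Pl_def)

lemma Pl_neg: "k < 0 \<Longrightarrow> Pl k = {0}"
  by (auto simp: Pl_def poly_eq_iff)

lemma Pl_degree: "q \<in> Pl (int n) \<longleftrightarrow> degree q \<le> n"
  by (auto simp: Pl_def intro: degree_le coeff_eq_0)

lemma Pl_mult: "p \<in> Pl k \<Longrightarrow> q \<in> Pl l \<Longrightarrow> p * q \<in> Pl (k + l)"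
proof (cases "k < 0 \<or> l < 0")
  case False
  assume pq: "p \<in> Pl k" "q \<in> Pl l"
  obtain n m where nm: "k = int n" "l = int m" using False by (metis nonneg_int_cases not_less)
  have "degree (p * q) \<le> n + m" using pq unfolding nm Pl_degree
    using degree_mult_le[of p q] by linarith
  then show ?thesis unfolding nm of_nat_add[symmetric] Pl_degree .
next
  case True
  assume "p \<in> Pl k" "q \<in> Pl l"
  then have "p * q = 0" using True by (auto simp: Pl_neg)
  then show ?thesis by (simp only: Pl_def) simp
qed

lemma fd_Pl: "fd smult {0} (Pl k) (nat (k + 1))"
proof (cases "k < 0")
  case True
  then show ?thesis by (simp add: Pl_neg fd_refl)
next
  case False
  have "fd smult {0} (Pl (int n - 1)) n" for n
  proof (induction n)
    case 0
    then show ?case by (simp add: Pl_neg fd_refl)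
  next
    case (Suc n)
    have "Pl (int n) = adj smult (Pl (int n - 1)) (monom 1 n)"
    proof (intro subset_antisym subsetI)
      fix q assume q: "q \<in> Pl (int n)"
      then have "q - smult (coeff q n) (monom 1 n) \<in> Pl (int n - 1)"
        by (auto simp: Pl_def smult_monom)
      then show "q \<in> adj smult (Pl (int n - 1)) (monom 1 n)" by (rule adjI[where c = "coeff q n"]) simp
    next
      fix q assume "q \<in> adj smult (Pl (int n - 1)) (monom 1 n)"
      then show "q \<in> Pl (int n)" by (auto simp: Pl_def adj_def smult_monom)
    qed
    moreover have "monom 1 n \<notin> Pl (int n - 1)" by (auto simp: Pl_def intro!: exI[of _ n])
    ultimately show ?case using fd_step[OF Suc] by simp
  qed
  from this[of "nat (k + 1)"] False show ?thesis by simp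
qed

definition lf :: "complex ^ 3 \<Rightarrow> S" where
  "lf a = (\<Sum>i\<in>UNIV. SC (a $ i) * xv i)"

lemma homogeneous_lf: "homogeneous 1 (lf a)"
  unfolding lf_def by (intro homogeneous_sum homogeneous_SC_mult homogeneous_xv)

lemma eval_lf: "rhom \<iota> \<Longrightarrow> eval_S \<iota> (lf a) v = (\<Sum>i\<in>UNIV. \<iota> (a $ i) * v $ i)"
  by (simp add: lf_def rhom_sum[OF eval_hom] rhom_mult[OF eval_hom] eval_const eval_var)

lemma linear_form: "homogeneous 1 f \<Longrightarrow> \<exists>a. f = lf a"
proof -
  assume f: "homogeneous 1 f"
  have "homogeneous 0 (pd i f)" for i using homogeneous_pd[OF f, of i] by simp
  then have "pd i f = SC (cf (pd i f) 0 0 0)" for i by (rule homogeneous_const)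
  then have "(\<Sum>i\<in>UNIV. xv i * pd i f) = lf (\<chi> i. cf (pd i f) 0 0 0)"
    by (simp add: lf_def mult.commute)
  moreover have "(\<Sum>i\<in>UNIV. xv i * pd i f) = f" using euler[of 1 f] f by simp
  ultimately show ?thesis by metis
qed

lemma pd_lf: "pd i (lf a) = SC (a $ i)"
proof -
  have "pd i (\<Sum>j\<in>A. SC (a $ j) * xv j) = (\<Sum>j\<in>A. SC (a $ j) * (if i = j then 1 else 0))" for A
    by (induction A rule: infinite_finite_induct)
       (simp_all add: pd_add pd_SC_mult pd_xv pd_SC[of i 0, unfolded rhom_0[OF SC_hom]])
  then show ?thesis by (simp add: lf_def mult_delta_right)
qed

abbreviation ev :: "S \<Rightarrow> complex ^ 3 \<Rightarrow> complex" where "ev f v \<equiv> eval_S id f v"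

lemma id_hom: "rhom id" by (simp add: rhom_def)

lemmas ev_hom = eval_hom[OF id_hom] 

lemma ev_lf: "ev (lf a) v = (\<Sum>i\<in>UNIV. a $ i * v $ i)"
  by (simp add: eval_lf[OF id_hom])

text \<open>Linear forms \<open>X, Y, L\<close> with the dual basis \<open>P, Q, R\<close>: the line
  is spanned by \<open>P\<close> and \<open>Q\<close> and parametrized by \<open>P + t Q\<close>,
  with \<open>Q\<close> as its point at infinity. \<open>expand\<close> writes the standard
  coordinates in terms of these forms.\<close>

locale coords =
  fixes X Y L :: S and P Q R :: "complex ^ 3"
  assumes lin: "homogeneous 1 X" "homogeneous 1 Y" "homogeneous 1 L"
    and dual: "ev X P = 1" "ev X Q = 0" "ev X R = 0" "ev Y P = 0" "ev Y Q = 1" "ev Y R = 0"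
      "ev L P = 0" "ev L Q = 0" "ev L R = 1"
    and expand: "\<And>i. xv i = SC (P $ i) * X + SC (Q $ i) * Y + SC (R $ i) * L"

lemma eval_cong_dvd:
  fixes v v' :: "S ^ 3"
  assumes "\<And>i. l dvd v $ i - v' $ i"
  shows "l dvd eval_S SC f v - eval_S SC f v'"
proof (induction f rule: S_induct)
  case (const c)
  then show ?case by (simp add: eval_const[OF SC_hom])
next
  case (add f g)
  then have "l dvd (eval_S SC f v - eval_S SC f v') + (eval_S SC g v - eval_S SC g v')" by (rule dvd_add)
  then show ?case by (simp add: rhom_add[OF eval_hom[OF SC_hom]] algebra_simps)
next
  case (var i f)
  have "l dvd v $ i * (eval_S SC f v - eval_S SC f v') + (v $ i - v' $ i) * eval_S SC f v'"
    using var assms by (intro dvd_add dvd_mult dvd_mult2)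
  then show ?case by (simp add: rhom_mult[OF eval_hom[OF SC_hom]] eval_var[OF SC_hom] algebra_simps)
qed

lemma to_fract_hom: "rhom (to_fract :: S \<Rightarrow> S fract)"
  by (simp add: rhom_def)

context coords
begin

definition r :: "S \<Rightarrow> complex poly" where
  "r f = eval_S (\<lambda>c. [:c:]) f (\<chi> i. [:P $ i, Q $ i:])"

lemma cpoly_hom: "rhom (\<lambda>c. [:c:])"
  by (simp add: rhom_def one_pCons)

lemma r_hom: "rhom r"
  unfolding r_def by (rule eval_hom[OF cpoly_hom])

lemma r_SC: "r (SC c) = [:c:]" and r_xv: "r (xv i) = [:P $ i, Q $ i:]"
  unfolding r_def by (simp_all add: eval_const[OF cpoly_hom] eval_var[OF cpoly_hom])

lemma poly_r: "poly (r f) t = ev f (P + t *s Q)"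
proof -
  have h: "rhom (\<lambda>p. poly p t)" by (simp add: rhom_def)
  show ?thesis unfolding r_def
    using hom_eval[OF h cpoly_hom, of f "\<chi> i. [:P $ i, Q $ i:]"]
    by (simp add: id_def vector_scalar_mult_def plus_vec_def)
qed

lemma r_linear_form: "homogeneous 1 f \<Longrightarrow> r f = [:ev f P, ev f Q:]"
proof -
  assume "homogeneous 1 f"
  then obtain a where "f = lf a" using linear_form by blast
  then show ?thesis
    by (simp add: lf_def rhom_add[OF r_hom] rhom_mult[OF r_hom] r_SC r_xv rhom_add[OF ev_hom] rhom_mult[OF ev_hom]
      eval_const[OF id_hom] eval_var[OF id_hom] sum_3)
qed

lemma r_X: "r X = 1" and r_Y: "r Y = [:0, 1:]" and r_L: "r L = 0"
  using r_linear_form[OF lin(1)] r_linear_form[OF lin(2)] r_linear_form[OF lin(3)]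
  by (simp_all add: dual one_pCons)

lemma r_Pl: "homogeneous d f \<Longrightarrow> r f \<in> Pl d"
proof -
  have "\<forall>d. r (hp d f) \<in> Pl d" for f
  proof (induction f rule: S_induct)
    case (const c)
    have "hp d (SC c) = (if d = 0 then SC c else 0)" for d by (rule hp_self[OF homogeneous_SC])
    then show ?case by (auto simp: rhom_0[OF r_hom] r_SC Pl_def coeff_pCons split: nat.splits)
  next
    case (add f g)
    then show ?case using VP.subspace_add[OF subspace_Pl] by (simp add: hp_add rhom_add[OF r_hom])
  next
    case (var i f)
    have "[:P $ i, Q $ i:] \<in> Pl 1" by (auto simp: Pl_def coeff_pCons split: nat.splits)
    then have "[:P $ i, Q $ i:] * r (hp (d - 1) f) \<in> Pl (1 + (d - 1))" for d
      using var by (intro Pl_mult) auto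
    then show ?case by (simp only: hp_mult[OF homogeneous_xv] rhom_mult[OF r_hom] r_xv) simp
  qed
  moreover assume "homogeneous d f"
  ultimately show ?thesis using homogeneous_iff by metis
qed

lemma mod_L: "L dvd f - eval_S SC f (\<chi> i. SC (P $ i) * X + SC (Q $ i) * Y)"
proof -
  have "L dvd eval_S SC f (\<chi> i. xv i) - eval_S SC f (\<chi> i. SC (P $ i) * X + SC (Q $ i) * Y)"
    by (rule eval_cong_dvd) (simp add: expand)
  then show ?thesis by (simp add: eval_id)
qed

lemma X_nonzero: "X \<noteq> 0" and L_nonzero: "L \<noteq> 0"
  using dual by (auto simp: rhom_0[OF ev_hom])

text \<open>Homogeneity is essential, as \<open>r X = 1\<close>: in the fraction field a form
  \<open>f\<close> of degree \<open>n\<close> satisfies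
  \<open>f(P X + Q Y) = X^n r(f)(Y / X)\<close>, and \<open>f\<close> is congruent to the left side
  modulo \<open>L\<close>.\<close>

lemma r_kernel:
  assumes "homogeneous d f"
  shows "r f = 0 \<longleftrightarrow> L dvd f"
proof
  assume "L dvd f"
  then show "r f = 0" by (auto simp: rhom_mult[OF r_hom] r_L elim: dvdE)
next
  assume r: "r f = 0"
  show "L dvd f"
  proof (cases "d < 0")
    case True
    then show ?thesis using assms by (simp add: homogeneous_neg)
  next
    case False
    then obtain n where n: "homogeneous (int n) f" using assms by (metis nonneg_int_cases not_less)
    define v where "v = (\<chi> i. SC (P $ i) * X + SC (Q $ i) * Y)"
    define F where "F = (to_fract :: S \<Rightarrow> S fract)"
    have F: "rhom F" unfolding F_def by (rule to_fract_hom)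
    have FX: "F X \<noteq> 0" using X_nonzero by (simp add: F_def)
    define t where "t = F Y / F X"
    have FS: "rhom (\<lambda>c. F (SC c))" by (rule rhom_comp[OF F SC_hom])
    have "F (eval_S SC f v) = eval_S (\<lambda>c. F (SC c)) f (\<chi> i. F (v $ i))" by (rule hom_eval[OF F SC_hom])
    also have "(\<chi> i. F (v $ i)) = (\<chi> i. F X * (\<chi> i. F (SC (P $ i)) + F (SC (Q $ i)) * t) $ i)"
      using FX by (simp add: v_def rhom_simps[OF F] t_def vec_eq_iff field_simps)
    also have "eval_S (\<lambda>c. F (SC c)) f \<dots> = F X ^ n * eval_S (\<lambda>c. F (SC c)) f (\<chi> i. F (SC (P $ i)) + F (SC (Q $ i)) * t)"
      by (rule eval_homogeneous[OF n FS])
    also have "eval_S (\<lambda>c. F (SC c)) f (\<chi> i. F (SC (P $ i)) + F (SC (Q $ i)) * t) = poly (map_poly (\<lambda>c. F (SC c)) (r f)) t"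
      unfolding r_def using hom_eval[OF poly_map_hom[OF FS, of t] cpoly_hom, of f "\<chi> i. [:P $ i, Q $ i:]"]
      by (simp add: poly_map_pCons[OF FS] mult.commute)
    finally have "F (eval_S SC f v) = 0" by (simp add: r)
    then have "eval_S SC f v = 0" by (simp add: F_def)
    then show ?thesis using mod_L[of f] by (simp add: v_def)
  qed
qed

lemma L_quotient: "homogeneous d (L * g) \<Longrightarrow> homogeneous (d - 1) g"
  using L_nonzero by (simp add: homogeneous_iff hp_mult[OF lin(3)])

lemma r_surj:
  assumes "q \<in> Pl d"
  shows "\<exists>f. homogeneous d f \<and> r f = q"
proof (cases "d < 0")
  case True
  then show ?thesis using assms by (intro exI[of _ 0]) (simp add: Pl_neg homogeneous_0 rhom_0[OF r_hom])
next
  case False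
  then obtain n where d: "d = int n" by (metis nonneg_int_cases not_less)
  define f where "f = (\<Sum>i\<le>n. SC (coeff q i) * (X ^ (n - i) * Y ^ i))"
  have "homogeneous d f" unfolding f_def
  proof (intro homogeneous_sum homogeneous_SC_mult)
    fix i assume "i \<in> {..n}"
    then show "homogeneous d (X ^ (n - i) * Y ^ i)"
      using homogeneous_mult[OF homogeneous_power[OF lin(1), of "n - i"] homogeneous_power[OF lin(2), of i]]
      by (simp add: d of_nat_diff)
  qed
  moreover have "r f = (\<Sum>i\<le>n. smult (coeff q i) (monom 1 i))"
    by (simp add: f_def rhom_sum[OF r_hom] rhom_mult[OF r_hom] rhom_power[OF r_hom] r_X r_Y r_SC monom_altdef)
  moreover have "\<dots> = q"
    using assms by (intro poly_eqI) (auto simp: coeff_sum d Pl_def mult_delta_right)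
  ultimately show ?thesis by auto
qed

lemma r_linear: "Vector_Spaces.linear scS smult r"
  by (rule linI) (simp_all add: VS.vspace_axioms VP.vspace_axioms rhom_add[OF r_hom] scS_def rhom_mult[OF r_hom] r_SC)

lemma multL_linear: "Vector_Spaces.linear scS scS (\<lambda>f. L * f)"
  by (rule linI) (simp_all add: VS.vspace_axioms scS_def algebra_simps)

end

text \<open>The dimension of \<open>Hm k\<close>. The truncation by \<open>nat\<close> makes it
  vanish for negative \<open>k\<close>, and it agrees with the polynomial
  \<open>(k + 1) (k + 2) / 2\<close> already from \<open>k = -2\<close> on.\<close>

definition h2 :: "int \<Rightarrow> nat" where
  "h2 k = nat (k + 2) choose 2"

lemma h2_neg: "k < 0 \<Longrightarrow> h2 k = 0"
  by (simp add: h2_def binomial_eq_0)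

lemma h2_rec: "h2 k = h2 (k - 1) + nat (k + 1)"
proof (cases "k \<ge> -1")
  case True
  then have "nat (k + 2) = Suc (nat (k + 1))" by simp
  then show ?thesis by (simp add: h2_def numeral_2_eq_2 algebra_simps)
qed (simp add: h2_def binomial_eq_0)

lemma h2_formula: "k \<ge> -2 \<Longrightarrow> 2 * int (h2 k) = (k + 1) * (k + 2)"
proof -
  have "2 * int (h2 (int n - 2)) = (int n - 1) * int n" for n
  proof (induction n)
    case (Suc n)
    have "int (nat (int n)) = int n" by simp
    then show ?case using h2_rec[of "int n - 1"] Suc by (simp add: algebra_simps)
  qed (simp add: h2_def)
  from this[of "nat (k + 2)"] have "k \<ge> -2 \<Longrightarrow> 2 * int (h2 k) = (k + 1) * (k + 2)" by simp
  moreover assume "k \<ge> -2"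
  ultimately show ?thesis by simp
qed

lemma standard_coords: "coords (xv 1) (xv 2) (xv 3) (axis 1 1) (axis 2 1) (axis 3 1)"
proof -
  have *: "xv i = SC (axis 1 1 $ i) * xv 1 + SC (axis 2 1 $ i) * xv 2 + SC (axis 3 1 $ i) * xv 3" for i
    using exhaust_3[of i] by (elim disjE) (simp_all add: axis_def rhom_0[OF SC_hom] rhom_1[OF SC_hom])
  show ?thesis
  proof
    show "xv i = SC (axis 1 1 $ i) * xv 1 + SC (axis 2 1 $ i) * xv 2 + SC (axis 3 1 $ i) * xv 3" for i by (rule *)
  qed (simp_all add: homogeneous_xv eval_var[OF id_hom] axis_def)
qed

text \<open>Recursion over the degree along the exact sequence of multiplication by \<open>z\<close>
  and restriction to \<open>z = 0\<close>.\<close>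

lemma fd_Hm: "fd scS {0} (Hm d) (h2 d)"
proof -
  interpret coords "xv 1" "xv 2" "xv 3" "axis 1 1" "axis 2 1" "axis 3 1" by (rule standard_coords)
  have neg: "fd scS {0} (Hm d) (h2 d)" if "d < 0" for d
    using that by (simp add: h2_neg Hm_def homogeneous_neg fd_refl)
  have "fd scS {0} (Hm (int n - 1)) (h2 (int n - 1))" for n
  proof (induction n)
    case 0
    then show ?case by (rule neg) simp
  next
    case (Suc n)
    have "fd scS {0} ((\<lambda>f. xv 3 * f) ` Hm (int n - 1)) (h2 (int n - 1))"
      by (rule VS.fd_inj_image[OF Suc VS.vspace_axioms multL_linear]) (simp add: L_nonzero)
    moreover have "(\<lambda>f. xv 3 * f) ` Hm (int n - 1) = {v \<in> Hm (int n). r v = 0}"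
    proof (intro subset_antisym subsetI)
      fix f assume "f \<in> {v \<in> Hm (int n). r v = 0}"
      then show "f \<in> (\<lambda>f. xv 3 * f) ` Hm (int n - 1)"
        using r_kernel L_quotient unfolding Hm_def by (auto elim!: dvdE intro!: imageI)
    next
      fix f assume "f \<in> (\<lambda>f. xv 3 * f) ` Hm (int n - 1)"
      then show "f \<in> {v \<in> Hm (int n). r v = 0}"
        using homogeneous_mult[OF lin(3), of "int n - 1"] by (auto simp: Hm_def rhom_mult[OF r_hom] r_L)
    qed
    ultimately have "fd scS {0} {v \<in> Hm (int n). r v = 0} (h2 (int n - 1))" by simp
    moreover have "r ` Hm (int n) = Pl (int n)"
    proof (intro subset_antisym subsetI)
      fix q assume "q \<in> Pl (int n)"
      then obtain f where "homogeneous (int n) f" "r f = q" using r_surj by blast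
      then show "q \<in> r ` Hm (int n)" by (auto simp: Hm_def)
    qed (auto simp: Hm_def r_Pl)
    ultimately have "fd scS {0} (Hm (int n)) (h2 (int n - 1) + nat (int n + 1))"
      using VS.fd_kernel[OF subspace_Hm VP.vspace_axioms r_linear, of "int n"] fd_Pl[of "int n"] by simp
    then show ?case using h2_rec[of "int n"] by simp
  qed
  from this[of "nat (d + 1)"] show ?thesis using neg by (cases "d < 0") auto
qed

section \<open>Hilbert functions from free resolutions\<close>

definition scV :: "complex \<Rightarrow> S ^ 3 \<Rightarrow> S ^ 3" where "scV c \<theta> = SC c *s \<theta>"

interpretation VV: vspace scV
  by unfold_locales (simp_all add: scV_def SC_simps vec_eq_iff algebra_simps)

definition scN :: "complex \<Rightarrow> (nat \<Rightarrow> S) \<Rightarrow> (nat \<Rightarrow> S)" where "scN c v = (\<lambda>i. SC c * v i)"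

interpretation VN: vspace scN
  by unfold_locales (simp_all add: scN_def SC_simps fun_eq_iff algebra_simps)

definition Hd :: "int \<Rightarrow> (S ^ 3) set" where "Hd k = {\<theta>. homogeneous_der k \<theta>}"

lemma subspace_Hd: "VV.subspace (Hd k)"
  by (simp add: VV.subspace_def Hd_def homogeneous_der_def homogeneous_0 homogeneous_add homogeneous_SC_mult scV_def)

definition hpd :: "int \<Rightarrow> S ^ 3 \<Rightarrow> S ^ 3" where "hpd k \<theta> = (\<chi> i. hp k (\<theta> $ i))"

lemma hpd_Hd: "hpd k \<theta> \<in> Hd k"
  by (simp add: Hd_def homogeneous_der_def hpd_def hp_hom)

lemma hpd_self: "\<theta> \<in> Hd k \<Longrightarrow> hpd k \<theta> = \<theta>"
  by (simp add: Hd_def homogeneous_der_def hpd_def vec_eq_iff homogeneous_iff)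

text \<open>The part of degree \<open>k\<close> of the graded free module with generators in the
  degrees \<open>es\<close>.\<close>

definition Fr :: "int list \<Rightarrow> int \<Rightarrow> (nat \<Rightarrow> S) set" where
  "Fr es k = {v \<in> free_mod (length es). \<forall>j<length es. homogeneous (k - es ! j) (v j)}"

lemma subspace_Fr: "VN.subspace (Fr es k)"
  by (simp add: VN.subspace_def Fr_def free_mod_def homogeneous_0 homogeneous_add homogeneous_SC_mult scN_def)

lemma fd_Fr: "fd scN {0} (Fr es k) (\<Sum>e\<leftarrow>es. h2 (k - e))"
proof (induction es rule: rev_induct)
  case Nil
  have "Fr [] k = {0}" by (auto simp: Fr_def free_mod_def)
  then show ?case using fd_refl[of scN "{0}"] by (simp only: list.map sum_list.Nil)
next
  case (snoc e es)
  let ?n = "length es"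
  have lin: "Vector_Spaces.linear scN scS (\<lambda>v. v ?n)"
    by (rule linI) (simp_all add: VN.vspace_axioms VS.vspace_axioms scN_def scS_def)
  have eq: "{v \<in> Fr (es @ [e]) k. v ?n = 0} = Fr es k"
  proof (intro subset_antisym subsetI)
    fix v assume v: "v \<in> {v \<in> Fr (es @ [e]) k. v ?n = 0}"
    have "v j = 0" if "j \<ge> ?n" for j using v that by (cases "j = ?n") (auto simp: Fr_def free_mod_def)
    moreover have "homogeneous (k - es ! j) (v j)" if "j < ?n" for j
    proof -
      have "homogeneous (k - (es @ [e]) ! j) (v j)" using v that by (simp add: Fr_def)
      then show ?thesis using that by (simp add: nth_append)
    qed
    ultimately show "v \<in> Fr es k" by (simp add: Fr_def free_mod_def)
  next
    fix v assume "v \<in> Fr es k"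
    then show "v \<in> {v \<in> Fr (es @ [e]) k. v ?n = 0}"
      by (simp add: Fr_def free_mod_def nth_append homogeneous_0)
  qed
  have 1: "fd scN {0} {v \<in> Fr (es @ [e]) k. v ?n = 0} (\<Sum>e\<leftarrow>es. h2 (k - e))" unfolding eq by (rule snoc)
  have "(\<lambda>v. v ?n) ` Fr (es @ [e]) k = Hm (k - e)"
  proof (intro subset_antisym subsetI)
    fix f assume "f \<in> Hm (k - e)"
    then have "(\<lambda>j. if j = ?n then f else 0) \<in> Fr (es @ [e]) k"
      by (auto simp: Fr_def free_mod_def Hm_def nth_append homogeneous_0)
    then show "f \<in> (\<lambda>v. v ?n) ` Fr (es @ [e]) k" by (rule rev_image_eqI) simp
  qed (auto simp: Fr_def Hm_def nth_append)
  then have "fd scS {0} ((\<lambda>v. v ?n) ` Fr (es @ [e]) k) (h2 (k - e))" using fd_Hm by simp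
  from VN.fd_kernel[OF subspace_Fr VS.vspace_axioms lin this 1] show ?case
    by (simp only: map_append sum_list.append list.map sum_list.Cons sum_list.Nil add_0_right)
qed

definition hpv :: "int list \<Rightarrow> int \<Rightarrow> (nat \<Rightarrow> S) \<Rightarrow> (nat \<Rightarrow> S)" where
  "hpv es k v = (\<lambda>j. if j < length es then hp (k - es ! j) (v j) else 0)"

lemma hpv_Fr: "hpv es k v \<in> Fr es k"
  by (simp add: Fr_def free_mod_def hpv_def hp_hom)

lemma hpv_self: "v \<in> Fr es k \<Longrightarrow> hpv es k v = v"
  by (auto simp: Fr_def free_mod_def hpv_def fun_eq_iff homogeneous_iff)

lemma mat_map_linear: "Vector_Spaces.linear scN scN (mat_map r s A)"
  by (rule linI) (auto simp: VN.vspace_axioms scN_def mat_map_def fun_eq_iff algebra_simps sum.distrib sum_distrib_left)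

lemma der_map_linear: "Vector_Spaces.linear scN scV (der_map s \<Theta>)"
  by (rule linI) (simp_all add: VN.vspace_axioms VV.vspace_axioms scN_def scV_def der_map_def vec_eq_iff
      algebra_simps sum.distrib sum_distrib_left)

lemma mat_map_graded:
  assumes "\<And>i j. i < length ds \<Longrightarrow> j < length es \<Longrightarrow> homogeneous (es ! j - ds ! i) (A i j)"
  shows "mat_map (length ds) (length es) A (hpv es k v) = hpv ds k (mat_map (length ds) (length es) A v)"
proof
  fix i
  show "mat_map (length ds) (length es) A (hpv es k v) i = hpv ds k (mat_map (length ds) (length es) A v) i"
  proof (cases "i < length ds")
    case True
    have "hp (k - ds ! i) (A i j * v j) = A i j * hp (k - es ! j) (v j)" if "j < length es" for j
      using hp_mult[OF assms[OF True that], of "k - ds ! i" "v j"] by (simp add: algebra_simps)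
    then show ?thesis using True by (simp add: mat_map_def hpv_def hp_sum)
  qed (simp add: mat_map_def hpv_def)
qed

lemma der_map_graded:
  assumes "\<And>j. j < length es \<Longrightarrow> homogeneous_der (es ! j) (\<Theta> j)"
  shows "der_map (length es) \<Theta> (hpv es k v) = hpd k (der_map (length es) \<Theta> v)"
proof -
  have "hp k (v j * \<Theta> j $ i) = hp (k - es ! j) (v j) * \<Theta> j $ i" if "j < length es" for i j
    using hp_mult[of "es ! j" "\<Theta> j $ i" k "v j"] assms[OF that] by (simp add: homogeneous_der_def mult.commute)
  then show ?thesis by (simp add: der_map_def hpd_def hpv_def vec_eq_iff hp_sum)
qed

lemma int_sum_list: "int (\<Sum>x\<leftarrow>xs. g x) = (\<Sum>x\<leftarrow>xs. int (g x))"
  by (induction xs) simp_all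

text \<open>The maps of the resolution commute with the projections to degree \<open>k\<close>, so
  exactness persists in each degree; the dimensions of the images \<open>B i\<close> are then
  computed downwards from \<open>i = m\<close>.\<close>

lemma resolution_hilbert:
  assumes "graded_free_resolution M m d \<Theta> A"
  shows "\<exists>n. fd scV {0} (M \<inter> Hd k) n \<and> int n = (\<Sum>i\<le>m. (-1) ^ i * (\<Sum>e\<leftarrow>d i. int (h2 (k - e))))"
proof -
  define r where "r = (\<lambda>k. length (d k))"
  have res: "\<And>k. k > m \<Longrightarrow> d k = []"
    "\<And>j. j < length (d 0) \<Longrightarrow> homogeneous_der (d 0 ! j) (\<Theta> j)"
    "\<And>k i j. i < length (d k) \<Longrightarrow> j < length (d (Suc k)) \<Longrightarrow> homogeneous (d (Suc k) ! j - d k ! i) (A k i j)"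
    "der_map (length (d 0)) \<Theta> ` free_mod (length (d 0)) = M"
    "{v \<in> free_mod (length (d 0)). der_map (length (d 0)) \<Theta> v = 0} = mat_map (length (d 0)) (length (d 1)) (A 0) ` free_mod (length (d 1))"
    "\<And>k. {v \<in> free_mod (length (d (Suc k))). mat_map (length (d k)) (length (d (Suc k))) (A k) v = (\<lambda>_. 0)} =
         mat_map (length (d (Suc k))) (length (d (Suc (Suc k)))) (A (Suc k)) ` free_mod (length (d (Suc (Suc k))))"
    using assms unfolding graded_free_resolution_def Let_def by auto
  define F where "F i = Fr (d i) k" for i
  define f where "f i = (\<Sum>e\<leftarrow>d i. h2 (k - e))" for i
  define B where "B i = mat_map (length (d i)) (length (d (Suc i))) (A i) ` F (Suc i)" for i
  have F: "fd scN {0} (F i) (f i)" for i unfolding F_def f_def by (rule fd_Fr)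
  have zero: "(0 :: nat \<Rightarrow> S) = (\<lambda>_. 0)" by (simp add: fun_eq_iff)
  have Ffree: "F i \<subseteq> free_mod (length (d i))" for i by (auto simp: F_def Fr_def)
  have grm: "mat_map (length (d i)) (length (d (Suc i))) (A i) (hpv (d (Suc i)) k v) =
      hpv (d i) k (mat_map (length (d i)) (length (d (Suc i))) (A i) v)" for i v
    by (rule mat_map_graded) (rule res(3))
  have BF: "B i \<subseteq> F i" for i
  proof
    fix y assume "y \<in> B i"
    then obtain v where v: "v \<in> F (Suc i)" "y = mat_map (length (d i)) (length (d (Suc i))) (A i) v" by (auto simp: B_def)
    then have "y = hpv (d i) k y" using grm[of i v] hpv_self[of v] by (simp add: F_def)
    then show "y \<in> F i" using hpv_Fr[of "d i" k y] by (simp add: F_def)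
  qed
  have Zm: "{v \<in> F (Suc i). mat_map (length (d i)) (length (d (Suc i))) (A i) v = 0} = B (Suc i)" for i
  proof (intro subset_antisym subsetI)
    fix v assume v: "v \<in> {v \<in> F (Suc i). mat_map (length (d i)) (length (d (Suc i))) (A i) v = 0}"
    then obtain w where w: "v = mat_map (length (d (Suc i))) (length (d (Suc (Suc i)))) (A (Suc i)) w"
      using res(6)[of i] Ffree unfolding zero by blast
    have "v = hpv (d (Suc i)) k v" using v hpv_self by (simp add: F_def)
    also have "\<dots> = mat_map (length (d (Suc i))) (length (d (Suc (Suc i)))) (A (Suc i)) (hpv (d (Suc (Suc i))) k w)"
      unfolding grm w by (rule refl)
    finally show "v \<in> B (Suc i)" unfolding B_def using hpv_Fr by (auto simp: F_def)
  next
    fix v assume v: "v \<in> B (Suc i)"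
    then have "v \<in> mat_map (length (d (Suc i))) (length (d (Suc (Suc i)))) (A (Suc i)) ` free_mod (length (d (Suc (Suc i))))"
      using Ffree unfolding B_def by blast
    then have "mat_map (length (d i)) (length (d (Suc i))) (A i) v = 0" using res(6)[of i] unfolding zero by blast
    then show "v \<in> {v \<in> F (Suc i). mat_map (length (d i)) (length (d (Suc i))) (A i) v = 0}" using v BF by blast
  qed
  have gr0: "der_map (length (d 0)) \<Theta> (hpv (d 0) k v) = hpd k (der_map (length (d 0)) \<Theta> v)" for v
    by (rule der_map_graded) (rule res(2))
  have Z0: "{v \<in> F 0. der_map (length (d 0)) \<Theta> v = 0} = B 0"
  proof (intro subset_antisym subsetI)
    fix v assume v: "v \<in> {v \<in> F 0. der_map (length (d 0)) \<Theta> v = 0}"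
    then obtain w where w: "v = mat_map (length (d 0)) (length (d (Suc 0))) (A 0) w"
      using res(5) Ffree[of 0] by auto
    have "v = hpv (d 0) k v" using v hpv_self by (simp add: F_def)
    also have "\<dots> = mat_map (length (d 0)) (length (d (Suc 0))) (A 0) (hpv (d (Suc 0)) k w)"
      unfolding grm w by (rule refl)
    finally show "v \<in> B 0" unfolding B_def using hpv_Fr by (auto simp: F_def)
  next
    fix v assume v: "v \<in> B 0"
    then have "v \<in> mat_map (length (d 0)) (length (d 1)) (A 0) ` free_mod (length (d 1))"
      using Ffree[of 1] unfolding B_def by auto
    then have "der_map (length (d 0)) \<Theta> v = 0" unfolding res(5)[symmetric] by blast
    then show "v \<in> {v \<in> F 0. der_map (length (d 0)) \<Theta> v = 0}" using v BF by blast
  qed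
  have img: "der_map (length (d 0)) \<Theta> ` F 0 = M \<inter> Hd k"
  proof (intro subset_antisym subsetI)
    fix y assume "y \<in> der_map (length (d 0)) \<Theta> ` F 0"
    then obtain v where v: "v \<in> F 0" "y = der_map (length (d 0)) \<Theta> v" by auto
    then have "y = hpd k y" using gr0[of v] hpv_self[of v] by (simp add: F_def)
    then have "y \<in> Hd k" using hpd_Hd by metis
    moreover have "y \<in> M" using v Ffree res(4) by blast
    ultimately show "y \<in> M \<inter> Hd k" by blast
  next
    fix y assume y: "y \<in> M \<inter> Hd k"
    then obtain w where w: "y = der_map (length (d 0)) \<Theta> w" using res(4) by blast
    have "y = der_map (length (d 0)) \<Theta> (hpv (d 0) k w)" unfolding gr0 w[symmetric] using y hpd_self by auto
    then show "y \<in> der_map (length (d 0)) \<Theta> ` F 0" using hpv_Fr by (auto simp: F_def)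
  qed
  \<comment> \<open>The expected dimension of \<open>B i\<close>, the image of
    \<open>F (i + 1)\<close> in \<open>F i\<close>; the sum is empty from \<open>i = m\<close>
    on.\<close>
  define alt where "alt i = (\<Sum>t<m-i. (-1) ^ t * int (f (i + 1 + t)))" for i
  have B: "\<exists>z. fd scN {0} (B i) z \<and> int z = alt i" for i
  proof (induction "m - i" arbitrary: i)
    case 0
    then have "F (Suc i) = {0}" using res(1)[of "Suc i"] by (auto simp: F_def Fr_def free_mod_def)
    then have "B i = {0}"
      using mat_map_linear[THEN Vector_Spaces.linear.axioms(2)] by (auto simp: B_def mat_map_def fun_eq_iff)
    then have "fd scN {0} (B i) 0" by (simp only: fd_refl)
    then show ?case using 0 by (intro exI[of _ 0] conjI) (simp_all only: alt_def lessThan_0 sum.empty of_nat_0)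
  next
    case (Suc n)
    then obtain z where z: "fd scN {0} (B (Suc i)) z" "int z = alt (Suc i)" by (metis Suc_diff_Suc Suc_inject zero_less_Suc zero_less_diff)
    obtain a b where ab: "fd scN {0} (B (Suc i)) a" "fd scN {0} (B i) b" "a + b = f (Suc i)"
      using VN.fd_kernel'[OF F VN.vspace_axioms mat_map_linear, of "Suc i" "length (d i)" "length (d (Suc i))" "A i"]
      unfolding Zm B_def[symmetric] by blast
    have "a = z" by (rule VN.fd_unique[OF ab(1) z(1)]) simp
    moreover have "alt i = int (f (Suc i)) - alt (Suc i)"
    proof -
      have "m - i = Suc (m - Suc i)" using Suc by simp
      then show ?thesis unfolding alt_def by (simp add: sum.lessThan_Suc_shift sum_negf[symmetric] del: sum.lessThan_Suc)
    qed
    ultimately show ?case using ab z by (intro exI[of _ b]) auto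
  qed
  then obtain z where z: "fd scN {0} (B 0) z" "int z = alt 0" by blast
  obtain a b where ab: "fd scN {0} (B 0) a" "fd scV {0} (M \<inter> Hd k) b" "a + b = f 0"
    using VN.fd_kernel'[OF F VV.vspace_axioms der_map_linear, of 0 "length (d 0)" \<Theta>] unfolding Z0 img by blast
  have "a = z" by (rule VN.fd_unique[OF ab(1) z(1)]) simp
  then have "int b = int (f 0) - alt 0" using ab z by auto
  also have "\<dots> = (\<Sum>i\<le>m. (-1) ^ i * int (f i))"
    by (simp add: alt_def lessThan_Suc_atMost[symmetric] sum.lessThan_Suc_shift sum_negf[symmetric] del: sum.lessThan_Suc)
  also have "\<dots> = (\<Sum>i\<le>m. (-1) ^ i * (\<Sum>e\<leftarrow>d i. int (h2 (k - e))))"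
    by (simp add: f_def int_sum_list)
  finally show ?thesis using ab(2) by blast
qed

text \<open>The coefficients of a product of linear factors \<open>1 - et\<close> up to degree 2, in terms of the power
  sums \<open>s = \<Sum>e\<close> and \<open>q = \<Sum>e\<^sup>2\<close>.\<close>

definition power_sums :: "int poly \<Rightarrow> int \<Rightarrow> int \<Rightarrow> bool" where
  "power_sums p s q \<longleftrightarrow> coeff p 0 = 1 \<and> coeff p 1 = - s \<and> 2 * coeff p 2 = s\<^sup>2 - q"

lemma power_sums_mult:
  assumes "power_sums p s q" "power_sums p' s' q'"
  shows "power_sums (p * p') (s + s') (q + q')"
proof -
  have "coeff (p * p') 0 = coeff p 0 * coeff p' 0" "coeff (p * p') 1 = coeff p 0 * coeff p' 1 + coeff p 1 * coeff p' 0"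
    "coeff (p * p') 2 = coeff p 0 * coeff p' 2 + coeff p 1 * coeff p' 1 + coeff p 2 * coeff p' 0"
    by (simp_all add: coeff_mult numeral_2_eq_2)
  then show ?thesis using assms by (simp add: power_sums_def algebra_simps power2_eq_square)
qed

lemma power_sums_linear: "power_sums [:1, - e:] e (e\<^sup>2)"
  by (simp add: power_sums_def numeral_2_eq_2)

lemma power_sums_1: "power_sums 1 0 0"
  by (simp add: power_sums_def)

lemma power_sums_split: "power_sums (chern_split es) (sum_list es) (\<Sum>e\<leftarrow>es. e\<^sup>2)"
proof (induction es)
  case (Cons e es)
  then show ?case using power_sums_mult[OF power_sums_linear Cons] by (simp add: chern_split_def)
qed (simp add: chern_split_def power_sums_1)

lemma power_sums_prod:
  assumes "finite I"
  shows "power_sums (\<Prod>k\<in>I. chern_split (d k)) (\<Sum>k\<in>I. sum_list (d k)) (\<Sum>k\<in>I. \<Sum>e\<leftarrow>d k. e\<^sup>2)"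
  using assms
  by (induction I rule: finite_induct) (simp_all add: power_sums_1 power_sums_mult power_sums_split)

lemma power_sums_unique:
  assumes "power_sums p s q" "power_sums p' s' q'" "monom 1 3 dvd p - p'"
  shows "s = s'" "q = q'"
proof -
  have "coeff (p - p') i = 0" if "i < 3" for i using assms(3) that by (simp add: monom_1_dvd_iff')
  from this[of 1] this[of 2] show "s = s'" "q = q'" using assms(1,2) by (auto simp: power_sums_def)
qed

lemma parity_sum:
  fixes g :: "nat \<Rightarrow> int"
  shows "(\<Sum>i\<le>m. (-1) ^ i * g i) = (\<Sum>k | k \<le> m \<and> even k. g k) - (\<Sum>k | k \<le> m \<and> odd k. g k)"
proof -
  have "(\<Sum>i\<le>m. (-1) ^ i * g i) = (\<Sum>i\<le>m. (if even i then g i else 0) - (if odd i then g i else 0))"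
    by (intro sum.cong) auto
  also have "\<dots> = (\<Sum>i\<le>m. if even i then g i else 0) - (\<Sum>i\<le>m. if odd i then g i else 0)"
    by (rule sum_subtractf)
  also have "(\<Sum>i\<le>m. if even i then g i else 0) = (\<Sum>k | k \<le> m \<and> even k. g k)"
    by (subst sum.inter_filter[symmetric]) auto
  also have "(\<Sum>i\<le>m. if odd i then g i else 0) = (\<Sum>k | k \<le> m \<and> odd k. g k)"
    by (subst sum.inter_filter[symmetric]) auto
  finally show ?thesis .
qed

text \<open>Because of \<open>(k - e + 1) (k - e + 2) = (k + 1) (k + 2) - (2 k + 3) e + e^2\<close>,
  the Hilbert polynomial depends only on the alternating number, sum and sum of squares of the
  generator degrees. The last two are the power sums of the Chern polynomial; the first is the rank
  \<open>r\<close>, which the Chern polynomial leaves open.\<close>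

lemma chern_hilbert:
  assumes "has_chern_polynomial M ([:-1, a:] * [:-1, b:])"
  shows "\<exists>r K. \<forall>k\<ge>K. \<exists>n. fd scV {0} (M \<inter> Hd k) n \<and>
    2 * int n = r * ((k + 1) * (k + 2)) - (2 * k + 3) * (a + b) + (a\<^sup>2 + b\<^sup>2)"
proof -
  obtain m d \<Theta> A where res: "graded_free_resolution M m d \<Theta> A" and
    dvd: "monom 1 3 dvd [:-1, a:] * [:-1, b:] * (\<Prod>k\<in>{k. k \<le> m \<and> odd k}. chern_split (d k))
                      - (\<Prod>k\<in>{k. k \<le> m \<and> even k}. chern_split (d k))"
    using assms unfolding has_chern_polynomial_def by blast
  have fin: "finite {k. k \<le> m \<and> odd k}" "finite {k. k \<le> m \<and> even k}" by simp_all
  have "power_sums ([:-1, a:] * [:-1, b:]) (a + b) (a\<^sup>2 + b\<^sup>2)"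
    by (simp add: power_sums_def numeral_2_eq_2 algebra_simps)
  from power_sums_unique[OF power_sums_mult[OF this power_sums_prod[OF fin(1)]] power_sums_prod[OF fin(2)] dvd]
  have s: "(\<Sum>i\<le>m. (-1) ^ i * sum_list (d i)) = a + b" and q: "(\<Sum>i\<le>m. (-1) ^ i * (\<Sum>e\<leftarrow>d i. e\<^sup>2)) = a\<^sup>2 + b\<^sup>2"
    unfolding parity_sum by simp_all
  define r where "r = (\<Sum>i\<le>m. (-1) ^ i * int (length (d i)))"
  \<comment> \<open>A bound for all generator degrees, so that \<open>h2_formula\<close> applies to
    every summand.\<close>
  define K where "K = (\<Sum>i\<le>m. \<Sum>e\<leftarrow>d i. \<bar>e\<bar>)"
  have K: "e \<le> K" if "i \<le> m" "e \<in> set (d i)" for i e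
  proof -
    have nn: "0 \<le> (\<Sum>e\<leftarrow>xs. \<bar>e\<bar>)" for xs :: "int list" by (induction xs) simp_all
    have "x \<in> set xs \<Longrightarrow> \<bar>x\<bar> \<le> (\<Sum>e\<leftarrow>xs. \<bar>e\<bar>)" for x :: int and xs
    proof (induction xs)
      case (Cons y xs)
      then show ?case using nn[of xs] by auto
    qed simp
    then have "\<bar>e\<bar> \<le> (\<Sum>e\<leftarrow>d i. \<bar>e\<bar>)" using that by blast
    also have "\<dots> \<le> K" unfolding K_def
      by (rule member_le_sum) (use that nn in auto)
    finally show ?thesis by simp
  qed
  show ?thesis
  proof (rule exI[of _ r], rule exI[of _ K], intro allI impI)
    fix k assume k: "k \<ge> K"
    obtain n where n: "fd scV {0} (M \<inter> Hd k) n" "int n = (\<Sum>i\<le>m. (-1) ^ i * (\<Sum>e\<leftarrow>d i. int (h2 (k - e))))"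
      using resolution_hilbert[OF res] by blast
    have 1: "2 * (\<Sum>e\<leftarrow>es. int (h2 (k - e))) =
        int (length es) * ((k + 1) * (k + 2)) - (2 * k + 3) * sum_list es + (\<Sum>e\<leftarrow>es. e\<^sup>2)"
      if "\<And>e. e \<in> set es \<Longrightarrow> e \<le> K" for es
      using that
    proof (induction es)
      case (Cons e es)
      have "2 * int (h2 (k - e)) = (k - e + 1) * (k - e + 2)"
        using h2_formula[of "k - e"] Cons.prems[of e] k by simp
      then show ?case using Cons by (simp add: algebra_simps power2_eq_square)
    qed simp
    have "2 * int n = (\<Sum>i\<le>m. (-1) ^ i * (2 * (\<Sum>e\<leftarrow>d i. int (h2 (k - e)))))"
      unfolding n(2) by (simp add: sum_distrib_left algebra_simps)
    also have "\<dots> = (\<Sum>i\<le>m. (-1) ^ i * int (length (d i)) * ((k + 1) * (k + 2)) - (2 * k + 3) * ((-1) ^ i * sum_list (d i))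
        + (-1) ^ i * (\<Sum>e\<leftarrow>d i. e\<^sup>2))"
      by (intro sum.cong refl) (subst 1, use K in \<open>auto simp: algebra_simps\<close>)
    also have "\<dots> = r * ((k + 1) * (k + 2)) - (2 * k + 3) * (a + b) + (a\<^sup>2 + b\<^sup>2)"
      unfolding sum.distrib sum_subtractf sum_distrib_left[symmetric] sum_distrib_right[symmetric] s q r_def by (rule refl)
    finally show "\<exists>n. fd scV {0} (M \<inter> Hd k) n \<and> 2 * int n = r * ((k + 1) * (k + 2)) - (2 * k + 3) * (a + b) + (a\<^sup>2 + b\<^sup>2)"
      using n(1) by blast
  qed
qed

section \<open>The Jacobian ideal\<close>

lemma der_apply_sum: "der_apply \<theta> f = (\<Sum>i\<in>UNIV. \<theta> $ i * pd i f)"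
  by (simp add: der_apply_def sum_3 pd_simps)

lemma der_apply_add: "der_apply (\<theta> + \<eta>) f = der_apply \<theta> f + der_apply \<eta> f"
  and der_apply_diff: "der_apply (\<theta> - \<eta>) f = der_apply \<theta> f - der_apply \<eta> f"
  and der_apply_scale: "der_apply (g *s \<theta>) f = g * der_apply \<theta> f"
  by (simp_all add: der_apply_def algebra_simps)

lemma der_apply_mult: "der_apply \<theta> (f * g) = f * der_apply \<theta> g + der_apply \<theta> f * g"
  by (simp add: der_apply_sum pd_mult algebra_simps sum.distrib sum_distrib_left sum_distrib_right)

lemma der_apply_linear: "Vector_Spaces.linear scV scS (\<lambda>\<theta>. der_apply \<theta> f)"
  by (rule linI) (simp_all add: VV.vspace_axioms VS.vspace_axioms der_apply_add der_apply_scale scV_def scS_def)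

lemma der_apply_homogeneous:
  "homogeneous d f \<Longrightarrow> homogeneous_der k \<theta> \<Longrightarrow> homogeneous (k + d - 1) (der_apply \<theta> f)"
  unfolding der_apply_sum
  by (intro homogeneous_sum) (metis homogeneous_mult homogeneous_pd homogeneous_der_def add_diff_eq)

lemma fd_Hd: "fd scV {0} (Hd k) (3 * h2 k)"
proof -
  define T where "T v = ((\<chi> i. if i = 1 then v 0 else if i = 2 then v (Suc 0) else v (Suc (Suc 0))) :: S ^ 3)" for v :: "nat \<Rightarrow> S"
  have lin: "Vector_Spaces.linear scN scV T"
    by (rule linI) (simp_all add: VN.vspace_axioms VV.vspace_axioms T_def scN_def scV_def vec_eq_iff)
  have T: "T v $ 1 = v 0" "T v $ 2 = v (Suc 0)" "T v $ 3 = v (Suc (Suc 0))" for v by (simp_all add: T_def)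
  have inj: "v = 0" if "v \<in> Fr [0,0,0] k" "T v = 0" for v
  proof
    fix j
    have "v 0 = 0" "v (Suc 0) = 0" "v (Suc (Suc 0)) = 0" using T[of v] that(2) by simp_all
    moreover have "j = 0 \<or> j = Suc 0 \<or> j = Suc (Suc 0) \<or> j \<ge> length [0::int,0,0]" by (simp, linarith)
    ultimately show "v j = 0 j" using that(1) by (auto simp: Fr_def free_mod_def)
  qed
  have "T ` Fr [0,0,0] k = Hd k"
  proof (intro subset_antisym subsetI)
    fix \<theta> assume "\<theta> \<in> T ` Fr [0,0,0] k"
    then obtain v where v: "v \<in> Fr [0,0,0] k" "\<theta> = T v" by auto
    have "homogeneous (k - [0,0,0] ! j) (v j)" if "j < length [0::int,0,0]" for j
      using v(1) that unfolding Fr_def by blast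
    from this[of 0] this[of "Suc 0"] this[of "Suc (Suc 0)"]
    show "\<theta> \<in> Hd k" by (simp add: Hd_def homogeneous_der_def forall_3 T v(2))
  next
    fix \<theta> assume th: "\<theta> \<in> Hd k"
    define v where "v j = (if j = 0 then \<theta> $ 1 else if j = Suc 0 then \<theta> $ 2 else if j = Suc (Suc 0) then \<theta> $ 3 else 0)" for j
    have "v \<in> Fr [0,0,0] k" using th
      by (auto simp: v_def Fr_def free_mod_def Hd_def homogeneous_der_def less_Suc_eq)
    moreover have "\<theta> = T v" by (simp add: vec_eq_iff forall_3 T v_def)
    ultimately show "\<theta> \<in> T ` Fr [0,0,0] k" by blast
  qed
  moreover have "(\<Sum>e\<leftarrow>[0,0,0]. h2 (k - e)) = 3 * h2 k" by simp
  ultimately show ?thesis using VN.fd_inj_image[OF fd_Fr[of "[0,0,0]" k] VV.vspace_axioms lin inj] by (simp only:)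
qed

lemma homogeneous_quotient:
  assumes "homogeneous e A" "A \<noteq> 0" "homogeneous d (A * u)"
  shows "homogeneous (d - e) u"
  using assms by (simp add: homogeneous_iff[of d] homogeneous_iff[of "d - e"] hp_mult)

lemma mult_linear: "Vector_Spaces.linear scS scS (\<lambda>f. A * f)"
  by (rule linI) (simp_all add: VS.vspace_axioms scS_def algebra_simps)

lemma fd_mult_image: "A \<noteq> 0 \<Longrightarrow> fd scS {0} ((\<lambda>f. A * f) ` Hm k) (h2 k)"
  by (rule VS.fd_inj_image[OF fd_Hm VS.vspace_axioms mult_linear]) simp

text \<open>Koszul count: multiplication by \<open>B\<close> is injective modulo \<open>A\<close>,
  so the codimension is the second difference
  \<open>h2 j - 2 h2 (j - e) + h2 (j - 2 e) = e^2\<close>.\<close>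

lemma complete_intersection:
  assumes A: "homogeneous (int e) A" "A \<noteq> 0" and B: "homogeneous (int e) B"
    and cop: "\<And>b. A dvd B * b \<Longrightarrow> A dvd b" and j: "j \<ge> 2 * int e"
  shows "fd scS {B * v + w | v w. v \<in> Hm (j - int e) \<and> w \<in> (\<lambda>f. A * f) ` Hm (j - int e)} (Hm j) (e * e)"
proof -
  let ?e = "int e"
  let ?W = "{B * v + w | v w. v \<in> Hm (j - ?e) \<and> w \<in> (\<lambda>f. A * f) ` Hm (j - ?e)}"
  have sub1: "VS.subspace ((\<lambda>f. A * f) ` Hm k)" for k
    using VS.fd_subspace[OF fd_mult_image[OF A(2)]] by simp
  have "(\<lambda>f. A * f) ` Hm (j - 2 * ?e) \<subseteq> Hm (j - ?e)"
    using homogeneous_mult[OF A(1), of "j - 2 * ?e"] by (auto simp: Hm_def)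
  then obtain a n1 where n1: "fd scS {0} ((\<lambda>f. A * f) ` Hm (j - 2 * ?e)) a"
      "fd scS ((\<lambda>f. A * f) ` Hm (j - 2 * ?e)) (Hm (j - ?e)) n1" "a + n1 = h2 (j - ?e)"
    using VS.fd_split[OF fd_Hm VS.subspace_single_0 sub1, of "j - 2 * ?e" "j - ?e"] VS.subspace_0[OF sub1] by auto
  have a: "a = h2 (j - 2 * ?e)" by (rule VS.fd_unique[OF n1(1) fd_mult_image[OF A(2)]]) simp
  have "fd scS ((\<lambda>f. A * f) ` Hm (j - ?e)) ?W n1"
  proof (rule VS.fd_push[OF n1(2) sub1 VS.vspace_axioms mult_linear sub1])
    fix v assume v: "v \<in> Hm (j - ?e)"
    show "B * v \<in> (\<lambda>f. A * f) ` Hm (j - ?e) \<longleftrightarrow> v \<in> (\<lambda>f. A * f) ` Hm (j - 2 * ?e)"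
    proof
      assume "B * v \<in> (\<lambda>f. A * f) ` Hm (j - ?e)"
      then have "A dvd B * v" by auto
      then have "A dvd v" by (rule cop)
      then obtain u where u: "v = A * u" by (elim dvdE)
      then have "homogeneous (j - ?e - ?e) u" using v homogeneous_quotient[OF A, of "j - ?e" u] by (simp add: Hm_def)
      then show "v \<in> (\<lambda>f. A * f) ` Hm (j - 2 * ?e)" using u by (auto simp: Hm_def algebra_simps)
    next
      assume "v \<in> (\<lambda>f. A * f) ` Hm (j - 2 * ?e)"
      then obtain u where u: "v = A * u" "homogeneous (j - 2 * ?e) u" by (auto simp: Hm_def)
      have "homogeneous (j - ?e) (B * u)" using homogeneous_mult[OF B u(2)] by simp
      moreover have "B * v = A * (B * u)" by (simp add: u)
      ultimately show "B * v \<in> (\<lambda>f. A * f) ` Hm (j - ?e)" unfolding Hm_def by blast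
    qed
  qed
  from VS.fd_trans[OF this fd_mult_image[OF A(2)]]
  have W: "fd scS {0} ?W (h2 (j - ?e) + n1)" .
  have WH: "?W \<subseteq> Hm j"
  proof
    fix x assume "x \<in> ?W"
    then obtain v w where "x = B * v + A * w" "homogeneous (j - ?e) v" "homogeneous (j - ?e) w" by (auto simp: Hm_def)
    then show "x \<in> Hm j" using homogeneous_mult[OF B, of "j - ?e" v] homogeneous_mult[OF A(1), of "j - ?e" w]
      by (simp add: Hm_def homogeneous_add)
  qed
  have sW: "VS.subspace ?W" using VS.fd_subspace[OF W] by simp
  obtain b c where bc: "fd scS {0} ?W b" "fd scS ?W (Hm j) c" "b + c = h2 j"
    using VS.fd_split[OF fd_Hm VS.subspace_single_0 sW _ WH] VS.subspace_0[OF sW] by auto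
  have "b = h2 (j - ?e) + n1" by (rule VS.fd_unique[OF bc(1) W]) simp
  then have "int c = int (h2 j) - 2 * int (h2 (j - ?e)) + int (h2 (j - 2 * ?e))" using bc(3) n1(3) a by simp
  then have "2 * int c = 2 * int (h2 j) - 2 * (2 * int (h2 (j - ?e))) + 2 * int (h2 (j - 2 * ?e))" by simp
  also have "\<dots> = (j + 1) * (j + 2) - 2 * ((j - ?e + 1) * (j - ?e + 2)) + (j - 2 * ?e + 1) * (j - 2 * ?e + 2)"
    using j by (simp add: h2_formula)
  also have "\<dots> = 2 * (?e * ?e)" by (simp add: algebra_simps)
  finally have "int c = int (e * e)" by simp
  then have "c = e * e" by (simp only: of_nat_eq_iff)
  with bc(2) show ?thesis by simp
qed

text \<open>Otherwise Euler's relation gives \<open>f = p g\<close>, where \<open>p\<close> does not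
  divide \<open>g\<close>. Then \<open>p\<close> divides \<open>pd i p * g\<close>, hence
  \<open>pd i p\<close>, which has smaller degree and must be zero; so \<open>p\<close> would be
  constant.\<close>

lemma squarefree_no_common_partial:
  assumes f: "squarefree f" "homogeneous (int n) f" "n > 0" and p: "prime_elem p"
  shows "\<exists>i. \<not> p dvd pd i f"
proof (rule ccontr)
  assume "\<not> ?thesis"
  then have d: "p dvd pd i f" for i by blast
  have f0: "f \<noteq> 0" using f(1) by auto
  have "p dvd of_nat n * f" unfolding euler[OF f(2), symmetric] using d by (intro dvd_sum dvd_mult) auto
  moreover have "(of_nat n :: S) = SC (of_nat n)" by (simp add: rhom_of_nat[OF SC_hom])
  moreover have "SC (inverse (of_nat n)) * (SC (of_nat n) * f) = f"
    using f(3) by (simp add: mult.assoc[symmetric] rhom_mult[OF SC_hom, symmetric] rhom_1[OF SC_hom])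
  ultimately have "p dvd f" by (metis dvd_mult)
  then obtain g where g: "f = p * g" by (elim dvdE)
  have pg: "\<not> p dvd g"
  proof
    assume "p dvd g"
    then have "p\<^sup>2 dvd f" by (simp add: g power2_eq_square mult_dvd_mono)
    then show False using f(1) p unfolding squarefree_def by auto
  qed
  obtain m where m: "homogeneous (int m) p" using homogeneous_factor[of "int n" p g] f(2) f0 g by auto
  have p0: "pd i p = 0" for i
  proof (rule ccontr)
    assume nz: "pd i p \<noteq> 0"
    have "pd i f = p * pd i g + pd i p * g" by (simp add: g pd_mult)
    then have "p dvd pd i p * g" using d[of i] by (metis dvd_add_right_iff dvd_triv_left)
    then have "p dvd pd i p" using p pg prime_elem_dvd_mult_iff by blast
    then obtain h where h: "pd i p = p * h" by (elim dvdE)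
    have hh: "homogeneous (int m - 1) (p * h)" using homogeneous_pd[OF m, of i] h by simp
    have "homogeneous (int m - 1 - int m) h" by (rule homogeneous_quotient[OF m _ hh]) (use p in auto)
    then show False using nz h by (simp add: homogeneous_neg)
  qed
  have "of_nat m * p = 0" unfolding euler[OF m, symmetric] by (simp add: p0)
  then have "m = 0" using p by auto
  then have "p = SC (cf p 0 0 0)" using homogeneous_const[of p] m by simp
  moreover have "p \<noteq> 0" using p by auto
  ultimately have "p dvd 1" using homogeneous_unit by (metis SC_eq_0)
  then show False using p by auto
qed

text \<open>Two values of \<open>c\<close> that are bad for the same prime factor of
  \<open>A\<close> would force it to divide \<open>B\<close> and \<open>C\<close> as well; so each
  of the finitely many primes excludes at most one \<open>c\<close>.\<close>

lemma coprime_combination: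
  assumes A: "A \<noteq> 0" and nc: "\<And>p. prime p \<Longrightarrow> \<not> (p dvd A \<and> p dvd B \<and> p dvd C)"
  shows "\<exists>c. coprime A (B + SC c * (C :: S))"
proof -
  define bad where "bad p = {c. p dvd B + SC c * C}" for p
  have "finite (bad p)" if p: "p \<in> prime_factors A" for p
  proof -
    have pp: "prime p" "p dvd A" using p by (auto simp: in_prime_factors_iff)
    have "c = c'" if c: "c \<in> bad p" "c' \<in> bad p" for c c'
    proof (rule ccontr)
      assume "c \<noteq> c'"
      have "p dvd (B + SC c * C) - (B + SC c' * C)" using c by (intro dvd_diff) (auto simp: bad_def)
      then have "p dvd SC (c - c') * C" by (simp add: SC_simps algebra_simps)
      then have "p dvd SC (inverse (c - c')) * (SC (c - c') * C)" by (rule dvd_mult)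
      also have "SC (inverse (c - c')) * (SC (c - c') * C) = C"
        using \<open>c \<noteq> c'\<close> by (simp add: mult.assoc[symmetric] rhom_mult[OF SC_hom, symmetric] rhom_1[OF SC_hom])
      finally have C: "p dvd C" .
      have "p dvd (B + SC c * C) - SC c * C" using c C by (intro dvd_diff) (auto simp: bad_def)
      then have "p dvd B" by simp
      then show False using nc[OF pp(1)] pp C by blast
    qed
    then have "bad p \<subseteq> {c}" if "c \<in> bad p" for c using that by blast
    then show ?thesis by (metis finite.emptyI finite_insert finite_subset ex_in_conv)
  qed
  then have "finite (\<Union>p\<in>prime_factors A. bad p)" by simp
  then obtain c where c: "c \<notin> (\<Union>p\<in>prime_factors A. bad p)" using ex_new_if_finite infinite_UNIV_char_0 by blast
  have "coprime A (B + SC c * C)"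
  proof (rule coprimeI)
    fix d assume d: "d dvd A" "d dvd B + SC c * C"
    show "is_unit d"
    proof (rule ccontr)
      assume "\<not> is_unit d"
      moreover have "d \<noteq> 0" using d A by auto
      ultimately obtain p where p: "p dvd d" "prime p" using prime_divisor_exists by blast
      then have "p \<in> prime_factors A" using d A by (auto simp: in_prime_factors_iff intro: dvd_trans)
      then show False using c p d by (auto simp: bad_def intro: dvd_trans)
    qed
  qed
  then show ?thesis by blast
qed

text \<open>Take a nonzero partial derivative and a general combination of the other two; no prime
  divides all three.\<close>

lemma jacobian_coprime:
  assumes f: "squarefree f" "homogeneous (int n) f" "n > 0"
  shows "\<exists>A B \<alpha> \<beta>. homogeneous (int n - 1) A \<and> homogeneous (int n - 1) B \<and> A \<noteq> 0 \<and> (\<forall>b. A dvd B * b \<longrightarrow> A dvd b) \<and>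
    A = (\<Sum>i\<in>UNIV. SC (\<alpha> i) * pd i f) \<and> B = (\<Sum>i\<in>UNIV. SC (\<beta> i) * pd i f)"
proof -
  have f0: "f \<noteq> 0" using f(1) by auto
  have "\<exists>i. pd i f \<noteq> 0"
  proof (rule ccontr)
    assume "\<not> ?thesis"
    then have "of_nat n * f = 0" unfolding euler[OF f(2), symmetric] by simp
    then show False using f f0 by simp
  qed
  then obtain i where i: "pd i f \<noteq> 0" by blast
  obtain j l where jl: "UNIV = {i, j, l}" "i \<noteq> j" "i \<noteq> l" "j \<noteq> l"
  proof -
    have "i = 1 \<or> i = 2 \<or> i = 3" by (rule exhaust_3)
    moreover have "UNIV = {2, 1, 3 :: 3}" "UNIV = {3, 1, 2 :: 3}" using UNIV_3 by auto
    ultimately show thesis using that[of 2 3] that[of 1 3] that[of 1 2] UNIV_3 by (elim disjE) simp_all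
  qed
  have nc: "\<not> (p dvd pd i f \<and> p dvd pd j f \<and> p dvd pd l f)" if "prime p" for p
    using squarefree_no_common_partial[OF f, of p] that jl(1) by auto
  obtain c where c: "coprime (pd i f) (pd j f + SC c * pd l f)" using coprime_combination[OF i nc] by blast
  have s3: "(\<Sum>k\<in>UNIV. h k) = h i + h j + h l" for h :: "3 \<Rightarrow> S"
    unfolding jl(1) using jl(2-4) by simp
  define \<alpha> where "\<alpha> = (\<lambda>k. if k = i then 1 else (0::complex))"
  define \<beta> where "\<beta> = (\<lambda>k. if k = j then 1 else if k = l then c else (0::complex))"
  have sums: "pd i f = (\<Sum>k\<in>UNIV. SC (\<alpha> k) * pd k f)" "pd j f + SC c * pd l f = (\<Sum>k\<in>UNIV. SC (\<beta> k) * pd k f)"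
    using jl(2-4) not_sym by (simp_all add: s3 \<alpha>_def \<beta>_def rhom_0[OF SC_hom] rhom_1[OF SC_hom])
  have homs: "homogeneous (int n - 1) (pd i f)" "homogeneous (int n - 1) (pd j f + SC c * pd l f)"
    using homogeneous_pd[OF f(2)] by (auto intro!: homogeneous_add homogeneous_SC_mult)
  have cop: "\<forall>b. pd i f dvd (pd j f + SC c * pd l f) * b \<longrightarrow> pd i f dvd b"
    using c coprime_dvd_mult_right_iff by blast
  show ?thesis
    by (rule exI[of _ "pd i f"], rule exI[of _ "pd j f + SC c * pd l f"], rule exI[of _ \<alpha>], rule exI[of _ \<beta>])
       (intro conjI homs i cop sums)
qed

text \<open>The part of degree \<open>k + n - 1\<close> of the Jacobian ideal, if \<open>f\<close>
  has degree \<open>n\<close>.\<close>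

definition Jac :: "S \<Rightarrow> int \<Rightarrow> S set" where
  "Jac f k = (\<lambda>\<theta>. der_apply \<theta> f) ` Hd k"

text \<open>The singular points of a reduced curve are isolated: the Jacobian ideal contains two
  forms of degree \<open>n - 1\<close> without common factor, so the codimension stays below
  \<open>(n - 1)^2\<close> or equals it.\<close>

lemma jacobian_codim:
  assumes f: "squarefree f" "homogeneous (int n) f" "n > 0"
  shows "\<exists>c. \<forall>j \<ge> 2 * int n. \<exists>c'\<le>c. fd scS (Jac f (j - int n + 1)) (Hm j) c'"
proof -
  obtain A B \<alpha> \<beta> where A: "homogeneous (int n - 1) A" "A \<noteq> 0" and B: "homogeneous (int n - 1) B"
    and cop: "\<And>b. A dvd B * b \<Longrightarrow> A dvd b"
    and AB: "A = (\<Sum>i\<in>UNIV. SC (\<alpha> i) * pd i f)" "B = (\<Sum>i\<in>UNIV. SC (\<beta> i) * pd i f)"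
    using jacobian_coprime[OF f] by blast
  define e where "e = n - 1"
  have e: "int n - 1 = int e" using f(3) by (simp add: e_def)
  show ?thesis
  proof (rule exI[of _ "e * e"], intro allI impI)
    fix j assume j: "j \<ge> 2 * int n"
    let ?W = "{B * v + w | v w. v \<in> Hm (j - int e) \<and> w \<in> (\<lambda>f. A * f) ` Hm (j - int e)}"
    have fdW: "fd scS ?W (Hm j) (e * e)"
      by (rule complete_intersection[OF A(1)[unfolded e] A(2) B[unfolded e] cop]) (use j e in auto)
    have k: "j - int n + 1 = j - int e" using e by simp
    interpret T: Vector_Spaces.linear scV scS "\<lambda>\<theta>. der_apply \<theta> f" by (rule der_apply_linear)
    have sJ: "VS.subspace (Jac f (j - int n + 1))" unfolding Jac_def by (rule T.subspace_image[OF subspace_Hd])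
    have "?W \<subseteq> Jac f (j - int n + 1)"
    proof
      fix x assume "x \<in> ?W"
      then obtain v w where x: "x = B * v + A * w" "homogeneous (j - int e) v" "homogeneous (j - int e) w" by (auto simp: Hm_def)
      define \<theta> where "\<theta> = ((\<chi> i. SC (\<beta> i) * v + SC (\<alpha> i) * w) :: S ^ 3)"
      have "\<theta> \<in> Hd (j - int n + 1)" unfolding k Hd_def homogeneous_der_def \<theta>_def
        using x by (simp add: homogeneous_add homogeneous_SC_mult)
      moreover have "der_apply \<theta> f = x"
        unfolding der_apply_sum x(1) AB by (simp add: \<theta>_def sum_3 algebra_simps)
      ultimately show "x \<in> Jac f (j - int n + 1)" unfolding Jac_def by blast
    qed
    moreover have "Jac f (j - int n + 1) \<subseteq> Hm j"
      using der_apply_homogeneous[OF f(2), of "j - int n + 1"] by (auto simp: Jac_def Hd_def Hm_def)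
    moreover have "VS.subspace ?W"
    proof -
      interpret TA: Vector_Spaces.linear scS scS "\<lambda>f. A * f" by (rule mult_linear)
      interpret TB: Vector_Spaces.linear scS scS "\<lambda>f. B * f" by (rule mult_linear)
      have "?W = {x + y | x y. x \<in> (\<lambda>f. B * f) ` Hm (j - int e) \<and> y \<in> (\<lambda>f. A * f) ` Hm (j - int e)}" by blast
      then show ?thesis
        using VS.subspace_sums[OF TB.subspace_image[OF subspace_Hm] TA.subspace_image[OF subspace_Hm]] by simp
    qed
    ultimately show "\<exists>c'\<le>e * e. fd scS (Jac f (j - int n + 1)) (Hm j) c'"
      using VS.fd_split[OF fdW _ sJ] by (metis le_add2)
  qed
qed

lemma bounded_quadratic:
  fixes A B C M K :: int
  assumes "\<And>k. k \<ge> K \<Longrightarrow> \<bar>A * k\<^sup>2 + B * k + C\<bar> \<le> M"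
  shows "A = 0 \<and> B = 0"
proof -
  have lin: "b = 0" if "\<And>k. k \<ge> K \<Longrightarrow> \<bar>b * k + c\<bar> \<le> m" for b c m K :: int
  proof (rule ccontr)
    assume "b \<noteq> 0"
    define k where "k = \<bar>K\<bar> + \<bar>c\<bar> + \<bar>m\<bar> + 1"
    have "\<bar>b\<bar> * k \<ge> 1 * k" using \<open>b \<noteq> 0\<close> by (intro mult_right_mono) (auto simp: k_def)
    moreover have "k \<ge> 0" "k > \<bar>c\<bar> + \<bar>m\<bar>" "k \<ge> K" by (simp_all add: k_def)
    ultimately have "\<bar>b * k\<bar> \<ge> k" by (simp add: abs_mult)
    moreover have "\<bar>b * k + c\<bar> \<le> m" by (rule that) fact
    ultimately show False using \<open>k > \<bar>c\<bar> + \<bar>m\<bar>\<close> by linarith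
  qed
  have "\<bar>2 * A * k + (A + B)\<bar> \<le> 2 * M" if "k \<ge> K" for k
  proof -
    have "2 * A * k + (A + B) = (A * (k + 1)\<^sup>2 + B * (k + 1) + C) - (A * k\<^sup>2 + B * k + C)"
      by (simp add: power2_eq_square algebra_simps)
    then show ?thesis using assms[OF that] assms[of "k + 1"] that by linarith
  qed
  from lin[OF this] have "A = 0" by simp
  then show ?thesis using lin[of K B C M] assms by simp
qed

text \<open>Rank-nullity for \<open>\<theta> \<mapsto> \<theta>(f)\<close> expresses the Hilbert
  function of \<open>D0 f\<close> by binomials up to the codimension of the Jacobian ideal. As the
  latter is bounded, the coefficients of \<open>k^2\<close> and \<open>k\<close> must match, which
  fixes the rank \<open>r = 2\<close> and the sum \<open>a + b\<close>.\<close>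

theorem chern_exponents:
  assumes f: "squarefree f" "homogeneous (int n) f" "n > 0"
    and c: "has_chern_polynomial (D0 f) ([:-1, a:] * [:-1, b:])"
  shows "a + b = int n - 1"
    "\<exists>K. \<forall>k\<ge>K. \<exists>N. fd scV {0} (D0 f \<inter> Hd k) N \<and>
      2 * int N = (k - a + 1) * (k - a + 2) + (k - b + 1) * (k - b + 2)"
proof -
  obtain r K where K: "\<And>k. k \<ge> K \<Longrightarrow> \<exists>N. fd scV {0} (D0 f \<inter> Hd k) N \<and>
    2 * int N = r * ((k + 1) * (k + 2)) - (2 * k + 3) * (a + b) + (a\<^sup>2 + b\<^sup>2)"
    using chern_hilbert[OF c] by blast
  obtain c where c: "\<And>j. j \<ge> 2 * int n \<Longrightarrow> \<exists>c'\<le>c. fd scS (Jac f (j - int n + 1)) (Hm j) c'"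
    using jacobian_codim[OF f] by blast
  have eq: "\<exists>c'\<le>c. r * ((k + 1) * (k + 2)) - (2 * k + 3) * (a + b) + (a\<^sup>2 + b\<^sup>2) =
      3 * ((k + 1) * (k + 2)) - (k + int n) * (k + int n + 1) + 2 * int c'" if k: "k \<ge> K" "k \<ge> int n + 1" for k
  proof -
    obtain N where N: "fd scV {0} (D0 f \<inter> Hd k) N"
      "2 * int N = r * ((k + 1) * (k + 2)) - (2 * k + 3) * (a + b) + (a\<^sup>2 + b\<^sup>2)" using K[OF k(1)] by blast
    define j where "j = k + int n - 1"
    obtain c' where c': "c' \<le> c" "fd scS (Jac f k) (Hm j) c'" using c[of j] k by (auto simp: j_def)
    obtain x y where xy: "fd scV {0} {\<theta> \<in> Hd k. der_apply \<theta> f = 0} x" "fd scS {0} (Jac f k) y" "x + y = 3 * h2 k"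
      using VV.fd_kernel'[OF fd_Hd VS.vspace_axioms der_apply_linear, of k f] unfolding Jac_def by blast
    have "{\<theta> \<in> Hd k. der_apply \<theta> f = 0} = D0 f \<inter> Hd k" by (auto simp: D0_def)
    then have "x = N" using VV.fd_unique[OF xy(1) _ VV.subspace_single_0] N(1) by simp
    moreover have "y + c' = h2 j"
      using VS.fd_unique[OF VS.fd_trans[OF c'(2) xy(2)] fd_Hm VS.subspace_single_0] .
    ultimately have "int N = 3 * int (h2 k) - int (h2 j) + int c'" using xy(3) by linarith
    then have "2 * int N = 3 * (2 * int (h2 k)) - 2 * int (h2 j) + 2 * int c'" by simp
    also have "\<dots> = 3 * ((k + 1) * (k + 2)) - (j + 1) * (j + 2) + 2 * int c'"
      using k by (simp add: h2_formula j_def)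
    finally show ?thesis using c'(1) N(2) by (intro exI[of _ c']) (simp add: j_def)
  qed
  have "(r - 2) = 0 \<and> (3 * r - 2 * (a + b) - 9 + 2 * int n + 1) = 0"
  proof (rule bounded_quadratic)
    fix k assume k: "k \<ge> max K (int n + 1)"
    obtain c' where c': "c' \<le> c" "r * ((k + 1) * (k + 2)) - (2 * k + 3) * (a + b) + (a\<^sup>2 + b\<^sup>2) =
      3 * ((k + 1) * (k + 2)) - (k + int n) * (k + int n + 1) + 2 * int c'" using eq[of k] k by auto
    have "(r - 2) * k\<^sup>2 + (3 * r - 2 * (a + b) - 9 + 2 * int n + 1) * k
        + (2 * r - 3 * (a + b) + (a\<^sup>2 + b\<^sup>2) - 6 + int n * (int n + 1)) = 2 * int c'"
      using c'(2) by (simp add: algebra_simps power2_eq_square)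
    then show "\<bar>(r - 2) * k\<^sup>2 + (3 * r - 2 * (a + b) - 9 + 2 * int n + 1) * k
        + (2 * r - 3 * (a + b) + (a\<^sup>2 + b\<^sup>2) - 6 + int n * (int n + 1))\<bar> \<le> 2 * int c" using c'(1) by simp
  qed
  then have r: "r = 2" and s: "a + b = int n - 1" by auto
  show "a + b = int n - 1" by (rule s)
  show "\<exists>K. \<forall>k\<ge>K. \<exists>N. fd scV {0} (D0 f \<inter> Hd k) N \<and>
      2 * int N = (k - a + 1) * (k - a + 2) + (k - b + 1) * (k - b + 2)"
  proof (rule exI[of _ K], intro allI impI)
    fix k assume "k \<ge> K"
    from K[OF this] show "\<exists>N. fd scV {0} (D0 f \<inter> Hd k) N \<and>
      2 * int N = (k - a + 1) * (k - a + 2) + (k - b + 1) * (k - b + 2)"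
      unfolding r by (simp add: algebra_simps power2_eq_square)
  qed
qed

section \<open>Restriction of logarithmic derivations to a line\<close>

definition sc3 :: "complex \<Rightarrow> complex poly ^ 3 \<Rightarrow> complex poly ^ 3" where
  "sc3 c v = (\<chi> i. smult c (v $ i))"

interpretation V3: vspace sc3
  by unfold_locales (simp_all add: sc3_def vec_eq_iff smult_add_right smult_add_left)

lemma D0_iff: "\<theta> \<in> D0 f \<longleftrightarrow> der_apply \<theta> f = 0"
  by (simp add: D0_def)

lemma D0_add: "\<theta> \<in> D0 f \<Longrightarrow> \<eta> \<in> D0 f \<Longrightarrow> \<theta> + \<eta> \<in> D0 f"
  and D0_diff: "\<theta> \<in> D0 f \<Longrightarrow> \<eta> \<in> D0 f \<Longrightarrow> \<theta> - \<eta> \<in> D0 f"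
  and D0_scale: "\<theta> \<in> D0 f \<Longrightarrow> h *s \<theta> \<in> D0 f"
  and D0_0: "0 \<in> D0 f"
  by (simp_all add: D0_iff der_apply_add der_apply_diff der_apply_scale) (simp add: der_apply_def)

lemma subspace_D0: "VV.subspace (D0 f)"
  by (simp add: VV.subspace_def D0_add D0_scale D0_0 scV_def)

lemma Hd_scale: "homogeneous d h \<Longrightarrow> \<theta> \<in> Hd k \<Longrightarrow> h *s \<theta> \<in> Hd (d + k)"
  by (simp add: Hd_def homogeneous_der_def homogeneous_mult)

lemma Hd_add: "\<theta> \<in> Hd k \<Longrightarrow> \<eta> \<in> Hd k \<Longrightarrow> \<theta> + \<eta> \<in> Hd k"
  and Hd_diff: "\<theta> \<in> Hd k \<Longrightarrow> \<eta> \<in> Hd k \<Longrightarrow> \<theta> - \<eta> \<in> Hd k"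
  by (simp_all add: Hd_def homogeneous_der_def homogeneous_add homogeneous_diff)

lemma Hd_neg: "k < 0 \<Longrightarrow> Hd k = {0}"
  by (auto simp: Hd_def homogeneous_der_def homogeneous_neg vec_eq_iff)

lemma hpd_der_apply:
  assumes "homogeneous d f"
  shows "der_apply (hpd k \<theta>) f = hp (k + d - 1) (der_apply \<theta> f)"
proof -
  have "hp (k + d - 1) (\<theta> $ i * pd i f) = hp k (\<theta> $ i) * pd i f" for i
    using hp_mult[OF homogeneous_pd[OF assms, of i], of "k + d - 1" "\<theta> $ i"] by (simp add: mult.commute algebra_simps)
  then show ?thesis by (simp add: der_apply_sum hp_sum hpd_def)
qed

lemma hpd_D0: "homogeneous d f \<Longrightarrow> \<theta> \<in> D0 f \<Longrightarrow> hpd k \<theta> \<in> D0 f"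
  by (simp add: D0_iff hpd_der_apply hp_0)

lemma hpd_decomp: "\<exists>N. \<forall>n\<ge>N. \<theta> = (\<Sum>d\<le>n. hpd (int d) \<theta>)"
proof -
  have "\<forall>i. \<exists>N. \<forall>n\<ge>N. \<theta> $ i = (\<Sum>d\<le>n. hp (int d) (\<theta> $ i))" by (intro allI hp_decomp)
  from choice[OF this] obtain N where N': "\<forall>i. \<forall>n\<ge>N i. \<theta> $ i = (\<Sum>d\<le>n. hp (int d) (\<theta> $ i))" ..
  note N = N'[rule_format]
  have "\<theta> = (\<Sum>d\<le>n. hpd (int d) \<theta>)" if "n \<ge> N 1 + N 2 + N 3" for n
  proof -
    have nN: "n \<ge> N i" for i using exhaust_3[of i] that by auto
    have comp: "(\<Sum>d\<le>n. hpd (int d) \<theta>) $ i = (\<Sum>d\<le>n. hp (int d) (\<theta> $ i))" for i by (simp add: hpd_def)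
    show ?thesis unfolding vec_eq_iff by (intro allI trans[OF N[OF nN] comp[symmetric]])
  qed
  then show ?thesis by blast
qed

definition ptl :: "complex ^ 3 \<Rightarrow> S \<Rightarrow> S" where
  "ptl b f = (\<Sum>i\<in>UNIV. SC (b $ i) * pd i f)"

definition euler_der :: "S ^ 3" where "euler_der = (\<chi> i. xv i)"

text \<open>The logarithmic derivation \<open>deg(f) f \<partial>\<^sub>b - (\<partial>\<^sub>b f) E\<close>, with \<open>E\<close> the Euler derivation.\<close>

definition kosz :: "nat \<Rightarrow> S \<Rightarrow> complex ^ 3 \<Rightarrow> S ^ 3" where
  "kosz n f b = (\<chi> i. of_nat n * f * SC (b $ i) - ptl b f * xv i)"

lemma euler_der_apply: "homogeneous (int n) f \<Longrightarrow> der_apply euler_der f = of_nat n * f"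
  using euler[of n f] by (simp add: der_apply_sum euler_der_def)

lemma euler_der_Hd: "euler_der \<in> Hd 1"
  by (simp add: euler_der_def Hd_def homogeneous_der_def homogeneous_xv)

lemma kosz_apply:
  assumes "homogeneous (int m) h"
  shows "der_apply (kosz n f b) h = of_nat n * f * ptl b h - of_nat m * ptl b f * h"
proof -
  have "der_apply (kosz n f b) h = of_nat n * f * ptl b h - ptl b f * (\<Sum>i\<in>UNIV. xv i * pd i h)"
    by (simp add: der_apply_sum kosz_def ptl_def sum_3 algebra_simps)
  then show ?thesis unfolding euler[OF assms] by (simp add: algebra_simps)
qed

lemma kosz_D0: "homogeneous (int n) f \<Longrightarrow> kosz n f b \<in> D0 f"
  by (simp add: D0_iff kosz_apply)

lemma of_nat_SC: "(of_nat n :: S) = SC (of_nat n)"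
  by (simp add: rhom_of_nat[OF SC_hom])

lemma homogeneous_ptl: "homogeneous d f \<Longrightarrow> homogeneous (d - 1) (ptl b f)"
  unfolding ptl_def by (intro homogeneous_sum homogeneous_SC_mult homogeneous_pd)

lemma kosz_Hd:
  assumes "homogeneous (int n) f"
  shows "kosz n f b \<in> Hd (int n)"
proof -
  have "homogeneous (int n) (of_nat n * f * SC (b $ i))" for i
    using homogeneous_SC_mult[OF homogeneous_SC_mult[OF assms, of "of_nat n"], of "b $ i"] by (simp add: of_nat_SC mult.commute)
  moreover have "homogeneous (int n) (ptl b f * xv i)" for i
    using homogeneous_mult[OF homogeneous_ptl[OF assms, of b] homogeneous_xv[of i]] by simp
  ultimately show ?thesis by (simp add: Hd_def homogeneous_der_def kosz_def homogeneous_diff)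
qed

lemma ptl_lf: "ptl b (lf a) = SC (ev (lf a) b)"
  by (simp add: ptl_def pd_lf ev_lf rhom_sum[OF SC_hom] rhom_mult[OF SC_hom] mult.commute)

lemma ptl_linear: "homogeneous 1 l \<Longrightarrow> ptl b l = SC (ev l b)"
  using linear_form ptl_lf by metis

context coords
begin

definition r3 :: "S ^ 3 \<Rightarrow> complex poly ^ 3" where "r3 \<theta> = (\<chi> i. r (\<theta> $ i))"

definition psi :: "S ^ 3 \<Rightarrow> complex poly" where "psi \<theta> = r (der_apply \<theta> L)"

lemma r3_linear: "Vector_Spaces.linear scV sc3 r3"
  by (rule linI) (simp_all add: VV.vspace_axioms V3.vspace_axioms r3_def vec_eq_iff rhom_add[OF r_hom] scV_def sc3_def
      rhom_mult[OF r_hom] r_SC)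

lemma psi_linear: "Vector_Spaces.linear scV smult psi"
  by (rule linI) (simp_all add: VV.vspace_axioms VP.vspace_axioms psi_def der_apply_add rhom_add[OF r_hom] scV_def
      der_apply_scale rhom_mult[OF r_hom] r_SC)

lemma psi_add: "psi (\<theta> + \<eta>) = psi \<theta> + psi \<eta>"
  and psi_diff: "psi (\<theta> - \<eta>) = psi \<theta> - psi \<eta>"
  and psi_scale: "psi (h *s \<theta>) = r h * psi \<theta>"
  by (simp_all add: psi_def der_apply_add der_apply_diff der_apply_scale rhom_simps[OF r_hom])

lemma psi_sum: "psi (sum f A) = (\<Sum>a\<in>A. psi (f a))"
  by (induction A rule: infinite_finite_induct) (simp_all add: psi_add, simp_all add: psi_def der_apply_def rhom_0[OF r_hom])

lemma r3_scale: "r3 (h *s \<theta>) = (\<chi> i. r h * r3 \<theta> $ i)"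
  by (simp add: r3_def vec_eq_iff rhom_mult[OF r_hom])

text \<open>\<open>Q\<close> is the point at infinity of \<open>P + t Q\<close>, so the value there
  appears as the coefficient in top degree.\<close>

lemma coeff_top_r: "homogeneous (int n) f \<Longrightarrow> coeff (r f) n = ev f Q"
proof -
  have "coeff (r (hp (int n) f)) n = ev (hp (int n) f) Q" for f and n
  proof (induction f arbitrary: n rule: S_induct)
    case (const c)
    have "hp (int n) (SC c) = (if n = 0 then SC c else 0)" by (subst hp_self[OF homogeneous_SC]) simp
    then show ?case by (simp add: rhom_0[OF r_hom] rhom_0[OF ev_hom] r_SC eval_const[OF id_hom] del: id_apply) simp
  next
    case (add f h)
    then show ?case by (simp add: hp_add rhom_add[OF r_hom] rhom_add[OF ev_hom] del: id_apply)
  next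
    case (var i f)
    show ?case
    proof (cases n)
      case 0
      have "hp 0 (xv i * f) = 0" by (simp add: hp_mult[OF homogeneous_xv]) (simp add: hp_def)
      then show ?thesis by (simp add: 0 rhom_0[OF r_hom] rhom_0[OF ev_hom] del: id_apply)
    next
      case (Suc m)
      have h: "hp (int n) (xv i * f) = xv i * hp (int m) f" by (simp add: hp_mult[OF homogeneous_xv] Suc)
      have "r (hp (int m) f) \<in> Pl (int m)" by (rule r_Pl[OF hp_hom])
      then have "coeff (r (hp (int m) f)) (Suc m) = 0" by (simp add: Pl_def)
      then show ?thesis using var.IH[of m]
        unfolding h rhom_mult[OF r_hom] rhom_mult[OF ev_hom] r_xv eval_var[OF id_hom] by (simp add: Suc del: id_apply)
    qed
  qed
  moreover assume "homogeneous (int n) f"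
  ultimately show ?thesis using homogeneous_iff by metis
qed

end

text \<open>The condition at \<open>Q\<close> keeps the curve away from the point at infinity of the
  line: \<open>r g\<close> then has degree exactly \<open>dg\<close>, and every intersection point
  corresponds to a root of it.\<close>

locale line_curve = coords +
  fixes g :: S and dg :: nat
  assumes g: "homogeneous (int dg) g" "dg > 0" "\<not> L dvd g" "ev g Q \<noteq> 0"
begin

text \<open>\<open>Ik\<close> and \<open>Vk\<close> are the two graded spaces over the line.
  \<open>Kk\<close> consists of the derivations in \<open>D0 g\<close> that are tangent to the
  line.\<close>

definition Mk :: "int \<Rightarrow> (S ^ 3) set" where "Mk k = D0 g \<inter> Hd k"
definition Ik :: "int \<Rightarrow> complex poly set" where "Ik k = psi ` Mk k"
definition Kk :: "int \<Rightarrow> (S ^ 3) set" where "Kk k = {\<theta> \<in> Mk k. psi \<theta> = 0}"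
definition Vk :: "int \<Rightarrow> (complex poly ^ 3) set" where "Vk k = r3 ` Kk k"

lemma subspace_Mk: "VV.subspace (Mk k)"
  unfolding Mk_def by (intro VV.subspace_inter subspace_D0 subspace_Hd)

lemma Mk_0: "0 \<in> Mk k"
  by (rule VV.subspace_0[OF subspace_Mk])

lemma Mk_scale: "homogeneous d h \<Longrightarrow> \<theta> \<in> Mk k \<Longrightarrow> h *s \<theta> \<in> Mk (d + k)"
  by (simp add: Mk_def D0_scale Hd_scale)

lemma Kk_scale: "homogeneous d h \<Longrightarrow> \<theta> \<in> Kk k \<Longrightarrow> h *s \<theta> \<in> Kk (d + k)"
  by (simp add: Kk_def Mk_scale psi_scale)

lemma fd_Mk: "\<exists>n. fd scV {0} (Mk k) n"
  using VV.fd_split[OF fd_Hd VV.subspace_single_0 subspace_Mk, of k k] Mk_0 by (auto simp: Mk_def)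

definition dM :: "int \<Rightarrow> nat" where "dM k = (SOME n. fd scV {0} (Mk k) n)"
definition dI :: "int \<Rightarrow> nat" where "dI k = (SOME n. fd smult {0} (Ik k) n)"
definition dK :: "int \<Rightarrow> nat" where "dK k = (SOME n. fd scV {0} (Kk k) n)"
definition dV :: "int \<Rightarrow> nat" where "dV k = (SOME n. fd sc3 {0} (Vk k) n)"

lemma dM: "fd scV {0} (Mk k) (dM k)"
  unfolding dM_def by (rule someI_ex[OF fd_Mk])

lemma fd_KI: "\<exists>a b. fd scV {0} (Kk k) a \<and> fd smult {0} (Ik k) b \<and> a + b = dM k"
  using VV.fd_kernel'[OF dM VP.vspace_axioms psi_linear] by (simp add: Kk_def Ik_def)

lemma dK: "fd scV {0} (Kk k) (dK k)" and dI: "fd smult {0} (Ik k) (dI k)"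
  unfolding dK_def dI_def by (rule someI_ex, use fd_KI in blast)+

lemma dims_MKI: "dM k = dK k + dI k"
proof -
  obtain a b where ab: "fd scV {0} (Kk k) a" "fd smult {0} (Ik k) b" "a + b = dM k" using fd_KI by blast
  have "a = dK k" "b = dI k"
    using VV.fd_unique[OF ab(1) dK VV.subspace_single_0] VP.fd_unique[OF ab(2) dI VP.subspace_single_0] by auto
  then show ?thesis using ab(3) by simp
qed

text \<open>Together with \<open>psi\<close> this yields
  \<open>dM k - dM (k - 1) = dI k + dV k\<close>. All multiples of \<open>L\<close> are tangent to
  the line, and a derivation whose multiple by \<open>L\<close> kills \<open>g\<close> kills
  \<open>g\<close> itself.\<close>

lemma kernel_r3: "{\<theta> \<in> Kk k. r3 \<theta> = 0} = (\<lambda>\<theta>. L *s \<theta>) ` Mk (k - 1)"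
proof (intro subset_antisym subsetI)
  fix \<theta> assume th: "\<theta> \<in> {\<theta> \<in> Kk k. r3 \<theta> = 0}"
  then have hom: "homogeneous k (\<theta> $ i)" and "r (\<theta> $ i) = 0" for i
    by (simp_all add: Kk_def Mk_def Hd_def homogeneous_der_def r3_def vec_eq_iff)
  then have "L dvd \<theta> $ i" for i using r_kernel by blast
  then have "\<forall>i. \<exists>h. \<theta> $ i = L * h" by (simp add: dvd_def)
  from choice[OF this] obtain \<eta> where \<eta>: "\<And>i. \<theta> $ i = L * \<eta> i" by blast
  define e where "e = ((\<chi> i. \<eta> i) :: S ^ 3)"
  have e: "\<theta> = L *s e" by (simp add: e_def vec_eq_iff \<eta>)
  have "L * der_apply e g = 0" using th unfolding e by (simp add: Kk_def Mk_def D0_iff der_apply_scale)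
  then have "e \<in> D0 g" using L_nonzero by (simp add: D0_iff)
  moreover have "e \<in> Hd (k - 1)"
    using hom L_quotient by (simp add: Hd_def homogeneous_der_def e_def \<eta>)
  ultimately show "\<theta> \<in> (\<lambda>\<theta>. L *s \<theta>) ` Mk (k - 1)" using e by (auto simp: Mk_def)
next
  fix \<theta> assume "\<theta> \<in> (\<lambda>\<theta>. L *s \<theta>) ` Mk (k - 1)"
  then obtain e where e: "e \<in> Mk (k - 1)" "\<theta> = L *s e" by auto
  have "r3 (L *s e) = 0" by (simp add: vec_eq_iff r_L r3_scale)
  then show "\<theta> \<in> {\<theta> \<in> Kk k. r3 \<theta> = 0}" unfolding e(2)
    using Mk_scale[OF lin(3) e(1)] by (simp add: Kk_def psi_scale r_L)
qed

lemma fd_LM: "fd scV {0} ((\<lambda>\<theta>. L *s \<theta>) ` Mk (k - 1)) (dM (k - 1))"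
proof (rule VV.fd_inj_image[OF dM VV.vspace_axioms])
  show "Vector_Spaces.linear scV scV (\<lambda>\<theta>. L *s \<theta>)"
    by (rule linI) (simp_all add: VV.vspace_axioms scV_def vec_eq_iff algebra_simps)
  show "L *s v = 0 \<Longrightarrow> v = 0" for v using L_nonzero by (simp add: vec_eq_iff)
qed

lemma fd_V: "fd sc3 {0} (Vk k) (dV k)" and dims_KV: "dK k = dM (k - 1) + dV k"
proof -
  obtain a b where ab: "fd scV {0} ((\<lambda>\<theta>. L *s \<theta>) ` Mk (k - 1)) a" "fd sc3 {0} (Vk k) b" "a + b = dK k"
    using VV.fd_kernel'[OF dK V3.vspace_axioms r3_linear, of k] unfolding kernel_r3 Vk_def by blast
  show 1: "fd sc3 {0} (Vk k) (dV k)" unfolding dV_def by (rule someI[where P = "fd sc3 {0} (Vk k)", OF ab(2)])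
  show "dK k = dM (k - 1) + dV k"
    using ab(3) VV.fd_unique[OF ab(1) fd_LM VV.subspace_single_0] V3.fd_unique[OF ab(2) 1 V3.subspace_single_0]
    by simp
qed

lemma Ik_Pl: "Ik k \<subseteq> Pl k"
  using der_apply_homogeneous[OF lin(3), of k] r_Pl
  by (fastforce simp: Ik_def Mk_def Hd_def psi_def)

lemma Vk_Pl: "v \<in> Vk k \<Longrightarrow> v $ i \<in> Pl k"
proof -
  assume "v \<in> Vk k"
  then obtain \<theta> where "\<theta> \<in> Hd k" "v = r3 \<theta>" by (auto simp: Vk_def Kk_def Mk_def)
  then show ?thesis using r_Pl[of k "\<theta> $ i"] by (simp add: r3_def Hd_def homogeneous_der_def)
qed

lemma Ik_step: "q \<in> Ik k \<Longrightarrow> q \<in> Ik (k + 1)" "q \<in> Ik k \<Longrightarrow> [:0, 1:] * q \<in> Ik (k + 1)"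
proof -
  assume "q \<in> Ik k"
  then obtain \<theta> where th: "\<theta> \<in> Mk k" "q = psi \<theta>" by (auto simp: Ik_def)
  have "X *s \<theta> \<in> Mk (k + 1)" "Y *s \<theta> \<in> Mk (k + 1)"
    using Mk_scale[OF lin(1) th(1)] Mk_scale[OF lin(2) th(1)] by (simp_all add: add.commute)
  moreover have "psi (X *s \<theta>) = q" "psi (Y *s \<theta>) = [:0, 1:] * q" by (simp_all only: psi_scale r_X r_Y th(2) mult_1)
  ultimately show "q \<in> Ik (k + 1)" "[:0, 1:] * q \<in> Ik (k + 1)" unfolding Ik_def by (metis imageI)+
qed

lemma Vk_step: "v \<in> Vk k \<Longrightarrow> v \<in> Vk (k + 1)" "v \<in> Vk k \<Longrightarrow> (\<chi> i. [:0, 1:] * v $ i) \<in> Vk (k + 1)"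
proof -
  assume "v \<in> Vk k"
  then obtain \<theta> where th: "\<theta> \<in> Kk k" "v = r3 \<theta>" by (auto simp: Vk_def)
  have "X *s \<theta> \<in> Kk (k + 1)" "Y *s \<theta> \<in> Kk (k + 1)"
    using Kk_scale[OF lin(1) th(1)] Kk_scale[OF lin(2) th(1)] by (simp_all add: add.commute)
  moreover have "r3 (X *s \<theta>) = v" "r3 (Y *s \<theta>) = (\<chi> i. [:0, 1:] * v $ i)"
    by (simp_all only: r3_scale r_X r_Y th(2) mult_1) (simp add: vec_eq_iff)
  ultimately show "v \<in> Vk (k + 1)" "(\<chi> i. [:0, 1:] * v $ i) \<in> Vk (k + 1)" unfolding Vk_def by (metis imageI)+
qed

text \<open>No nonzero space of polynomials of bounded degree is stable under multiplication by the variable.\<close>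

lemma Ik_growth: "Ik k \<noteq> {0} \<Longrightarrow> dI k + 1 \<le> dI (k + 1)"
proof -
  assume "Ik k \<noteq> {0}"
  moreover have "0 \<in> Ik k" using VP.fd_subset[OF dI] by simp
  ultimately obtain q where q: "q \<in> Ik k" "q \<noteq> 0" by blast
  have sub: "Ik k \<subseteq> Ik (k + 1)" using Ik_step by blast
  have "Ik k \<noteq> Ik (k + 1)"
  proof
    assume eq: "Ik k = Ik (k + 1)"
    have "monom 1 m * q \<in> Ik k" for m
    proof (induction m)
      case (Suc m)
      have "monom 1 (Suc m) * q = [:0, 1:] * (monom 1 m * q)" by (simp add: monom_Suc)
      then show ?case using Ik_step(2)[OF Suc] eq by metis
    qed (simp add: q(1) monom_0 one_pCons[symmetric])
    then have "monom 1 (nat k + 1) * q \<in> Pl k" using Ik_Pl by blast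
    moreover have "coeff (monom 1 (nat k + 1) * q) (nat k + 1 + degree q) \<noteq> 0"
      using q(2) by (simp add: coeff_monom_mult)
    moreover have "int (nat k + 1 + degree q) > k" by simp
    ultimately show False unfolding Pl_def by blast
  qed
  moreover have "dI k \<le> dI (k + 1)" by (rule VP.fd_le[OF dI dI VP.subspace_single_0 sub])
  moreover have "dI k = dI (k + 1) \<Longrightarrow> Ik k = Ik (k + 1)"
    using VP.fd_eq[OF dI[of "k + 1"] _ VP.subspace_single_0 sub] dI[of k] by simp
  ultimately show ?thesis by linarith
qed

lemma Vk_growth: "Vk k \<noteq> {0} \<Longrightarrow> dV k + 1 \<le> dV (k + 1)"
proof -
  assume "Vk k \<noteq> {0}"
  moreover have "0 \<in> Vk k" using V3.fd_subset[OF fd_V] by simp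
  ultimately obtain q where q: "q \<in> Vk k" "q \<noteq> 0" by blast
  then obtain i where i: "q $ i \<noteq> 0" by (auto simp: vec_eq_iff)
  have sub: "Vk k \<subseteq> Vk (k + 1)" using Vk_step by blast
  have "Vk k \<noteq> Vk (k + 1)"
  proof
    assume eq: "Vk k = Vk (k + 1)"
    have "(\<chi> i. monom 1 m * q $ i) \<in> Vk k" for m
    proof (induction m)
      case 0
      have "(\<chi> i. monom 1 0 * q $ i) = q" by (simp add: vec_eq_iff monom_0 one_pCons[symmetric])
      then show ?case using q by simp
    next
      case (Suc m)
      have "(\<chi> i. monom 1 (Suc m) * q $ i) = (\<chi> i. [:0, 1:] * (\<chi> i. monom 1 m * q $ i) $ i)"
        by (simp add: vec_eq_iff monom_Suc)
      then show ?case using Vk_step(2)[OF Suc] eq by metis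
    qed
    then have "(\<chi> i. monom 1 (nat k + 1) * q $ i) $ i \<in> Pl k" using Vk_Pl by blast
    then have "monom 1 (nat k + 1) * q $ i \<in> Pl k" by simp
    moreover have "coeff (monom 1 (nat k + 1) * q $ i) (nat k + 1 + degree (q $ i)) \<noteq> 0"
      using i by (simp add: coeff_monom_mult)
    moreover have "int (nat k + 1 + degree (q $ i)) > k" by simp
    ultimately show False unfolding Pl_def by blast
  qed
  moreover have "dV k \<le> dV (k + 1)" by (rule V3.fd_le[OF fd_V fd_V V3.subspace_single_0 sub])
  moreover have "dV k = dV (k + 1) \<Longrightarrow> Vk k = Vk (k + 1)"
    using V3.fd_eq[OF fd_V[of "k + 1"] _ V3.subspace_single_0 sub] fd_V[of k] by simp
  ultimately show ?thesis by linarith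
qed

text \<open>Once \<open>d\<close> is positive it grows by at least one per step, so at
  \<open>j\<close> it cannot exceed what the values in large degrees allow.\<close>

lemma growth_bound:
  fixes d :: "int \<Rightarrow> nat"
  assumes step: "\<And>k. d k \<noteq> 0 \<Longrightarrow> d k + 1 \<le> d (k + 1)" and asy: "\<And>k. k \<ge> K \<Longrightarrow> int (d k) = k + 1 - e"
  shows "int (d j) \<le> int (nat (j + 1 - e))"
proof (cases "d j = 0")
  case False
  have "d j + m \<le> d (j + int m) \<and> d (j + int m) \<noteq> 0" for m
  proof (induction m)
    case (Suc m)
    then have "d (j + int m) + 1 \<le> d (j + int m + 1)" using step by blast
    moreover have "j + int m + 1 = j + int (Suc m)" by simp
    ultimately show ?case using Suc by simp
  qed (simp add: False)
  from this[of "nat (K - j)"] have 1: "d j + nat (K - j) \<le> d (j + int (nat (K - j)))" by blast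
  have "int (d (j + int (nat (K - j)))) = j + int (nat (K - j)) + 1 - e" by (rule asy) simp
  then have "int (d j) \<le> j + 1 - e" using 1 by linarith
  then show ?thesis by simp
qed simp

lemma dI_zero: "dI k \<noteq> 0 \<Longrightarrow> Ik k \<noteq> {0}"
proof
  assume "dI k \<noteq> 0" "Ik k = {0}"
  from this(2) have "fd smult {0} (Ik k) 0" by (simp only: fd_refl)
  from VP.fd_unique[OF dI this VP.subspace_single_0] show False using \<open>dI k \<noteq> 0\<close> by simp
qed

lemma dV_zero: "dV k \<noteq> 0 \<Longrightarrow> Vk k \<noteq> {0}"
proof
  assume "dV k \<noteq> 0" "Vk k = {0}"
  from this(2) have "fd sc3 {0} (Vk k) 0" by (simp only: fd_refl)
  from V3.fd_unique[OF fd_V this V3.subspace_single_0] show False using \<open>dV k \<noteq> 0\<close> by simp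
qed

lemma dI_bound: "(\<And>k. k \<ge> K \<Longrightarrow> int (dI k) = k + 1 - e) \<Longrightarrow> int (dI j) \<le> int (nat (j + 1 - e))"
  by (rule growth_bound[of dI K e j, OF Ik_growth[OF dI_zero]])

lemma dV_bound: "(\<And>k. k \<ge> K \<Longrightarrow> int (dV k) = k + 1 - e) \<Longrightarrow> int (dV j) \<le> int (nat (j + 1 - e))"
  by (rule growth_bound[of dV K e j, OF Vk_growth[OF dV_zero]])

lemma degree_rg: "degree (r g) = dg" "r g \<noteq> 0"
proof -
  have "coeff (r g) dg \<noteq> 0" using coeff_top_r[OF g(1)] g(4) by simp
  moreover have "degree (r g) \<le> dg" using r_Pl[OF g(1)] by (simp add: Pl_degree)
  ultimately show "degree (r g) = dg" "r g \<noteq> 0" using le_degree by (force intro: antisym)+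
qed

lemma psi_kosz: "psi (kosz dg g b) = smult (of_nat dg * ev L b) (r g)"
proof -
  have "der_apply (kosz dg g b) L = of_nat dg * g * ptl b L - of_nat 1 * ptl b g * L"
    by (rule kosz_apply) (simp add: lin)
  then show ?thesis
    by (simp add: psi_def ptl_linear[OF lin(3)] of_nat_SC rhom_simps[OF r_hom] r_L r_SC)
qed

text \<open>The Koszul derivation along \<open>R\<close>, where \<open>L\<close> takes the value 1,
  puts \<open>r g\<close> into the restricted ideal. So this ideal is nonzero and its generator
  divides \<open>r g\<close>.\<close>

lemma rg_Ik: "smult (of_nat dg) (r g) \<in> Ik (int dg)"
proof -
  have "kosz dg g R \<in> Mk (int dg)" by (simp add: Mk_def kosz_D0 kosz_Hd g)
  then have "psi (kosz dg g R) \<in> Ik (int dg)" by (simp add: Ik_def)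
  then show ?thesis by (simp add: psi_kosz dual)
qed

lemma Ik_mono: "q \<in> Ik k \<Longrightarrow> k \<le> l \<Longrightarrow> q \<in> Ik l"
proof -
  assume q: "q \<in> Ik k" "k \<le> l"
  have "q \<in> Ik (k + int m)" for m
  proof (induction m)
    case (Suc m)
    then show ?case using Ik_step(1)[OF Suc] by (simp add: add.commute add.left_commute)
  qed (use q in simp)
  from this[of "nat (l - k)"] show ?thesis using q by simp
qed

lemma Ik_mult: "q \<in> Ik k \<Longrightarrow> p \<in> Pl d \<Longrightarrow> p * q \<in> Ik (d + k)"
proof -
  assume q: "q \<in> Ik k" "p \<in> Pl d"
  obtain h where h: "homogeneous d h" "r h = p" using r_surj q(2) by blast
  obtain \<theta> where th: "\<theta> \<in> Mk k" "q = psi \<theta>" using q(1) by (auto simp: Ik_def)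
  have "psi (h *s \<theta>) \<in> Ik (d + k)" unfolding Ik_def using Mk_scale[OF h(1) th(1)] by (rule imageI)
  then show ?thesis by (simp add: psi_scale h(2) th(2))
qed

lemma subspace_Ik: "VP.subspace (Ik k)"
  using VP.fd_subspace[OF dI] by simp

lemma psi_D0_Ik: "\<theta> \<in> D0 g \<Longrightarrow> \<exists>k. psi \<theta> \<in> Ik k"
proof -
  assume th: "\<theta> \<in> D0 g"
  obtain N where N: "\<theta> = (\<Sum>d\<le>N. hpd (int d) \<theta>)" using hpd_decomp[of \<theta>] by blast
  have "psi (hpd (int d) \<theta>) \<in> Ik (int N)" if "d \<le> N" for d
  proof (rule Ik_mono)
    show "psi (hpd (int d) \<theta>) \<in> Ik (int d)"
      using hpd_D0[OF g(1) th] hpd_Hd by (auto simp: Ik_def Mk_def)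
  qed (use that in simp)
  then have "(\<Sum>d\<le>N. psi (hpd (int d) \<theta>)) \<in> Ik (int N)" by (intro VP.subspace_sum[OF subspace_Ik]) auto
  then have "psi \<theta> \<in> Ik (int N)" by (subst N) (simp add: psi_sum)
  then show ?thesis by blast
qed

text \<open>\<open>G\<close> is a nonzero element of least degree in the union of all
  \<open>Ik\<close>, an ideal of polynomials in one variable. A single \<open>Ik k\<close> consists
  of all multiples of \<open>G\<close> of degree at most \<open>k\<close> only for large
  \<open>k\<close>, and this is shown by division by \<open>r g\<close>.\<close>

theorem restriction_gcd:
  "\<exists>G K. G \<noteq> 0 \<and> (\<forall>\<theta>\<in>D0 g. G dvd psi \<theta>) \<and> (\<exists>k. G \<in> Ik k) \<and> G dvd r g \<and>
     (\<forall>k\<ge>K. int (dI k) = k + 1 - int (degree G))"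
proof -
  define A where "A = (\<Union>k. Ik k)"
  have W: "smult (of_nat dg) (r g) \<in> A" "smult (of_nat dg) (r g) \<noteq> 0" using rg_Ik degree_rg g(2) by (auto simp: A_def)
  then obtain G where G: "G \<in> A" "G \<noteq> 0" "\<And>q. q \<in> A \<Longrightarrow> q \<noteq> 0 \<Longrightarrow> degree G \<le> degree q"
    using arg_min_nat_lemma[of "\<lambda>q. q \<in> A \<and> q \<noteq> 0" _ degree] by (metis (no_types, lifting))
  obtain k1 where k1: "G \<in> Ik k1" using G by (auto simp: A_def)
  have diff: "p - q \<in> A" if "p \<in> A" "q \<in> A" for p q
  proof -
    obtain k where "p \<in> Ik k" using \<open>p \<in> A\<close> unfolding A_def by blast
    moreover obtain l where "q \<in> Ik l" using \<open>q \<in> A\<close> unfolding A_def by blast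
    ultimately have "p \<in> Ik (max k l)" "q \<in> Ik (max k l)" using Ik_mono by (meson max.cobounded1 max.cobounded2)+
    then show ?thesis unfolding A_def using VP.subspace_diff[OF subspace_Ik] by blast
  qed
  have dvd: "G dvd q" if "q \<in> A" for q
  proof -
    have "q div G * G \<in> A" using Ik_mult[OF k1, of "q div G" "int (degree (q div G))"] by (auto simp: A_def Pl_degree)
    then have "q - q div G * G \<in> A" by (rule diff[OF that])
    then have "q mod G \<in> A" by (simp add: minus_div_mult_eq_mod)
    then have "q mod G = 0" using G(2,3) degree_mod_less[OF G(2), of q] by force
    then show ?thesis by (simp add: dvd_eq_mod_eq_0)
  qed
  have Grg: "G dvd r g" using dvd[OF W(1)] g(2) by (simp add: dvd_smult_iff)
  have all: "\<forall>\<theta>\<in>D0 g. G dvd psi \<theta>" using psi_D0_Ik dvd by (auto simp: A_def)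
  define K where "K = max (int dg + \<bar>k1\<bar> + int (degree G)) 0"
  have "int (dI k) = k + 1 - int (degree G)" if k: "k \<ge> K" for k
  proof -
    have "Ik k = (\<lambda>q. G * q) ` Pl (k - int (degree G))"
    proof (intro subset_antisym subsetI)
      fix q assume q: "q \<in> Ik k"
      then obtain p where p: "q = G * p" using dvd by (auto simp: A_def elim: dvdE)
      have "p \<in> Pl (k - int (degree G))"
      proof (cases "p = 0")
        case False
        obtain m where m: "k = int m" using k by (metis K_def max.boundedE nonneg_int_cases)
        have "degree q \<le> m" using Ik_Pl[of k] q m Pl_degree by auto
        then have "degree G + degree p \<le> m" using p False G(2) by (simp add: degree_mult_eq)
        then show ?thesis unfolding m by (metis Pl_degree of_nat_diff add_leD1 le_diff_conv2 add.commute)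
      qed (simp add: Pl_def)
      then show "q \<in> (\<lambda>q. G * q) ` Pl (k - int (degree G))" using p by blast
    next
      fix q assume "q \<in> (\<lambda>q. G * q) ` Pl (k - int (degree G))"
      then obtain p where p: "q = G * p" "p \<in> Pl (k - int (degree G))" by auto
      \<comment> \<open>\<open>W\<close> lies in \<open>Ik dg\<close> and has the full degree
        \<open>dg\<close>, so the part of \<open>q\<close> that is a multiple of \<open>W\<close>
        costs no degree. The remainder modulo \<open>W\<close> is \<open>G\<close> times a factor of
        degree at most \<open>dg\<close>, hence in \<open>Ik (dg + k1)\<close>.\<close>
      define W where "W = smult (of_nat dg) (r g)"
      have W0: "W \<noteq> 0" "degree W = dg" "G dvd W" using W degree_rg g(2) dvd by (auto simp: W_def)
      have kG: "k - int (degree G) \<ge> 0" using k by (simp add: K_def)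
      have qk: "q \<in> Pl k"
      proof -
        have "G \<in> Pl (int (degree G))" by (simp add: Pl_degree)
        from Pl_mult[OF this p(2)] show ?thesis using p(1) by simp
      qed
      have 1: "q div W * W \<in> Ik k"
      proof -
        have "q div W \<in> Pl (k - int dg)"
        proof -
          have "degree q \<le> nat k" using qk kG by (metis Pl_degree nat_0_le add_increasing2 diff_ge_0_iff_ge of_nat_0_le_iff order_trans)
          moreover have "degree (q div W) + dg \<le> degree q" if nz: "q div W \<noteq> 0"
          proof -
            have 1: "degree (q div W * W) = degree (q div W) + dg" using nz W0 by (simp add: degree_mult_eq)
            have "q mod W = 0 \<or> degree (q mod W) < degree (q div W * W)"
              using degree_mod_less[OF W0(1), of q] W0(2) 1 by auto
            then have "degree (q div W * W + q mod W) = degree (q div W * W)"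
              using degree_add_eq_left[of "q mod W" "q div W * W"] by (metis add.right_neutral)
            then show ?thesis using 1 by simp
          qed
          ultimately have "degree (q div W) \<le> nat k - dg" by (cases "q div W = 0") auto
          moreover have "k - int dg = int (nat k - dg)" using k by (simp add: K_def)
          ultimately show ?thesis by (simp only: Pl_degree)
        qed
        from Ik_mult[OF rg_Ik this] show ?thesis by (simp add: W_def)
      qed
      have "G dvd q mod W" using p(1) W0(3) by (simp add: dvd_mod)
      then obtain s where s: "q mod W = G * s" by (elim dvdE)
      have "s \<in> Pl (int dg)"
      proof (cases "s = 0")
        case False
        then have "degree s \<le> degree (q mod W)" using s G(2) by (simp add: degree_mult_eq)
        also have "\<dots> \<le> dg" using degree_mod_less[OF W0(1), of q] W0(2) by auto
        finally show ?thesis by (simp add: Pl_degree)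
      qed (simp add: Pl_def)
      from Ik_mult[OF k1 this] have "q mod W \<in> Ik (int dg + k1)" by (simp add: s mult.commute)
      then have "q mod W \<in> Ik k" using k by (elim Ik_mono) (simp add: K_def)
      with 1 have "q div W * W + q mod W \<in> Ik k" by (intro VP.subspace_add[OF subspace_Ik])
      then show "q \<in> Ik k" by simp
    qed
    moreover have "fd smult {0} ((\<lambda>q. G * q) ` Pl (k - int (degree G))) (nat (k - int (degree G) + 1))"
    proof (rule VP.fd_inj_image[OF fd_Pl VP.vspace_axioms])
      show "Vector_Spaces.linear smult smult (\<lambda>q. G * q)"
        by (rule linI) (simp_all add: VP.vspace_axioms algebra_simps)
    qed (use G(2) in simp)
    ultimately have "dI k = nat (k - int (degree G) + 1)" using VP.fd_unique[OF dI _ VP.subspace_single_0] by simp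
    then show ?thesis using k by (simp add: K_def)
  qed
  then show ?thesis using G(2) all k1 Grg by blast
qed

end

section \<open>Free curves\<close>

definition crs :: "S ^ 3 \<Rightarrow> S ^ 3 \<Rightarrow> S ^ 3" where
  "crs x y = (\<chi> i. if i = 1 then x $ 2 * y $ 3 - x $ 3 * y $ 2
     else if i = 2 then x $ 3 * y $ 1 - x $ 1 * y $ 3 else x $ 1 * y $ 2 - x $ 2 * y $ 1)"

lemma crs_nth: "crs x y $ 1 = x $ 2 * y $ 3 - x $ 3 * y $ 2" "crs x y $ 2 = x $ 3 * y $ 1 - x $ 1 * y $ 3"
  "crs x y $ 3 = x $ 1 * y $ 2 - x $ 2 * y $ 1"
  by (simp_all add: crs_def)

lemma crs_combination: "crs (a *s x + b *s y) (c *s x + d *s y) = (a * d - b * c) *s crs x y"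
  by (simp add: vec_eq_iff forall_3 crs_nth algebra_simps)

lemma crs_proportional: "crs x y = 0 \<Longrightarrow> x $ i *s y = y $ i *s x"
proof -
  assume "crs x y = 0"
  then have "crs x y $ 1 = 0" "crs x y $ 2 = 0" "crs x y $ 3 = 0" by simp_all
  then show ?thesis using exhaust_3[of i] unfolding crs_nth
    by (auto simp: vec_eq_iff forall_3 algebra_simps)
qed

definition det3 :: "S ^ 3 \<Rightarrow> S ^ 3 \<Rightarrow> S ^ 3 \<Rightarrow> S" where
  "det3 x y z = x $ 1 * crs y z $ 1 + x $ 2 * crs y z $ 2 + x $ 3 * crs y z $ 3"

lemma crs_relation:
  "(crs y z $ l *s x + crs z x $ l *s y + crs x y $ l *s z) $ k = (if k = l then det3 x y z else 0)"
  using exhaust_3[of k] exhaust_3[of l] by (elim disjE) (simp_all add: det3_def crs_nth algebra_simps)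

text \<open>By Cramer's rule \<open>crs_relation\<close> the combination \<open>v\<close> points in
  the direction \<open>l\<close> with the determinant as its only entry; as it kills
  \<open>f\<close>, the determinant vanishes. So \<open>D0 f\<close> has rank at most 2.\<close>

lemma det3_D0:
  assumes "x \<in> D0 f" "y \<in> D0 f" "z \<in> D0 f" "pd l f \<noteq> 0"
  shows "det3 x y z = 0"
proof -
  define v where "v = crs y z $ l *s x + crs z x $ l *s y + crs x y $ l *s z"
  have "v \<in> D0 f" unfolding v_def using assms by (intro D0_add D0_scale)
  then have "(\<Sum>k\<in>UNIV. v $ k * pd k f) = 0" by (simp add: D0_iff der_apply_sum)
  moreover have "v $ k * pd k f = (if k = l then det3 x y z * pd l f else 0)" for k
    unfolding v_def crs_relation by simp
  ultimately show ?thesis using assms(4) by simp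
qed

lemma partial_nonzero:
  assumes "homogeneous (int n) f" "n > 0" "f \<noteq> 0"
  shows "\<exists>l. pd l f \<noteq> 0"
proof (rule ccontr)
  assume "\<not> ?thesis"
  then have "of_nat n * f = 0" unfolding euler[OF assms(1), symmetric] by simp
  then show False using assms by simp
qed

text \<open>The trivial relations between two partial derivatives already have rank 2: the squares
  of the partial derivatives occur in their cross products.\<close>

lemma D0_rank:
  assumes "pd l f \<noteq> 0"
  shows "\<exists>\<theta>\<in>D0 f. \<exists>\<eta>\<in>D0 f. crs \<theta> \<eta> \<noteq> 0"
proof -
  define a where "a = ((\<chi> i. if i = 1 then pd 2 f else if i = 2 then - pd 1 f else 0) :: S ^ 3)"
  define b where "b = ((\<chi> i. if i = 2 then pd 3 f else if i = 3 then - pd 2 f else 0) :: S ^ 3)"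
  define c where "c = ((\<chi> i. if i = 3 then pd 1 f else if i = 1 then - pd 3 f else 0) :: S ^ 3)"
  have D: "a \<in> D0 f" "b \<in> D0 f" "c \<in> D0 f"
    by (simp_all add: D0_iff der_apply_sum sum_3 a_def b_def c_def)
  have "crs a b $ 2 = pd 2 f * pd 2 f" "crs b c $ 3 = pd 3 f * pd 3 f" "crs c a $ 1 = pd 1 f * pd 1 f"
    by (simp_all add: crs_nth a_def b_def c_def)
  then have "pd 2 f \<noteq> 0 \<Longrightarrow> crs a b \<noteq> 0" "pd 3 f \<noteq> 0 \<Longrightarrow> crs b c \<noteq> 0" "pd 1 f \<noteq> 0 \<Longrightarrow> crs c a \<noteq> 0"
    by (metis mult_eq_0_iff zero_index)+
  then show ?thesis using D assms exhaust_3[of l] by blast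
qed

definition generates :: "S ^ 3 \<Rightarrow> S ^ 3 \<Rightarrow> (S ^ 3) set \<Rightarrow> bool" where
  "generates \<theta> \<eta> M \<longleftrightarrow> (\<forall>\<zeta>\<in>M. \<exists>u v. \<zeta> = u *s \<theta> + v *s \<eta>)"

lemma generates_crs:
  assumes "generates \<theta> \<eta> (D0 f)" "pd l f \<noteq> 0"
  shows "crs \<theta> \<eta> \<noteq> 0"
proof
  assume 0: "crs \<theta> \<eta> = 0"
  obtain x y where xy: "x \<in> D0 f" "y \<in> D0 f" "crs x y \<noteq> 0" using D0_rank[OF assms(2)] by blast
  obtain a b where x: "x = a *s \<theta> + b *s \<eta>" using assms(1) xy(1) unfolding generates_def by blast
  obtain c d where y: "y = c *s \<theta> + d *s \<eta>" using assms(1) xy(2) unfolding generates_def by blast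
  have "crs x y = 0" unfolding x y crs_combination 0 by (simp add: vec_eq_iff)
  then show False using xy(3) by simp
qed

lemma crs_independent:
  assumes "crs \<theta> \<eta> \<noteq> 0" "u *s \<theta> + v *s \<eta> = u' *s \<theta> + v' *s \<eta>"
  shows "u = u'" "v = v'"
proof -
  obtain i where i: "crs \<theta> \<eta> $ i \<noteq> 0" using assms(1) by (auto simp: vec_eq_iff)
  have "crs (u *s \<theta> + v *s \<eta>) (0 *s \<theta> + 1 *s \<eta>) = crs (u' *s \<theta> + v' *s \<eta>) (0 *s \<theta> + 1 *s \<eta>)"
    using assms(2) by simp
  then have "u *s crs \<theta> \<eta> = u' *s crs \<theta> \<eta>" unfolding crs_combination by simp
  then have "u * crs \<theta> \<eta> $ i = u' * crs \<theta> \<eta> $ i" by (metis vector_smult_component)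
  then show "u = u'" using i by simp
  have "crs (1 *s \<theta> + 0 *s \<eta>) (u *s \<theta> + v *s \<eta>) = crs (1 *s \<theta> + 0 *s \<eta>) (u' *s \<theta> + v' *s \<eta>)"
    using assms(2) by simp
  then have "v *s crs \<theta> \<eta> = v' *s crs \<theta> \<eta>" unfolding crs_combination by simp
  then have "v * crs \<theta> \<eta> $ i = v' * crs \<theta> \<eta> $ i" by (metis vector_smult_component)
  then show "v = v'" using i by simp
qed

lemma free_with_exponentsI:
  assumes "\<theta> \<in> D0 f \<inter> Hd a" "\<eta> \<in> D0 f \<inter> Hd b" "generates \<theta> \<eta> (D0 f)" "pd l f \<noteq> 0"
  shows "free_with_exponents f a b"
  unfolding free_with_exponents_def
proof (intro exI conjI)
  show "homogeneous_der a \<theta>" "homogeneous_der b \<eta>" using assms by (auto simp: Hd_def)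
  note crs = generates_crs[OF assms(3,4)]
  show "bij_betw (\<lambda>(u, v). u *s \<theta> + v *s \<eta>) UNIV (D0 f)"
    unfolding bij_betw_def
  proof
    show "inj (\<lambda>(u, v). u *s \<theta> + v *s \<eta>)"
      by (rule injI) (auto dest: crs_independent[OF crs])
    show "range (\<lambda>(u, v). u *s \<theta> + v *s \<eta>) = D0 f"
    proof (intro subset_antisym subsetI)
      fix \<zeta> assume "\<zeta> \<in> range (\<lambda>(u, v). u *s \<theta> + v *s \<eta>)"
      then show "\<zeta> \<in> D0 f" using assms by (auto intro: D0_add D0_scale)
    next
      fix \<zeta> assume "\<zeta> \<in> D0 f"
      then obtain u v where "\<zeta> = u *s \<theta> + v *s \<eta>" using assms(3) unfolding generates_def by blast
      then show "\<zeta> \<in> range (\<lambda>(u, v). u *s \<theta> + v *s \<eta>)" by (intro image_eqI[of _ _ "(u, v)"]) auto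
    qed
  qed
qed

lemma generates_commute: "generates \<theta> \<eta> M \<Longrightarrow> generates \<eta> \<theta> M"
  unfolding generates_def by (metis add.commute)

lemma module_vec: "module ((*s) :: S \<Rightarrow> S ^ 3 \<Rightarrow> S ^ 3)"
  by unfold_locales (simp_all add: vec_eq_iff algebra_simps)

text \<open>Three elements of a basis would satisfy the relation of \<open>crs_relation\<close>, in
  which a coefficient \<open>crs x y $ i\<close> is nonzero; so a basis has at most two
  elements.\<close>

lemma free_curve_basis:
  assumes "free_curve f" "pd l f \<noteq> 0"
  shows "\<exists>x y. x \<in> D0 f \<and> y \<in> D0 f \<and> generates x y (D0 f)"
proof -
  obtain B where ind: "\<not> module.dependent (*s) B" and sp: "module.span (*s) B = D0 f"
    using assms(1) unfolding free_curve_def by blast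
  note ex = module.dependent_explicit[OF module_vec]
  have BD: "B \<subseteq> D0 f" using module.span_superset[OF module_vec, of B] sp by simp
  have rel2: "u = 0" if xy: "x \<in> B" "y \<in> B" "x \<noteq> y" and 0: "u *s x + v *s y = 0" for x y u v
  proof (rule ccontr)
    assume "u \<noteq> 0"
    moreover have "(\<Sum>w\<in>{x, y}. (if w = x then u else v) *s w) = 0" using xy 0 by simp
    ultimately have "module.dependent (*s) B" unfolding ex using xy
      by (intro exI[of _ "{x, y}"] conjI exI[of _ "\<lambda>w. if w = x then u else v"]) auto
    then show False using ind by simp
  qed
  have rel3: "u = 0" if xyz: "x \<in> B" "y \<in> B" "z \<in> B" "x \<noteq> y" "x \<noteq> z" "y \<noteq> z" and 0: "t *s x + v *s y + u *s z = 0"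
    for x y z t u v
  proof (rule ccontr)
    assume "u \<noteq> 0"
    define c where "c = (\<lambda>w. if w = x then t else if w = y then v else u)"
    have "(\<Sum>w\<in>{x, y, z}. c w *s w) = 0" using xyz 0 by (simp add: c_def add.assoc)
    moreover have "c z \<noteq> 0" using \<open>u \<noteq> 0\<close> xyz by (simp add: c_def)
    ultimately have "module.dependent (*s) B" unfolding ex using xyz
      by (intro exI[of _ "{x, y, z}"] conjI exI[of _ c]) auto
    then show False using ind by simp
  qed
  have cr: "crs x y \<noteq> 0" if "x \<in> B" "y \<in> B" "x \<noteq> y" for x y
  proof
    assume "crs x y = 0"
    then have "x $ i *s y + (- y $ i) *s x = 0" for i
      using crs_proportional[of x y i] by (simp add: vec_eq_iff)
    then have "x $ i = 0" for i using rel2[OF that(2,1) that(3)[symmetric]] by blast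
    then have "1 *s x + 0 *s y = 0" by (simp add: vec_eq_iff)
    then have "(1::S) = 0" by (rule rel2[OF that])
    then show False by simp
  qed
  have "\<exists>x y. B \<subseteq> {x, y}"
  proof (rule ccontr)
    assume no: "\<not> ?thesis"
    then obtain x where x: "x \<in> B" by blast
    with no obtain y where y: "y \<in> B" "y \<noteq> x" by blast
    with no obtain z where z: "z \<in> B" "z \<noteq> x" "z \<noteq> y" by blast
    obtain i where i: "crs x y $ i \<noteq> 0" using cr[OF x y(1) y(2)[symmetric]] by (auto simp: vec_eq_iff)
    have "det3 x y z = 0" by (rule det3_D0[OF _ _ _ assms(2)]) (use BD x y z in auto)
    then have "crs y z $ i *s x + crs z x $ i *s y + crs x y $ i *s z = 0"
      unfolding vec_eq_iff crs_relation by simp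
    then show False using rel3[OF x y(1) z(1)] y z i by metis
  qed
  then obtain x y where xy: "B \<subseteq> {x, y}" by blast
  \<comment> \<open>A missing basis element is replaced by 0, so that there are always two
    generators.\<close>
  define x' where "x' = (if x \<in> B then x else 0)"
  define y' where "y' = (if y \<in> B then y else 0)"
  have D: "x' \<in> D0 f" "y' \<in> D0 f" using BD D0_0 by (auto simp: x'_def y'_def)
  have "B \<subseteq> {x', y'}" using xy by (auto simp: x'_def y'_def)
  have "generates x' y' (D0 f)" unfolding generates_def
  proof
    fix \<zeta> assume "\<zeta> \<in> D0 f"
    then have "\<zeta> \<in> module.span (*s) {x', y'}" using sp module.span_mono[OF module_vec \<open>B \<subseteq> {x', y'}\<close>] by blast
    then obtain u v where "\<zeta> - u *s x' - v *s y' = 0"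
      unfolding module.span_insert[OF module_vec] module.span_empty[OF module_vec] by auto
    then have "\<zeta> = u *s x' + v *s y'" by (simp add: algebra_simps)
    then show "\<exists>u v. \<zeta> = u *s x' + v *s y'" by blast
  qed
  then show ?thesis using D by blast
qed

text \<open>A basis \<open>x, y\<close> need not be homogeneous. The determinants
  \<open>D k m\<close> of a component of \<open>x\<close> and a component of \<open>y\<close>,
  expressed in the basis, add up to 1, so one of them has a nonzero constant term. As a factor of
  the homogeneous entries of \<open>crs \<theta> \<eta>\<close> it is homogeneous, hence a nonzero
  constant, and these two components generate as well.\<close>

lemma free_curve_homogeneous_basis:
  assumes f: "homogeneous d f" "free_curve f" "pd l f \<noteq> 0"
  shows "\<exists>p q \<theta> \<eta>. \<theta> \<in> D0 f \<inter> Hd (int p) \<and> \<eta> \<in> D0 f \<inter> Hd (int q) \<and> generates \<theta> \<eta> (D0 f)"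
proof -
  obtain x y where xy: "x \<in> D0 f" "y \<in> D0 f" and gen: "generates x y (D0 f)"
    using free_curve_basis[OF f(2,3)] by blast
  note cr = generates_crs[OF gen f(3)]
  note ind = crs_independent[OF cr]
  obtain N where Nx: "x = (\<Sum>k\<le>N. hpd (int k) x)" and Ny: "y = (\<Sum>k\<le>N. hpd (int k) y)"
    using hpd_decomp[of x] hpd_decomp[of y] by (metis nat_le_linear)
  have "\<forall>k. \<exists>uv. hpd (int k) x = fst uv *s x + snd uv *s y"
    using gen hpd_D0[OF f(1) xy(1)] unfolding generates_def by (metis fst_conv snd_conv)
  then obtain s where s: "\<And>k. hpd (int k) x = fst (s k) *s x + snd (s k) *s y" by metis
  have "\<forall>k. \<exists>uv. hpd (int k) y = fst uv *s x + snd uv *s y"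
    using gen hpd_D0[OF f(1) xy(2)] unfolding generates_def by (metis fst_conv snd_conv)
  then obtain t where t: "\<And>k. hpd (int k) y = fst (t k) *s x + snd (t k) *s y" by metis
  have sumv: "(\<Sum>k\<le>N. a k *s x + b k *s y) = (\<Sum>k\<le>N. a k) *s x + (\<Sum>k\<le>N. b k) *s y" for a b
    by (simp add: vec_eq_iff sum.distrib sum_distrib_right)
  have "1 *s x + 0 *s y = (\<Sum>k\<le>N. fst (s k)) *s x + (\<Sum>k\<le>N. snd (s k)) *s y"
    using Nx unfolding s sumv by (simp add: vec_eq_iff)
  from ind[OF this] have S: "(\<Sum>k\<le>N. fst (s k)) = 1" "(\<Sum>k\<le>N. snd (s k)) = 0" by simp_all
  have "0 *s x + 1 *s y = (\<Sum>k\<le>N. fst (t k)) *s x + (\<Sum>k\<le>N. snd (t k)) *s y"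
    using Ny unfolding t sumv by (simp add: vec_eq_iff)
  from ind[OF this] have T: "(\<Sum>k\<le>N. fst (t k)) = 0" "(\<Sum>k\<le>N. snd (t k)) = 1" by simp_all
  define D where "D k m = fst (s k) * snd (t m) - snd (s k) * fst (t m)" for k m
  have "(\<Sum>k\<le>N. \<Sum>m\<le>N. D k m) = 1"
    unfolding D_def sum_subtractf sum_product[symmetric] S T by simp
  then have "cf (\<Sum>k\<le>N. \<Sum>m\<le>N. D k m) 0 0 0 = 1" by (simp add: rhom_1[OF SC_hom, symmetric] cf_SC)
  moreover have "cf (sum h A) 0 0 0 = (\<Sum>k\<in>A. cf (h k) 0 0 0)" for h and A :: "nat set"
    by (induction A rule: infinite_finite_induct) simp_all
  ultimately have "(\<Sum>k\<le>N. \<Sum>m\<le>N. cf (D k m) 0 0 0) \<noteq> 0" by simp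
  then obtain k m where D0: "cf (D k m) 0 0 0 \<noteq> 0" by (meson sum.not_neutral_contains_not_neutral)
  define \<theta> where "\<theta> = hpd (int k) x"
  define \<eta> where "\<eta> = hpd (int m) y"
  have \<theta>: "\<theta> \<in> D0 f \<inter> Hd (int k)" and \<eta>: "\<eta> \<in> D0 f \<inter> Hd (int m)"
    using hpd_D0[OF f(1)] hpd_Hd xy by (auto simp: \<theta>_def \<eta>_def)
  have cD: "crs \<theta> \<eta> = D k m *s crs x y" unfolding \<theta>_def \<eta>_def s t crs_combination D_def ..
  obtain i where i: "crs x y $ i \<noteq> 0" using cr by (auto simp: vec_eq_iff)
  have "homogeneous (int k + int m) (crs \<theta> \<eta> $ i)"
    using \<theta> \<eta> exhaust_3[of i] by (auto simp: crs_nth Hd_def homogeneous_der_def intro!: homogeneous_diff homogeneous_mult)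
  then have "homogeneous (int k + int m) (D k m * crs x y $ i)" unfolding cD by simp
  moreover have "D k m * crs x y $ i \<noteq> 0" using D0 i by auto
  ultimately obtain n where n: "homogeneous (int n) (D k m)" using homogeneous_factor by blast
  have "n = 0" using n D0 unfolding homogeneous_cf by (metis add_0 of_nat_0 of_nat_eq_0_iff)
  then obtain c where c: "D k m = SC c" using homogeneous_const n by (metis of_nat_0)
  have c0: "c \<noteq> 0" using D0 c by (auto simp: rhom_0[OF SC_hom])
  have inv: "SC (inverse c) * D k m = 1" using c0 by (simp add: c rhom_mult[OF SC_hom, symmetric] rhom_1[OF SC_hom])
  have X: "x = (SC (inverse c) * snd (t m)) *s \<theta> + (- SC (inverse c) * snd (s k)) *s \<eta>"
  proof -
    have "(SC (inverse c) * snd (t m)) *s \<theta> + (- SC (inverse c) * snd (s k)) *s \<eta> = (SC (inverse c) * D k m) *s x"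
      unfolding \<theta>_def \<eta>_def s t D_def by (simp add: vec_eq_iff algebra_simps)
    then show ?thesis unfolding inv by (simp add: vec_eq_iff)
  qed
  have Y: "y = (- SC (inverse c) * fst (t m)) *s \<theta> + (SC (inverse c) * fst (s k)) *s \<eta>"
  proof -
    have "(- SC (inverse c) * fst (t m)) *s \<theta> + (SC (inverse c) * fst (s k)) *s \<eta> = (SC (inverse c) * D k m) *s y"
      unfolding \<theta>_def \<eta>_def s t D_def by (simp add: vec_eq_iff algebra_simps)
    then show ?thesis unfolding inv by (simp add: vec_eq_iff)
  qed
  have "generates \<theta> \<eta> (D0 f)" unfolding generates_def
  proof
    fix \<zeta> assume "\<zeta> \<in> D0 f"
    then obtain u v where "\<zeta> = u *s x + v *s y" using gen unfolding generates_def by blast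
    then have "\<zeta> = (u * (SC (inverse c) * snd (t m)) + v * (- SC (inverse c) * fst (t m))) *s \<theta> +
        (u * (- SC (inverse c) * snd (s k)) + v * (SC (inverse c) * fst (s k))) *s \<eta>"
      using X Y by (simp add: vec_eq_iff algebra_simps)
    then show "\<exists>u v. \<zeta> = u *s \<theta> + v *s \<eta>" by blast
  qed
  then show ?thesis using \<theta> \<eta> by blast
qed

section \<open>Hilbert functions of free curves and comparison with the given exponents\<close>

lemma free_hilbert:
  assumes f: "homogeneous d f" "pd l f \<noteq> 0"
    and \<theta>: "\<theta> \<in> D0 f \<inter> Hd p" and \<eta>: "\<eta> \<in> D0 f \<inter> Hd q" and gen: "generates \<theta> \<eta> (D0 f)"
  shows "fd scV {0} (D0 f \<inter> Hd k) (h2 (k - p) + h2 (k - q))"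
proof -
  define T where "T v = v 0 *s \<theta> + v (Suc 0) *s \<eta>" for v :: "nat \<Rightarrow> S"
  have lin: "Vector_Spaces.linear scN scV T"
    by (rule linI) (simp_all add: VN.vspace_axioms VV.vspace_axioms T_def scN_def scV_def vec_eq_iff algebra_simps)
  note ind = crs_independent[OF generates_crs[OF gen f(2)]]
  have inj: "v = 0" if v: "v \<in> Fr [p, q] k" "T v = 0" for v
  proof
    fix j
    have "v 0 *s \<theta> + v (Suc 0) *s \<eta> = 0 *s \<theta> + 0 *s \<eta>" using v(2) by (simp add: T_def vec_eq_iff)
    from ind[OF this] have "v 0 = 0" "v (Suc 0) = 0" by simp_all
    moreover have "j = 0 \<or> j = Suc 0 \<or> j \<ge> length [p, q]" by (simp, linarith)
    ultimately show "v j = 0 j" using v(1) by (auto simp: Fr_def free_mod_def)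
  qed
  have img: "T ` Fr [p, q] k = D0 f \<inter> Hd k"
  proof (intro subset_antisym subsetI)
    fix \<zeta> assume "\<zeta> \<in> T ` Fr [p, q] k"
    then obtain v where v: "v \<in> Fr [p, q] k" "\<zeta> = T v" by auto
    have "homogeneous (k - [p, q] ! j) (v j)" if "j < length [p, q]" for j
      using v(1) that unfolding Fr_def by blast
    from this[of 0] this[of "Suc 0"] have h: "homogeneous (k - p) (v 0)" "homogeneous (k - q) (v (Suc 0))" by simp_all
    have "T v \<in> Hd k" unfolding T_def using Hd_scale[OF h(1), of \<theta> p] Hd_scale[OF h(2), of \<eta> q] \<theta> \<eta>
      by (intro Hd_add) auto
    moreover have "T v \<in> D0 f" unfolding T_def using \<theta> \<eta> by (intro D0_add D0_scale) auto
    ultimately show "\<zeta> \<in> D0 f \<inter> Hd k" using v by simp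
  next
    fix \<zeta> assume z: "\<zeta> \<in> D0 f \<inter> Hd k"
    then obtain u v where uv: "\<zeta> = u *s \<theta> + v *s \<eta>" using gen unfolding generates_def by blast
    define w where "w j = (if j = 0 then hp (k - p) u else if j = Suc 0 then hp (k - q) v else 0)" for j
    have "w \<in> Fr [p, q] k" by (auto simp: w_def Fr_def free_mod_def less_Suc_eq hp_hom)
    moreover have "\<zeta> = T w"
    proof -
      have "hp k (u * \<theta> $ i) = hp (k - p) u * \<theta> $ i" "hp k (v * \<eta> $ i) = hp (k - q) v * \<eta> $ i" for i
        using hp_mult[of p "\<theta> $ i" k u] hp_mult[of q "\<eta> $ i" k v] \<theta> \<eta>
        by (simp_all add: Hd_def homogeneous_der_def mult.commute)
      then have "hpd k \<zeta> = T w" unfolding uv by (simp add: hpd_def T_def w_def vec_eq_iff hp_add)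
      then show ?thesis using z hpd_self by auto
    qed
    ultimately show "\<zeta> \<in> T ` Fr [p, q] k" by blast
  qed
  have sm: "(\<Sum>e\<leftarrow>[p, q]. h2 (k - e)) = h2 (k - p) + h2 (k - q)" by simp
  show ?thesis using VN.fd_inj_image[OF fd_Fr[of "[p, q]" k] VV.vspace_axioms lin inj] unfolding img sm .
qed

text \<open>Equality of the polynomials means equal sums and equal sums of squares, so
  \<open>p\<close> and \<open>q\<close> are \<open>a\<close> and \<open>b\<close> in some
  order.\<close>

lemma quadratic_exponents:
  fixes a b p q K :: int
  assumes "\<And>k. k \<ge> K \<Longrightarrow> (k - a + 1) * (k - a + 2) + (k - b + 1) * (k - b + 2) =
      (k - p + 1) * (k - p + 2) + (k - q + 1) * (k - q + 2)" "a \<le> b"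
  shows "p \<le> b" "q \<le> b"
proof -
  have e: "(p\<^sup>2 + q\<^sup>2 - a\<^sup>2 - b\<^sup>2) = (2 * k + 3) * (p + q - a - b)" if "k \<ge> K" for k
    using assms(1)[OF that] by (simp add: algebra_simps power2_eq_square)
  from e[of K] e[of "K + 1"] have s: "p + q = a + b" by (simp add: algebra_simps)
  have sq: "p\<^sup>2 + q\<^sup>2 = a\<^sup>2 + b\<^sup>2" using e[of K] s by simp
  have q: "q = a + b - p" using s by simp
  have "(p - a) * (p - b) = 0" using sq unfolding q by (simp add: algebra_simps power2_eq_square)
  then show "p \<le> b" "q \<le> b" using s assms(2) by auto
qed

lemma free_exponents_le:
  assumes f: "homogeneous d f" "pd l f \<noteq> 0" "free_curve f" and "a \<le> b"
    and hil: "\<And>k. k \<ge> K \<Longrightarrow> \<exists>N. fd scV {0} (D0 f \<inter> Hd k) N \<and>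
      2 * int N = (k - a + 1) * (k - a + 2) + (k - b + 1) * (k - b + 2)"
  shows "\<exists>p q \<theta> \<eta>. \<theta> \<in> D0 f \<inter> Hd p \<and> \<eta> \<in> D0 f \<inter> Hd q \<and> generates \<theta> \<eta> (D0 f) \<and> p \<le> b \<and> q \<le> b"
proof -
  obtain p q \<theta> \<eta> where pq: "\<theta> \<in> D0 f \<inter> Hd (int p)" "\<eta> \<in> D0 f \<inter> Hd (int q)" "generates \<theta> \<eta> (D0 f)"
    using free_curve_homogeneous_basis[OF f(1,3,2)] by blast
  have "(k - a + 1) * (k - a + 2) + (k - b + 1) * (k - b + 2) =
      (k - int p + 1) * (k - int p + 2) + (k - int q + 1) * (k - int q + 2)" if k: "k \<ge> max K (int p + int q)" for k
  proof -
    obtain N where N: "fd scV {0} (D0 f \<inter> Hd k) N"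
      "2 * int N = (k - a + 1) * (k - a + 2) + (k - b + 1) * (k - b + 2)" using hil[of k] k by auto
    have "N = h2 (k - int p) + h2 (k - int q)"
      by (rule VV.fd_unique[OF N(1) free_hilbert[OF f(1,2) pq] VV.subspace_single_0])
    then have "2 * int N = 2 * int (h2 (k - int p)) + 2 * int (h2 (k - int q))" by simp
    then show ?thesis using N(2) k by (simp add: h2_formula)
  qed
  from quadratic_exponents[OF this \<open>a \<le> b\<close>] show ?thesis using pq by blast
qed

text \<open>\<open>D\<close> is compared with the Hilbert function of
  \<open>S(-e) \<oplus> S(-e')\<close>. The gap is nonnegative at \<open>-1\<close>, never
  decreases, and in large degrees equals \<open>(e - a) (e - b) = a b - e e'\<close>, the difference
  of the second Chern numbers. If that is 0, the gap is constantly 0 and every step is an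
  equality.\<close>

lemma hilbert_compare:
  fixes D :: "int \<Rightarrow> nat" and a b e e' K :: int
  assumes D0: "D (-1) = 0"
    and step: "\<And>k. k \<ge> 0 \<Longrightarrow> int (D k) \<le> int (D (k - 1)) + int (nat (k + 1 - e)) + int (nat (k + 1 - e'))"
    and asy: "\<And>k. k \<ge> K \<Longrightarrow> 2 * int (D k) = (k - a + 1) * (k - a + 2) + (k - b + 1) * (k - b + 2)"
    and s: "e + e' = a + b"
  shows "0 \<le> (e - a) * (e - b)"
    "(e - a) * (e - b) = 0 \<Longrightarrow> k \<ge> 0 \<Longrightarrow> int (D k) = int (D (k - 1)) + int (nat (k + 1 - e)) + int (nat (k + 1 - e'))"
proof -
  define gap where "gap k = int (h2 (k - e)) + int (h2 (k - e')) - int (D k)" for k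
  have rec: "gap k = gap (k - 1) + (int (D (k - 1)) + int (nat (k + 1 - e)) + int (nat (k + 1 - e')) - int (D k))" for k
  proof -
    have "int (h2 (k - e)) = int (h2 (k - 1 - e)) + int (nat (k + 1 - e))" for e
      using h2_rec[of "k - e"] by (simp add: algebra_simps)
    then show ?thesis unfolding gap_def by simp
  qed
  have mono: "gap k \<le> gap (k + int m)" if "k \<ge> -1" for k m
  proof (induction m)
    case (Suc m)
    have "gap (k + int m) \<le> gap (k + int (Suc m))" using rec[of "k + int (Suc m)"] step[of "k + int (Suc m)"] that by simp
    then show ?case using Suc by simp
  qed simp
  have g0: "gap (-1) \<ge> 0" by (simp add: gap_def D0)
  have lim: "gap k = (e - a) * (e - b)" if k: "k \<ge> K" "k \<ge> e" "k \<ge> e'" for k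
  proof -
    have e': "e' = a + b - e" using s by simp
    have "2 * gap k = 2 * int (h2 (k - e)) + 2 * int (h2 (k - e')) - 2 * int (D k)" by (simp add: gap_def)
    also have "\<dots> = (k - e + 1) * (k - e + 2) + (k - e' + 1) * (k - e' + 2) - ((k - a + 1) * (k - a + 2) + (k - b + 1) * (k - b + 2))"
      using k by (simp add: h2_formula asy)
    also have "\<dots> = 2 * ((e - a) * (e - b))" unfolding e' by (simp add: algebra_simps)
    finally show ?thesis by simp
  qed
  define m where "m = nat (max K (max e e')) + 1"
  have big: "gap (k + int m) = (e - a) * (e - b)" if "k \<ge> -1" for k
    by (rule lim) (use that in \<open>auto simp: m_def\<close>)
  show "0 \<le> (e - a) * (e - b)" using mono[of "-1" m] g0 big[of "-1"] by simp
  assume z: "(e - a) * (e - b) = 0" and k: "k \<ge> 0"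
  have all: "gap k = 0" if "k \<ge> -1" for k
  proof -
    have "gap k \<le> 0" using mono[OF that, of m] big[OF that] z by simp
    moreover have "gap (-1) \<le> gap (-1 + int (nat (k + 1)))" by (rule mono) simp
    ultimately show ?thesis using g0 that by simp
  qed
  show "int (D k) = int (D (k - 1)) + int (nat (k + 1 - e)) + int (nat (k + 1 - e'))"
    using rec[of k] all[of k] all[of "k - 1"] k by simp
qed

lemma generates_homogeneous:
  assumes f: "homogeneous d f" and gen: "\<And>k \<zeta>. \<zeta> \<in> D0 f \<inter> Hd k \<Longrightarrow> \<exists>u v. \<zeta> = u *s \<theta> + v *s \<eta>"
  shows "generates \<theta> \<eta> (D0 f)"
  unfolding generates_def
proof
  fix \<zeta> assume \<zeta>: "\<zeta> \<in> D0 f"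
  obtain N where N: "\<zeta> = (\<Sum>d\<le>N. hpd (int d) \<zeta>)" using hpd_decomp[of \<zeta>] by blast
  have "\<exists>u v. hpd (int d) \<zeta> = u *s \<theta> + v *s \<eta>" for d
    by (rule gen[of _ "int d"]) (use hpd_D0[OF f \<zeta>] hpd_Hd in blast)
  then obtain u v where uv: "\<And>d. hpd (int d) \<zeta> = u d *s \<theta> + v d *s \<eta>" by metis
  have "\<zeta> = (\<Sum>d\<le>N. u d) *s \<theta> + (\<Sum>d\<le>N. v d) *s \<eta>"
    by (subst N) (simp add: uv vec_eq_iff sum.distrib sum_distrib_right)
  then show "\<exists>u v. \<zeta> = u *s \<theta> + v *s \<eta>" by blast
qed

section \<open>Addition: freeness of \<open>g\<close> by restriction to the line\<close>

context line_curve
begin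

definition restr_gcd :: "complex poly \<Rightarrow> bool" where
  "restr_gcd G \<longleftrightarrow> G \<noteq> 0 \<and> (\<forall>\<theta>\<in>D0 g. G dvd psi \<theta>) \<and> (\<exists>k. G \<in> Ik k) \<and> G dvd r g \<and>
     (\<exists>K. \<forall>k\<ge>K. int (dI k) = k + 1 - int (degree G))"

lemma restr_gcd_exists: "\<exists>G. restr_gcd G"
  using restriction_gcd unfolding restr_gcd_def by blast

lemma Mk_Pl_zero:
  assumes G: "restr_gcd G" and th: "\<theta> \<in> Mk k" "k < int (degree G)"
  shows "psi \<theta> = 0"
proof (rule ccontr)
  assume nz: "psi \<theta> \<noteq> 0"
  have "psi \<theta> \<in> Pl k" using Ik_Pl th(1) unfolding Ik_def by blast
  moreover have "G dvd psi \<theta>" using G th by (simp add: restr_gcd_def Mk_def)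
  then have "degree G \<le> degree (psi \<theta>)" using nz by (rule dvd_imp_degree_le)
  then have "int (degree (psi \<theta>)) > k" using th(2) by linarith
  ultimately have "coeff (psi \<theta>) (degree (psi \<theta>)) = 0" unfolding Pl_def by blast
  then show False using nz by simp
qed

text \<open>A nonzero value of \<open>psi\<close> in degree \<open>deg G\<close> is \<open>G\<close>
  times a constant, and \<open>G\<close> divides all other values, with a quotient of the expected
  degree.\<close>

lemma psi_generator:
  assumes G: "restr_gcd G" and th: "\<theta> \<in> Mk (int (degree G))" "psi \<theta> \<noteq> 0" and z: "\<zeta> \<in> Mk k"
  shows "\<exists>u. homogeneous (k - int (degree G)) u \<and> psi \<zeta> = r u * psi \<theta>"
proof (cases "psi \<zeta> = 0")
  case True
  then show ?thesis by (intro exI[of _ 0]) (simp add: homogeneous_0 rhom_0[OF r_hom])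
next
  case False
  have th_Pl: "psi \<theta> \<in> Pl (int (degree G))" "psi \<zeta> \<in> Pl k" using Ik_Pl th(1) z unfolding Ik_def by blast+
  have dvd: "G dvd psi \<theta>" "G dvd psi \<zeta>" using G th z by (simp_all add: restr_gcd_def Mk_def)
  obtain c where c: "psi \<theta> = G * c" using dvd by (elim dvdE)
  obtain q where q: "psi \<zeta> = G * q" using dvd by (elim dvdE)
  have G0: "G \<noteq> 0" "c \<noteq> 0" "q \<noteq> 0" using th(2) c q False by auto
  have "degree c = 0" using th_Pl(1) c G0 by (simp add: Pl_degree degree_mult_eq)
  then obtain c0 where c0: "c = [:c0:]" by (metis degree_eq_zeroE)
  have "k \<ge> 0"
  proof (rule ccontr)
    assume "\<not> k \<ge> 0"
    then show False using th_Pl(2) False by (simp add: Pl_neg)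
  qed
  then have "degree (psi \<zeta>) \<le> nat k" using th_Pl(2) by (metis Pl_degree int_nat_eq)
  then have "degree G + degree q \<le> nat k" using q G0 by (simp add: degree_mult_eq)
  then have kn: "int (nat k - degree G) = k - int (degree G)" "degree q \<le> nat k - degree G" using \<open>k \<ge> 0\<close> by linarith+
  then have "smult (1 / c0) q \<in> Pl (k - int (degree G))"
    unfolding kn(1)[symmetric] Pl_degree by simp
  then obtain u where u: "homogeneous (k - int (degree G)) u" "r u = smult (1 / c0) q" using r_surj by blast
  have "c0 \<noteq> 0" using G0 c0 by auto
  then have "psi \<zeta> = r u * psi \<theta>" unfolding u(2) c q c0 by simp
  then show ?thesis using u by blast
qed

text \<open>The multiples of \<open>r3 \<eta>\<close> by \<open>Pl (k - n)\<close> already have the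
  dimension that bounds \<open>dV k\<close>, so they fill the whole space.\<close>

lemma V_generator:
  assumes b: "\<And>j. int (dV j) \<le> int (nat (j + 1 - n))" and e: "\<eta> \<in> Kk n" "r3 \<eta> \<noteq> 0" and z: "\<zeta> \<in> Kk k"
  shows "\<exists>v. homogeneous (k - n) v \<and> r3 \<zeta> = r3 (v *s \<eta>)"
proof -
  define W where "W = (\<lambda>q. (\<chi> i. q * r3 \<eta> $ i)) ` Pl (k - n)"
  obtain i where i: "r3 \<eta> $ i \<noteq> 0" using e(2) by (auto simp: vec_eq_iff)
  have fW: "fd sc3 {0} W (nat (k - n + 1))" unfolding W_def
  proof (rule VP.fd_inj_image[OF fd_Pl V3.vspace_axioms])
    show "Vector_Spaces.linear smult sc3 (\<lambda>q. \<chi> i. q * r3 \<eta> $ i)"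
      by (rule linI) (simp_all add: VP.vspace_axioms V3.vspace_axioms sc3_def vec_eq_iff algebra_simps)
    show "(\<chi> i. v * r3 \<eta> $ i) = 0 \<Longrightarrow> v = 0" for v using i by (auto simp: vec_eq_iff)
  qed
  have sub: "W \<subseteq> Vk k"
  proof
    fix w assume "w \<in> W"
    then obtain q where q: "q \<in> Pl (k - n)" "w = (\<chi> i. q * r3 \<eta> $ i)" by (auto simp: W_def)
    obtain v where v: "homogeneous (k - n) v" "r v = q" using r_surj[OF q(1)] by blast
    have "v *s \<eta> \<in> Kk k" using Kk_scale[OF v(1) e(1)] by simp
    moreover have "r3 (v *s \<eta>) = w" by (simp add: r3_scale v q)
    ultimately show "w \<in> Vk k" unfolding Vk_def by blast
  qed
  have "nat (k - n + 1) \<le> dV k" by (rule V3.fd_le[OF fd_V fW V3.subspace_single_0 sub])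
  then have "nat (k - n + 1) = dV k" using b[of k] by (simp add: algebra_simps split: if_splits) 
  then have "W = Vk k" using V3.fd_eq[OF _ fW V3.subspace_single_0 sub] fd_V[of k] by simp
  moreover have "r3 \<zeta> \<in> Vk k" using z by (simp add: Vk_def)
  ultimately obtain q where q: "q \<in> Pl (k - n)" "r3 \<zeta> = (\<chi> i. q * r3 \<eta> $ i)" unfolding W_def by blast
  obtain v where v: "homogeneous (k - n) v" "r v = q" using r_surj[OF q(1)] by blast
  have "r3 \<zeta> = r3 (v *s \<eta>)" by (simp add: r3_scale v q)
  then show ?thesis using v by blast
qed

lemma Kk_diff: "\<zeta> \<in> Kk k \<Longrightarrow> \<eta> \<in> Kk k \<Longrightarrow> \<zeta> - \<eta> \<in> Kk k"
  by (simp add: Kk_def Mk_def psi_diff D0_diff Hd_diff)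

lemma r3_diff: "r3 (\<zeta> - \<eta>) = r3 \<zeta> - r3 \<eta>"
  by (simp add: r3_def vec_eq_iff rhom_diff[OF r_hom])

lemma K_quotient:
  assumes b: "\<And>j. int (dV j) \<le> int (nat (j + 1 - n))" and e: "\<eta> \<in> Kk n" "r3 \<eta> \<noteq> 0" and z: "\<zeta> \<in> Kk k"
  shows "\<exists>v. \<exists>\<xi>\<in>Mk (k - 1). \<zeta> = v *s \<eta> + L *s \<xi>"
proof -
  obtain v where v: "homogeneous (k - n) v" "r3 \<zeta> = r3 (v *s \<eta>)" using V_generator[OF b e z] by blast
  have "v *s \<eta> \<in> Kk k" using Kk_scale[OF v(1) e(1)] by simp
  then have "\<zeta> - v *s \<eta> \<in> {\<theta> \<in> Kk k. r3 \<theta> = 0}" using z v(2) by (simp add: Kk_diff r3_diff)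
  then obtain \<xi> where "\<xi> \<in> Mk (k - 1)" "\<zeta> - v *s \<eta> = L *s \<xi>" unfolding kernel_r3 by blast
  then show ?thesis by (metis add.commute diff_add_cancel)
qed

text \<open>Graded Nakayama for the multiplication by \<open>L\<close>.\<close>

lemma M_generators:
  assumes G: "restr_gcd G" and b: "\<And>j. int (dV j) \<le> int (nat (j + 1 - n))"
    and e: "\<eta> \<in> Kk n" "r3 \<eta> \<noteq> 0" and th: "\<theta> \<in> Mk (int (degree G))" "psi \<theta> \<noteq> 0"
  shows "\<zeta> \<in> Mk k \<Longrightarrow> \<exists>u v. \<zeta> = u *s \<theta> + v *s \<eta>"
proof (induction "nat (k + 1)" arbitrary: k \<zeta>)
  case 0
  then have "\<zeta> = 0" using Hd_neg[of k] by (simp add: Mk_def)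
  then show ?case by (intro exI[of _ 0]) simp
next
  case (Suc m)
  obtain u where u: "homogeneous (k - int (degree G)) u" "psi \<zeta> = r u * psi \<theta>" using psi_generator[OF G th Suc.prems] by blast
  have "u *s \<theta> \<in> Mk k" using Mk_scale[OF u(1) th(1)] by simp
  then have "\<zeta> - u *s \<theta> \<in> Kk k" using Suc.prems u(2) by (simp add: Kk_def Mk_def D0_diff Hd_diff psi_diff psi_scale)
  then obtain v \<xi> where v: "\<xi> \<in> Mk (k - 1)" "\<zeta> - u *s \<theta> = v *s \<eta> + L *s \<xi>" using K_quotient[OF b e] by blast
  have "m = nat (k - 1 + 1)" using Suc.hyps(2) by simp
  then obtain u' v' where "\<xi> = u' *s \<theta> + v' *s \<eta>" using Suc.hyps(1)[OF _ v(1)] by blast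
  with v(2) have "\<zeta> = (u + L * u') *s \<theta> + (v + L * v') *s \<eta>" by (simp add: vec_eq_iff algebra_simps)
  then show ?case by blast
qed

lemma psi_nonzero: "\<exists>\<theta>\<in>D0 g. psi \<theta> \<noteq> 0"
proof
  show "kosz dg g R \<in> D0 g" by (rule kosz_D0[OF g(1)])
  show "psi (kosz dg g R) \<noteq> 0" using degree_rg g(2) by (simp add: psi_kosz dual)
qed

lemma dI_nonzero: "dI k \<noteq> 0 \<Longrightarrow> \<exists>\<theta>\<in>Mk k. psi \<theta> \<noteq> 0"
  using dI_zero[of k] psi_linear Mk_0[of k] unfolding Ik_def by force

lemma dV_nonzero: "dV k \<noteq> 0 \<Longrightarrow> \<exists>\<eta>\<in>Kk k. r3 \<eta> \<noteq> 0"
proof (rule ccontr)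
  assume "dV k \<noteq> 0" "\<not> (\<exists>\<eta>\<in>Kk k. r3 \<eta> \<noteq> 0)"
  moreover have "0 \<in> Vk k" using V3.fd_subset[OF fd_V] by simp
  ultimately have "Vk k = {0}" unfolding Vk_def by force
  then show False using dV_zero \<open>dV k \<noteq> 0\<close> by blast
qed

lemma dV_r3: "int (dV k) \<le> 0 \<Longrightarrow> \<eta> \<in> Kk k \<Longrightarrow> r3 \<eta> = 0"
proof -
  assume "int (dV k) \<le> 0" "\<eta> \<in> Kk k"
  then have "fd sc3 {0} (Vk k) 0" using fd_V[of k] by simp
  then have "Vk k = {0}" by (simp only: V3.fd_0)
  then show ?thesis using \<open>\<eta> \<in> Kk k\<close> unfolding Vk_def by blast
qed

lemma dM_neg: "dM (-1) = 0"
proof -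
  have "Mk (-1) = {0}" using Hd_neg[of "-1"] D0_0 by (auto simp: Mk_def)
  then have "fd scV {0} (Mk (-1)) 0" by (simp only: fd_refl)
  from VV.fd_unique[OF dM this VV.subspace_single_0] show ?thesis .
qed

context
  fixes G a b K
  assumes G: "restr_gcd G" and ab: "0 < a" "a \<le> (b :: int)"
    and hil: "\<And>k. k \<ge> K \<Longrightarrow> 2 * int (dM k) = (k - a + 1) * (k - a + 2) + (k - b + 1) * (k - b + 2)"
begin

text \<open>As \<open>a + b\<close> will be \<open>deg g - 1\<close>, this is
  \<open>deg g - 1 - deg G\<close>.\<close>

private definition "n = a + b - int (degree G)"

private lemma dV_asymptotic: "\<exists>K. \<forall>k\<ge>K. int (dV k) = k + 1 - n"
proof -
  obtain K1 where K1: "\<forall>k\<ge>K1. int (dI k) = k + 1 - int (degree G)" using G by (auto simp: restr_gcd_def)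
  have "int (dV k) = k + 1 - n" if "k \<ge> max K1 (K + 1)" for k
  proof -
    have "2 * int (dM k) - 2 * int (dM (k - 1)) = 2 * (2 * k + 2 - a - b)"
      using that hil[of k] hil[of "k - 1"] by (simp add: algebra_simps)
    moreover have "int (dI k) = k + 1 - int (degree G)" using K1 that by simp
    ultimately show ?thesis using dims_MKI[of k] dims_KV[of k] by (simp add: n_def)
  qed
  then show ?thesis by blast
qed

private lemma dV_le: "int (dV j) \<le> int (nat (j + 1 - n))"
proof -
  obtain K1 where "\<forall>k\<ge>K1. int (dV k) = k + 1 - n" using dV_asymptotic by blast
  then show ?thesis using dV_bound[of K1 n] by blast
qed

private lemma dI_le: "int (dI j) \<le> int (nat (j + 1 - int (degree G)))"
proof -
  obtain K1 where "\<forall>k\<ge>K1. int (dI k) = k + 1 - int (degree G)" using G by (auto simp: restr_gcd_def)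
  then show ?thesis using dI_bound[of K1 "int (degree G)"] by blast
qed

private lemma stepM: "int (dM k) \<le> int (dM (k - 1)) + int (nat (k + 1 - n)) + int (nat (k + 1 - int (degree G)))"
  using dims_MKI[of k] dims_KV[of k] dI_le[of k] dV_le[of k] by linarith

private lemma sum_n: "n + int (degree G) = a + b" by (simp add: n_def)

lemma addition_a: "0 \<le> (a + b - int (degree G) - a) * (a + b - int (degree G) - b)"
  using hilbert_compare(1)[of dM n "int (degree G)" K a b, OF dM_neg stepM hil sum_n] by (simp add: n_def)

lemma addition_b:
  assumes eq: "a + b - int (degree G) = a \<or> a + b - int (degree G) = b"
  shows "free_with_exponents g a b"
proof -
  have z: "(n - a) * (n - b) = 0" using eq by (auto simp: n_def)
  have n0: "n \<ge> 0" using eq ab by (auto simp: n_def)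
  have ex: "int (dM k) = int (dM (k - 1)) + int (nat (k + 1 - n)) + int (nat (k + 1 - int (degree G)))" if "k \<ge> 0" for k
    by (rule hilbert_compare(2)[of dM n "int (degree G)" K a b, OF dM_neg stepM hil sum_n z that])
  \<comment> \<open>In degree \<open>n\<close> the sum of the two bounds is attained, and the bound
    for \<open>dV n\<close> is 1.\<close>
  have "dV n \<noteq> 0" using ex[OF n0] dims_MKI[of n] dims_KV[of n] dI_le[of n] by simp
  then obtain \<eta> where e: "\<eta> \<in> Kk n" "r3 \<eta> \<noteq> 0" using dV_nonzero by blast
  have "dI (int (degree G)) \<noteq> 0"
    using ex[of "int (degree G)"] dims_MKI[of "int (degree G)"] dims_KV[of "int (degree G)"] dV_le[of "int (degree G)"] by simp
  then obtain \<theta> where th: "\<theta> \<in> Mk (int (degree G))" "psi \<theta> \<noteq> 0" using dI_nonzero by blast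
  have gen: "generates \<theta> \<eta> (D0 g)"
    using M_generators[OF G dV_le e th] unfolding Mk_def by (rule generates_homogeneous[OF g(1)])
  have "g \<noteq> 0" using g(3) by auto
  then obtain l where l: "pd l g \<noteq> 0" using partial_nonzero[OF g(1,2)] by blast
  have D: "\<theta> \<in> D0 g \<inter> Hd (int (degree G))" "\<eta> \<in> D0 g \<inter> Hd n" using e th by (auto simp: Kk_def Mk_def)
  show ?thesis
  proof (cases "n = b")
    case True
    then have "int (degree G) = a" by (simp add: n_def)
    then show ?thesis using free_with_exponentsI[OF D(1,2) gen l] True by simp
  next
    case False
    then have "n = a" using eq unfolding n_def by auto
    moreover from this have "int (degree G) = b" by (simp add: n_def)
    ultimately show ?thesis using free_with_exponentsI[OF D(2,1) generates_commute[OF gen] l] by simp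
  qed
qed

text \<open>The hypothesis means \<open>deg G > b\<close>. Homogeneous generators of a free
  \<open>D0 g\<close> have degree at most \<open>b\<close>, so \<open>psi\<close> vanishes on them
  and hence on all of \<open>D0 g\<close>, which the Koszul derivation contradicts.\<close>

lemma addition_c:
  assumes lt: "a + b - int (degree G) < a"
  shows "\<not> free_curve g"
proof
  assume fr: "free_curve g"
  have "g \<noteq> 0" using g(3) by auto
  then obtain l where l: "pd l g \<noteq> 0" using partial_nonzero[OF g(1,2)] by blast
  have "\<exists>N. fd scV {0} (D0 g \<inter> Hd k) N \<and> 2 * int N = (k - a + 1) * (k - a + 2) + (k - b + 1) * (k - b + 2)" if "k \<ge> K" for k
    using dM[of k] hil[OF that] unfolding Mk_def by blast
  from free_exponents_le[OF g(1) l fr ab(2) this]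
  obtain p q \<theta> \<eta> where pq: "\<theta> \<in> Mk p" "\<eta> \<in> Mk q" "generates \<theta> \<eta> (D0 g)" "p \<le> b" "q \<le> b" unfolding Mk_def by blast
  have "psi \<theta> = 0" "psi \<eta> = 0" using Mk_Pl_zero[OF G pq(1)] Mk_Pl_zero[OF G pq(2)] pq(4,5) lt by simp_all
  moreover obtain \<zeta> where z: "\<zeta> \<in> D0 g" "psi \<zeta> \<noteq> 0" using psi_nonzero by blast
  moreover obtain u v where "\<zeta> = u *s \<theta> + v *s \<eta>" using pq(3) z(1) unfolding generates_def by blast
  ultimately show False by (simp add: psi_add psi_scale)
qed

end

section \<open>Deletion: the derivations of \<open>L * g\<close> and its freeness\<close>

lemma psi_dvd: "\<zeta> \<in> Hd k \<Longrightarrow> psi \<zeta> = 0 \<longleftrightarrow> L dvd der_apply \<zeta> L"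
  unfolding psi_def
  by (rule r_kernel[OF der_apply_homogeneous[OF lin(3)]]) (simp add: Hd_def)

abbreviation "F \<equiv> L * g"

lemma homogeneous_F: "homogeneous (int (dg + 1)) F"
  using homogeneous_mult[OF lin(3) g(1)] by (simp add: add.commute)

lemma F_nonzero: "F \<noteq> 0" using L_nonzero g(3) by auto

lemma euler_F: "der_apply euler_der F = of_nat (dg + 1) * F"
  by (rule euler_der_apply[OF homogeneous_F])

lemma euler_L: "der_apply euler_der L = L"
  using euler_der_apply[of 1 L] lin(3) by simp

text \<open>Adding a multiple of the Euler derivation identifies \<open>D0 (L * g)\<close> with the derivations in
  \<open>D0 g\<close> that preserve the ideal \<open>(L)\<close>.\<close>

lemma D0_F_to_K:
  assumes z: "\<zeta> \<in> D0 F \<inter> Hd k"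
  shows "\<exists>c. homogeneous (k - 1) c \<and> \<zeta> + c *s euler_der \<in> Kk k"
proof -
  have 0: "der_apply \<zeta> L * g + L * der_apply \<zeta> g = 0" using z by (simp add: D0_iff der_apply_mult algebra_simps)
  have "psi \<zeta> * r g = 0" using arg_cong[OF 0, of r]
    by (simp add: psi_def rhom_add[OF r_hom] rhom_mult[OF r_hom] rhom_0[OF r_hom] r_L)
  then have "L dvd der_apply \<zeta> L" using degree_rg z psi_dvd[of \<zeta> k] by simp
  then obtain c where c: "der_apply \<zeta> L = L * c" by (elim dvdE)
  have "L * (c * g + der_apply \<zeta> g) = 0" using 0 c by (simp add: algebra_simps)
  then have zg: "der_apply \<zeta> g = - (c * g)" using L_nonzero by (simp add: eq_neg_iff_add_eq_0 add.commute)
  have "homogeneous (k + 1 - 1) (der_apply \<zeta> L)" by (rule der_apply_homogeneous[OF lin(3)]) (use z in \<open>simp add: Hd_def\<close>)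
  then have hc: "homogeneous (k - 1) c" unfolding c by (intro L_quotient) simp
  \<comment> \<open>The Euler derivation multiplies \<open>g\<close> by \<open>dg\<close>, so this
    multiple of it cancels the value \<open>- c g\<close> of \<open>\<zeta>\<close> at
    \<open>g\<close>.\<close>
  define c' where "c' = SC (1 / of_nat dg) * c"
  have hc': "homogeneous (k - 1) c'" unfolding c'_def by (rule homogeneous_SC_mult[OF hc])
  have cc: "of_nat dg * c' = c" using g(2)
    by (simp add: c'_def of_nat_SC mult.assoc[symmetric] rhom_mult[OF SC_hom, symmetric] rhom_1[OF SC_hom])
  have "\<zeta> + c' *s euler_der \<in> D0 g"
    using zg cc by (simp add: D0_iff der_apply_add der_apply_scale euler_der_apply[OF g(1)] mult.assoc[symmetric] mult.commute)
  moreover have "\<zeta> + c' *s euler_der \<in> Hd k" using Hd_add[of \<zeta> k] Hd_scale[OF hc' euler_der_Hd] z by simp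
  moreover have "psi (\<zeta> + c' *s euler_der) = 0"
    unfolding psi_def der_apply_add der_apply_scale euler_L c by (simp add: rhom_add[OF r_hom] rhom_mult[OF r_hom] r_L)
  ultimately show ?thesis using hc' by (auto simp: Kk_def Mk_def)
qed

lemma K_to_D0_F:
  assumes e: "\<eta> \<in> Kk k"
  shows "\<exists>c. homogeneous (k - 1) c \<and> \<eta> + c *s euler_der \<in> D0 F \<inter> Hd k"
proof -
  have H: "\<eta> \<in> Hd k" "der_apply \<eta> g = 0" using e by (simp_all add: Kk_def Mk_def D0_iff)
  have "L dvd der_apply \<eta> L" using e psi_dvd[of \<eta> k] by (simp add: Kk_def Mk_def)
  then obtain c where c: "der_apply \<eta> L = L * c" by (elim dvdE)
  have "homogeneous (k + 1 - 1) (der_apply \<eta> L)" by (rule der_apply_homogeneous[OF lin(3)]) (use H in \<open>simp add: Hd_def\<close>)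
  then have hc: "homogeneous (k - 1) c" unfolding c by (intro L_quotient) simp
  \<comment> \<open>This time the value \<open>c L g\<close> of \<open>\<eta>\<close> at
    \<open>L * g\<close> has to be cancelled, and the degree of \<open>L * g\<close> is
    \<open>dg + 1\<close>.\<close>
  define c' where "c' = SC (- 1 / of_nat (dg + 1)) * c"
  have hc': "homogeneous (k - 1) c'" unfolding c'_def by (rule homogeneous_SC_mult[OF hc])
  have "of_nat (dg + 1) * c' = SC (of_nat (dg + 1) * (- 1 / of_nat (dg + 1))) * c"
    unfolding c'_def of_nat_SC rhom_mult[OF SC_hom] by (simp only: mult.assoc)
  also have "of_nat (dg + 1) * (- 1 / of_nat (dg + 1)) = (- 1 :: complex)" by (simp add: divide_simps del: of_nat_add of_nat_Suc)
  finally have cc: "of_nat (dg + 1) * c' = - c" by (simp add: rhom_minus[OF SC_hom] rhom_1[OF SC_hom])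
  have "der_apply (\<eta> + c' *s euler_der) F = L * c * g + of_nat (dg + 1) * c' * F"
    unfolding der_apply_add der_apply_scale euler_F der_apply_mult[of \<eta>] H c by (simp add: algebra_simps)
  then have "\<eta> + c' *s euler_der \<in> D0 F" unfolding cc D0_iff by (simp add: algebra_simps)
  moreover have "\<eta> + c' *s euler_der \<in> Hd k" using Hd_add[OF H(1)] Hd_scale[OF hc' euler_der_Hd] by simp
  ultimately show ?thesis using hc' by auto
qed

lemma euler_D0_F: "c *s euler_der \<in> D0 F \<Longrightarrow> c = 0"
  using F_nonzero unfolding D0_iff der_apply_scale euler_F
  by (simp del: of_nat_Suc of_nat_add add: L_nonzero)

lemma euler_D0_g: "c *s euler_der \<in> D0 g \<Longrightarrow> c = 0"
  using g(2,3) unfolding D0_iff der_apply_scale euler_der_apply[OF g(1)] by auto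

text \<open>The correction by the Euler derivation is linear but involves a division by
  \<open>L\<close>. Multiplying by \<open>L\<close> avoids it: if \<open>\<zeta> + c E\<close> is
  tangent and kills \<open>g\<close>, then \<open>\<zeta>(L) = dg c L\<close>, so
  \<open>T \<zeta>\<close> is \<open>dg L (\<zeta> + c E)\<close>.\<close>

lemma dK_D0_F: "fd scV {0} (D0 F \<inter> Hd k) (dK k)"
proof -
  define T where "T \<zeta> = of_nat dg * L *s \<zeta> + der_apply \<zeta> L *s euler_der" for \<zeta>
  have lin: "Vector_Spaces.linear scV scV T"
    by (rule linI) (simp_all add: VV.vspace_axioms T_def der_apply_add der_apply_scale scV_def vec_eq_iff algebra_simps)
  have kerT: "\<zeta> = 0" if "\<zeta> \<in> D0 F \<inter> Hd k" "T \<zeta> = 0" for \<zeta>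
  proof -
    have "der_apply (T \<zeta>) L = 0" using that by (simp add: der_apply_sum)
    moreover have "der_apply (T \<zeta>) L = of_nat (dg + 1) * (L * der_apply \<zeta> L)"
      unfolding T_def der_apply_add der_apply_scale euler_L by (simp add: algebra_simps)
    ultimately have "of_nat (dg + 1) * (L * der_apply \<zeta> L) = 0" by simp
    then have "der_apply \<zeta> L = 0" using L_nonzero by (simp del: of_nat_Suc of_nat_add)
    then have "(of_nat dg * L) *s \<zeta> = 0" using that(2) by (simp add: T_def)
    then show "\<zeta> = 0" using L_nonzero g(2) by (simp add: vec_eq_iff)
  qed
  have "fd scV {0} ((\<lambda>\<eta>. L *s \<eta>) ` Kk k) (dK k)"
  proof (rule VV.fd_inj_image[OF dK VV.vspace_axioms])
    show "Vector_Spaces.linear scV scV (\<lambda>\<theta>. L *s \<theta>)"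
      by (rule linI) (simp_all add: VV.vspace_axioms scV_def vec_eq_iff algebra_simps)
    show "L *s v = 0 \<Longrightarrow> v = 0" for v using L_nonzero by (simp add: vec_eq_iff)
  qed
  moreover have "T ` (D0 F \<inter> Hd k) = (\<lambda>\<eta>. L *s \<eta>) ` Kk k"
  proof (intro subset_antisym subsetI)
    fix x assume "x \<in> T ` (D0 F \<inter> Hd k)"
    then obtain \<zeta> where z: "\<zeta> \<in> D0 F \<inter> Hd k" "x = T \<zeta>" by blast
    obtain c where c: "homogeneous (k - 1) c" "\<zeta> + c *s euler_der \<in> Kk k" using D0_F_to_K[OF z(1)] by blast
    define \<eta> where "\<eta> = \<zeta> + c *s euler_der"
    have "der_apply \<eta> g = 0" using c by (simp add: \<eta>_def Kk_def Mk_def D0_iff)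
    then have zg: "der_apply \<zeta> g = - (of_nat dg * c * g)" unfolding \<eta>_def der_apply_add der_apply_scale euler_der_apply[OF g(1)]
      by (simp add: eq_neg_iff_add_eq_0 algebra_simps)
    have "der_apply \<zeta> F = 0" using z by (simp add: D0_iff)
    then have "g * (der_apply \<zeta> L - of_nat dg * c * L) = 0" unfolding der_apply_mult zg by (simp add: algebra_simps)
    then have "der_apply \<zeta> L = of_nat dg * c * L" using F_nonzero by simp
    then have "T \<zeta> = L *s (of_nat dg *s \<eta>)" unfolding T_def \<eta>_def by (simp add: vec_eq_iff algebra_simps)
    moreover have "of_nat dg *s \<eta> \<in> Kk k"
      using Kk_scale[of 0 "of_nat dg" \<eta> k] c homogeneous_SC[of "of_nat dg"] by (simp add: \<eta>_def of_nat_SC)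
    ultimately show "x \<in> (\<lambda>\<eta>. L *s \<eta>) ` Kk k" using z by blast
  next
    fix x assume "x \<in> (\<lambda>\<eta>. L *s \<eta>) ` Kk k"
    then obtain \<eta> where e: "\<eta> \<in> Kk k" "x = L *s \<eta>" by blast
    obtain c where c: "homogeneous (k - 1) c" "\<eta> + c *s euler_der \<in> D0 F \<inter> Hd k" using K_to_D0_F[OF e(1)] by blast
    define \<zeta> where "\<zeta> = \<eta> + c *s euler_der"
    have "der_apply \<eta> g = 0" using e by (simp add: Kk_def Mk_def D0_iff)
    then have zg: "der_apply \<zeta> g = of_nat dg * c * g" unfolding \<zeta>_def der_apply_add der_apply_scale euler_der_apply[OF g(1)]
      by (simp add: algebra_simps)
    have "der_apply \<zeta> F = 0" using c by (simp add: D0_iff \<zeta>_def)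
    then have "g * (der_apply \<zeta> L + of_nat dg * c * L) = 0" unfolding der_apply_mult zg by (simp add: algebra_simps)
    then have "der_apply \<zeta> L + of_nat dg * c * L = 0" using F_nonzero by simp
    then have "der_apply \<zeta> L = - (of_nat dg * c * L)" by (simp add: eq_neg_iff_add_eq_0)
    then have T: "T \<zeta> = of_nat dg *s x" unfolding T_def \<zeta>_def e by (simp add: vec_eq_iff algebra_simps)
    interpret T: Vector_Spaces.linear scV scV T by (rule lin)
    have "T (scV (1 / of_nat dg) \<zeta>) = SC (1 / of_nat dg) *s (SC (of_nat dg) *s x)"
      unfolding T.scale unfolding T by (simp add: scV_def of_nat_SC)
    also have "\<dots> = x" using g(2) by (simp add: vec_eq_iff mult.assoc[symmetric] rhom_mult[OF SC_hom, symmetric] rhom_1[OF SC_hom])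
    finally have "x = T (scV (1 / of_nat dg) \<zeta>)" by simp
    moreover have "scV (1 / of_nat dg) \<zeta> \<in> D0 F \<inter> Hd k"
      using D0_scale[of \<zeta> F] c(2) Hd_scale[OF homogeneous_SC, of \<zeta> k] unfolding \<zeta>_def[symmetric] by (simp add: scV_def)
    ultimately show "x \<in> T ` (D0 F \<inter> Hd k)" by (rule image_eqI)
  qed
  moreover obtain N where N: "fd scV {0} (D0 F \<inter> Hd k) N"
    using VV.fd_sub[OF fd_Hd VV.subspace_single_0, of "D0 F \<inter> Hd k" k] VV.subspace_inter[OF subspace_D0 subspace_Hd] D0_0
    by (metis VV.subspace_0 Int_lower2 empty_subsetI insert_subset)
  ultimately have "N = dK k"
    using VV.fd_unique[OF VV.fd_inj_image[OF N VV.vspace_axioms lin kerT] _ VV.subspace_single_0] by simp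
  then show ?thesis using N by simp
qed

context
  fixes G a b K
  assumes G: "restr_gcd G" and ab: "0 < a" "a \<le> (b :: int)"
    and hil: "\<And>k. k \<ge> K \<Longrightarrow> 2 * int (dK k) = (k - a + 1) * (k - a + 2) + (k - b + 1) * (k - b + 2)"
begin

text \<open>Now \<open>a + b\<close> will be \<open>dg\<close>. The spaces compared are the
  \<open>Kk\<close>, with \<open>dK k - dK (k - 1) = dV k + dI (k - 1)\<close>; the shift of
  \<open>dI\<close> by one degree turns the second exponent into \<open>deg G + 1\<close>.\<close>

private definition "nd = a + b - 1 - int (degree G)"

private lemma dV_asymptotic_del: "\<exists>K. \<forall>k\<ge>K. int (dV k) = k + 1 - nd"
proof -
  obtain K1 where K1: "\<forall>k\<ge>K1. int (dI k) = k + 1 - int (degree G)" using G by (auto simp: restr_gcd_def)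
  have "int (dV k) = k + 1 - nd" if "k \<ge> max (K1 + 1) (K + 1)" for k
  proof -
    have "2 * int (dK k) - 2 * int (dK (k - 1)) = 2 * (2 * k + 2 - a - b)"
      using that hil[of k] hil[of "k - 1"] by (simp add: algebra_simps)
    moreover have "int (dI (k - 1)) = k - int (degree G)" using K1 that by simp
    ultimately show ?thesis using dims_MKI[of "k - 1"] dims_KV[of k] by (simp add: nd_def)
  qed
  then show ?thesis by blast
qed

private lemma dV_le_del: "int (dV j) \<le> int (nat (j + 1 - nd))"
proof -
  obtain K1 where "\<forall>k\<ge>K1. int (dV k) = k + 1 - nd" using dV_asymptotic_del by blast
  then show ?thesis using dV_bound[of K1 nd] by blast
qed

private lemma dI_le_del: "int (dI (k - 1)) \<le> int (nat (k + 1 - (int (degree G) + 1)))"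
proof -
  obtain K1 where "\<forall>k\<ge>K1. int (dI k) = k + 1 - int (degree G)" using G by (auto simp: restr_gcd_def)
  then show ?thesis using dI_bound[of K1 "int (degree G)" "k - 1"] by simp
qed

private lemma stepK: "int (dK k) \<le> int (dK (k - 1)) + int (nat (k + 1 - nd)) + int (nat (k + 1 - (int (degree G) + 1)))"
  using dims_MKI[of "k - 1"] dims_KV[of k] dI_le_del[of k] dV_le_del[of k] by linarith

private lemma sum_n_del: "nd + (int (degree G) + 1) = a + b" by (simp add: nd_def)

private lemma dK_neg: "dK (-1) = 0" using dM_neg dims_MKI[of "-1"] by simp

lemma deletion_a: "0 \<le> (a + b - 1 - int (degree G) - a) * (a + b - 1 - int (degree G) - b)"
  using hilbert_compare(1)[of dK nd "int (degree G) + 1" K a b, OF dK_neg stepK hil sum_n_del] by (simp add: nd_def)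

lemma deletion_b:
  assumes eq: "a + b - 1 - int (degree G) = a \<or> a + b - 1 - int (degree G) = b"
  shows "free_with_exponents F a b"
proof -
  have z: "(nd - a) * (nd - b) = 0" using eq by (auto simp: nd_def)
  have n0_del: "nd \<ge> 0" using eq ab by (auto simp: nd_def)
  have ex: "int (dK k) = int (dK (k - 1)) + int (nat (k + 1 - nd)) + int (nat (k + 1 - (int (degree G) + 1)))" if "k \<ge> 0" for k
    by (rule hilbert_compare(2)[of dK nd "int (degree G) + 1" K a b, OF dK_neg stepK hil sum_n_del z that])
  have "dV nd \<noteq> 0" using ex[OF n0_del] dims_MKI[of "nd - 1"] dims_KV[of nd] dI_le_del[of nd] by simp
  then obtain \<eta> where e: "\<eta> \<in> Kk nd" "r3 \<eta> \<noteq> 0" using dV_nonzero by blast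
  have "dI (int (degree G) + 1 - 1) \<noteq> 0"
    using ex[of "int (degree G) + 1"] dims_MKI[of "int (degree G) + 1 - 1"] dims_KV[of "int (degree G) + 1"]
      dV_le_del[of "int (degree G) + 1"] by linarith
  then obtain \<theta> where th: "\<theta> \<in> Mk (int (degree G))" "psi \<theta> \<noteq> 0" using dI_nonzero[of "int (degree G)"] by auto
  define p where "p = int (degree G) + 1"
  \<comment> \<open>\<open>\<theta>\<close> is not tangent to the line, but
    \<open>L \<theta>\<close> is; this accounts for the generator of degree
    \<open>deg G + 1\<close>.\<close>
  have L\<theta>: "L *s \<theta> \<in> Kk p" using Mk_scale[OF lin(3) th(1)]
    by (simp add: Kk_def psi_scale r_L p_def add.commute)
  obtain c1 where c1: "\<eta> + c1 *s euler_der \<in> D0 F \<inter> Hd nd" using K_to_D0_F[OF e(1)] by blast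
  obtain c2 where c2: "L *s \<theta> + c2 *s euler_der \<in> D0 F \<inter> Hd p" using K_to_D0_F[OF L\<theta>] by blast
  have gen: "generates (\<eta> + c1 *s euler_der) (L *s \<theta> + c2 *s euler_der) (D0 F)"
  proof (rule generates_homogeneous[OF homogeneous_F])
    fix k \<zeta> assume z: "\<zeta> \<in> D0 F \<inter> Hd k"
    obtain c where "\<zeta> + c *s euler_der \<in> Kk k" using D0_F_to_K[OF z] by blast
    then obtain v \<xi> where v: "\<xi> \<in> Mk (k - 1)" "\<zeta> + c *s euler_der = v *s \<eta> + L *s \<xi>"
      using K_quotient[OF dV_le_del e] by blast
    obtain u w where uw: "\<xi> = u *s \<theta> + w *s \<eta>" using M_generators[OF G dV_le_del e th v(1)] by blast
    \<comment> \<open>\<open>\<zeta>\<close> and the candidate \<open>\<zeta>'\<close> differ by a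
      multiple of the Euler derivation, and such a multiple lies in \<open>D0 F\<close> only if it
      is 0.\<close>
    define \<zeta>' where "\<zeta>' = (v + L * w) *s (\<eta> + c1 *s euler_der) + u *s (L *s \<theta> + c2 *s euler_der)"
    define d where "d = (v + L * w) * c1 + u * c2 + c"
    have "d *s euler_der + \<zeta> = \<zeta>'"
    proof -
      have "\<zeta> = v *s \<eta> + L *s \<xi> - c *s euler_der" using v(2) by (simp add: eq_diff_eq)
      then have zi: "\<zeta> $ i = v * \<eta> $ i + L * \<xi> $ i - c * euler_der $ i" for i by simp
      show ?thesis unfolding \<zeta>'_def d_def vec_eq_iff by (simp add: zi uw algebra_simps)
    qed
    moreover have "\<zeta>' \<in> D0 F" unfolding \<zeta>'_def
      by (intro D0_add[OF D0_scale D0_scale] IntD1[OF c1] IntD1[OF c2])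
    ultimately have "d *s euler_der = \<zeta>' - \<zeta>" "\<zeta>' - \<zeta> \<in> D0 F" using z by (auto simp: D0_diff)
    then have "d = 0" using euler_D0_F by metis
    then have "\<zeta> = \<zeta>'" using \<open>d *s euler_der + \<zeta> = \<zeta>'\<close> by simp
    then show "\<exists>u v. \<zeta> = u *s (\<eta> + c1 *s euler_der) + v *s (L *s \<theta> + c2 *s euler_der)" unfolding \<zeta>'_def by blast
  qed
  obtain l where l: "pd l F \<noteq> 0" using partial_nonzero[OF homogeneous_F _ F_nonzero] by auto
  show ?thesis
  proof (cases "nd = b")
    case True
    then have "p = a" by (simp add: nd_def p_def)
    then show ?thesis using free_with_exponentsI[OF c2 c1 generates_commute[OF gen] l] True by simp
  next
    case False
    then have "nd = a" using eq unfolding nd_def by auto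
    moreover from this have "p = b" by (simp add: nd_def p_def)
    ultimately show ?thesis using free_with_exponentsI[OF c1 c2 gen l] by simp
  qed
qed

text \<open>The corrected generators lie in \<open>Kk p\<close> and \<open>Kk q\<close> with
  \<open>p, q \<le> b < nd\<close>, where \<open>dV\<close> is 0, so they restrict to 0. Then so
  would every element of every \<open>Kk k\<close>, although \<open>dV k = k + 1 - nd\<close> for
  large \<open>k\<close>.\<close>

lemma deletion_c:
  assumes gt: "a + b - 1 - int (degree G) > b"
  shows "\<not> free_curve F"
proof
  assume fr: "free_curve F"
  obtain l where l: "pd l F \<noteq> 0" using partial_nonzero[OF homogeneous_F _ F_nonzero] by auto
  have "\<exists>N. fd scV {0} (D0 F \<inter> Hd k) N \<and> 2 * int N = (k - a + 1) * (k - a + 2) + (k - b + 1) * (k - b + 2)" if "k \<ge> K" for k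
    using dK_D0_F[of k] hil[OF that] by blast
  from free_exponents_le[OF homogeneous_F l fr ab(2) this]
  obtain p q \<theta> \<eta> where pq: "\<theta> \<in> D0 F \<inter> Hd p" "\<eta> \<in> D0 F \<inter> Hd q" "generates \<theta> \<eta> (D0 F)" "p \<le> b" "q \<le> b" by blast
  obtain c1 where c1: "\<theta> + c1 *s euler_der \<in> Kk p" using D0_F_to_K[OF pq(1)] by blast
  obtain c2 where c2: "\<eta> + c2 *s euler_der \<in> Kk q" using D0_F_to_K[OF pq(2)] by blast
  have r0: "r3 (\<theta> + c1 *s euler_der) = 0" "r3 (\<eta> + c2 *s euler_der) = 0"
  proof -
    have "int (dV p) \<le> 0" "int (dV q) \<le> 0" using dV_le_del[of p] dV_le_del[of q] pq gt by (simp_all add: nd_def)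
    then show "r3 (\<theta> + c1 *s euler_der) = 0" "r3 (\<eta> + c2 *s euler_der) = 0" using dV_r3 c1 c2 by blast+
  qed
  obtain K1 where K1: "\<forall>k\<ge>K1. int (dV k) = k + 1 - nd" using dV_asymptotic_del by blast
  define k where "k = max K1 nd"
  have "int (dV k) = k + 1 - nd" "nd \<le> k" using K1 by (auto simp: k_def)
  then have "dV k \<noteq> 0" by auto
  then obtain \<xi> where x: "\<xi> \<in> Kk k" "r3 \<xi> \<noteq> 0" using dV_nonzero by blast
  obtain c where "\<xi> + c *s euler_der \<in> D0 F" using K_to_D0_F[OF x(1)] by blast
  then obtain u v where uv: "\<xi> + c *s euler_der = u *s \<theta> + v *s \<eta>" using pq(3) unfolding generates_def by blast
  define \<xi>' where "\<xi>' = u *s (\<theta> + c1 *s euler_der) + v *s (\<eta> + c2 *s euler_der)"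
  have "(u * c1 + v * c2 + c) *s euler_der = \<xi>' - \<xi>"
  proof -
    have "\<xi> = u *s \<theta> + v *s \<eta> - c *s euler_der" using uv by (simp only: eq_diff_eq)
    then have xi: "\<xi> $ i = u * \<theta> $ i + v * \<eta> $ i - c * euler_der $ i" for i by simp
    show ?thesis unfolding \<xi>'_def vec_eq_iff by (simp add: xi algebra_simps)
  qed
  moreover have "\<xi>' - \<xi> \<in> D0 g" 
  proof -
    have "\<theta> + c1 *s euler_der \<in> D0 g" "\<eta> + c2 *s euler_der \<in> D0 g" "\<xi> \<in> D0 g" using c1 c2 x(1) by (simp_all add: Kk_def Mk_def)
    then show ?thesis unfolding \<xi>'_def by (intro D0_diff[OF D0_add[OF D0_scale D0_scale]])
  qed
  ultimately have "u * c1 + v * c2 + c = 0" "(u * c1 + v * c2 + c) *s euler_der = \<xi>' - \<xi>" using euler_D0_g by metis+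
  then have "\<xi> = \<xi>'" by simp
  moreover have "r3 \<xi>' = 0" 
  proof -
    have add: "r3 (x + y) = r3 x + r3 y" for x y by (simp add: r3_def vec_eq_iff rhom_add[OF r_hom])
    show ?thesis unfolding \<xi>'_def add[of "u *s _"] r3_scale r0 by (simp add: vec_eq_iff)
  qed
  ultimately show False using x(2) by simp
qed

end

end

section \<open>Logarithmic derivations at a point of the line\<close>

text \<open>The Jacobian ideal of \<open>f\<close>.\<close>

definition jid :: "S \<Rightarrow> S set" where "jid f = range (\<lambda>\<theta>. der_apply \<theta> f)"

lemma ideal_jid: "is_ideal (jid f)"
  unfolding is_ideal_def
proof (intro conjI ballI allI)
  show "0 \<in> jid f" unfolding jid_def by (rule range_eqI[of _ _ 0]) (simp add: der_apply_sum)
  fix x assume "x \<in> jid f"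
  then obtain \<theta> where x: "x = der_apply \<theta> f" by (auto simp: jid_def)
  show "a * x \<in> jid f" for a unfolding jid_def by (rule range_eqI[of _ _ "a *s \<theta>"]) (simp add: x der_apply_scale)
  fix y assume "y \<in> jid f"
  then obtain \<eta> where y: "y = der_apply \<eta> f" by (auto simp: jid_def)
  show "x + y \<in> jid f" unfolding jid_def by (rule range_eqI[of _ _ "\<theta> + \<eta>"]) (simp add: x y der_apply_add)
qed

lemma ptl_jid: "ptl b f \<in> jid f"
  unfolding jid_def by (rule range_eqI[of _ _ "\<chi> i. SC (b $ i)"]) (simp add: der_apply_sum ptl_def)

lemma self_jid:
  assumes "homogeneous (int n) f" "n > 0"
  shows "f \<in> jid f"
  unfolding jid_def
proof (rule range_eqI)
  show "f = der_apply (SC (1 / of_nat n) *s euler_der) f"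
    using assms(2) by (simp add: der_apply_scale euler_der_apply[OF assms(1)] of_nat_SC mult.assoc[symmetric]
      rhom_mult[OF SC_hom, symmetric] rhom_1[OF SC_hom])
qed

lemma ev_homogeneous: "homogeneous (int n) f \<Longrightarrow> ev f (c *s v) = c ^ n * ev f v"
  using eval_homogeneous[OF _ id_hom, of n f c v] by (simp add: vector_scalar_mult_def)

context coords
begin

lemma pd_coords:
  "pd i f = pd i X * ptl P f + pd i Y * ptl Q f + pd i L * ptl R f"
proof -
  have "(if i = j then 1 else 0) = pd i (xv j)" for j by (simp add: pd_xv)
  also have "pd i (xv j) = SC (P $ j) * pd i X + SC (Q $ j) * pd i Y + SC (R $ j) * pd i L" for j
    by (subst expand) (simp add: pd_add pd_SC_mult)
  finally have d: "(if i = j then 1 else 0) = SC (P $ j) * pd i X + SC (Q $ j) * pd i Y + SC (R $ j) * pd i L" for j .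
  have "pd i f = (\<Sum>j\<in>UNIV. (if i = j then 1 else 0) * pd j f)" by (simp add: mult_delta_left)
  also have "\<dots> = pd i X * ptl P f + pd i Y * ptl Q f + pd i L * ptl R f"
    unfolding d ptl_def by (simp add: sum_distrib_left sum.distrib[symmetric] algebra_simps)
  finally show ?thesis .
qed

lemma euler_coords:
  assumes "homogeneous (int n) f"
  shows "of_nat n * f = X * ptl P f + Y * ptl Q f + L * ptl R f"
proof -
  have "of_nat n * f = (\<Sum>i\<in>UNIV. (SC (P $ i) * X + SC (Q $ i) * Y + SC (R $ i) * L) * pd i f)"
    unfolding euler[OF assms, symmetric] by (intro sum.cong refl arg_cong[of _ _ "\<lambda>x. x * _"] expand)
  then show ?thesis unfolding ptl_def by (simp add: sum_distrib_left sum.distrib[symmetric] algebra_simps)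
qed

text \<open>The germ at \<open>P\<close> in the chart \<open>X = 1\<close>, with \<open>Y\<close> as
  u and \<open>L\<close> as w.\<close>

definition Gam :: "S \<Rightarrow> local_ring" where
  "Gam h = eval_S const2 h (\<chi> i. const2 (P $ i) + const2 (Q $ i) * var_u + const2 (R $ i) * var_w)"

lemma Gam_hom: "rhom Gam" unfolding Gam_def by (rule eval_hom[OF const2_hom])

lemma Gam_SC: "Gam (SC c) = const2 c" and Gam_xv: "Gam (xv i) = const2 (P $ i) + const2 (Q $ i) * var_u + const2 (R $ i) * var_w"
  unfolding Gam_def by (simp_all add: eval_const[OF const2_hom] eval_var[OF const2_hom])

lemma Gam_linear: "homogeneous 1 l \<Longrightarrow> Gam l = const2 (ev l P) + const2 (ev l Q) * var_u + const2 (ev l R) * var_w"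
proof -
  assume "homogeneous 1 l"
  then obtain a where a: "l = lf a" using linear_form by blast
  show ?thesis unfolding a ev_lf
    by (simp add: lf_def rhom_sum[OF Gam_hom] rhom_mult[OF Gam_hom] rhom_add[OF Gam_hom] Gam_SC Gam_xv sum_3 const2_simps algebra_simps)
qed

lemma Gam_X: "Gam X = 1" and Gam_Y: "Gam Y = var_u" and Gam_L: "Gam L = var_w"
  using Gam_linear[OF lin(1)] Gam_linear[OF lin(2)] Gam_linear[OF lin(3)] by (simp_all add: dual const2_simps)

lemma c2_Gam_00: "c2 (Gam h) 0 0 = ev h P"
proof -
  have h: "rhom (\<lambda>h. c2 (Gam h) 0 0)" using rhom_comp[OF c2_00_hom Gam_hom] .
  have "c2 var_u 0 0 = 0" "c2 var_w 0 0 = 0" using u_Fil w_Fil by (simp_all add: Fil_1)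
  then have "c2 (Gam (SC c)) 0 0 = ev (SC c) P" "c2 (Gam (xv i)) 0 0 = ev (xv i) P" for c i
    unfolding Gam_SC Gam_xv eval_const[OF id_hom] eval_var[OF id_hom] by simp_all
  then show ?thesis by (rule S_hom_ext[OF h ev_hom])
qed

lemma nth0_Gam: "fps_nth (Gam h) 0 = fps_of_poly (r h)"
proof (rule S_hom_ext)
  show "rhom (\<lambda>h. fps_nth (Gam h) 0)" using rhom_comp[OF nth0_hom Gam_hom] .
  show "rhom (\<lambda>h. fps_of_poly (r h))" using r_hom by (simp add: rhom_def fps_of_poly_add fps_of_poly_mult)
  show "fps_nth (Gam (SC c)) 0 = fps_of_poly (r (SC c))" for c by (simp add: Gam_SC r_SC const2_def fps_of_poly_const)
  show "fps_nth (Gam (xv i)) 0 = fps_of_poly (r (xv i))" for i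
    by (simp add: Gam_xv r_xv const2_def var_u_def var_w_def fps_of_poly_pCons fps_of_poly_const mult.commute)
qed

lemma du_Gam: "du (Gam h) = Gam (ptl Q h)" and dw_Gam: "dw (Gam h) = Gam (ptl R h)"
proof -
  have "du (Gam h) = (\<Sum>i\<in>UNIV. Gam (pd i h) * const2 (Q $ i))"
    unfolding Gam_def by (subst eval_chain[OF const2_hom du_add du_mult du_const])
      (simp add: du_add du_mult du_const du_u du_w)
  then show "du (Gam h) = Gam (ptl Q h)" by (simp add: ptl_def rhom_sum[OF Gam_hom] rhom_mult[OF Gam_hom] Gam_SC mult.commute)
  have "dw (Gam h) = (\<Sum>i\<in>UNIV. Gam (pd i h) * const2 (R $ i))"
    unfolding Gam_def by (subst eval_chain[OF const2_hom dw_add dw_mult dw_const])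
      (simp add: dw_add dw_mult dw_const dw_u dw_w)
  then show "dw (Gam h) = Gam (ptl R h)" by (simp add: ptl_def rhom_sum[OF Gam_hom] rhom_mult[OF Gam_hom] Gam_SC mult.commute)
qed

abbreviation "Tj f \<equiv> id3 (Gam f) (du (Gam f)) (dw (Gam f))"

text \<open>The derivative along \<open>P\<close> is not one of the two local derivatives; Euler's
  relation recovers it from \<open>f\<close> and these.\<close>

lemma Gam_jid:
  assumes f: "homogeneous (int n) f" and h: "h \<in> jid f"
  shows "Gam h \<in> Tj f"
proof -
  note id = ideal_id3[of "Gam f" "du (Gam f)" "dw (Gam f)"]
  note gen = id3_gen[where a = "Gam f" and b = "du (Gam f)" and c = "dw (Gam f)"]
  have "of_nat n * Gam f - var_u * Gam (ptl Q f) - var_w * Gam (ptl R f) \<in> Tj f"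
    unfolding du_Gam[symmetric] dw_Gam[symmetric] by (intro ideal_diff[OF id] ideal_mult[OF id] gen)
  moreover have "of_nat n * Gam f = Gam (of_nat n * f)" by (simp add: rhom_mult[OF Gam_hom] rhom_of_nat[OF Gam_hom])
  ultimately have P: "Gam (ptl P f) \<in> Tj f" unfolding euler_coords[OF f]
    by (simp add: rhom_add[OF Gam_hom] rhom_mult[OF Gam_hom] Gam_X Gam_Y Gam_L)
  have i: "Gam (pd i f) \<in> Tj f" for i
    unfolding pd_coords[of i f] rhom_add[OF Gam_hom] rhom_mult[OF Gam_hom] du_Gam[symmetric] dw_Gam[symmetric]
    by (intro ideal_add[OF id] ideal_mult[OF id] gen P)
  obtain \<theta> where "h = der_apply \<theta> f" using h by (auto simp: jid_def)
  then show ?thesis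
    by (simp add: der_apply_sum rhom_add[OF Gam_hom] rhom_mult[OF Gam_hom] sum_3 ideal_add[OF id] ideal_mult[OF id] i)
qed

lemma Gam_approx: "\<exists>h. homogeneous (int N) h \<and> x - Gam h \<in> Fil N"
proof -
  have 1: "\<exists>h. homogeneous (int N) h \<and> const2 c * var_u ^ k * var_w ^ l - Gam h \<in> Fil N" for c k l
  proof (cases "k + l \<le> N")
    case True
    have "homogeneous (0 + (int (N - (k + l)) * 1 + (int k * 1 + int l * 1))) (SC c * (X ^ (N - (k + l)) * (Y ^ k * L ^ l)))"
      by (intro homogeneous_mult homogeneous_SC homogeneous_power lin)
    moreover have "Gam (SC c * (X ^ (N - (k + l)) * (Y ^ k * L ^ l))) = const2 c * var_u ^ k * var_w ^ l"
      by (simp add: rhom_mult[OF Gam_hom] rhom_power[OF Gam_hom] Gam_SC Gam_X Gam_Y Gam_L)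
    ultimately show ?thesis using True
      by (intro exI[of _ "SC c * (X ^ (N - (k + l)) * (Y ^ k * L ^ l))"] conjI) (simp_all add: Fil_0 of_nat_diff)
  next
    case False
    have "const2 c * var_u ^ k * var_w ^ l \<in> Fil (k + l)"
      using Fil_mult_left[OF Fil_mult[OF Fil_power[OF u_Fil, of k] Fil_power[OF w_Fil, of l]]] by (simp add: mult.assoc)
    then show ?thesis using False
      by (intro exI[of _ 0]) (auto simp: homogeneous_0 rhom_0[OF Gam_hom] elim: Fil_mono)
  qed
  have 2: "\<exists>h. homogeneous (int N) h \<and> x + y - Gam h \<in> Fil N"
    if "\<exists>h. homogeneous (int N) h \<and> x - Gam h \<in> Fil N" "\<exists>h. homogeneous (int N) h \<and> y - Gam h \<in> Fil N" for x y
  proof -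
    from that obtain h k where hk: "homogeneous (int N) h" "x - Gam h \<in> Fil N" "homogeneous (int N) k" "y - Gam k \<in> Fil N" by blast
    have "x + y - Gam (h + k) = (x - Gam h) + (y - Gam k)" unfolding rhom_add[OF Gam_hom, of h k] by (rule add_diff_add)
    then show ?thesis using homogeneous_add[OF hk(1,3)] Fil_add[OF hk(2,4)] by (intro exI[of _ "h + k"] conjI) (simp_all only:)
  qed
  obtain y where y: "\<exists>h. homogeneous (int N) h \<and> y - Gam h \<in> Fil N" "x - y \<in> Fil N"
    using O_monom_approx[of "\<lambda>y. \<exists>h. homogeneous (int N) h \<and> y - Gam h \<in> Fil N", OF 1 2] by blast
  then obtain h where h: "homogeneous (int N) h" "y - Gam h \<in> Fil N" by blast
  have "x - Gam h = (x - y) + (y - Gam h)" by simp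
  then show ?thesis using h Fil_add[OF y(2) h(2)] by (intro exI[of _ h]) simp
qed

lemma vanish_decomp:
  assumes q: "homogeneous d q" "ev q P = 0"
  shows "\<exists>a b. homogeneous (d - 1) a \<and> homogeneous (d - 1) b \<and> q = Y * a + L * b"
proof (cases "d < 0")
  case True
  then show ?thesis using q by (intro exI[of _ 0]) (simp add: homogeneous_neg)
next
  case False
  then obtain n where n: "d = int n" by (metis nonneg_int_cases not_less)
  define v1 where "v1 = (\<chi> i. SC (P $ i) * X + SC (Q $ i) * Y)"
  define v2 where "v2 = (\<chi> i. X * (\<chi> i. SC (P $ i)) $ i)"
  obtain b where b: "q - eval_S SC q v1 = L * b" using mod_L[of q] unfolding v1_def by (elim dvdE)
  have "Y dvd eval_S SC q v1 - eval_S SC q v2"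
    by (rule eval_cong_dvd) (simp add: v1_def v2_def mult.commute)
  then obtain a where a: "eval_S SC q v1 - eval_S SC q v2 = Y * a" by (elim dvdE)
  have "eval_S SC q v2 = X ^ n * eval_S SC q (\<chi> i. SC (P $ i))"
    unfolding v2_def by (rule eval_homogeneous) (use q n SC_hom in auto)
  also have "eval_S SC q (\<chi> i. SC (P $ i)) = SC (ev q P)"
    using hom_eval[OF SC_hom id_hom, of q P] by simp
  finally have "q = Y * a + L * b" using a b q(2) by (simp add: rhom_0[OF SC_hom] eq_diff_eq diff_eq_eq add.commute)
  then have "hp d q = Y * hp (d - 1) a + L * hp (d - 1) b"
    by (simp add: hp_add hp_mult[OF lin(2)] hp_mult[OF lin(3)])
  then show ?thesis using q(1) hp_hom homogeneous_iff[of d q] by metis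
qed

text \<open>A form that vanishes to order \<open>N\<close> at \<open>P\<close> lies in the
  \<open>N\<close>-th power of \<open>(Y, L)\<close>. In the induction the coefficients of total
  order \<open>N\<close> of the germ are the values of the \<open>q a\<close> at \<open>P\<close>;
  as they vanish, each \<open>q a\<close> splits further by \<open>vanish_decomp\<close>.\<close>

lemma Fil_decomp_homogeneous:
  assumes h: "homogeneous d h"
  shows "Gam h \<in> Fil N \<Longrightarrow>
    \<exists>q. (\<forall>b\<le>N. homogeneous (d - int N) (q b)) \<and> h = (\<Sum>b\<le>N. Y ^ b * (L ^ (N - b) * q b))"
proof (induction N)
  case 0
  show ?case using h by (intro exI[of _ "\<lambda>_. h"]) simp
next
  case (Suc N)
  then obtain q where q: "\<And>b. b \<le> N \<Longrightarrow> homogeneous (d - int N) (q b)" "h = (\<Sum>b\<le>N. Y ^ b * (L ^ (N - b) * q b))"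
    using Fil_mono[OF Suc.prems, of N] by auto
  have z: "ev (q a) P = 0" if a: "a \<le> N" for a
  proof -
    have "c2 (Gam h) a (N - a) = 0" using Suc.prems a by (simp add: Fil_def)
    moreover have "c2 (Gam h) a (N - a) = (\<Sum>b\<le>N. c2 (var_u ^ b * (var_w ^ (N - b) * Gam (q b))) a (N - a))"
      unfolding q(2) by (simp add: rhom_sum[OF Gam_hom] rhom_mult[OF Gam_hom] rhom_power[OF Gam_hom] Gam_Y Gam_L c2_sum)
    moreover have "c2 (var_u ^ b * (var_w ^ (N - b) * Gam (q b))) a (N - a) = (if b = a then ev (q a) P else 0)" if "b \<le> N" for b
      using a that by (auto simp: c2_u_power c2_w_power c2_Gam_00[symmetric])
    ultimately show ?thesis using a by simp
  qed
  have "\<forall>b. \<exists>x y. b \<le> N \<longrightarrow> homogeneous (d - int N - 1) x \<and> homogeneous (d - int N - 1) y \<and> q b = Y * x + L * y"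
    using vanish_decomp[OF q(1) z] by blast
  then obtain x y where xy: "\<And>b. b \<le> N \<Longrightarrow> homogeneous (d - int (Suc N)) (x b)" "\<And>b. b \<le> N \<Longrightarrow> homogeneous (d - int (Suc N)) (y b)"
    "\<And>b. b \<le> N \<Longrightarrow> q b = Y * x b + L * y b" unfolding of_nat_Suc diff_diff_eq by (metis add.commute)
  define p where "p b = (if b = 0 then 0 else x (b - 1)) + (if b \<le> N then y b else 0)" for b
  have 1: "homogeneous (d - int (Suc N)) (p b)" if "b \<le> Suc N" for b
    unfolding p_def using xy that by (intro homogeneous_add) (auto simp: homogeneous_0)
  have "h = (\<Sum>b\<le>N. Y ^ Suc b * (L ^ (N - b) * x b)) + (\<Sum>b\<le>N. Y ^ b * (L ^ Suc (N - b) * y b))"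
    unfolding q(2) sum.distrib[symmetric] by (intro sum.cong refl) (simp add: xy(3) algebra_simps)
  also have "(\<Sum>b\<le>N. Y ^ Suc b * (L ^ (N - b) * x b)) = (\<Sum>b\<le>Suc N. Y ^ b * (L ^ (Suc N - b) * (if b = 0 then 0 else x (b - 1))))"
    by (subst sum.atMost_Suc_shift) simp
  also have "(\<Sum>b\<le>N. Y ^ b * (L ^ Suc (N - b) * y b)) = (\<Sum>b\<le>Suc N. Y ^ b * (L ^ (Suc N - b) * (if b \<le> N then y b else 0)))"
    by (simp add: Suc_diff_le)
  finally have "h = (\<Sum>b\<le>Suc N. Y ^ b * (L ^ (Suc N - b) * p b))"
    unfolding p_def sum.distrib[symmetric] distrib_left[symmetric] .
  then show ?case using 1 by blast
qed

text \<open>In each monomial \<open>Y^b L^(s + t - b)\<close> either \<open>b\<close> is at least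
  \<open>s\<close> or the exponent of \<open>L\<close> is at least \<open>t\<close>. When
  \<open>U\<close> and \<open>V\<close> do not vanish at \<open>P\<close>, this says that
  \<open>J\<close> contains all forms of high order at \<open>P\<close> up to a local unit.\<close>

lemma Fil_ideal:
  assumes J: "is_ideal J" "Y ^ s * U \<in> J" "L ^ t * V \<in> J" and h: "homogeneous d h" "Gam h \<in> Fil (s + t)"
  shows "U * V * h \<in> J"
proof -
  obtain q where q: "h = (\<Sum>b\<le>s + t. Y ^ b * (L ^ (s + t - b) * q b))" using Fil_decomp_homogeneous[OF h] by blast
  have 1: "U * V * (Y ^ b * (L ^ (s + t - b) * q b)) \<in> J" if "b \<le> s + t" for b
  proof (cases "s \<le> b")
    case True
    then have "Y ^ b = Y ^ (b - s) * Y ^ s" by (simp add: power_add[symmetric])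
    then have "U * V * (Y ^ b * (L ^ (s + t - b) * q b)) = (V * Y ^ (b - s) * L ^ (s + t - b) * q b) * (Y ^ s * U)"
      by (simp add: algebra_simps)
    then show ?thesis using ideal_mult[OF J(1,2)] by metis
  next
    case False
    then have "L ^ (s + t - b) = L ^ (s - b) * L ^ t" by (simp add: power_add[symmetric])
    then have "U * V * (Y ^ b * (L ^ (s + t - b) * q b)) = (U * Y ^ b * L ^ (s - b) * q b) * (L ^ t * V)"
      by (simp add: algebra_simps)
    then show ?thesis using ideal_mult[OF J(1,3)] by metis
  qed
  have "(\<Sum>b\<in>A. U * V * (Y ^ b * (L ^ (s + t - b) * q b))) \<in> J" if "A \<subseteq> {..s + t}" for A
    using finite_subset[OF that] that by (induction A rule: finite_induct) (auto simp: ideal_0[OF J(1)] intro: ideal_add[OF J(1)] 1)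
  then show ?thesis by (simp add: q sum_distrib_left)
qed

lemma ev_power_form: "homogeneous 1 B \<Longrightarrow> ev B P = 0 \<Longrightarrow> ev (X ^ k * B ^ j) P = (if j = 0 then 1 else 0)"
  by (simp only: rhom_mult[OF ev_hom] rhom_power[OF ev_hom] dual) simp

text \<open>The Jacobian ideal has bounded codimension in each degree, so the forms \<open>X ^ (k - t) * B ^ t\<close>,
  \<open>t \<le> c\<close>, are linearly dependent modulo it.\<close>

lemma jid_power:
  assumes f: "squarefree f" "homogeneous (int n) f" "n > 0" and B: "homogeneous 1 B" "ev B P = 0"
  shows "\<exists>t U d. homogeneous (int d) U \<and> ev U P \<noteq> 0 \<and> B ^ t * U \<in> jid f"
proof -
  obtain c where c: "\<forall>j \<ge> 2 * int n. \<exists>c'\<le>c. fd scS (Jac f (j - int n + 1)) (Hm j) c'" using jacobian_codim[OF f] by blast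
  define k where "k = 2 * n + c"
  obtain c' where c': "c' \<le> c" "fd scS (Jac f (int k - int n + 1)) (Hm (int k)) c'" using c[rule_format, of "int k"] by (auto simp: k_def)
  define J where "J = Jac f (int k - int n + 1)"
  interpret T: Vector_Spaces.linear scV scS "\<lambda>\<theta>. der_apply \<theta> f" by (rule der_apply_linear)
  have sJ: "VS.subspace J" unfolding J_def Jac_def by (rule T.subspace_image[OF subspace_Hd])
  have JH: "J \<subseteq> Hm (int k)" using VS.fd_subset[OF c'(2)[folded J_def] sJ] .
  define T where "T q = (\<Sum>t\<le>c. SC (coeff q t) * (X ^ (k - t) * B ^ t))" for q :: "complex poly"
  have lT: "Vector_Spaces.linear smult scS T"
    by (rule linI) (simp_all add: VP.vspace_axioms VS.vspace_axioms T_def rhom_add[OF SC_hom] rhom_mult[OF SC_hom]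
      scS_def sum.distrib sum_distrib_left algebra_simps)
  have TH: "T q \<in> Hm (int k)" for q
  proof -
    have "homogeneous (int k) (SC (coeff q t) * (X ^ (k - t) * B ^ t))" if "t \<le> c" for t
    proof -
      have "homogeneous (int (k - t) * 1 + int t * 1) (X ^ (k - t) * B ^ t)" by (intro homogeneous_mult homogeneous_power lin B)
      then show ?thesis using that by (intro homogeneous_SC_mult) (simp add: k_def of_nat_diff)
    qed
    then show ?thesis unfolding T_def Hm_def by (auto intro: homogeneous_sum)
  qed
  have "\<exists>q\<in>Pl (int c). q \<noteq> 0 \<and> T q \<in> J"
  proof (rule ccontr)
    assume no: "\<not> ?thesis"
    interpret TT: Vector_Spaces.linear smult scS T by (rule lT)
    have "T v \<in> J \<longleftrightarrow> v \<in> {0}" if "v \<in> Pl (int c)" for v using no that VS.subspace_0[OF sJ] by (auto simp: TT.zero)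
    from VP.fd_push[OF fd_Pl VP.subspace_single_0 VS.vspace_axioms lT sJ this]
    have p: "fd scS J {T v + j | v j. v \<in> Pl (int c) \<and> j \<in> J} (nat (int c + 1))" by blast
    have "{T v + j | v j. v \<in> Pl (int c) \<and> j \<in> J} \<subseteq> Hm (int k)"
      using JH TH VS.subspace_add[OF subspace_Hm] by blast
    from VS.fd_le[OF c'(2)[folded J_def] p sJ this] c'(1) show False by simp
  qed
  then obtain q where q: "q \<in> Pl (int c)" "q \<noteq> 0" "T q \<in> J" by blast
  define t where "t = (LEAST t. coeff q t \<noteq> 0)"
  have t: "coeff q t \<noteq> 0" unfolding t_def by (rule LeastI[of _ "degree q"]) (use q(2) in simp)
  have tl: "coeff q s = 0" if "s < t" for s using not_less_Least[of s "\<lambda>t. coeff q t \<noteq> 0"] that unfolding t_def by blast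
  have tc: "t \<le> c" using q(1) t unfolding Pl_degree using le_degree[of q t] by linarith
  \<comment> \<open>The dependence relation divided by its lowest power of \<open>B\<close>; at
    \<open>P\<close> only the term \<open>s = t\<close> survives.\<close>
  define U where "U = (\<Sum>s\<in>{t..c}. SC (coeff q s) * (X ^ (k - s) * B ^ (s - t)))"
  have "T q = (\<Sum>s\<in>{t..c}. SC (coeff q s) * (X ^ (k - s) * B ^ s))" unfolding T_def
  proof (rule sum.mono_neutral_right)
    show "\<forall>s\<in>{..c} - {t..c}. SC (coeff q s) * (X ^ (k - s) * B ^ s) = 0"
    proof
      fix s assume "s \<in> {..c} - {t..c}"
      then have "s < t" by auto
      then show "SC (coeff q s) * (X ^ (k - s) * B ^ s) = 0" by (simp add: tl)
    qed
  qed auto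
  also have "\<dots> = B ^ t * U" unfolding U_def sum_distrib_left
    by (intro sum.cong refl) (simp add: power_add[symmetric] mult.left_commute[of "B ^ t"])
  finally have "B ^ t * U \<in> jid f" using q(3) by (auto simp: J_def Jac_def jid_def)
  moreover have "homogeneous (int (k - t)) U" unfolding U_def
  proof (intro homogeneous_sum homogeneous_SC_mult)
    fix s assume s: "s \<in> {t..c}"
    have "homogeneous (int (k - s) * 1 + int (s - t) * 1) (X ^ (k - s) * B ^ (s - t))" by (intro homogeneous_mult homogeneous_power lin B)
    moreover have "int (k - s) * 1 + int (s - t) * 1 = int (k - t)" using s by (simp add: k_def of_nat_diff)
    ultimately show "homogeneous (int (k - t)) (X ^ (k - s) * B ^ (s - t))" by simp
  qed
  moreover have "ev U P \<noteq> 0"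
  proof -
  have "ev U P = (\<Sum>s\<in>{t..c}. coeff q s * (if s - t = 0 then 1 else 0))"
    unfolding U_def rhom_sum[OF ev_hom] rhom_mult[OF ev_hom, of "SC _"] eval_const[OF id_hom] ev_power_form[OF B] by simp
  also have "\<dots> = (\<Sum>s\<in>{t..c}. if s = t then coeff q s else 0)" by (intro sum.cong) auto
  finally show ?thesis using t tc by simp
  qed
  ultimately show ?thesis by blast
qed

end

section \<open>Milnor and Tjurina numbers at a point of the line\<close>

lemma order_factor:
  fixes q :: "complex poly"
  assumes "p = [:- a, 1:] ^ j * q" "poly q a \<noteq> 0"
  shows "order a p = j"
proof -
  have "q \<noteq> 0" using assms(2) by auto
  then have "order a p = order a ([:- a, 1:] ^ j) + order a q" using assms(1) by (simp add: order_mult)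
  then show ?thesis using assms(2) by (simp add: order_power_n_n order_0I)
qed

lemma order_subdegree: "p \<noteq> 0 \<Longrightarrow> subdegree (fps_of_poly p) = order 0 (p :: complex poly)"
proof -
  assume "p \<noteq> 0"
  then obtain q where q: "p = [:- 0, 1:] ^ order 0 p * q" "\<not> [:- 0, 1:] dvd q" using order_decomp by blast
  define j where "j = order 0 p"
  have "coeff q 0 \<noteq> 0" using q(2) poly_eq_0_iff_dvd[of q 0] by (simp add: poly_0_coeff_0)
  moreover have "fps_of_poly p = fps_X ^ j * fps_of_poly q"
    by (subst q(1)) (simp add: fps_of_poly_mult fps_of_poly_power fps_of_poly_pCons j_def)
  ultimately show ?thesis unfolding j_def[symmetric]
    by (intro subdegreeI) (simp_all add: coeff_monom_mult)
qed

context coords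
begin

lemma L_not_unit: "\<not> L dvd 1"
proof
  assume "L dvd 1"
  then obtain c where "L = SC c" by (auto simp: homogeneous_unit)
  then show False using dual by (metis eval_const[OF id_hom] id_apply zero_neq_one)
qed

lemma Tj_LG:
  "Tj (L * g) = id3 (var_w * Gam g) (var_w * du (Gam g)) (Gam g + var_w * dw (Gam g))"
  by (simp add: rhom_mult[OF Gam_hom] Gam_L du_mult dw_mult du_w dw_w add.commute)

context
  fixes g :: S and dg :: nat
  assumes g: "homogeneous (int dg) g" "dg > 0" "squarefree (L * g)"
begin

lemma squarefree_r: "r g \<noteq> 0"
proof
  assume "r g = 0"
  then have "L dvd g" using r_kernel[OF g(1)] by simp
  then have "L ^ 2 dvd L * g" by (simp add: power2_eq_square mult_dvd_mono)
  then show False using g(3) L_not_unit by (auto simp: squarefree_def)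
qed

lemma hom_LG: "homogeneous (int (dg + 1)) (L * g)"
  using homogeneous_mult[OF lin(3) g(1)] by (simp add: add.commute)

lemma jid_unit:
  assumes "B ^ t * U \<in> jid (L * g)" "ev U P \<noteq> 0"
  shows "Gam B ^ t \<in> Tj (L * g)"
proof -
  have 1: "Gam B ^ t * Gam U \<in> Tj (L * g)" using Gam_jid[OF hom_LG assms(1)] by (simp add: rhom_mult[OF Gam_hom] rhom_power[OF Gam_hom])
  obtain y where "Gam U * y = 1" using O_unit[of "Gam U"] assms(2) by (auto simp: c2_Gam_00)
  then have "Gam B ^ t * Gam U * y = Gam B ^ t" by (simp add: mult.assoc)
  then show ?thesis using ideal_mult'[OF ideal_id3 1, of y] by (simp only:)
qed

lemma isolated: "\<exists>K. var_u ^ K \<in> Tj (L * g) \<and> var_w ^ K \<in> Tj (L * g)"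
proof -
  obtain s U where s: "ev U P \<noteq> 0" "Y ^ s * U \<in> jid (L * g)"
    using jid_power[OF g(3) hom_LG _ lin(2)] dual by auto
  obtain t V where t: "ev V P \<noteq> 0" "L ^ t * V \<in> jid (L * g)"
    using jid_power[OF g(3) hom_LG _ lin(3)] dual by auto
  have "var_u ^ s \<in> Tj (L * g)" "var_w ^ t \<in> Tj (L * g)"
    using jid_unit[OF s(2,1)] jid_unit[OF t(2,1)] by (simp_all add: Gam_Y Gam_L)
  then have "var_u ^ t * var_u ^ s \<in> Tj (L * g)" "var_w ^ s * var_w ^ t \<in> Tj (L * g)" by (auto intro: ideal_mult[OF ideal_id3])
  then show ?thesis by (intro exI[of _ "s + t"]) (simp add: power_add mult.commute)
qed

lemma nth0_decomp: "\<exists>y. x = ou (fps_nth x 0) + var_w * y"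
proof -
  have "var_w dvd x - ou (fps_nth x 0)" by (simp add: w_dvd ou_nth0)
  then obtain y where "x - ou (fps_nth x 0) = var_w * y" by (elim dvdE)
  then show ?thesis by (intro exI[of _ y]) (simp add: diff_eq_eq add.commute)
qed

text \<open>\<open>w * g\<close> lies in the Tjurina ideal of the union, so only the restriction of
  \<open>x\<close> to \<open>w = 0\<close> counts, and that is a power of u times a unit.\<close>

lemma colon_u_power:
  assumes "x * Gam g \<in> Tj (L * g)" "fps_nth x 0 \<noteq> 0"
  shows "var_u ^ subdegree (fps_nth x 0) * Gam g \<in> Tj (L * g)"
proof -
  note id = ideal_id3[of "Gam (L * g)" "du (Gam (L * g))" "dw (Gam (L * g))"]
  define e where "e = fps_nth x 0"
  obtain y where y: "x = ou e + var_w * y" using nth0_decomp unfolding e_def by blast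
  obtain f where f: "fps_nth f 0 \<noteq> 0" "e = fps_X ^ subdegree e * f" using fps_unit_factor[of e] assms(2) unfolding e_def by blast
  have "var_w * Gam g \<in> Tj (L * g)" using id3_gen(1)[of "Gam (L * g)"] by (simp add: rhom_mult[OF Gam_hom] Gam_L)
  then have "y * (var_w * Gam g) \<in> Tj (L * g)" by (rule ideal_mult[OF id])
  from ideal_diff[OF id assms(1) this] have 1: "ou e * Gam g \<in> Tj (L * g)" unfolding y by (simp add: algebra_simps)
  have e: "ou e = var_u ^ subdegree e * ou f" by (subst f(2)) (simp add: rhom_mult[OF ou_hom] rhom_power[OF ou_hom] ou_X)
  have "c2 (ou f) 0 0 \<noteq> 0" using f by (simp add: c2_ou)
  then obtain z where z: "ou f * z = 1" using O_unit by blast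
  have "z * (ou e * Gam g) = (ou f * z) * (var_u ^ subdegree e * Gam g)" unfolding e by (simp add: algebra_simps)
  then show ?thesis using ideal_mult[OF id 1, of z] unfolding z e_def by (simp only: mult_1)
qed

text \<open>From local to global. The coefficients of the local relation are replaced by forms; the
  error has high order at \<open>P\<close>, and its multiple by \<open>U V\<close> lies in the
  Jacobian ideal of \<open>L * g\<close>. The resulting \<open>\<theta>\<close> satisfies
  \<open>\<theta>(L g) = H Y^j g\<close> with \<open>H\<close> nonzero at \<open>P\<close>, which
  forces \<open>\<theta>(L) = H Y^j\<close> on the line.\<close>

lemma colon_global:
  assumes j: "var_u ^ j * Gam g \<in> Tj (L * g)"
  shows "\<exists>k. \<exists>\<theta>\<in>D0 g \<inter> Hd k. psi \<theta> \<noteq> 0 \<and> order 0 (psi \<theta>) = j"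
proof -
  define F where "F = L * g"
  note F = hom_LG[folded F_def]
  obtain s U d1 where s: "ev U P \<noteq> 0" "Y ^ s * U \<in> jid F" "homogeneous (int d1) U"
    using jid_power[OF g(3) hom_LG _ lin(2)] dual unfolding F_def by auto
  obtain t V d2 where t: "ev V P \<noteq> 0" "L ^ t * V \<in> jid F" "homogeneous (int d2) V"
    using jid_power[OF g(3) hom_LG _ lin(3)] dual unfolding F_def by auto
  obtain A B C where ABC: "var_u ^ j * Gam g = Gam F * A + du (Gam F) * B + dw (Gam F) * C"
    using j unfolding F_def by (rule id3E)
  define N where "N = s + t + j"
  obtain a where a: "homogeneous (int N) a" "A - Gam a \<in> Fil N" using Gam_approx by blast
  obtain b where b: "homogeneous (int N) b" "B - Gam b \<in> Fil N" using Gam_approx by blast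
  obtain c where c: "homogeneous (int N) c" "C - Gam c \<in> Fil N" using Gam_approx by blast
  \<comment> \<open>The factors \<open>X\<close> do not change the germs, since \<open>X = 1\<close>
    in the chart; they bring all terms of \<open>h\<close> to the degree
    \<open>N + dg + 1\<close>.\<close>
  define W where "W = X ^ (N + 1 - j) * (Y ^ j * g)"
  define h where "h = W - (a * F + b * (X * ptl Q F) + c * (X * ptl R F))"
  have hX: "homogeneous (int N + int (dg + 1)) (z * (X * ptl v F))" if "homogeneous (int N) z" for z v
    using homogeneous_mult[OF that homogeneous_mult[OF lin(1) homogeneous_ptl[OF F]]] by simp
  have "homogeneous (int (N + 1 - j) * 1 + (int j * 1 + int dg)) W" unfolding W_def
    by (intro homogeneous_mult homogeneous_power lin g)
  moreover have "int (N + 1 - j) * 1 + (int j * 1 + int dg) = int N + int (dg + 1)" by (simp add: N_def of_nat_diff)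
  ultimately have "homogeneous (int N + int (dg + 1)) W" by (simp only:)
  then have hh: "homogeneous (int N + int (dg + 1)) h" unfolding h_def
    by (intro homogeneous_diff homogeneous_add hX a b c homogeneous_mult[OF a(1) F])
  have "Gam h = Gam F * (A - Gam a) + du (Gam F) * (B - Gam b) + dw (Gam F) * (C - Gam c)"
  proof -
    have "Gam h = var_u ^ j * Gam g - (Gam a * Gam F + Gam b * du (Gam F) + Gam c * dw (Gam F))"
      unfolding h_def W_def by (simp add: rhom_diff[OF Gam_hom] rhom_add[OF Gam_hom] rhom_mult[OF Gam_hom]
        rhom_power[OF Gam_hom] Gam_X Gam_Y du_Gam dw_Gam)
    then show ?thesis unfolding ABC by (simp add: algebra_simps)
  qed
  then have "Gam h \<in> Fil N" using a b c by (simp add: Fil_add Fil_mult_left)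
  then have "Gam h \<in> Fil (s + t)" by (rule Fil_mono) (simp add: N_def)
  note id = ideal_jid[of F]
  have "U * V * h \<in> jid F" by (rule Fil_ideal[OF id s(2) t(2) hh \<open>Gam h \<in> Fil (s + t)\<close>])
  moreover have "a * F + b * (X * ptl Q F) + c * (X * ptl R F) \<in> jid F"
    by (intro ideal_add[OF id] ideal_mult[OF id] ptl_jid self_jid[OF F]) simp
  then have "U * V * (a * F + b * (X * ptl Q F) + c * (X * ptl R F)) \<in> jid F" by (rule ideal_mult[OF id])
  ultimately have "U * V * h + U * V * (a * F + b * (X * ptl Q F) + c * (X * ptl R F)) \<in> jid F" by (rule ideal_add[OF id])
  then have "U * V * W \<in> jid F" unfolding h_def distrib_left[symmetric] by simp
  then obtain \<theta>' where th': "U * V * W = der_apply \<theta>' F" by (auto simp: jid_def)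
  define H where "H = U * (V * X ^ (N + 1 - j))"
  define d where "d = d1 + (d2 + (N + 1 - j))"
  have "homogeneous (int d1 + (int d2 + int (N + 1 - j) * 1)) H" unfolding H_def
    by (intro homogeneous_mult homogeneous_power lin s t)
  then have H: "homogeneous (int d) H" by (simp add: d_def)
  have HP: "ev H P \<noteq> 0" unfolding H_def using s(1) t(1) by (simp only: rhom_mult[OF ev_hom] rhom_power[OF ev_hom] dual) simp
  define k where "k = int d + int j"
  have HY: "homogeneous k (H * Y ^ j)" using homogeneous_mult[OF H homogeneous_power[OF lin(2), of j]] by (simp add: k_def)
  have W: "U * V * W = H * Y ^ j * g" by (simp add: W_def H_def algebra_simps)
  \<comment> \<open>The value at \<open>F\<close> is a form, so the homogeneous component of
    \<open>\<theta>'\<close> of matching degree has the same value.\<close>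
  define \<theta> where "\<theta> = hpd k \<theta>'"
  have "der_apply \<theta> F = hp (k + int (dg + 1) - 1) (H * Y ^ j * g)" unfolding \<theta>_def hpd_der_apply[OF F] th'[symmetric] W ..
  also have "\<dots> = H * Y ^ j * g" using hp_self[OF homogeneous_mult[OF HY g(1)]] by simp
  finally have thF: "L * der_apply \<theta> g + der_apply \<theta> L * g = H * Y ^ j * g" by (simp add: F_def der_apply_mult)
  have thH: "\<theta> \<in> Hd k" unfolding \<theta>_def by (rule hpd_Hd)
  have hL: "homogeneous k (der_apply \<theta> L)" using der_apply_homogeneous[OF lin(3), of k \<theta>] thH by (simp add: Hd_def)
  have "r (L * der_apply \<theta> g + der_apply \<theta> L * g) = r (H * Y ^ j) * r g" unfolding thF by (rule rhom_mult[OF r_hom])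
  then have psi: "psi \<theta> = r (H * Y ^ j)" using squarefree_r by (simp add: psi_def rhom_add[OF r_hom] rhom_mult[OF r_hom] r_L)
  then have "r (H * Y ^ j - der_apply \<theta> L) = 0" by (simp add: rhom_diff[OF r_hom] psi_def)
  then have "L dvd H * Y ^ j - der_apply \<theta> L" using r_kernel[OF homogeneous_diff[OF HY hL]] by simp
  then obtain q where q: "H * Y ^ j - der_apply \<theta> L = L * q" by (elim dvdE)
  have hq: "homogeneous (k - 1) q" using homogeneous_diff[OF HY hL] unfolding q by (rule L_quotient)
  have "L * der_apply \<theta> g = (H * Y ^ j - der_apply \<theta> L) * g" using thF by (simp add: algebra_simps eq_diff_eq)
  then have "L * der_apply \<theta> g = L * (q * g)" unfolding q by (simp add: mult.assoc)
  then have thg: "der_apply \<theta> g = q * g" using L_nonzero by simp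
  \<comment> \<open>\<open>\<theta>\<close> multiplies \<open>g\<close> by \<open>q\<close>.
    Subtracting this multiple of the Euler derivation makes it kill \<open>g\<close> and leaves
    \<open>psi\<close> unchanged, because the Euler derivation is tangent to the line.\<close>
  define c' where "c' = SC (1 / of_nat dg) * q"
  have cc: "c' * of_nat dg = q" using g(2)
    by (simp add: c'_def of_nat_SC mult.assoc mult.left_commute[of _ q] rhom_mult[OF SC_hom, symmetric] rhom_1[OF SC_hom])
  define \<eta> where "\<eta> = \<theta> - c' *s euler_der"
  have "der_apply (\<eta> + c' *s euler_der) g = der_apply \<eta> g + c' * of_nat dg * g"
    unfolding der_apply_add der_apply_scale euler_der_apply[OF g(1)] by (simp add: mult.assoc)
  moreover have "\<eta> + c' *s euler_der = \<theta>" by (simp add: \<eta>_def)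
  ultimately have "q * g = der_apply \<eta> g + q * g" unfolding cc thg by (simp only: thg)
  then have "der_apply \<eta> g = 0" by simp
  then have "\<eta> \<in> D0 g" by (simp add: D0_iff)
  moreover have "\<eta> \<in> Hd k" unfolding \<eta>_def
    using Hd_diff[OF thH, of "c' *s euler_der"] Hd_scale[OF homogeneous_SC_mult[OF hq] euler_der_Hd] by (simp add: c'_def)
  moreover have "psi \<eta> = r H * [:0, 1:] ^ j"
  proof -
    have "psi euler_der = 0" using euler_der_apply[of 1 L] lin(3) by (simp add: psi_def r_L)
    then have "psi \<eta> = r (H * Y ^ j)" by (simp add: \<eta>_def psi_diff psi_scale psi)
    then show ?thesis by (simp add: rhom_mult[OF r_hom] rhom_power[OF r_hom] r_Y)
  qed
  moreover have "poly (r H) 0 \<noteq> 0" using HP by (simp add: poly_r)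
  ultimately show ?thesis using order_factor[of "psi \<eta>" 0 j "r H"] by (intro exI[of _ k] bexI[of _ \<eta>]) (auto simp: mult.commute)
qed

text \<open>The colon ideal contains w, so it is determined by the orders of its elements on
  \<open>w = 0\<close>. \<open>\<theta>\<close> provides the order \<open>m\<close>, and by
  \<open>colon_global\<close> every order that occurs locally comes from a global derivation, so
  \<open>m\<close> is the least.\<close>

lemma colon_eq:
  assumes \<theta>: "\<theta> \<in> D0 g" "psi \<theta> \<noteq> 0" "order 0 (psi \<theta>) = m"
    and min: "\<And>k \<eta>. \<eta> \<in> D0 g \<inter> Hd k \<Longrightarrow> psi \<eta> \<noteq> 0 \<Longrightarrow> m \<le> order 0 (psi \<eta>)"
  shows "{x. x * Gam g \<in> Tj (L * g)} = id2 var_w (var_u ^ m)"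
proof (intro subset_antisym subsetI)
  note id = ideal_id3[of "Gam (L * g)" "du (Gam (L * g))" "dw (Gam (L * g))"]
  have w: "var_w * Gam g \<in> Tj (L * g)" using id3_gen(1)[of "Gam (L * g)"] by (simp add: rhom_mult[OF Gam_hom] Gam_L)
  have "der_apply \<theta> (L * g) \<in> jid (L * g)" by (simp add: jid_def)
  moreover have "der_apply \<theta> (L * g) = der_apply \<theta> L * g" using \<theta>(1) by (simp add: D0_iff der_apply_mult)
  ultimately have "Gam (der_apply \<theta> L) * Gam g \<in> Tj (L * g)"
    using Gam_jid[OF hom_LG] by (simp add: rhom_mult[OF Gam_hom, symmetric])
  moreover have "fps_nth (Gam (der_apply \<theta> L)) 0 = fps_of_poly (psi \<theta>)" by (simp add: nth0_Gam psi_def)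
  ultimately have u: "var_u ^ m * Gam g \<in> Tj (L * g)"
    using colon_u_power[of "Gam (der_apply \<theta> L)"] \<theta> by (simp add: order_subdegree)
  fix x assume "x \<in> id2 var_w (var_u ^ m)"
  then obtain y z where x: "x = var_w * y + var_u ^ m * z" by (rule id2E)
  have "y * (var_w * Gam g) + z * (var_u ^ m * Gam g) \<in> Tj (L * g)" by (intro ideal_add[OF id] ideal_mult[OF id] u w)
  then show "x \<in> {x. x * Gam g \<in> Tj (L * g)}" unfolding x by (simp add: algebra_simps)
next
  fix x assume "x \<in> {x. x * Gam g \<in> Tj (L * g)}"
  then have x: "x * Gam g \<in> Tj (L * g)" by simp
  define e where "e = fps_nth x 0"
  obtain y where y: "x = ou e + var_w * y" using nth0_decomp unfolding e_def by blast
  have "ou e \<in> id2 var_w (var_u ^ m)"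
  proof (cases "e = 0")
    case True
    then show ?thesis using ideal_0[OF ideal_id2] by (simp add: rhom_0[OF ou_hom])
  next
    case False
    obtain k \<eta> where "\<eta> \<in> D0 g \<inter> Hd k" "psi \<eta> \<noteq> 0" "order 0 (psi \<eta>) = subdegree e"
      using colon_global[OF colon_u_power[OF x]] False unfolding e_def by blast
    then have "m \<le> subdegree e" using min by force
    obtain f where "e = fps_X ^ subdegree e * f" using fps_unit_factor[OF False] by blast
    also have "\<dots> = fps_X ^ m * (fps_X ^ (subdegree e - m) * f)" using \<open>m \<le> subdegree e\<close>
      by (simp add: mult.assoc[symmetric] power_add[symmetric])
    finally have "ou e = var_w * 0 + var_u ^ m * ou (fps_X ^ (subdegree e - m) * f)"
      by (metis rhom_mult[OF ou_hom] rhom_power[OF ou_hom] ou_X mult_zero_right add_0)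
    then show ?thesis by (rule id2I)
  qed
  moreover have "var_w * y \<in> id2 var_w (var_u ^ m)" by (rule ideal_mult'[OF ideal_id2 id2_gen(1)])
  ultimately show "x \<in> id2 var_w (var_u ^ m)" unfolding y by (rule ideal_add[OF ideal_id2])
qed

text \<open>By \<open>colon_eq\<close> the correction term in \<open>tjurina_union\<close>, the
  colength of the colon ideal, is the order \<open>m\<close> of a global
  \<open>psi \<theta>\<close>.\<close>

theorem local_numbers:
  assumes "ev g P = 0"
    and \<theta>: "\<theta> \<in> D0 g" "psi \<theta> \<noteq> 0" "order 0 (psi \<theta>) = m"
    and min: "\<And>k \<eta>. \<eta> \<in> D0 g \<inter> Hd k \<Longrightarrow> psi \<eta> \<noteq> 0 \<Longrightarrow> m \<le> order 0 (psi \<eta>)"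
  shows "\<exists>t \<mu> i. i = order 0 (r g) \<and> i \<ge> 1 \<and> cd (Tj g) t \<and> cd (Tj (L * g)) (t + i + m) \<and>
    cd (id2 (du (Gam g)) (dw (Gam g))) \<mu> \<and> cd (id2 (du (Gam (L * g))) (dw (Gam (L * g)))) (\<mu> + 2 * i - 1)"
proof -
  have 0: "c2 (Gam g) 0 0 = 0" using assms(1) by (simp add: c2_Gam_00)
  have nz: "fps_nth (Gam g) 0 \<noteq> 0" using squarefree_r by (simp add: nth0_Gam)
  have i: "order 0 (r g) = subdegree (fps_nth (Gam g) 0)" using squarefree_r by (simp add: nth0_Gam order_subdegree)
  obtain K where K: "var_u ^ K \<in> Tj (L * g)" "var_w ^ K \<in> Tj (L * g)" using isolated by blast
  have col: "{x. x * Gam g \<in> Tj (L * g)} = id2 var_w (var_u ^ m)" by (rule colon_eq[OF \<theta> min])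
  have "cd (id2 var_w (var_u ^ m)) m" using cd_w[of "var_u ^ m"] by (simp add: u_power_nth0)
  moreover obtain t m' where t: "cd (Tj g) t" "cd (Tj (L * g)) (t + order 0 (r g) + m')" "cd {x. x * Gam g \<in> Tj (L * g)} m'"
    using tjurina_union[OF 0 nz i K[unfolded Tj_LG]] unfolding Tj_LG by blast
  ultimately have "m' = m" unfolding col by (intro O.fd_unique[OF _ _ subspace_id2])
  moreover obtain \<mu> where "cd (id2 (du (Gam g)) (dw (Gam g))) \<mu>"
    "cd (id2 (var_w * du (Gam g)) (Gam g + var_w * dw (Gam g))) (\<mu> + 2 * order 0 (r g) - 1)" "order 0 (r g) \<ge> 1"
    using milnor_union[OF 0 nz i K[unfolded Tj_LG]] by blast
  moreover have "du (Gam (L * g)) = var_w * du (Gam g)" "dw (Gam (L * g)) = Gam g + var_w * dw (Gam g)"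
    by (simp_all add: rhom_mult[OF Gam_hom] Gam_L du_mult dw_mult du_w dw_w)
  ultimately show ?thesis using t(1,2) by auto
qed

end
end

section \<open>Linear changes of the local coordinates\<close>

context
  fixes p q r s :: complex
  assumes det: "p * s - q * r = 1"
begin

private definition "A = const2 p * var_u + const2 q * var_w"
private definition "B = const2 r * var_u + const2 s * var_w"

private lemma lin_Fil: "const2 c * var_u + const2 d * var_w \<in> Fil (Suc 0)"
  by (intro Fil_add Fil_mult_left u_Fil w_Fil)

private lemma AB_Fil: "A \<in> Fil (Suc 0)" "B \<in> Fil (Suc 0)"
  unfolding A_def B_def by (rule lin_Fil)+

private lemma hom: "rhom (phi A B)" by (rule phi_hom[OF AB_Fil])

private lemma phi_lin:
  assumes "a \<in> Fil (Suc 0)" "b \<in> Fil (Suc 0)"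
  shows "phi a b (const2 c * var_u + const2 d * var_w) = const2 c * a + const2 d * b"
  by (simp add: rhom_add[OF phi_hom] rhom_mult[OF phi_hom] phi_const phi_u phi_w assms)

private lemma bij: "bij (phi A B)"
proof -
  define A' where "A' = const2 s * var_u + const2 (- q) * var_w"
  define B' where "B' = const2 (- r) * var_u + const2 p * var_w"
  have F: "A' \<in> Fil (Suc 0)" "B' \<in> Fil (Suc 0)" unfolding A'_def B'_def by (rule lin_Fil)+
  have comb: "const2 a * (const2 b * x + const2 c * y) + const2 a' * (const2 b' * x + const2 c' * y) =
      const2 (a * b + a' * b') * x + const2 (a * c + a' * c') * y" for a b c a' b' c' x y
    by (simp add: const2_simps algebra_simps)
  have e: "s * p - q * r = 1" using det by (simp add: mult.commute)
  have "phi A B A' = var_u" "phi A B B' = var_w"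
    unfolding A'_def B'_def phi_lin[OF AB_Fil] unfolding A_def B_def comb using e det
    by (simp_all add: const2_simps algebra_simps)
  then have 1: "phi A B (phi A' B' x) = x" for x by (simp add: phi_phi AB_Fil F phi_id)
  have "phi A' B' A = var_u" "phi A' B' B = var_w"
    unfolding A_def B_def phi_lin[OF F] unfolding A'_def B'_def comb using e det
    by (simp_all add: const2_simps algebra_simps)
  then have 2: "phi A' B' (phi A B x) = x" for x by (simp add: phi_phi AB_Fil F phi_id)
  show ?thesis by (rule o_bij[of "phi A' B'"]) (simp_all add: fun_eq_iff 1 2)
qed

private lemma der: "du (phi A B x) = const2 p * phi A B (du x) + const2 r * phi A B (dw x)"
  "dw (phi A B x) = const2 q * phi A B (du x) + const2 s * phi A B (dw x)"
proof -
  have "du A = const2 p" "du B = const2 r" "dw A = const2 q" "dw B = const2 s"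
    by (simp_all add: A_def B_def du_add dw_add du_mult dw_mult du_const dw_const du_u du_w dw_u dw_w)
  then show "du (phi A B x) = const2 p * phi A B (du x) + const2 r * phi A B (dw x)"
    "dw (phi A B x) = const2 q * phi A B (du x) + const2 s * phi A B (dw x)"
    using phi_chain[OF AB_Fil, of du, OF du_add du_mult du_const du_Fil, of x]
      phi_chain[OF AB_Fil, of dw, OF dw_add dw_mult dw_const dw_Fil, of x] by (simp_all add: mult.commute)
qed

private lemma der_inv: "phi A B (du x) = const2 s * du (phi A B x) + const2 (- r) * dw (phi A B x)"
  "phi A B (dw x) = const2 (- q) * du (phi A B x) + const2 p * dw (phi A B x)"
proof -
  have comb: "const2 a * (const2 b * x + const2 c * y) + const2 a' * (const2 b' * x + const2 c' * y) =
      const2 (a * b + a' * b') * x + const2 (a * c + a' * c') * y" for a b c a' b' c' x y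
    by (simp add: const2_simps algebra_simps)
  show "phi A B (du x) = const2 s * du (phi A B x) + const2 (- r) * dw (phi A B x)"
    "phi A B (dw x) = const2 (- q) * du (phi A B x) + const2 p * dw (phi A B x)"
    unfolding der comb using det by (simp_all add: const2_simps algebra_simps)
qed

private lemma pull_id3: "phi A B x \<in> id3 (phi A B a) (phi A B b) (phi A B c) \<longleftrightarrow> x \<in> id3 a b c"
proof
  assume "phi A B x \<in> id3 (phi A B a) (phi A B b) (phi A B c)"
  then obtain y1 y2 y3 where y: "phi A B x = phi A B a * y1 + phi A B b * y2 + phi A B c * y3" by (rule id3E)
  obtain z1 z2 z3 where "y1 = phi A B z1" "y2 = phi A B z2" "y3 = phi A B z3" using bij_is_surj[OF bij] by (meson surjD)
  then have "phi A B x = phi A B (a * z1 + b * z2 + c * z3)" by (simp add: y rhom_add[OF hom] rhom_mult[OF hom])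
  then have "x = a * z1 + b * z2 + c * z3" using bij_is_inj[OF bij] by (rule injD[rotated])
  then show "x \<in> id3 a b c" by (rule id3I)
next
  assume "x \<in> id3 a b c"
  then obtain z1 z2 z3 where "x = a * z1 + b * z2 + c * z3" by (rule id3E)
  then show "phi A B x \<in> id3 (phi A B a) (phi A B b) (phi A B c)"
    by (intro id3I[of _ _ "phi A B z1" _ "phi A B z2" _ "phi A B z3"]) (simp add: rhom_add[OF hom] rhom_mult[OF hom])
qed

text \<open>Makes the Milnor ideal the case \<open>z = 0\<close> of the argument for the Tjurina
  ideal.\<close>

private lemma id2_id3: "id2 a b = id3 0 a (b :: local_ring)"
  by (auto simp: id2_def id3_def)

private lemma id3_phi: "z = 0 \<or> z = h \<Longrightarrow>
  id3 (phi A B z) (du (phi A B h)) (dw (phi A B h)) = id3 (phi A B z) (phi A B (du h)) (phi A B (dw h))"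
proof (intro subset_antisym id3_least ideal_id3)
  show "du (phi A B h) \<in> id3 (phi A B z) (phi A B (du h)) (phi A B (dw h))"
    "dw (phi A B h) \<in> id3 (phi A B z) (phi A B (du h)) (phi A B (dw h))"
    unfolding der by (intro ideal_add[OF ideal_id3] ideal_mult[OF ideal_id3] id3_gen)+
  show "phi A B (du h) \<in> id3 (phi A B z) (du (phi A B h)) (dw (phi A B h))"
    "phi A B (dw h) \<in> id3 (phi A B z) (du (phi A B h)) (dw (phi A B h))"
    unfolding der_inv by (intro ideal_add[OF ideal_id3] ideal_mult[OF ideal_id3] id3_gen)+
qed (rule id3_gen)+

lemma linear_substitution:
  assumes "\<And>x. phi (const2 p * var_u + const2 q * var_w) (const2 r * var_u + const2 s * var_w) x = \<Lambda> x"
  shows "cd (id3 (\<Lambda> h) (du (\<Lambda> h)) (dw (\<Lambda> h))) n \<Longrightarrow> cd (id3 h (du h) (dw h)) n"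
    "cd (id2 (du (\<Lambda> h)) (dw (\<Lambda> h))) n \<Longrightarrow> cd (id2 (du h) (dw h)) n"
proof -
  have \<Lambda>: "\<Lambda> = phi A B" using assms by (auto simp: A_def B_def)
  have lin: "Vector_Spaces.linear sc sc (phi A B)" by (rule linear_hom[OF hom phi_const[OF AB_Fil]])
  have gen: "cd (id3 z (du h) (dw h)) n" if z: "z = 0 \<or> z = h" and c: "cd (id3 (phi A B z) (du (phi A B h)) (dw (phi A B h))) n" for z
    using cd_pull[OF c subspace_id3 lin bij_is_surj[OF bij]] unfolding id3_phi[OF z] pull_id3 by simp
  show "cd (id3 (\<Lambda> h) (du (\<Lambda> h)) (dw (\<Lambda> h))) n \<Longrightarrow> cd (id3 h (du h) (dw h)) n"
    unfolding \<Lambda> by (rule gen) auto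
  show "cd (id2 (du (\<Lambda> h)) (dw (\<Lambda> h))) n \<Longrightarrow> cd (id2 (du h) (dw h)) n"
    using gen[of 0] unfolding \<Lambda> id2_id3 by (simp add: rhom_0[OF hom])
qed

end

lemma three_shift: "(k :: 3) = i \<or> k = i + 1 \<or> k = i + 2" "(i :: 3) \<noteq> i + 1" "(i :: 3) \<noteq> i + 2" "(i :: 3) + 1 \<noteq> i + 2"
proof -
  have "(1 :: 3) \<noteq> 0" "(2 :: 3) \<noteq> 0" "(1 :: 3) \<noteq> 2" by simp_all
  then show n: "(i :: 3) \<noteq> i + 1" "(i :: 3) \<noteq> i + 2" "(i :: 3) + 1 \<noteq> i + 2" by simp_all
  have "card {i, i + 1, i + 2} = CARD(3)" using n by simp
  then have "{i, i + 1, i + 2} = (UNIV :: 3 set)" by (intro card_eq_UNIV_imp_eq_UNIV) simp_all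
  then show "(k :: 3) = i \<or> k = i + 1 \<or> k = i + 2" by blast
qed

lemma sum_shift: "sum f (UNIV :: 3 set) = f i + (f (i + 1) + f (i + 2))"
proof -
  have "UNIV = {i, i + 1, i + 2}" using three_shift(1)[of _ i] by blast
  then have "sum f UNIV = sum f {i, i + 1, i + 2}" by (simp only:)
  then show ?thesis using three_shift(2-4)[of i] by simp
qed

text \<open>\<open>germ\<close> varies only the coordinates with indices \<open>i + 1\<close> and
  \<open>i + 2\<close>. As \<open>Q\<close> and \<open>R\<close> have no \<open>i\<close>-th
  component, \<open>Gam\<close> arises from it by the linear substitution whose matrix consists of
  their other components.\<close>

lemma (in coords) germ_Gam:
  assumes "Q $ i = 0" "R $ i = 0"
    and det: "Q $ (i + 1) * R $ (i + 2) - R $ (i + 1) * Q $ (i + 2) = 1"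
  shows "cd (Tj h) n \<Longrightarrow> cd (id3 (germ h P i) (du (germ h P i)) (dw (germ h P i))) n"
    "cd (id2 (du (Gam h)) (dw (Gam h))) n \<Longrightarrow> cd (id2 (du (germ h P i)) (dw (germ h P i))) n"
proof -
  define A where "A = const2 (Q $ (i + 1)) * var_u + const2 (R $ (i + 1)) * var_w"
  define B where "B = const2 (Q $ (i + 2)) * var_u + const2 (R $ (i + 2)) * var_w"
  have AB: "A \<in> Fil (Suc 0)" "B \<in> Fil (Suc 0)" unfolding A_def B_def by (intro Fil_add Fil_mult_left u_Fil w_Fil)+
  have "phi A B (germ h P i) = Gam h"
  proof -
    have v: "(\<chi> k. phi A B ((\<chi> k. const2 (P $ k) + (if k = i + 1 then var_u else if k = i + 2 then var_w else 0)) $ k)) =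
        (\<chi> k. const2 (P $ k) + const2 (Q $ k) * var_u + const2 (R $ k) * var_w)"
      unfolding vec_eq_iff
    proof
      fix k :: 3
      show "(\<chi> k. phi A B ((\<chi> k. const2 (P $ k) + (if k = i + 1 then var_u else if k = i + 2 then var_w else 0)) $ k)) $ k =
        (\<chi> k. const2 (P $ k) + const2 (Q $ k) * var_u + const2 (R $ k) * var_w) $ k"
        using three_shift(1)[of k i] three_shift(2-4)[of i] assms(1,2)
        by (elim disjE) (simp_all add: rhom_add[OF phi_hom[OF AB]] rhom_0[OF phi_hom[OF AB]] phi_const[OF AB]
          phi_u[OF AB] phi_w[OF AB] const2_simps A_def[symmetric] B_def[symmetric] add.assoc)
    qed
    show ?thesis unfolding germ_def Gam_def hom_eval[OF phi_hom[OF AB] const2_hom] v phi_const[OF AB] ..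
  qed
  then show "cd (Tj h) n \<Longrightarrow> cd (id3 (germ h P i) (du (germ h P i)) (dw (germ h P i))) n"
    "cd (id2 (du (Gam h)) (dw (Gam h))) n \<Longrightarrow> cd (id2 (du (germ h P i)) (dw (germ h P i))) n"
    using linear_substitution[OF det, of "phi A B" "germ h P i" n] unfolding A_def B_def by simp_all
qed

text \<open>The affine chart \<open>x\<^sub>i = v\<^sub>i\<close> of \<open>germ\<close>, with a second coordinate along the line \<open>L = 0\<close>.\<close>

lemma chart_coords:
  fixes v :: "complex ^ 3"
  assumes L: "homogeneous 1 L" "L \<noteq> 0" "ev L v = 0" and v: "v $ i \<noteq> 0"
  shows "\<exists>X Y D E. coords X Y L v D E \<and> D $ i = 0 \<and> E $ i = 0 \<and> D $ (i + 1) * E $ (i + 2) - E $ (i + 1) * D $ (i + 2) = 1"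
proof -
  obtain \<alpha> where \<alpha>: "L = lf \<alpha>" using linear_form[OF L(1)] by blast
  obtain i1 i2 where i: "i1 = i + 1" "i2 = i + 2" by blast
  have ix: "k = i \<or> k = i1 \<or> k = i2" "i \<noteq> i1" "i \<noteq> i2" "i1 \<noteq> i2" for k :: 3 using three_shift(1)[of k i] three_shift(2-4)[of i] by (simp_all add: i)
  have sum: "sum f UNIV = f i + (f i1 + f i2)" for f :: "3 \<Rightarrow> 'a::comm_monoid_add" unfolding i by (rule sum_shift)
  obtain v0 v1 v2 where vv: "v $ i = v0" "v $ i1 = v1" "v $ i2 = v2" by blast
  obtain a0 a1 a2 where aa: "\<alpha> $ i = a0" "\<alpha> $ i1 = a1" "\<alpha> $ i2 = a2" by blast
  have v0: "v0 \<noteq> 0" using v vv by simp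
  have Lv: "a0 * v0 + (a1 * v1 + a2 * v2) = 0" using L(3) unfolding \<alpha> ev_lf sum aa vv .
  have "a1 \<noteq> 0 \<or> a2 \<noteq> 0"
  proof (rule ccontr)
    assume no: "\<not> ?thesis"
    then have "a0 = 0" using Lv v0 by simp
    then have "\<alpha> $ k = 0" for k using no aa ix(1)[of k] by auto
    then show False using L(2) by (simp add: \<alpha> lf_def rhom_0[OF SC_hom])
  qed
  \<comment> \<open>\<open>\<beta>, \<gamma>\<close> will be the entries of \<open>E\<close>, so
    this is \<open>L(E) = 1\<close>. With \<open>D = (a2, - a1)\<close>, the direction of the line
    in the chart, the determinant of \<open>D\<close> and \<open>E\<close> is the same
    expression.\<close>
  then obtain \<beta> \<gamma> where bc: "a1 * \<beta> + a2 * \<gamma> = 1"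
    by (metis add.commute add.right_neutral mult_zero_right nonzero_mult_div_cancel_left times_divide_eq_right)
  define vec3 where "vec3 a b c = (\<chi> k. if k = i then a else if k = i1 then b else c)" for a b c :: complex
  have vec3: "vec3 a b c $ i = a" "vec3 a b c $ i1 = b" "vec3 a b c $ i2 = c" for a b c
    using ix by (simp_all add: vec3_def)
  define D where "D = vec3 0 a2 (- a1)"
  define E where "E = vec3 0 \<beta> \<gamma>"
  define x where "x = vec3 (1 / v0) 0 0"
  define y where "y = vec3 ((\<beta> * v2 - \<gamma> * v1) / v0) \<gamma> (- \<beta>)"
  have a0: "a0 = - (a1 * v1 + a2 * v2) / v0"
    using Lv v0 by (simp add: field_simps eq_neg_iff_add_eq_0)
  have f1: "v1 + a2 * (\<beta> * v2 - \<gamma> * v1) - \<beta> * (a1 * v1 + a2 * v2) = 0" using bc by algebra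
  have f2: "v2 - a1 * (\<beta> * v2 - \<gamma> * v1) - \<gamma> * (a1 * v1 + a2 * v2) = 0" using bc by algebra
  have g1: "v1 * (1 / v0) + a2 * ((\<beta> * v2 - \<gamma> * v1) / v0) + \<beta> * a0 = 0"
  proof -
    have "v1 * (1 / v0) + a2 * ((\<beta> * v2 - \<gamma> * v1) / v0) + \<beta> * a0 = (v1 + a2 * (\<beta> * v2 - \<gamma> * v1) - \<beta> * (a1 * v1 + a2 * v2)) / v0"
      by (simp only: a0 times_divide_eq_right mult_1_right add_divide_distrib[symmetric]) (simp add: algebra_simps)
    then show ?thesis by (simp only: f1 div_0)
  qed
  have g2: "v2 * (1 / v0) + (- a1) * ((\<beta> * v2 - \<gamma> * v1) / v0) + \<gamma> * a0 = 0"
  proof -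
    have "v2 * (1 / v0) + (- a1) * ((\<beta> * v2 - \<gamma> * v1) / v0) + \<gamma> * a0 = (v2 - a1 * (\<beta> * v2 - \<gamma> * v1) - \<gamma> * (a1 * v1 + a2 * v2)) / v0"
      by (simp only: a0 times_divide_eq_right mult_1_right add_divide_distrib[symmetric]) (simp add: algebra_simps)
    then show ?thesis by (simp only: f2 div_0)
  qed
  have g3: "a2 * \<gamma> + \<beta> * a1 = 1" "(- a1) * (- \<beta>) + \<gamma> * a2 = 1" "a2 * (- \<beta>) + \<beta> * a2 = 0" "(- a1) * \<gamma> + \<gamma> * a1 = 0"
    using bc by (simp_all add: algebra_simps)
  have g4: "(\<beta> * v2 - \<gamma> * v1) / v0 * v0 + (\<gamma> * v1 + (- \<beta>) * v2) = 0" using v0 by simp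
  have "coords (lf x) (lf y) L v D E"
  proof
    show "homogeneous 1 (lf x)" "homogeneous 1 (lf y)" "homogeneous 1 L" by (simp_all add: homogeneous_lf \<alpha>)
    show "ev (lf x) v = 1" "ev (lf x) D = 0" "ev (lf x) E = 0"
      "ev (lf y) v = 0" "ev (lf y) D = 1" "ev (lf y) E = 0" "ev L v = 0" "ev L D = 0" "ev L E = 1"
      unfolding \<alpha> ev_lf sum x_def y_def D_def E_def vec3 vv aa using v0 g3 g4 Lv bc by (simp_all add: algebra_simps)
    fix k :: 3
    have fin: "v $ k * x $ j + D $ k * y $ j + E $ k * \<alpha> $ j = (if j = k then 1 else 0)" for j
    proof -
      have z: "v0 * (1 / v0) = 1" using v0 by simp
      consider "k = i" | "k = i1" | "k = i2" using ix(1)[of k] by blast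
      then show ?thesis
      proof cases
        case 1
        have "v $ k * x $ j = (if j = k then 1 else 0)" using ix(1)[of j] ix(2-4) z by (elim disjE) (simp_all add: 1 x_def vec3 vv)
        then show ?thesis by (simp add: 1 D_def E_def vec3)
      next
        case 2
        then show ?thesis using ix(1)[of j] ix(2-4) ix(4)[symmetric] g1 g3
          by (elim disjE) (simp_all only: 2 x_def y_def D_def E_def vec3 vv aa mult_zero_right add_0 if_True if_False refl)
      next
        case 3
        then show ?thesis using ix(1)[of j] ix(2-4) ix(4)[symmetric] g2 g3
          by (elim disjE) (simp_all only: 3 x_def y_def D_def E_def vec3 vv aa mult_zero_right add_0 if_True if_False refl)
      qed
    qed
    have "SC (v $ k) * lf x + SC (D $ k) * lf y + SC (E $ k) * L =
        (\<Sum>j\<in>UNIV. SC (v $ k * x $ j + D $ k * y $ j + E $ k * \<alpha> $ j) * xv j)"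
      unfolding \<alpha> lf_def sum_distrib_left sum.distrib[symmetric]
      by (intro sum.cong refl) (simp add: rhom_add[OF SC_hom] rhom_mult[OF SC_hom] algebra_simps)
    also have "\<dots> = (\<Sum>j\<in>UNIV. if j = k then xv j else 0)"
      unfolding fin by (intro sum.cong refl) (simp add: rhom_1[OF SC_hom] rhom_0[OF SC_hom])
    finally show "xv k = SC (v $ k) * lf x + SC (D $ k) * lf y + SC (E $ k) * L" by simp
  qed
  moreover have "D $ i = 0 \<and> E $ i = 0 \<and> D $ (i + 1) * E $ (i + 2) - E $ (i + 1) * D $ (i + 2) = 1"
    unfolding i[symmetric] D_def E_def vec3 using bc by (simp add: algebra_simps)
  ultimately show ?thesis by blast
qed

lemma sum_order:
  fixes p :: "complex poly"
  assumes "p \<noteq> 0" "finite Z" "{t. poly p t = 0} \<subseteq> Z"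
  shows "(\<Sum>t\<in>Z. order t p) = degree p"
proof -
  have "degree p = (\<Sum>t\<in>set_mset (proots p). order t p)"
    unfolding size_proots_complex[symmetric] size_multiset_overloaded_eq using assms(1) by simp
  also have "\<dots> = (\<Sum>t\<in>Z. order t p)"
    by (rule sum.mono_neutral_left) (use assms in \<open>auto simp: order_root\<close>)
  finally show ?thesis by simp
qed

lemma span_scale_point:
  fixes v :: "complex ^ 3"
  assumes "c \<noteq> 0"
  shows "vec.span {c *s v} = vec.span {v}"
proof -
  have 1: "vec.span {a *s w} \<subseteq> vec.span {w}" for a and w :: "complex ^ 3"
    using vec.span_scale[OF vec.span_base[of w "{w}"], of a] by (intro vec.span_minimal vec.subspace_span) simp
  have "v = inverse c *s (c *s v)" using assms by (simp add: vec_eq_iff)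
  then show ?thesis using 1[of c v] 1[of "inverse c" "c *s v"] by simp
qed

text \<open>The order is read off from \<open>h = T^j q + L y\<close>, where the linear form
  \<open>T\<close> vanishes at the point and \<open>q\<close> does not; such a decomposition makes
  no reference to the coordinate on the line.\<close>

lemma (in coords) order_transfer:
  assumes N: "coords X' Y' L v D E" and v: "v = c *s (P + t *s Q)" "c \<noteq> 0"
    and h: "homogeneous (int d) h" "r h \<noteq> 0"
  shows "coords.r v D h \<noteq> 0" "order 0 (coords.r v D h) = order t (r h)"
proof -
  interpret N: coords X' Y' L v D E by (rule N)
  obtain q0 where q0: "r h = [:- t, 1:] ^ order t (r h) * q0" "\<not> [:- t, 1:] dvd q0" using order_decomp[OF h(2)] by blast
  define j where "j = order t (r h)"
  have q00: "q0 \<noteq> 0" "poly q0 t \<noteq> 0" using q0(2) by (auto simp: poly_eq_0_iff_dvd)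
  have "degree (r h) = j + degree q0" using q0(1) q00(1) unfolding j_def
    by (metis degree_linear_power degree_mult_eq power_eq_0_iff pCons_eq_0_iff one_neq_zero)
  moreover have "degree (r h) \<le> d" using r_Pl[OF h(1)] by (simp add: Pl_degree)
  ultimately have jd: "j \<le> d" "q0 \<in> Pl (int (d - j))" unfolding Pl_degree by simp_all
  obtain q where q: "homogeneous (int (d - j)) q" "r q = q0" using r_surj[OF jd(2)] by blast
  define T where "T = Y - SC t * X"
  have T: "homogeneous 1 T" unfolding T_def by (intro homogeneous_diff homogeneous_SC_mult lin)
  have rT: "r T = [:- t, 1:]" by (simp add: T_def rhom_diff[OF r_hom] rhom_mult[OF r_hom] r_X r_Y r_SC one_pCons)
  have hT: "homogeneous (int d) (T ^ j * q)"
    using homogeneous_mult[OF homogeneous_power[OF T, of j] q(1)] jd(1) by (simp add: of_nat_diff)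
  have "r (h - T ^ j * q) = 0" using q0(1) by (simp add: rhom_diff[OF r_hom] rhom_mult[OF r_hom] rhom_power[OF r_hom] rT q(2) j_def)
  then have "L dvd h - T ^ j * q" using r_kernel[OF homogeneous_diff[OF h(1) hT]] by simp
  then obtain y where "h - T ^ j * q = L * y" by (elim dvdE)
  then have hy: "h = T ^ j * q + L * y" by (simp add: diff_eq_eq add.commute)
  have ev_v: "ev f v = c ^ n * poly (r f) t" if "homogeneous (int n) f" for f n
    unfolding v(1) poly_r by (rule ev_homogeneous[OF that])
  have "ev T v = 0" using ev_v[of 1 T] T by (simp add: rT)
  then have NT: "N.r T = [:0, ev T D:]" using N.r_linear_form[OF T] by simp
  have TD: "ev T D \<noteq> 0"
  proof
    assume "ev T D = 0"
    then have "L dvd T" using N.r_kernel[OF T] NT by simp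
    then have "r T = 0" using r_kernel[OF T] by simp
    then show False by (simp add: rT)
  qed
  have "N.r h = [:- 0, 1:] ^ j * (smult (ev T D ^ j) (N.r q))"
  proof -
    have "[:0, ev T D:] = smult (ev T D) [:- 0, 1:]" by simp
    then have "[:0, ev T D:] ^ j = smult (ev T D ^ j) ([:- 0, 1:] ^ j)" by (simp only: smult_power)
    then show ?thesis unfolding hy rhom_add[OF N.r_hom] rhom_mult[OF N.r_hom] rhom_power[OF N.r_hom] NT N.r_L
      by (simp only: mult_zero_left add_0_right mult_smult_left mult_smult_right)
  qed
  moreover have p0: "poly (smult (ev T D ^ j) (N.r q)) 0 \<noteq> 0"
    using TD v(2) q00(2) ev_v[OF q(1)] by (simp add: N.poly_r q(2))
  ultimately show "order 0 (N.r h) = order t (r h)" using order_factor[of _ 0] unfolding j_def by blast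
  show "N.r h \<noteq> 0" using \<open>N.r h = _\<close> p0 by auto
qed

section \<open>Counting over the intersection points\<close>

context line_curve
begin

lemma ev_X_point: "ev X (P + t *s Q) = 1" and ev_Y_point: "ev Y (P + t *s Q) = t" and ev_L_point: "ev L (P + t *s Q) = 0"
  by (simp_all add: poly_r[symmetric] r_X r_Y r_L)

lemma ev_0: "homogeneous 1 f \<Longrightarrow> ev f 0 = 0"
  by (metis ev_homogeneous mult_zero_left of_nat_1 power_one_right vector_smult_lzero)

text \<open>With \<open>m\<close> the order of \<open>r g\<close> at \<open>t\<close>, the Milnor
  number grows by \<open>2 m - 1\<close> and the Tjurina number by \<open>m\<close> plus the order
  of \<open>G\<close>. The representative \<open>v\<close> and the index \<open>i\<close> are
  whatever the choice in \<open>local_equation\<close> yields, so the coordinates are adapted to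
  them.\<close>

lemma point_eps:
  assumes G: "restr_gcd G" and sq: "squarefree F" and t: "poly (r g) t = 0"
  shows "eps F (vec.span {P + t *s Q}) - eps g (vec.span {P + t *s Q}) = int (order t (r g)) - int (order t G) - 1"
proof -
  define p where "p = vec.span {P + t *s Q}"
  define vi where "vi = (SOME vi. fst vi \<in> p \<and> fst vi $ snd vi \<noteq> (0 :: complex))"
  have "P + t *s Q \<noteq> 0" using ev_X_point[of t] ev_0[OF lin(1)] by auto
  then obtain i where "(P + t *s Q) $ i \<noteq> 0" by (auto simp: vec_eq_iff)
  then have "\<exists>vi. fst vi \<in> p \<and> fst vi $ snd vi \<noteq> 0"
    by (intro exI[of _ "(P + t *s Q, i)"]) (simp add: p_def vec.span_base)
  then have vi: "fst vi \<in> p" "fst vi $ snd vi \<noteq> 0" unfolding vi_def by (metis (mono_tags, lifting) someI_ex)+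
  define v where "v = fst vi"
  define i where "i = snd vi"
  have le: "local_equation h p = germ h v i" for h
    unfolding local_equation_def vi_def[symmetric] v_def i_def by (simp add: case_prod_beta)
  obtain c where c: "v = c *s (P + t *s Q)" using vi(1) by (auto simp: v_def p_def vec.span_singleton)
  have "v $ i \<noteq> 0" using vi(2) by (simp add: v_def i_def)
  then have "c \<noteq> 0" using c by auto
  have Lv: "ev L v = 0" using ev_homogeneous[of 1 L c "P + t *s Q"] lin(3) by (simp add: c ev_L_point)
  obtain X' Y' D E where N: "coords X' Y' L v D E" and DE: "D $ i = 0" "E $ i = 0" "D $ (i + 1) * E $ (i + 2) - E $ (i + 1) * D $ (i + 2) = 1"
    using chart_coords[OF lin(3) L_nonzero Lv \<open>v $ i \<noteq> 0\<close>] by blast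
  interpret N: coords X' Y' L v D E by (rule N)
  note tr = order_transfer[OF N c \<open>c \<noteq> 0\<close>]
  have hom_psi: "\<exists>d. homogeneous (int d) (der_apply \<eta> L)" if "\<eta> \<in> Hd k" "r (der_apply \<eta> L) \<noteq> 0 \<or> N.r (der_apply \<eta> L) \<noteq> 0" for \<eta> k
  proof -
    have hk: "homogeneous k (der_apply \<eta> L)" using der_apply_homogeneous[OF lin(3), of k \<eta>] that(1) by (simp add: Hd_def)
    then have "k \<ge> 0" using that(2) homogeneous_neg[of k] by (force simp: rhom_0[OF r_hom] rhom_0[OF N.r_hom])
    then show ?thesis using hk by (metis nonneg_int_cases)
  qed
  obtain k0 \<theta> where \<theta>: "\<theta> \<in> D0 g \<inter> Hd k0" "psi \<theta> = G" using G by (auto simp: restr_gcd_def Ik_def Mk_def)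
  have G0: "G \<noteq> 0" using G by (simp add: restr_gcd_def)
  have "\<exists>d. homogeneous (int d) (der_apply \<theta> L)" using hom_psi[of \<theta> k0] \<theta> G0 by (simp add: psi_def)
  then have N\<theta>: "N.psi \<theta> \<noteq> 0" "order 0 (N.psi \<theta>) = order t G"
    using tr[of _ "der_apply \<theta> L"] \<theta>(2) G0 by (auto simp: psi_def N.psi_def)
  have min: "order t G \<le> order 0 (N.psi \<eta>)" if e: "\<eta> \<in> D0 g \<inter> Hd k" "N.psi \<eta> \<noteq> 0" for \<eta> k
  proof -
    obtain d where d: "homogeneous (int d) (der_apply \<eta> L)" using hom_psi[of \<eta> k] e by (auto simp: N.psi_def)
    have "psi \<eta> \<noteq> 0" using r_kernel[OF d] N.r_kernel[OF d] e(2) by (simp add: psi_def N.psi_def)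
    moreover have "G dvd psi \<eta>" using G e(1) by (simp add: restr_gcd_def)
    ultimately have "order t G \<le> order t (psi \<eta>)" using dvd_imp_order_le by blast
    also have "\<dots> = order 0 (N.psi \<eta>)" using tr(2)[OF d] \<open>psi \<eta> \<noteq> 0\<close> by (simp add: psi_def N.psi_def)
    finally show ?thesis .
  qed
  have gv: "ev g v = 0" using ev_homogeneous[OF g(1), of c "P + t *s Q"] t by (simp add: c poly_r)
  have "\<exists>t' \<mu> i. i = order 0 (N.r g) \<and> i \<ge> 1 \<and> cd (N.Tj g) t' \<and> cd (N.Tj F) (t' + i + order t G) \<and>
    cd (id2 (du (N.Gam g)) (dw (N.Gam g))) \<mu> \<and> cd (id2 (du (N.Gam F)) (dw (N.Gam F))) (\<mu> + 2 * i - 1)"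
    by (rule N.local_numbers[OF g(1,2) sq gv IntD1[OF \<theta>(1)] N\<theta>]) (rule min)
  then obtain \<tau> \<mu> m where num: "m = order 0 (N.r g)" "m \<ge> 1" "cd (N.Tj g) \<tau>" "cd (N.Tj F) (\<tau> + m + order t G)"
    "cd (id2 (du (N.Gam g)) (dw (N.Gam g))) \<mu>" "cd (id2 (du (N.Gam F)) (dw (N.Gam F))) (\<mu> + 2 * m - 1)"
    by (elim exE conjE) (rule that)
  have tj: "tjurina h p = n" if "cd (N.Tj h) n" for h n
    using quotient_dim_eq[OF N.germ_Gam(1)[OF DE that] subspace_id3] by (simp add: tjurina_def le span_3)
  have mi: "milnor h p = n" if "cd (id2 (du (N.Gam h)) (dw (N.Gam h))) n" for h n
    using quotient_dim_eq[OF N.germ_Gam(2)[OF DE that] subspace_id2] by (simp add: milnor_def le span_2)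
  have "m = order t (r g)" using tr(2)[OF g(1)] degree_rg num(1) by simp
  then show ?thesis using num(2) unfolding eps_def p_def[symmetric] tj[OF num(3)] tj[OF num(4)] mi[OF num(5)] mi[OF num(6)] by simp
qed

lemma point_expand: "v = ev X v *s P + ev Y v *s Q + ev L v *s R"
proof -
  have "v $ i = ev (xv i) v" for i by (simp only: eval_var[OF id_hom])
  also have "ev (xv i) v = P $ i * ev X v + Q $ i * ev Y v + R $ i * ev L v" for i
    by (subst expand) (simp only: rhom_add[OF ev_hom] rhom_mult[OF ev_hom] eval_const[OF id_hom] id_apply)
  finally show ?thesis by (simp add: vec_eq_iff mult.commute)
qed

lemma intersection_points: "pts g \<inter> pts L = (\<lambda>t. vec.span {P + t *s Q}) ` {t. poly (r g) t = 0}"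
proof (intro subset_antisym subsetI)
  fix p assume p: "p \<in> pts g \<inter> pts L"
  then obtain v where v: "p = vec.span {v}" "v \<noteq> 0" by (auto simp: pts_def P2_def)
  have vp: "v \<in> p" unfolding v by (simp add: vec.span_base)
  then have z: "ev g v = 0" "ev L v = 0" using p by (auto simp: pts_def)
  define x y where "x = ev X v" and "y = ev Y v"
  have vxy: "v = x *s P + y *s Q" using point_expand[of v] z(2) by (simp add: x_def y_def)
  \<comment> \<open>Otherwise the point would be \<open>Q\<close>, which is not on the
    curve.\<close>
  have x0: "x \<noteq> 0"
  proof
    assume "x = 0"
    then have "v = y *s Q" "y \<noteq> 0" using vxy v(2) by auto
    then have "ev g v = y ^ dg * ev g Q" using ev_homogeneous[OF g(1)] by simp
    then show False using z(1) g(4) \<open>y \<noteq> 0\<close> by simp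
  qed
  have v': "v = x *s (P + (y / x) *s Q)" using x0 by (simp add: vxy vec_eq_iff field_simps)
  have "ev g v = x ^ dg * poly (r g) (y / x)" unfolding poly_r by (subst v') (rule ev_homogeneous[OF g(1)])
  then have "poly (r g) (y / x) = 0" using z(1) x0 by simp
  moreover have "vec.span {v} = vec.span {P + (y / x) *s Q}"
  proof -
    have "vec.span {x *s (P + (y / x) *s Q)} = vec.span {P + (y / x) *s Q}" by (rule span_scale_point[OF x0])
    then show ?thesis using v' by simp
  qed
  ultimately show "p \<in> (\<lambda>t. vec.span {P + t *s Q}) ` {t. poly (r g) t = 0}" using v(1) by auto
next
  fix p assume "p \<in> (\<lambda>t. vec.span {P + t *s Q}) ` {t. poly (r g) t = 0}"
  then obtain t where t: "poly (r g) t = 0" and p: "p = vec.span {P + t *s Q}" by blast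
  have "P + t *s Q \<noteq> 0" using ev_X_point[of t] ev_0[OF lin(1)] by auto
  then have "p \<in> P2" unfolding P2_def p by blast
  moreover have "ev g v = 0 \<and> ev L v = 0" if vp: "v \<in> p" for v
  proof -
    obtain c where c: "v = c *s (P + t *s Q)" using vp unfolding p vec.span_singleton by blast
    have "ev g v = 0" using ev_homogeneous[OF g(1), of c "P + t *s Q"] t by (simp add: c poly_r)
    moreover have "ev L v = 0" using ev_homogeneous[of 1 L c "P + t *s Q"] lin(3) by (simp add: c ev_L_point)
    ultimately show ?thesis by simp
  qed
  ultimately show "p \<in> pts g \<inter> pts L" by (simp add: pts_def)
qed

lemma inj_points: "inj (\<lambda>t. vec.span {P + t *s Q})"
proof (rule injI)
  fix s t assume "vec.span {P + s *s Q} = vec.span {P + t *s Q}"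
  then have "P + s *s Q \<in> vec.span {P + t *s Q}" using vec.span_base[of "P + s *s Q" "{P + s *s Q}"] by simp
  then obtain c where c: "P + s *s Q = c *s (P + t *s Q)" unfolding vec.span_singleton by blast
  have "ev f (P + s *s Q) = c * ev f (P + t *s Q)" if "homogeneous 1 f" for f
    using ev_homogeneous[of 1 f c "P + t *s Q"] that by (simp add: c)
  from this[OF lin(1)] this[OF lin(2)] show "s = t" by (simp add: ev_X_point ev_Y_point)
qed

text \<open>Each root of \<open>r g\<close> contributes its order there, minus the order of
  \<open>G\<close>, minus 1. All roots of \<open>G\<close> are among them because \<open>G\<close>
  divides \<open>r g\<close>, so both orders add up to degrees.\<close>

theorem intersection_number:
  assumes G: "restr_gcd G" and sq: "squarefree F"
  shows "int (card (pts g \<inter> pts L)) + eps_union g L = int dg - int (degree G)"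
proof -
  define Z where "Z = {t. poly (r g) t = 0}"
  have fin: "finite Z" unfolding Z_def using degree_rg(2) by (rule poly_roots_finite)
  have inj: "inj_on (\<lambda>t. vec.span {P + t *s Q}) Z" by (rule inj_on_subset[OF inj_points]) simp
  have "eps_union g L = (\<Sum>t\<in>Z. eps F (vec.span {P + t *s Q}) - eps g (vec.span {P + t *s Q}))"
    unfolding eps_union_def intersection_points Z_def[symmetric] sum.reindex[OF inj] mult.commute[of g L] by (simp add: o_def)
  also have "\<dots> = (\<Sum>t\<in>Z. int (order t (r g)) - int (order t G) - 1)"
    by (intro sum.cong refl point_eps[OF G sq]) (simp add: Z_def)
  also have "\<dots> = int (\<Sum>t\<in>Z. order t (r g)) - int (\<Sum>t\<in>Z. order t G) - int (card Z)"
    by (simp add: sum_subtractf)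
  also have "(\<Sum>t\<in>Z. order t (r g)) = dg" using sum_order[OF degree_rg(2) fin] by (simp add: Z_def degree_rg)
  also have "(\<Sum>t\<in>Z. order t G) = degree G"
  proof (rule sum_order[OF _ fin])
    show "G \<noteq> 0" using G by (simp add: restr_gcd_def)
    show "{t. poly G t = 0} \<subseteq> Z" using G by (auto simp: restr_gcd_def Z_def elim!: dvdE)
  qed
  also have "card Z = card (pts g \<inter> pts L)"
    unfolding intersection_points Z_def[symmetric] by (rule card_image[OF inj, symmetric])
  finally show ?thesis by simp
qed

end

text \<open>Only finitely many points of the line lie on the curve, so a point off the curve can
  serve as \<open>Q\<close>.\<close>

lemma line_curve_exists:
  assumes L: "homogeneous 1 L" "L \<noteq> 0" and g: "homogeneous (int dg) g" "dg > 0" "\<not> L dvd g"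
  shows "\<exists>X Y P Q R. line_curve X Y L P Q R g dg"
proof -
  obtain \<alpha> where \<alpha>: "L = lf \<alpha>" using linear_form[OF L(1)] by blast
  have "\<exists>v. v \<noteq> 0 \<and> ev L v = 0"
  proof (cases "\<alpha> $ 1 = 0")
    case True
    have "axis 1 1 \<noteq> (0 :: complex ^ 3)" by simp
    moreover have "ev L (axis 1 1) = 0" by (simp add: \<alpha> ev_lf sum_3 axis_def True)
    ultimately show ?thesis by blast
  next
    case False
    define v :: "complex ^ 3" where "v = (\<chi> i. if i = 1 then \<alpha> $ 2 else if i = 2 then - \<alpha> $ 1 else 0)"
    have "v $ 2 \<noteq> 0" using False by (simp add: v_def)
    then have "v \<noteq> 0" by auto
    moreover have "ev L v = 0" by (simp add: \<alpha> ev_lf sum_3 v_def)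
    ultimately show ?thesis by blast
  qed
  then obtain v :: "complex ^ 3" and i where v: "ev L v = 0" "v $ i \<noteq> 0" by (auto simp: vec_eq_iff)
  obtain X Y D E where c: "coords X Y L v D E" using chart_coords[OF L v] by blast
  interpret coords X Y L v D E by (rule c)
  have "r g \<noteq> 0" using r_kernel[OF g(1)] g(3) by simp
  then obtain t where t: "poly (r g) t \<noteq> 0" using poly_all_0_iff_0 by blast
  \<comment> \<open>The direction \<open>D\<close> becomes the origin \<open>P\<close> of the affine
    coordinate and \<open>v + t D\<close>, a point off the curve, becomes the point at infinity
    \<open>Q\<close>; the forms dual to them are \<open>X'\<close> and \<open>X\<close>.\<close>
  define X' where "X' = Y - SC t * X"
  have "line_curve X' X L D (v + t *s D) E g dg"
  proof
    show "homogeneous 1 X'" unfolding X'_def by (intro homogeneous_diff homogeneous_SC_mult lin)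
    show "homogeneous 1 X" "homogeneous 1 L" by (rule lin)+
    have ex: "ev X (v + t *s D) = 1" "ev Y (v + t *s D) = t" "ev L (v + t *s D) = 0"
      by (simp_all add: poly_r[symmetric] r_X r_Y r_L)
    have X': "ev X' w = ev Y w - t * ev X w" for w
      by (simp only: X'_def rhom_diff[OF ev_hom] rhom_mult[OF ev_hom] eval_const[OF id_hom] id_apply)
    show "ev X' D = 1" "ev X' (v + t *s D) = 0" "ev X' E = 0" by (simp_all only: X' ex dual) simp_all
    show "ev X D = 0" "ev X (v + t *s D) = 1" "ev X E = 0" "ev L D = 0" "ev L (v + t *s D) = 0" "ev L E = 1"
      by (rule dual ex)+
    show "xv k = SC (D $ k) * X' + SC ((v + t *s D) $ k) * X + SC (E $ k) * L" for k
      unfolding expand[of k] X'_def by (simp add: rhom_add[OF SC_hom] rhom_mult[OF SC_hom] algebra_simps)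
    show "ev g (v + t *s D) \<noteq> 0" using t by (simp add: poly_r)
  qed (use g in auto)
  then show ?thesis by blast
qed

section \<open>Both halves of the theorem for a linear form and a curve without it\<close>

lemma outside_interval: "0 \<le> (n - a) * (n - b) \<Longrightarrow> a \<le> b \<Longrightarrow> n \<le> a \<or> n \<ge> (b :: int)"
  by (metis linorder_not_le mult_pos_neg diff_gt_0_iff_gt diff_less_0_iff_less)

lemma squarefree_line:
  assumes L: "homogeneous 1 L" "L \<noteq> 0" and sq: "squarefree (L * g)"
  shows "\<not> L dvd g"
proof
  assume "L dvd g"
  then have "L ^ 2 dvd L * g" by (simp add: power2_eq_square mult_dvd_mono)
  then have "L dvd 1" using sq by (rule squarefreeD[rotated])
  then obtain c where "c \<noteq> 0" "L = SC c" by (auto simp: homogeneous_unit)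
  then show False using homogeneous_unique[OF L(1), of 0] homogeneous_SC[of c] L(2) by simp
qed

lemma addition_theorem:
  assumes L: "homogeneous 1 L" "L \<noteq> 0" and hg: "homogeneous (int dg) g" "dg > 0" "squarefree (L * g)"
    and ch: "has_chern_polynomial (D0 g) ([:-1, a:] * [:-1, b:])" and ab: "0 < a" "a \<le> b"
    and n: "n = int (card (pts g \<inter> pts L))" and e: "e = eps_union g L"
  shows "n \<le> a + 1 - e \<or> n \<ge> b + 1 - e" "n = a + 1 - e \<or> n = b + 1 - e \<Longrightarrow> free_with_exponents g a b"
    "n < a + 1 - e \<Longrightarrow> \<not> free_curve g"
proof -
  have nd: "\<not> L dvd g" by (rule squarefree_line[OF L hg(3)])
  obtain X Y P Q R where "line_curve X Y L P Q R g dg" using line_curve_exists[OF L hg(1,2) nd] by blast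
  then interpret line_curve X Y L P Q R g dg .
  have sg: "squarefree g" using squarefree_multD(2)[OF hg(3)] .
  have s: "a + b = int dg - 1" by (rule chern_exponents(1)[OF sg hg(1,2) ch])
  obtain K where K: "\<forall>k\<ge>K. \<exists>N. fd scV {0} (D0 g \<inter> Hd k) N \<and>
      2 * int N = (k - a + 1) * (k - a + 2) + (k - b + 1) * (k - b + 2)" using chern_exponents(2)[OF sg hg(1,2) ch] by blast
  have hil: "2 * int (dM k) = (k - a + 1) * (k - a + 2) + (k - b + 1) * (k - b + 2)" if "k \<ge> K" for k
    using K that VV.fd_unique[OF dM[unfolded Mk_def] _ VV.subspace_single_0] by metis
  obtain G where G: "restr_gcd G" using restr_gcd_exists by blast
  \<comment> \<open>\<open>a + b = dg - 1\<close> turns the number of intersection points plus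
    \<open>e\<close> into the exponent plus one.\<close>
  have ne: "a + b - int (degree G) = n + e - 1"
    using intersection_number[OF G hg(3)] s n e by simp
  show "n \<le> a + 1 - e \<or> n \<ge> b + 1 - e"
  proof -
    have "0 \<le> (n + e - 1 - a) * (n + e - 1 - b)" using addition_a[OF G ab, of K] hil unfolding ne by blast
    from outside_interval[OF this ab(2)] show ?thesis by linarith
  qed
  show "free_with_exponents g a b" if "n = a + 1 - e \<or> n = b + 1 - e"
    by (rule addition_b[OF G ab], erule hil, unfold ne) (use that in auto)
  show "\<not> free_curve g" if "n < a + 1 - e"
    by (rule addition_c[OF G ab], erule hil, unfold ne) (use that in linarith)
qed

lemma deletion_theorem:
  assumes L: "homogeneous 1 L" "L \<noteq> 0" and hg: "homogeneous (int dg) g" "squarefree (L * g)"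
    and ch: "has_chern_polynomial (D0 (L * g)) ([:-1, a:] * [:-1, b:])" and ab: "0 < a" "a \<le> b"
    and n: "n = int (card (pts g \<inter> pts L))" and e: "e = eps_union g L"
  shows "n \<le> a + 1 - e \<or> n \<ge> b + 1 - e" "n = a + 1 - e \<or> n = b + 1 - e \<Longrightarrow> free_with_exponents (L * g) a b"
    "n > b + 1 - e \<Longrightarrow> \<not> free_curve (L * g)"
proof -
  have nd: "\<not> L dvd g" by (rule squarefree_line[OF L hg(2)])
  have hF: "homogeneous (int (dg + 1)) (L * g)" using homogeneous_mult[OF L(1) hg(1)] by (simp add: add.commute)
  have s: "a + b = int dg" using chern_exponents(1)[OF hg(2) hF _ ch] by simp
  \<comment> \<open>Positivity of \<open>a\<close> and \<open>b\<close> rules out that the line is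
    the whole curve.\<close>
  then have dg: "dg > 0" using ab by linarith
  obtain X Y P Q R where "line_curve X Y L P Q R g dg" using line_curve_exists[OF L hg(1) dg nd] by blast
  then interpret line_curve X Y L P Q R g dg .
  obtain K where K: "\<forall>k\<ge>K. \<exists>N. fd scV {0} (D0 (L * g) \<inter> Hd k) N \<and>
      2 * int N = (k - a + 1) * (k - a + 2) + (k - b + 1) * (k - b + 2)" using chern_exponents(2)[OF hg(2) hF _ ch] by auto
  have hil: "2 * int (dK k) = (k - a + 1) * (k - a + 2) + (k - b + 1) * (k - b + 2)" if "k \<ge> K" for k
    using K that VV.fd_unique[OF dK_D0_F _ VV.subspace_single_0] by metis
  obtain G where G: "restr_gcd G" using restr_gcd_exists by blast
  have ne: "a + b - 1 - int (degree G) = n + e - 1"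
    using intersection_number[OF G hg(2)] s n e by simp
  show "n \<le> a + 1 - e \<or> n \<ge> b + 1 - e"
  proof -
    have "0 \<le> (n + e - 1 - a) * (n + e - 1 - b)" using deletion_a[OF G ab, of K] hil unfolding ne by blast
    from outside_interval[OF this ab(2)] show ?thesis by linarith
  qed
  show "free_with_exponents (L * g) a b" if "n = a + 1 - e \<or> n = b + 1 - e"
    by (rule deletion_b[OF G ab], erule hil, unfold ne) (use that in auto)
  show "\<not> free_curve (L * g)" if "n > b + 1 - e"
    by (rule deletion_c[OF G ab], erule hil, unfold ne) (use that in linarith)
qed

lemma prime_elem_line:
  assumes L: "homogeneous 1 L" "L \<noteq> (0 :: S)"
  shows "prime_elem L"
proof (rule irreducible_imp_prime_elem, rule irreducibleI)
  show "\<not> L dvd 1" using homogeneous_unique[OF L(1), of 0] homogeneous_SC L(2) by (auto simp: homogeneous_unit)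
  fix x y assume xy: "L = x * y"
  obtain i j where ij: "homogeneous (int i) x" "homogeneous (int j) y"
    using homogeneous_factor[of 1 x y] homogeneous_factor[of 1 y x] L xy by (auto simp: mult.commute)
  then have "int i + int j = 1" using homogeneous_unique[OF homogeneous_mult[OF ij], of 1] L xy by simp
  then consider "i = 0" | "j = 0" by linarith
  then show "x dvd 1 \<or> y dvd 1"
  proof cases
    case 1
    then show ?thesis using homogeneous_const[of x] ij(1) L(2) xy by (metis homogeneous_unit mult_zero_left of_nat_0 rhom_0[OF SC_hom])
  next
    case 2
    then show ?thesis using homogeneous_const[of y] ij(2) L(2) xy by (metis homogeneous_unit mult_zero_right of_nat_0 rhom_0[OF SC_hom])
  qed
qed (rule L(2))

theorem theoremA:
  fixes f :: S and a b :: int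
  assumes "reduced_curve f"
    and "has_chern_polynomial (D0 f) ([:-1, a:] * [:-1, b:])"
    and "0 < a" and "a \<le> b"
  shows
    "(\<forall>L f'. L \<in> Irr f \<and> line L \<and> f' = \<Prod>(Irr f - {L}) \<longrightarrow>
        (let n = int (card (pts f' \<inter> pts L)); e = eps_union f' L in
          (n \<le> a + 1 - e \<or> n \<ge> b + 1 - e) \<and>
          (n = a + 1 - e \<or> n = b + 1 - e \<longrightarrow> free_with_exponents f a b) \<and>
          (n > b + 1 - e \<longrightarrow> \<not> free_curve f))) \<and>
     (\<forall>L. line L \<and> normalize L \<notin> Irr f \<longrightarrow>
        (let n = int (card (pts f \<inter> pts L)); e = eps_union f L in
          (n \<le> a + 1 - e \<or> n \<ge> b + 1 - e) \<and>
          (n = a + 1 - e \<or> n = b + 1 - e \<longrightarrow> free_with_exponents f a b) \<and>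
          (n < a + 1 - e \<longrightarrow> \<not> free_curve f)))"
proof (intro conjI allI impI)
  obtain d where d: "homogeneous d f" and nu: "\<not> f dvd 1" and sq: "squarefree f"
    using assms(1) by (auto simp: reduced_curve_def)
  have f0: "f \<noteq> 0" using sq by auto
  have "d \<ge> 0" using d f0 homogeneous_neg not_less by blast
  then obtain df where df: "d = int df" by (metis nonneg_int_cases)
  have "df > 0"
  proof (rule ccontr)
    assume "\<not> df > 0"
    then have "f = SC (cf f 0 0 0)" using d df homogeneous_const by simp
    then show False using nu f0 homogeneous_unit SC_eq_0 by metis
  qed
  {
    fix L f' assume as: "L \<in> Irr f \<and> line L \<and> f' = \<Prod>(Irr f - {L})"
    then have L: "homogeneous 1 L" "L \<noteq> 0" by (auto simp: line_def)
    \<comment> \<open>Being squarefree, \<open>f\<close> is the product of its normalized prime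
      factors up to a unit. A unit is a nonzero constant, so \<open>f\<close> and
      \<open>L * f'\<close> have the same logarithmic derivations and thus the same
      freeness.\<close>
    have "prod_mset (prime_factorization f) = (\<Prod>p\<in>prime_factors f. p ^ count (prime_factorization f) p)"
      by (rule prod_mset_multiplicity)
    also have "\<dots> = (\<Prod>p\<in>prime_factors f. p)"
      using sq unfolding squarefree_factorial_semiring'[OF f0]
      by (intro prod.cong) (auto simp: count_prime_factorization_prime in_prime_factors_iff)
    also have "\<dots> = L * f'" using as prod.remove[of "prime_factors f" L "\<lambda>p. p"] by (simp add: Irr_def)
    finally have "normalize f = normalize (L * f')" using prod_mset_prime_factorization_weak[OF f0] by simp
    then obtain u where u: "u dvd 1" and f: "f = u * (L * f')" by (rule associatedE1)
    obtain c where c: "c \<noteq> 0" "u = SC c" using u by (auto simp: homogeneous_unit)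
    have D: "D0 f = D0 (L * f')" unfolding D0_def f c(2)
      by (simp add: der_apply_sum pd_SC_mult mult.left_commute[of _ "SC c"] sum_distrib_left[symmetric] c(1))
    obtain dg where dg: "homogeneous (int dg) f'"
      using homogeneous_factor[of d f' "u * L"] d f0 f by (metis mult.commute mult.left_commute)
    have "L * f' dvd f" by (subst f) simp
    then have sF: "squarefree (L * f')" using sq by (rule squarefree_mono)
    have fc: "free_curve f = free_curve (L * f')" "free_with_exponents f a b = free_with_exponents (L * f') a b"
      unfolding free_curve_def free_with_exponents_def D by simp_all
    show "let n = int (card (pts f' \<inter> pts L)); e = eps_union f' L in
          (n \<le> a + 1 - e \<or> n \<ge> b + 1 - e) \<and>
          (n = a + 1 - e \<or> n = b + 1 - e \<longrightarrow> free_with_exponents f a b) \<and>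
          (n > b + 1 - e \<longrightarrow> \<not> free_curve f)"
      using deletion_theorem[OF L dg sF assms(2)[unfolded D] assms(3,4) refl refl] unfolding Let_def fc by blast
  }
  {
    fix L assume as: "line L \<and> normalize L \<notin> Irr f"
    then have L: "homogeneous 1 L" "L \<noteq> 0" by (auto simp: line_def)
    have p: "prime_elem L" by (rule prime_elem_line[OF L])
    \<comment> \<open>The elements of \<open>Irr f\<close> are normalized, so a prime
      \<open>L\<close> divides \<open>f\<close> exactly if its normalization is one of them.\<close>
    have "\<not> L dvd f" using as p f0 by (auto simp: Irr_def in_prime_factors_iff)
    then have "squarefree (L * f)"
      by (intro squarefree_mult_coprime prime_elem_imp_coprime p squarefree_prime_elem sq)
    then show "let n = int (card (pts f \<inter> pts L)); e = eps_union f L in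
          (n \<le> a + 1 - e \<or> n \<ge> b + 1 - e) \<and>
          (n = a + 1 - e \<or> n = b + 1 - e \<longrightarrow> free_with_exponents f a b) \<and>
          (n < a + 1 - e \<longrightarrow> \<not> free_curve f)"
      using addition_theorem[OF L d[unfolded df] \<open>df > 0\<close> _ assms(2-4) refl refl] unfolding Let_def by blast
  }
qed

end
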